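(* Let $b$ be a non-extreme function in $H^\infty_1$ with $\|b\|_{H^\infty}=1$, let $a$ be its Pythagorean mate, let $\zeta_1,\ldots,\zeta_N\in\mathbb{T}$ be distinct points and let $\mu=\sum_{j=1}^N\delta_{\zeta_j}$. The following are equivalent: (A) $H(b)=\mathcal{D}_\mu$ as sets (hence with equivalent norms); (B) $\{\zeta_1,\ldots,\zeta_N\}=\mathbb{T}\setminus\sigma(b)$ and $0<\inf_{z\in\mathbb{D}}|a(z)|^2V_\mu(z)\le\sup_{z\in\mathbb{D}}|a(z)|^2V_\mu(z)<\infty$; (C) $\{\zeta_1,\ldots,\zeta_N\}=\mathbb{T}\setminus\sigma(b)$ and there exists $g\in H^\infty$ with $\inf_{\mathbb{D}}|g|>0$ such that $a(z)=\Big(\prod_{j=1}^N(z-\zeta_j)\Big)g(z)$ for all $z\in\mathbb{D}$.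
   Context: $\mathbb{D}$ is the open unit disk, $\mathbb{T}$ the unit circle, $m$ the normalized Lebesgue measure on $\mathbb{T}$. $H^2$ is the Hardy space, $H^\infty$ the bounded analytic functions on $\mathbb{D}$, $H^\infty_1$ its closed unit ball. A function $b\in H^\infty_1$ is non-extreme if $\int_{\mathbb{T}}\log(1-|b|)\,dm>-\infty$; then there is a unique outer function $a$ with $a(0)>0$ and $|a|^2+|b|^2=1$ $m$-a.e. on $\mathbb{T}$, called the Pythagorean mate of $b$. For $b$ with $\|b\|_{H^\infty}=1$, the spectrum is $\sigma(b)=\{\zeta\in\mathbb{T}:\liminf_{z\to\zeta,\,z\in\mathbb{D}}|b(z)|<1\}$. The de Branges–Rovnyak space $H(b)$ is $\operatorname{Ran}(I-T_bT_b^* )^{1/2}$ with the range norm, where $T_b f=bf$ on $H^2$; equivalently the reproducing kernel Hilbert space with kernel $k^b_w(z)=\frac{1-\overline{b(w)}b(z)}{1-\overline{w}z}$. For a finite positive Borel measure $\mu$ on $\mathbb{T}$, $\mathcal{D}_\mu=\{f\in H^2: \int_{\mathbb{D}}|f'(z)|^2P_\mu(z)\,dA(z)<\infty\}$, where $P_\mu$ is the Poisson integral of $\mu$ and $dA$ area measure. The potential of $\mu$ is $V_\mu(z)=\int_{\mathbb{T}}\frac{d\mu(\lambda)}{|\lambda-z|^2}$; for $\mu=\sum_j\delta_{\zeta_j}$, $V_\mu(z)=\sum_{j=1}^N|z-\zeta_j|^{-2}$. *)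

theory Defs
  imports "HOL-Analysis.Analysis"
begin

definition Hinf :: "(complex \<Rightarrow> complex) \<Rightarrow> bool" where
  "Hinf f \<longleftrightarrow> f holomorphic_on ball 0 1 \<and> bounded (f ` ball 0 1)"

definition Hinf_ball1 :: "(complex \<Rightarrow> complex) \<Rightarrow> bool" where
  "Hinf_ball1 f \<longleftrightarrow> f holomorphic_on ball 0 1 \<and> (\<forall>z\<in>ball 0 1. cmod (f z) \<le> 1)"

definition Hinf_norm :: "(complex \<Rightarrow> complex) \<Rightarrow> real" where
  "Hinf_norm f = (SUP z\<in>ball 0 1. cmod (f z))"

definition H2 :: "(complex \<Rightarrow> complex) \<Rightarrow> bool" where
  "H2 f \<longleftrightarrow> f holomorphic_on ball 0 1 \<and>
     (\<exists>M. \<forall>r. 0 \<le> r \<and> r < 1 \<longrightarrow>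
        integral {0..2*pi} (\<lambda>t. (cmod (f (complex_of_real r * cis t)))\<^sup>2) \<le> M)"

definition bdry :: "(complex \<Rightarrow> complex) \<Rightarrow> real \<Rightarrow> complex" where
  "bdry f t = Lim (at_left (1::real)) (\<lambda>r. f (complex_of_real r * cis t))"

text \<open>Non-extreme: integral of log(1 - |b|) over T is finite (> -infinity).
  Since ln 0 = 0 in Isabelle, we additionally require |b*| < 1 a.e., which is
  implied by finiteness of the integral with the convention log 0 = -infinity.\<close>
definition nonextreme :: "(complex \<Rightarrow> complex) \<Rightarrow> bool" where
  "nonextreme b \<longleftrightarrow> Hinf_ball1 b \<and>
     (AE t in lebesgue_on {0..2*pi}. cmod (bdry b t) < 1) \<and>
     (\<lambda>t. ln (1 - cmod (bdry b t))) absolutely_integrable_on {0..2*pi}"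

definition outer :: "(complex \<Rightarrow> complex) \<Rightarrow> bool" where
  "outer a \<longleftrightarrow> a holomorphic_on ball 0 1 \<and>
     (\<lambda>t. ln (cmod (bdry a t))) absolutely_integrable_on {0..2*pi} \<and>
     (\<exists>c. cmod c = 1 \<and> (\<forall>z\<in>ball 0 1.
        a z = c * exp (integral {0..2*pi}
          (\<lambda>t. (cis t + z) / (cis t - z) * complex_of_real (ln (cmod (bdry a t)))) / (2 * pi))))"

definition pyth_mate :: "(complex \<Rightarrow> complex) \<Rightarrow> (complex \<Rightarrow> complex) \<Rightarrow> bool" where
  "pyth_mate b a \<longleftrightarrow> outer a \<and> a 0 \<in> \<real> \<and> Re (a 0) > 0 \<and>
     (AE t in lebesgue_on {0..2*pi}. (cmod (bdry a t))\<^sup>2 + (cmod (bdry b t))\<^sup>2 = 1)"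

definition spectrum_b :: "(complex \<Rightarrow> complex) \<Rightarrow> complex set" where
  "spectrum_b b = {\<zeta> \<in> sphere 0 1.
      Liminf (at \<zeta> within ball 0 1) (\<lambda>z. ereal (cmod (b z))) < 1}"

definition kb :: "(complex \<Rightarrow> complex) \<Rightarrow> complex \<Rightarrow> complex \<Rightarrow> complex" where
  "kb b w z = (1 - cnj (b w) * b z) / (1 - cnj w * z)"

text \<open>Membership in the reproducing kernel Hilbert space with kernel kb
  (Aronszajn: f belongs to H(K) iff C K(z,w) - f(z) conj(f(w)) is a positive kernel for some C).\<close>
definition in_Hb :: "(complex \<Rightarrow> complex) \<Rightarrow> (complex \<Rightarrow> complex) \<Rightarrow> bool" where
  "in_Hb b f \<longleftrightarrow> (\<exists>C\<ge>0. \<forall>(n::nat) (w::nat \<Rightarrow> complex) (c::nat \<Rightarrow> complex).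
      (\<forall>i<n. w i \<in> ball 0 1) \<longrightarrow>
      (cmod (\<Sum>i<n. cnj (c i) * f (w i)))\<^sup>2
        \<le> C * Re (\<Sum>i<n. \<Sum>j<n. c j * cnj (c i) * kb b (w j) (w i)))"

text \<open>For mu = sum of Dirac masses at the points of the finite set Z.\<close>
definition Poisson_mu :: "complex set \<Rightarrow> complex \<Rightarrow> real" where
  "Poisson_mu Z z = (\<Sum>\<zeta>\<in>Z. (1 - (cmod z)\<^sup>2) / (cmod (\<zeta> - z))\<^sup>2)"

definition V_mu :: "complex set \<Rightarrow> complex \<Rightarrow> real" where
  "V_mu Z z = (\<Sum>\<zeta>\<in>Z. 1 / (cmod (z - \<zeta>))\<^sup>2)"

definition in_Dmu :: "complex set \<Rightarrow> (complex \<Rightarrow> complex) \<Rightarrow> bool" where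
  "in_Dmu Z f \<longleftrightarrow> H2 f \<and>
     (\<integral>\<^sup>+ z. indicator (ball 0 1) z * ennreal ((cmod (deriv f z))\<^sup>2 * Poisson_mu Z z) \<partial>lborel) < \<infinity>"

end

theory Submission
  imports Defs "HOL-Complex_Analysis.Complex_Analysis" "HOL-Real_Asymp.Real_Asymp"
begin

text \<open>On a combination \<open>k\<close> of Szego kernels the positive form of \<open>H(b)\<close> is, up to the factor \<open>2 \<pi>\<close>, the integral of
  \<open>(1 - |b|\<^sup>2) |k|\<^sup>2\<close> over the circle plus the squared norm of \<open>cnj b k - T k\<close>, where \<open>T\<close> is the Toeplitz operator of
  symbol \<open>cnj b\<close>. Write \<open>p\<close> for the product of the \<open>z - \<zeta>\<close>. If \<open>|a|\<close> is comparable to \<open>|p|\<close>, the first summand is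
  comparable to \<open>\<parallel>p k\<parallel>\<^sup>2\<close>. The second one is dominated by it, because near the zeros of \<open>p\<close> the function \<open>cnj b\<close> is \<open>1/b\<close> up
  to \<open>1 - |b|\<^sup>2\<close> and the contour can be moved into the disc. So \<open>f\<close> lies in \<open>H(b)\<close> iff its evaluation functionals are
  bounded by \<open>\<parallel>p k\<parallel>\<close>. Testing this on polynomials bounds the variance of the partial sums of \<open>f\<close> at each \<open>\<zeta>\<close>, which
  characterizes finite local Dirichlet integral; conversely every \<open>f\<close> in \<open>D_\<mu>\<close> is the sum of an entire function and a
  multiple \<open>p G\<close> with \<open>G\<close> in \<open>H\<^sup>2\<close>, and both summands satisfy the bound.

  If the two spaces coincide, a gliding hump argument with series of normalized kernels replaces the closed graph theorem
  and yields \<open>|p|\<^sup>2 \<le> C (1 - |b|\<^sup>2)\<close> and \<open>1 - |b|\<^sup>2 \<le> C ((1 - |z|\<^sup>2) + |p|\<^sup>2)\<close> in the disc. This determines the spectrum, and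
  in the radial limit it compares \<open>|a|\<close> with \<open>|p|\<close> on the circle. Both functions being outer, the comparison
  persists in the disc.\<close>

section \<open>Lipschitz functions and Fatou's theorem\<close>

text \<open>No Hilbert space is built: membership in \<open>H(b)\<close> is the bound
  \<open>in_Hb\<close> on evaluation functionals, so both inclusions become inequalities between the
  form \<open>Qb\<close> and weighted L^2 norms of the Szego combination \<open>k\<close>. The
  residual \<open>cnj b k - T k\<close> can be estimated because its squared norm equals its pairing
  with \<open>cnj b k\<close>: the estimate of that pairing contains the norm of the residual once
  more, and one factor cancels. Here it matters that the points lie off the spectrum, since then
  \<open>|b|\<close> is at least 1/2 near them and one can divide by \<open>b\<close>.

  In the converse direction \<open>1 - |b|\<^sup>2\<close> cannot be bounded by
  \<open>|p|\<^sup>2\<close> alone inside the disc: \<open>D_\<mu>\<close> contains the constants,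
  and they account for the term \<open>1 - |z|\<^sup>2\<close>, which disappears in the radial
  limit.

  Boundary values exist only almost everywhere and only radially. Hence every boundary function is
  replaced by a version that is bounded everywhere and measurable.

  For empty \<open>Z\<close> the potential vanishes identically, and the equivalence survives
  because norm one of \<open>b\<close> excludes that \<open>H(b)\<close> is all of
  \<open>H^2\<close>.\<close>

lemma vitali_difference_quotients:
  fixes G :: "real \<Rightarrow> real"
  assumes W: "open W" "E \<subseteq> W"
    and fr: "\<And>x. x \<in> E \<Longrightarrow> \<exists>\<^sub>F y in at x. R ((G y - G x) / (y - x))"
  obtains C :: "(real \<times> real) set" where "countable C"
    "\<And>c r. (c, r) \<in> C \<Longrightarrow> 0 < r \<and> cball c r \<subseteq> W \<and> R ((G (c + r) - G (c - r)) / (2 * r))"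
    "pairwise (\<lambda>i j. disjnt (cball (fst i) (snd i)) (cball (fst j) (snd j))) C"
    "negligible (E - (\<Union>i\<in>C. cball (fst i) (snd i)))"
proof -
  define K where "K = {(c, r). 0 < r \<and> cball c r \<subseteq> W \<and> R ((G (c + r) - G (c - r)) / (2 * r))}"
  have 1: "0 < snd i" if "i \<in> K" for i
    using that by (auto simp: K_def)
  have 2: "\<exists>i. i \<in> K \<and> x \<in> cball (fst i) (snd i) \<and> snd i < d" if x: "x \<in> E" and "0 < d" for x d
  proof -
    obtain e where e: "e > 0" "ball x e \<subseteq> W"
      using W x by (meson openE subsetD)
    have "\<exists>y\<in>UNIV. y \<noteq> x \<and> dist y x < min d e \<and> R ((G y - G x) / (y - x))"
      using fr[OF x] e(1) \<open>0 < d\<close> unfolding frequently_at by (drule_tac x="min d e" in spec) auto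
    then obtain y where y: "y \<noteq> x" "\<bar>y - x\<bar> < min d e" "R ((G y - G x) / (y - x))"
      by (auto simp: dist_real_def)
    \<comment> \<open>The interval with endpoints \<open>x\<close> and \<open>y\<close>, recorded by
      centre and radius as the covering theorem wants it. The increment of \<open>G\<close> over it
      divided by its length is the quotient at \<open>x\<close>, on whichever side \<open>y\<close>
      lies.\<close>
    define c where "c = (x + y) / 2"
    define r where "r = \<bar>y - x\<bar> / 2"
    have r: "0 < r" using y by (simp add: r_def)
    have sub: "cball c r \<subseteq> ball x e"
    proof
      fix u assume "u \<in> cball c r"
      then have "\<bar>c - u\<bar> \<le> r" by (simp add: dist_real_def)
      moreover have "\<bar>x - c\<bar> \<le> r" unfolding c_def r_def by (simp add: field_simps abs_if)
      ultimately have "\<bar>x - u\<bar> \<le> 2 * r" by linarith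
      then show "u \<in> ball x e" using y(2) by (simp add: dist_real_def r_def)
    qed
    have xin: "x \<in> cball c r" by (auto simp: c_def r_def dist_real_def)
    have "(G (c + r) - G (c - r)) / (2 * r) = (G y - G x) / (y - x)"
    proof (cases "y > x")
      case True
      then have e: "c + r = y" "c - r = x" "2 * r = y - x" by (auto simp: c_def r_def field_simps)
      show ?thesis unfolding e ..
    next
      case False
      then have e: "c + r = x" "c - r = y" "2 * r = x - y" using y(1) by (auto simp: c_def r_def field_simps)
      show ?thesis unfolding e by (metis minus_diff_eq minus_divide_divide)
    qed
    then have "(c, r) \<in> K" using r sub e(2) y(3) by (auto simp: K_def)
    moreover have "r < d" using y \<open>0 < d\<close> by (auto simp: r_def)
    ultimately show ?thesis using xin by (intro exI[of _ "(c, r)"]) auto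
  qed
  obtain C where C: "countable C" "C \<subseteq> K"
     "pairwise (\<lambda>i j. disjnt (cball (fst i) (snd i)) (cball (fst j) (snd j))) C"
     "negligible (E - (\<Union>i\<in>C. cball (fst i) (snd i)))"
    by (rule Vitali_covering_theorem_cballs[where a = fst and r = snd, OF 1 2]) (assumption | rule that)+
  show thesis
    by (rule that[OF C(1) _ C(3,4)]) (use C(2) in \<open>auto simp: K_def\<close>)
qed

text \<open>The classical covering argument. Let \<open>m\<close> be the outer measure of
  \<open>E\<close>. An open set of measure below \<open>m + e\<close> contains disjoint intervals
  that cover almost all of \<open>E\<close> and over which \<open>G\<close> grows by less than
  \<open>\<alpha>\<close> times the length. Inside them lie disjoint intervals, again covering
  almost all of \<open>E\<close>, over which it grows by more than \<open>\<beta>\<close> times the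
  length. Comparing the growth gives \<open>\<beta> * m \<le> \<alpha> * (m + e)\<close>.\<close>

lemma mono_dini_gap_negligible:
  fixes G :: "real \<Rightarrow> real"
  assumes mono: "mono G" and cont: "continuous_on UNIV G" and ab: "0 \<le> \<alpha>" "\<alpha> < \<beta>"
    and E: "E \<subseteq> {a<..<b}"
    and lo: "\<And>x. x \<in> E \<Longrightarrow> \<exists>\<^sub>F y in at x. (G y - G x) / (y - x) < \<alpha>"
    and up: "\<And>x. x \<in> E \<Longrightarrow> \<exists>\<^sub>F y in at x. \<beta> < (G y - G x) / (y - x)"
  shows "negligible E"
proof -
  \<comment> \<open>The measure of an interval under \<open>\<nu>\<close> is the increment of
    \<open>G\<close>, so that increments over countably many disjoint intervals add up and compare
    by inclusion.\<close>
  define \<nu> where "\<nu> = interval_measure G"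
  have sets_nu [measurable_cong, simp]: "sets \<nu> = sets borel" by (simp add: \<nu>_def)
  have nu_cball: "emeasure \<nu> (cball c r) = ennreal (G (c + r) - G (c - r))" if "0 < r" for c r
    unfolding \<nu>_def cball_eq_atLeastAtMost using that mono cont
    by (subst emeasure_interval_measure_Icc) (auto simp: mono_def)
  have lb_cball: "emeasure lborel (cball c r) = ennreal (2 * r)" if "0 < r" for c r :: real
    unfolding cball_eq_atLeastAtMost using that by simp
  define S where "S = {measure lebesgue U |U. open U \<and> E \<subseteq> U \<and> U \<subseteq> {a<..<b}}"
  define m where "m = Inf S"
  have S_ne: "S \<noteq> {}" using E unfolding S_def by (auto intro!: exI[of _ "{a<..<b}"])
  have S_bdd: "bdd_below S" unfolding S_def by (auto intro!: bdd_belowI[of _ 0])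
  have lmU: "U \<in> lmeasurable" if "open U" "U \<subseteq> {a<..<b}" for U
    using that by (meson bounded_Ioo bounded_subset lmeasurable_open)
  \<comment> \<open>\<open>m\<close> is an infimum over open sets. Outer regularity extends the
    bound to measurable sets that miss only a null part of \<open>E\<close>, such as the unions of
    closed intervals below.\<close>
  have m_le: "m \<le> measure lebesgue T" if T: "T \<in> lmeasurable" and N: "negligible (E - T)" for T
  proof (rule field_le_epsilon)
    fix e :: real assume "e > 0"
    have TN: "T \<union> (E - T) \<in> lmeasurable"
      using T N negligible_iff_measure by blast
    have eqm: "measure lebesgue (T \<union> (E - T)) = measure lebesgue T"
      using N T by (intro measure_negligible_symdiff) (auto elim: negligible_subset)
    obtain V where V0: "open V" "T \<union> (E - T) \<subseteq> V" "V - (T \<union> (E - T)) \<in> lmeasurable"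
      "emeasure lebesgue (V - (T \<union> (E - T))) < ennreal e"
      using sets_lebesgue_outer_open[OF fmeasurableD[OF TN] \<open>e > 0\<close>] by metis
    have Veq: "V = (T \<union> (E - T)) \<union> (V - (T \<union> (E - T)))" using V0(2) by auto
    have "V \<in> lmeasurable" using TN V0(3) by (subst Veq) (rule fmeasurable.Un)
    moreover have "measure lebesgue V \<le> measure lebesgue (T \<union> (E - T)) + measure lebesgue (V - (T \<union> (E - T)))"
      using TN V0(3) by (subst Veq) (intro measure_Un_le fmeasurableD)
    moreover have "measure lebesgue (V - (T \<union> (E - T))) < e"
      using V0(3,4) \<open>e > 0\<close> by (subst (asm) emeasure_eq_measure2) (auto simp: ennreal_less_iff)
    ultimately have V: "open V" "T \<union> (E - T) \<subseteq> V" "V \<in> lmeasurable"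
      "measure lebesgue V < measure lebesgue (T \<union> (E - T)) + e"
      using V0 by auto
    have "m \<le> measure lebesgue (V \<inter> {a<..<b})"
      unfolding m_def S_def
      by (rule cInf_lower[OF _ S_bdd[unfolded S_def]], rule CollectI, rule exI[of _ "V \<inter> {a<..<b}"]) (use V E in auto)
    also have "\<dots> \<le> measure lebesgue V"
      using V(3) lmU[of "V \<inter> {a<..<b}"] V(1) by (intro measure_mono_fmeasurable) (auto simp: fmeasurableD)
    finally show "m \<le> measure lebesgue T + e" using V(4) eqm by linarith
  qed
  have m0: "0 \<le> m" unfolding m_def by (rule cInf_greatest[OF S_ne]) (auto simp: S_def)
  have exU: "\<exists>U. open U \<and> E \<subseteq> U \<and> U \<subseteq> {a<..<b} \<and> measure lebesgue U < m + e" if "e > 0" for e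
  proof -
    have "\<exists>x\<in>S. x < m + e" using that cInf_lessD[OF S_ne, of "m + e"] unfolding m_def by linarith
    then show ?thesis unfolding S_def by blast
  qed
  have key: "\<beta> * m \<le> \<alpha> * (m + e)" if e: "e > 0" for e
  proof -
    obtain U where U: "open U" "E \<subseteq> U" "U \<subseteq> {a<..<b}" "measure lebesgue U < m + e"
      using exU[OF e] by blast
    obtain C where C: "countable C"
      "\<And>c r. (c, r) \<in> C \<Longrightarrow> 0 < r \<and> cball c r \<subseteq> U \<and> (G (c + r) - G (c - r)) / (2 * r) < \<alpha>"
      "pairwise (\<lambda>i j. disjnt (cball (fst i) (snd i)) (cball (fst j) (snd j))) C"
      "negligible (E - (\<Union>i\<in>C. cball (fst i) (snd i)))"
      by (rule vitali_difference_quotients[OF U(1,2), where R = "\<lambda>q. q < \<alpha>" and G = G, OF lo]) blast+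
    \<comment> \<open>The second covering must take place inside an open set. Passing to open
      intervals loses only countably many endpoints.\<close>
    define W where "W = (\<Union>i\<in>C. ball (fst i) (snd i))"
    define I where "I = (\<Union>i\<in>C. cball (fst i) (snd i))"
    have W: "open W" by (auto simp: W_def)
    have WI: "W \<subseteq> I" unfolding W_def I_def by (rule UN_mono[OF order_refl ball_subset_cball])
    have IU: "I \<subseteq> U" unfolding I_def by (rule UN_least) (metis C(2) prod.collapse)
    have Ib: "I \<in> sets borel" unfolding I_def using C(1) by (intro sets.countable_UN') auto
    have dC: "disjoint_family_on (\<lambda>i. cball (fst i) (snd i)) C"
      using C(3) by (auto simp: disjoint_family_on_def pairwise_def disjnt_def)
    have nuI: "emeasure \<nu> I \<le> ennreal \<alpha> * emeasure lborel I"
    proof -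
      have "emeasure \<nu> I = (\<integral>\<^sup>+ i. emeasure \<nu> (cball (fst i) (snd i)) \<partial>count_space C)"
        unfolding I_def by (rule emeasure_UN_countable[OF _ C(1) dC]) auto
      also have "\<dots> \<le> (\<integral>\<^sup>+ i. ennreal \<alpha> * emeasure lborel (cball (fst i) (snd i)) \<partial>count_space C)"
      proof (rule nn_integral_mono)
        fix i assume "i \<in> space (count_space C)"
        then have i: "0 < snd i" "(G (fst i + snd i) - G (fst i - snd i)) / (2 * snd i) < \<alpha>"
          using C(2)[of "fst i" "snd i"] by auto
        then have "G (fst i + snd i) - G (fst i - snd i) \<le> \<alpha> * (2 * snd i)" by (simp add: field_simps)
        then show "emeasure \<nu> (cball (fst i) (snd i)) \<le> ennreal \<alpha> * emeasure lborel (cball (fst i) (snd i))"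
          using i ab by (simp only: nu_cball lb_cball) (simp add: ennreal_mult[symmetric] ennreal_leI)
      qed
      also have "\<dots> = ennreal \<alpha> * emeasure lborel I"
        unfolding I_def by (subst emeasure_UN_countable[OF _ C(1) dC]) (auto intro: nn_integral_cmult)
      finally show ?thesis .
    qed
    have neg1: "negligible (E - W)"
    proof (rule negligible_subset)
      show "negligible ((E - I) \<union> (\<Union>i\<in>C. sphere (fst i) (snd i)))"
        using C(1,4) unfolding I_def by (intro negligible_Un negligible_countable_Union) (auto simp: negligible_sphere)
      show "E - W \<subseteq> (E - I) \<union> (\<Union>i\<in>C. sphere (fst i) (snd i))"
      proof
        fix x assume x: "x \<in> E - W"
        show "x \<in> (E - I) \<union> (\<Union>i\<in>C. sphere (fst i) (snd i))"
        proof (cases "x \<in> I")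
          case True
          then obtain i where "i \<in> C" "x \<in> cball (fst i) (snd i)" by (auto simp only: I_def UN_iff)
          moreover have "x \<notin> ball (fst i) (snd i)" using x \<open>i \<in> C\<close> unfolding W_def by blast
          ultimately have "x \<in> sphere (fst i) (snd i)" by (simp add: mem_cball mem_ball mem_sphere)
          then show ?thesis using \<open>i \<in> C\<close> by blast
        qed (use x in blast)
      qed
    qed
    have up': "\<And>x. x \<in> E \<inter> W \<Longrightarrow> \<exists>\<^sub>F y in at x. \<beta> < (G y - G x) / (y - x)" using up by auto
    obtain D where D: "countable D"
      "\<And>c r. (c, r) \<in> D \<Longrightarrow> 0 < r \<and> cball c r \<subseteq> W \<and> \<beta> < (G (c + r) - G (c - r)) / (2 * r)"
      "pairwise (\<lambda>i j. disjnt (cball (fst i) (snd i)) (cball (fst j) (snd j))) D"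
      "negligible (E \<inter> W - (\<Union>i\<in>D. cball (fst i) (snd i)))"
      by (rule vitali_difference_quotients[OF W Int_lower2, where R = "\<lambda>q. \<beta> < q" and G = G, OF up']) blast+
    define J where "J = (\<Union>i\<in>D. cball (fst i) (snd i))"
    have JW: "J \<subseteq> W" unfolding J_def by (rule UN_least) (metis D(2) prod.collapse)
    have Jb: "J \<in> sets borel" unfolding J_def using D(1) by (intro sets.countable_UN') auto
    have dD: "disjoint_family_on (\<lambda>i. cball (fst i) (snd i)) D"
      using D(3) by (auto simp: disjoint_family_on_def pairwise_def disjnt_def)
    have nuJ: "ennreal \<beta> * emeasure lborel J \<le> emeasure \<nu> J"
    proof -
      have "ennreal \<beta> * emeasure lborel J = (\<integral>\<^sup>+ i. ennreal \<beta> * emeasure lborel (cball (fst i) (snd i)) \<partial>count_space D)"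
        unfolding J_def by (subst emeasure_UN_countable[OF _ D(1) dD]) (auto intro: nn_integral_cmult[symmetric])
      also have "\<dots> \<le> (\<integral>\<^sup>+ i. emeasure \<nu> (cball (fst i) (snd i)) \<partial>count_space D)"
      proof (rule nn_integral_mono)
        fix i assume "i \<in> space (count_space D)"
        then have i: "0 < snd i" "\<beta> < (G (fst i + snd i) - G (fst i - snd i)) / (2 * snd i)"
          using D(2)[of "fst i" "snd i"] by auto
        then have "\<beta> * (2 * snd i) \<le> G (fst i + snd i) - G (fst i - snd i)" by (simp add: field_simps)
        then show "ennreal \<beta> * emeasure lborel (cball (fst i) (snd i)) \<le> emeasure \<nu> (cball (fst i) (snd i))"
          using i ab by (simp only: nu_cball lb_cball) (simp add: ennreal_mult[symmetric] ennreal_leI)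
      qed
      also have "\<dots> = emeasure \<nu> J"
        unfolding J_def by (rule emeasure_UN_countable[OF _ D(1) dD, symmetric]) auto
      finally show ?thesis .
    qed
    have "emeasure \<nu> J \<le> emeasure \<nu> I"
      using JW WI Ib by (intro emeasure_mono) auto
    then have lin: "ennreal \<beta> * emeasure lborel J \<le> ennreal \<alpha> * emeasure lborel I"
      by (rule order_trans[OF nuJ order_trans[OF _ nuI]])
    have fin1: "T \<in> lmeasurable" if T: "T \<in> sets borel" "T \<subseteq> U" for T
      by (rule fmeasurableI2[OF lmU[OF U(1,3)] T(2)]) (use T(1) in simp)
    have fin2: "emeasure lborel T = ennreal (measure lebesgue T)" if T: "T \<in> sets borel" "T \<subseteq> U" for T
      using emeasure_eq_measure2[OF fin1[OF T]] T(1) by simp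
    have JI: "J \<subseteq> U" using JW WI IU by auto
    have "ennreal (\<beta> * measure lebesgue J) \<le> ennreal (\<alpha> * measure lebesgue I)"
      using lin ab unfolding fin2[OF Jb JI] fin2[OF Ib IU] by (simp add: ennreal_mult)
    then have 1: "\<beta> * measure lebesgue J \<le> \<alpha> * measure lebesgue I"
      using ab by (subst (asm) ennreal_le_iff) auto
    have "negligible (E - J)"
      by (rule negligible_subset[OF negligible_Un[OF neg1 D(4)]]) (auto simp: J_def)
    then have "m \<le> measure lebesgue J" using m_le fin1[OF Jb JI] by blast
    then have "\<beta> * m \<le> \<beta> * measure lebesgue J" using ab by (intro mult_left_mono) auto
    also note 1
    also have "\<alpha> * measure lebesgue I \<le> \<alpha> * (m + e)"
    proof (rule mult_left_mono)
      have "measure lebesgue I \<le> measure lebesgue U"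
        using fin1[OF Ib IU] lmU[OF U(1,3)] IU by (intro measure_mono_fmeasurable) (auto simp: fmeasurableD)
      then show "measure lebesgue I \<le> m + e" using U(4) by linarith
    qed (use ab in auto)
    finally show ?thesis .
  qed
  have "m = 0"
  proof (rule ccontr)
    assume "m \<noteq> 0"
    with m0 have "m > 0" by simp
    \<comment> \<open>With this \<open>e\<close> the fact \<open>key\<close> bounds
      \<open>(\<beta> - \<alpha>) * m\<close> by \<open>\<alpha> * e\<close>, which is only the
      fraction \<open>\<alpha> / (\<alpha> + 1)\<close> of it.\<close>
    then have "(\<beta> - \<alpha>) * m / (\<alpha> + 1) > 0" using ab by simp
    from key[OF this] have "(\<beta> - \<alpha>) * m \<le> \<alpha> * ((\<beta> - \<alpha>) * m / (\<alpha> + 1))" by (simp add: algebra_simps)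
    also have "\<dots> = (\<beta> - \<alpha>) * m * (\<alpha> / (\<alpha> + 1))" by simp
    also have "\<dots> < (\<beta> - \<alpha>) * m * 1" using \<open>m > 0\<close> ab by (intro mult_strict_left_mono) (auto simp: field_simps)
    finally show False by simp
  qed
  show ?thesis
  proof (subst negligible_outer_le, intro allI impI)
    fix e :: real assume "e > 0"
    obtain U where U: "open U" "E \<subseteq> U" "U \<subseteq> {a<..<b}" "measure lebesgue U < m + e"
      using exU[OF \<open>e > 0\<close>] by blast
    then show "\<exists>T. E \<subseteq> T \<and> T \<in> lmeasurable \<and> measure lebesgue T \<le> e"
      using lmU[OF U(1,3)] U(2,4) \<open>m = 0\<close> by (intro exI[of _ U] conjI) simp_all
  qed
qed

text \<open>Where the quotients have no limit, two rationals separate their lower and upper limits,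
  and for each of the countably many pairs the gap lemma applies. Monotonicity and the Lipschitz
  bound keep both limits between 0 and \<open>L\<close>, so that equality of the two gives a finite
  limit.\<close>

lemma mono_lipschitz_ae_derivative:
  fixes G :: "real \<Rightarrow> real"
  assumes mono: "mono G" and lip: "L-lipschitz_on UNIV G"
  shows "negligible {x \<in> {a<..<b}. \<not> (\<exists>l. ((\<lambda>y. (G y - G x) / (y - x)) \<longlongrightarrow> l) (at x))}"
proof -
  define q where "q = (\<lambda>x y. (G y - G x) / (y - x))"
  define Ez where "Ez = (\<lambda>p :: rat \<times> rat. {x \<in> {a<..<b}. 0 \<le> real_of_rat (fst p) \<and> real_of_rat (fst p) < real_of_rat (snd p) \<and>
      (\<exists>\<^sub>F y in at x. q x y < real_of_rat (fst p)) \<and> (\<exists>\<^sub>F y in at x. real_of_rat (snd p) < q x y)})"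
  have cont: "continuous_on UNIV G" using lip by (rule lipschitz_on_continuous_on)
  have "negligible (Ez p)" for p
  proof (cases "0 \<le> real_of_rat (fst p) \<and> real_of_rat (fst p) < real_of_rat (snd p)")
    case True
    then show ?thesis
      by (intro mono_dini_gap_negligible[OF mono cont, of "real_of_rat (fst p)" "real_of_rat (snd p)" _ a b])
        (auto simp: Ez_def q_def)
  next
    case False
    then have "Ez p = {}" by (auto simp: Ez_def)
    then show ?thesis by simp
  qed
  then have neg: "negligible (\<Union>p. Ez p)"
    by (intro negligible_countable_Union) auto
  have q0: "0 \<le> q x y" for x y
    using mono by (cases "x \<le> y") (auto simp: q_def mono_def divide_nonneg_nonneg divide_nonpos_nonpos)
  have qL: "q x y \<le> L" for x y
  proof -
    have "\<bar>G y - G x\<bar> \<le> L * \<bar>y - x\<bar>" using lipschitz_onD[OF lip, of y x] by (simp add: dist_real_def)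
    then have "\<bar>q x y\<bar> \<le> L"
      unfolding q_def abs_divide using lipschitz_on_nonneg[OF lip]
      by (cases "y = x") (auto simp: divide_le_eq)
    then show ?thesis by linarith
  qed
  have "\<exists>l. ((\<lambda>y. q x y) \<longlongrightarrow> l) (at x)" if x: "x \<in> {a<..<b}" "\<And>p. x \<notin> Ez p" for x
  proof -
    define Li where "Li = Liminf (at x) (\<lambda>y. ereal (q x y))"
    define Ls where "Ls = Limsup (at x) (\<lambda>y. ereal (q x y))"
    have LL: "Li \<le> Ls" unfolding Li_def Ls_def by (rule Liminf_le_Limsup) simp
    have Li0: "0 \<le> Li" unfolding Li_def by (rule Liminf_bounded) (auto simp: q0)
    have LsL: "Ls \<le> ereal L" unfolding Ls_def by (rule Limsup_bounded) (auto simp: qL)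
    have "\<not> Li < Ls"
    proof
      assume "Li < Ls"
      then obtain r1 :: rat where r1: "Li < real_of_rat r1" "real_of_rat r1 < Ls" using ereal_dense3 by blast
      obtain r2 :: rat where r2: "real_of_rat r1 < ereal (real_of_rat r2)" "real_of_rat r2 < Ls" using ereal_dense3[OF r1(2)] by blast
      have "0 < ereal (real_of_rat r1)" using Li0 r1(1) by (rule le_less_trans)
      then have "0 \<le> real_of_rat r1" by simp
      moreover have "\<exists>\<^sub>F y in at x. q x y < real_of_rat r1"
      proof (rule ccontr)
        assume "\<not> (\<exists>\<^sub>F y in at x. q x y < real_of_rat r1)"
        then have "\<forall>\<^sub>F y in at x. ereal (real_of_rat r1) \<le> ereal (q x y)" by (simp add: not_frequently not_less)
        then have "ereal (real_of_rat r1) \<le> Li" unfolding Li_def by (rule Liminf_bounded)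
        with r1 show False by simp
      qed
      moreover have "\<exists>\<^sub>F y in at x. real_of_rat r2 < q x y"
      proof (rule ccontr)
        assume "\<not> (\<exists>\<^sub>F y in at x. real_of_rat r2 < q x y)"
        then have "\<forall>\<^sub>F y in at x. ereal (q x y) \<le> ereal (real_of_rat r2)" by (simp add: not_frequently not_less)
        then have "Ls \<le> ereal (real_of_rat r2)" unfolding Ls_def by (rule Limsup_bounded)
        with r2 show False by simp
      qed
      ultimately have "x \<in> Ez (r1, r2)" using x(1) r2(1) by (simp add: Ez_def)
      with x(2) show False by blast
    qed
    with LL have eq: "Li = Ls" by simp
    obtain l where l: "Li = ereal l" using Li0 LsL eq by (cases Li) auto
    have "((\<lambda>y. ereal (q x y)) \<longlongrightarrow> ereal l) (at x)"
      using eq l unfolding Li_def Ls_def by (intro Liminf_eq_Limsup) auto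
    then show ?thesis by auto
  qed
  then have "{x \<in> {a<..<b}. \<not> (\<exists>l. ((\<lambda>y. q x y) \<longlongrightarrow> l) (at x))} \<subseteq> (\<Union>p. Ez p)"
    by (intro subsetI) (metis (mono_tags, lifting) UN_I UNIV_I mem_Collect_eq)
  then show ?thesis
    unfolding q_def by (rule negligible_subset[OF neg])
qed

text \<open>Adding \<open>L * x\<close> turns a real \<open>L\<close>-Lipschitz function into a
  monotone one; real and imaginary parts are treated separately.\<close>

lemma lipschitz_ae_vector_derivative:
  fixes \<phi> :: "real \<Rightarrow> complex"
  assumes lip: "L-lipschitz_on UNIV \<phi>"
  shows "negligible {x \<in> {a<..<b}. \<not> (\<exists>D. (\<phi> has_vector_derivative D) (at x))}"
proof -
  have L0: "0 \<le> L" using lip by (rule lipschitz_on_nonneg)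
  have main: "negligible {x \<in> {a<..<b}. \<not> (\<exists>D. (u has_real_derivative D) (at x))}"
    if u: "\<And>x y. \<bar>u x - u y\<bar> \<le> L * \<bar>x - y\<bar>" for u :: "real \<Rightarrow> real"
  proof -
    define G where "G = (\<lambda>x. u x + L * x)"
    have "mono G"
    proof (rule monoI)
      fix x y :: real assume "x \<le> y"
      then show "G x \<le> G y" using u[of x y] by (simp add: G_def algebra_simps abs_if split: if_splits)
    qed
    moreover have "(2 * L)-lipschitz_on UNIV G"
    proof (rule lipschitz_onI)
      fix x y :: real
      have "G x - G y = (u x - u y) + L * (x - y)" by (simp add: G_def algebra_simps)
      also have "\<bar>\<dots>\<bar> \<le> \<bar>u x - u y\<bar> + L * \<bar>x - y\<bar>" using L0 by (metis abs_mult abs_of_nonneg abs_triangle_ineq)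
      finally show "dist (G x) (G y) \<le> 2 * L * dist x y" using u[of x y] by (simp add: dist_real_def)
    qed (use L0 in auto)
    ultimately have neg: "negligible {x \<in> {a<..<b}. \<not> (\<exists>l. ((\<lambda>y. (G y - G x) / (y - x)) \<longlongrightarrow> l) (at x))}"
      by (rule mono_lipschitz_ae_derivative)
    show ?thesis
    proof (rule negligible_subset[OF neg], safe)
      fix x l assume "\<nexists>D. (u has_real_derivative D) (at x)" "((\<lambda>y. (G y - G x) / (y - x)) \<longlongrightarrow> l) (at x)"
      then have "(G has_real_derivative l) (at x)" by (simp add: has_field_derivative_iff)
      then have "((\<lambda>x. G x - L * x) has_real_derivative (l - L)) (at x)" by (auto intro!: derivative_eq_intros)
      then have "(u has_real_derivative (l - L)) (at x)" by (simp add: G_def)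
      with \<open>\<nexists>D. (u has_real_derivative D) (at x)\<close> show False by blast
    qed
  qed
  have d: "cmod (\<phi> x - \<phi> y) \<le> L * \<bar>x - y\<bar>" for x y
    using lipschitz_onD[OF lip, of x y] by (simp add: dist_norm)
  have 1: "\<bar>Re (\<phi> x) - Re (\<phi> y)\<bar> \<le> L * \<bar>x - y\<bar>" for x y
    using order_trans[OF abs_Re_le_cmod d[of x y]] by simp
  have 2: "\<bar>Im (\<phi> x) - Im (\<phi> y)\<bar> \<le> L * \<bar>x - y\<bar>" for x y
    using order_trans[OF abs_Im_le_cmod d[of x y]] by simp
  have ex: "\<exists>D. (\<phi> has_vector_derivative D) (at x)"
    if "((\<lambda>x. Re (\<phi> x)) has_real_derivative D1) (at x)" "((\<lambda>x. Im (\<phi> x)) has_real_derivative D2) (at x)" for x D1 D2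
  proof -
    have "((\<lambda>x. complex_of_real (Re (\<phi> x))) has_vector_derivative of_real D1) (at x)"
      "((\<lambda>x. complex_of_real (Im (\<phi> x))) has_vector_derivative of_real D2) (at x)"
      using that by (auto intro!: has_vector_derivative_of_real simp: has_real_derivative_iff_has_vector_derivative)
    then have "((\<lambda>x. complex_of_real (Re (\<phi> x)) + \<i> * complex_of_real (Im (\<phi> x))) has_vector_derivative of_real D1 + \<i> * of_real D2) (at x)"
      by (intro has_vector_derivative_add has_vector_derivative_mult_right)
    then show ?thesis by (auto simp: complex_eq[symmetric])
  qed
  show ?thesis
    by (rule negligible_subset[OF negligible_Un[OF main[OF 1] main[OF 2]]]) (use ex in blast)
qed

section \<open>Integration over the circle and Cauchy's formula\<close>

abbreviation TT :: "real measure" where "TT \<equiv> lebesgue_on {0..2*pi}"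

text \<open>The reproducing kernel of \<open>H^2\<close> at \<open>w\<close>; the kernel
  \<open>kb b w z\<close> is \<open>1 - cnj (b w) * b z\<close> times it.\<close>

definition szego :: "complex \<Rightarrow> complex \<Rightarrow> complex" where "szego w z = 1 / (1 - cnj w * z)"

lemma finite_measure_TT: "finite_measure TT"
  by (rule finite_measure_lebesgue_on) simp

lemma integrable_TT_continuous:
  fixes u :: "real \<Rightarrow> 'a::euclidean_space"
  shows "continuous_on UNIV u \<Longrightarrow> integrable TT u"
  by (rule continuous_imp_integrable_real) (rule continuous_on_subset, auto)

lemma integral_TT:
  fixes u :: "real \<Rightarrow> 'a::euclidean_space"
  shows "continuous_on UNIV u \<Longrightarrow> integral\<^sup>L TT u = integral {0..2*pi} u"
  by (rule lebesgue_integral_eq_integral[OF integrable_TT_continuous]) auto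

lemma integral_TT_const: "integral\<^sup>L TT (\<lambda>t. c) = (2 * pi) *\<^sub>R (c::'a::euclidean_space)"
  by (subst integral_TT) (auto simp: continuous_on_const)

lemma norm_integral_TT_le:
  fixes f :: "real \<Rightarrow> complex"
  assumes "integrable TT f" "integrable TT g" "\<And>t. t \<in> {0..2*pi} \<Longrightarrow> cmod (f t) \<le> g t"
  shows "cmod (integral\<^sup>L TT f) \<le> integral\<^sup>L TT g"
  by (rule order_trans[OF integral_norm_bound integral_mono]) (use assms in auto)

lemma continuous_on_circle:
  assumes "continuous_on (cball 0 1) G"
  shows "continuous_on UNIV (\<lambda>t. G (cis t))"
  by (rule continuous_on_compose2[OF assms]) (auto intro!: continuous_intros)

lemma cauchy_circle_aux:
  fixes G :: "complex \<Rightarrow> complex"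
  assumes "continuous_on (cball 0 1) G" "G holomorphic_on ball 0 1" "cmod w < 1"
  shows "integral\<^sup>L TT (\<lambda>t. G (cis t) * (cis t / (cis t - w))) = 2 * pi * G w"
proof -
  have ne: "cis t \<noteq> w" for t using assms(3) by (metis norm_cis less_irrefl)
  have "((\<lambda>u. G u/(u-w)) has_contour_integral (2 * of_real pi * \<i> * G w)) (part_circlepath 0 1 0 (2*pi))"
    using Cauchy_integral_circlepath[of 0 1 G w] assms by (simp add: circlepath_def)
  then have "((\<lambda>t. G (cis t) / (cis t - w) * \<i> * cis t) has_integral (2 * of_real pi * \<i> * G w)) {0..2*pi}"
    by (subst (asm) has_contour_integral_part_circlepath_iff) auto
  then have "((\<lambda>t. (- \<i>) * (G (cis t) / (cis t - w) * \<i> * cis t)) has_integral (- \<i>) * (2 * of_real pi * \<i> * G w)) {0..2*pi}"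
    by (rule has_integral_mult_right)
  moreover have "(\<lambda>t. (- \<i>) * (G (cis t) / (cis t - w) * \<i> * cis t)) = (\<lambda>t. G (cis t) * (cis t / (cis t - w)))"
    by (auto simp: field_simps fun_eq_iff)
  moreover have "(- \<i>) * (2 * of_real pi * \<i> * G w) = 2 * pi * G w" by simp
  ultimately have "((\<lambda>t. G (cis t) * (cis t / (cis t - w))) has_integral 2 * pi * G w) {0..2*pi}" by (simp only:)
  then have "integral {0..2*pi} (\<lambda>t. G (cis t) * (cis t / (cis t - w))) = 2 * pi * G w" by (rule integral_unique)
  moreover have "continuous_on UNIV (\<lambda>t. G (cis t) * (cis t / (cis t - w)))"
    by (intro continuous_intros continuous_on_circle assms) (use ne in auto)
  ultimately show ?thesis by (simp add: integral_TT)
qed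

lemma cnj_szego_cis:
  assumes "cmod w < 1" shows "cnj (szego w (cis t)) = cis t / (cis t - w)"
proof -
  have ne: "cis t \<noteq> w" using assms by (metis norm_cis less_irrefl)
  have "cnj (szego w (cis t)) = 1 / (1 - w * cis (-t))" by (simp add: szego_def cis_cnj)
  also have "1 - w * cis (-t) = (cis t - w) * cis (-t)" by (simp add: algebra_simps cis_mult)
  also have "1 / ((cis t - w) * cis (-t)) = cis t / (cis t - w)"
    by (simp add: cis_inverse[symmetric] field_simps)
  finally show ?thesis .
qed

text \<open>On the circle \<open>cnj (szego w)\<close> is the Cauchy kernel with respect to arc
  length, so Cauchy's formula becomes the reproducing property.\<close>

lemma cauchy_circle:
  fixes G :: "complex \<Rightarrow> complex"
  assumes "continuous_on (cball 0 1) G" "G holomorphic_on ball 0 1" "cmod w < 1"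
  shows "integral\<^sup>L TT (\<lambda>t. G (cis t) * cnj (szego w (cis t))) = 2 * pi * G w"
  unfolding cnj_szego_cis[OF assms(3)] by (rule cauchy_circle_aux[OF assms])

lemma mean_value_circle:
  fixes G :: "complex \<Rightarrow> complex"
  assumes "continuous_on (cball 0 1) G" "G holomorphic_on ball 0 1"
  shows "integral\<^sup>L TT (\<lambda>t. G (cis t)) = 2 * pi * G 0"
  using cauchy_circle[OF assms, of 0] by (simp add: szego_def)

section \<open>The derivative of the Poisson kernel and radial limits\<close>

lemma cauchy_circle_deriv:
  fixes G :: "complex \<Rightarrow> complex"
  assumes "continuous_on (cball 0 1) G" "G holomorphic_on ball 0 1" "cmod w < 1"
  shows "integral\<^sup>L TT (\<lambda>t. G (cis t) * (cis t / (cis t - w)\<^sup>2)) = 2 * pi * deriv G w"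
proof -
  have ne: "cis t \<noteq> w" for t using assms(3) by (metis norm_cis less_irrefl)
  have w: "w \<in> ball 0 1" using assms by simp
  note C = Cauchy_derivative_integral_circlepath[OF assms(1,2) w]
  define I where "I = contour_integral (circlepath 0 1) (\<lambda>u. G u / (u - w)\<^sup>2)"
  have I: "deriv G w = 1 / (2 * of_real pi * \<i>) * I" unfolding I_def by (rule DERIV_imp_deriv[OF C(2)])
  have "((\<lambda>u. G u/(u-w)\<^sup>2) has_contour_integral I) (part_circlepath 0 1 0 (2*pi))"
    using has_contour_integral_integral[OF C(1)] by (simp add: circlepath_def I_def)
  then have "((\<lambda>t. G (cis t) / (cis t - w)\<^sup>2 * \<i> * cis t) has_integral I) {0..2*pi}"
    by (subst (asm) has_contour_integral_part_circlepath_iff) auto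
  then have "((\<lambda>t. (- \<i>) * (G (cis t) / (cis t - w)\<^sup>2 * \<i> * cis t)) has_integral (- \<i>) * I) {0..2*pi}"
    by (rule has_integral_mult_right)
  moreover have "(\<lambda>t. (- \<i>) * (G (cis t) / (cis t - w)\<^sup>2 * \<i> * cis t)) = (\<lambda>t. G (cis t) * (cis t / (cis t - w)\<^sup>2))"
    by (auto simp: field_simps fun_eq_iff)
  moreover have "I = 2 * of_real pi * \<i> * deriv G w" using I by (simp add: field_simps)
  then have "(- \<i>) * I = 2 * pi * deriv G w" by simp
  ultimately have "((\<lambda>t. G (cis t) * (cis t / (cis t - w)\<^sup>2)) has_integral 2 * pi * deriv G w) {0..2*pi}" by (simp only:)
  then have "integral {0..2*pi} (\<lambda>t. G (cis t) * (cis t / (cis t - w)\<^sup>2)) = 2 * pi * deriv G w" by (rule integral_unique)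
  moreover have "continuous_on UNIV (\<lambda>t. G (cis t) * (cis t / (cis t - w)\<^sup>2))"
    by (intro continuous_intros continuous_on_circle assms) (use ne in auto)
  ultimately show ?thesis by (simp add: integral_TT)
qed

text \<open>Minus the derivative in \<open>t\<close> of the Poisson kernel
  \<open>(1 - r\<^sup>2) / (cmod (1 - of_real r * cis t))\<^sup>2\<close>. By partial integration,
  pairing with it yields the angular derivative at the point \<open>r\<close>, whence the factor
  \<open>\<i> * r\<close> in front of \<open>deriv F\<close> below.\<close>

definition dpoisson :: "real \<Rightarrow> real \<Rightarrow> real" where
  "dpoisson r t = 2 * r * (1 - r\<^sup>2) * sin t / (cmod (1 - of_real r * cis t)) ^ 4"

text \<open>The first summand is the Cauchy kernel of the derivative at \<open>r\<close>. The second
  is the boundary function of a holomorphic function vanishing at the origin, and so contributes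
  nothing when integrated against a holomorphic \<open>F\<close>.\<close>

lemma dpoisson_eq:
  assumes r: "0 \<le> r" "r < 1"
  shows "complex_of_real (dpoisson r t) =
    \<i> * (of_real r * (cis t / (cis t - of_real r)\<^sup>2) - of_real r * cis t / (1 - of_real r * cis t)\<^sup>2)"
proof -
  define e where "e = cis t"
  have e1: "e * cnj e = 1" by (simp add: e_def complex_norm_square[symmetric])
  have e0: "e \<noteq> 0" by (simp add: e_def)
  have ce: "cnj e = 1 / e" using e1 e0 by (simp add: field_simps)
  have n1: "1 - of_real r * e \<noteq> 0"
  proof
    assume "1 - of_real r * e = 0"
    then have "cmod (of_real r * e) = 1" by simp
    then show False using r by (simp add: e_def norm_mult)
  qed
  have n2: "e - of_real r \<noteq> 0"
  proof
    assume "e - of_real r = 0"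
    then have "cmod e = r" using r by simp
    then show False using r by (simp add: e_def)
  qed
  have sin: "complex_of_real (sin t) = (e - cnj e) / (2 * \<i>)"
    by (simp add: e_def complex_eq_iff)
  have nrm: "complex_of_real ((cmod (1 - of_real r * e)) ^ 4) = ((1 - of_real r * e) * (1 - of_real r * cnj e))\<^sup>2"
  proof -
    have "complex_of_real ((cmod (1 - of_real r * e)) ^ 4) = (complex_of_real ((cmod (1 - of_real r * e))\<^sup>2))\<^sup>2"
      by (simp flip: power_mult of_real_power)
    also have "complex_of_real ((cmod (1 - of_real r * e))\<^sup>2) = (1 - of_real r * e) * cnj (1 - of_real r * e)"
      by (rule complex_norm_square)
    finally show ?thesis by simp
  qed
  have "complex_of_real (dpoisson r t) = 2 * of_real r * (1 - (of_real r)\<^sup>2) * ((e - cnj e) / (2 * \<i>)) / ((1 - of_real r * e) * (1 - of_real r * cnj e))\<^sup>2"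
    unfolding dpoisson_def e_def[symmetric] of_real_divide nrm using sin by simp
  also have "1 - of_real r * cnj e = (e - of_real r) / e" using e0 by (simp add: ce field_simps)
  also have "2 * of_real r * (1 - (of_real r)\<^sup>2) * ((e - cnj e) / (2 * \<i>)) / ((1 - of_real r * e) * ((e - of_real r) / e))\<^sup>2
     = \<i> * (of_real r * (e / (e - of_real r)\<^sup>2) - of_real r * e / (1 - of_real r * e)\<^sup>2)"
  proof -
    have A: "2 * of_real r * (1 - (of_real r)\<^sup>2) * ((e - cnj e) / (2 * \<i>)) = - \<i> * (of_real r * (1 - (of_real r)\<^sup>2) * ((e\<^sup>2 - 1) / e))"
      using e0 by (simp add: ce field_simps power2_eq_square)
    have B: "of_real r * (1 - (of_real r)\<^sup>2) * ((e\<^sup>2 - 1) / e) / ((1 - of_real r * e) * ((e - of_real r) / e))\<^sup>2 =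
       - (of_real r * (e / (e - of_real r)\<^sup>2) - of_real r * e / (1 - of_real r * e)\<^sup>2)"
    proof -
      have "of_real r * (1 - (of_real r)\<^sup>2) * ((e\<^sup>2 - 1) / e) / ((1 - of_real r * e) * ((e - of_real r) / e))\<^sup>2 =
        of_real r * e * ((1 - (of_real r)\<^sup>2) * (e\<^sup>2 - 1)) / ((1 - of_real r * e)\<^sup>2 * (e - of_real r)\<^sup>2)"
        using e0 n1 n2 by (simp add: power_mult_distrib power_divide power2_eq_square mult_ac)
      also have "(1 - (complex_of_real r)\<^sup>2) * (e\<^sup>2 - 1) = (e - of_real r)\<^sup>2 - (1 - of_real r * e)\<^sup>2"
        by (simp add: power2_eq_square algebra_simps)
      finally show ?thesis using n1 n2 by (simp add: field_simps)
    qed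
    show ?thesis unfolding A times_divide_eq_right[symmetric, of "- \<i>"] B by (simp add: right_diff_distrib)
  qed
  finally show ?thesis by (simp add: e_def)
qed

lemma one_minus_r_cis_nz: "0 \<le> r \<Longrightarrow> r < 1 \<Longrightarrow> 1 - complex_of_real r * cis t \<noteq> 0"
  by (metis abs_of_nonneg less_irrefl mult.right_neutral norm_cis norm_mult norm_of_real norm_one right_minus_eq)

lemma continuous_dpoisson: "0 \<le> r \<Longrightarrow> r < 1 \<Longrightarrow> continuous_on UNIV (dpoisson r)"
  unfolding dpoisson_def using one_minus_r_cis_nz by (intro continuous_intros) auto

lemma dpoisson_integral:
  fixes F :: "complex \<Rightarrow> complex"
  assumes "continuous_on (cball 0 1) F" "F holomorphic_on ball 0 1" and r: "0 \<le> r" "r < 1"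
  shows "integral\<^sup>L TT (\<lambda>t. F (cis t) * of_real (dpoisson r t)) = 2 * pi * (\<i> * r * deriv F (of_real r))"
proof -
  let ?r = "complex_of_real r"
  have ne: "1 - ?r * z \<noteq> 0" if "cmod z \<le> 1" for z
  proof
    assume "1 - ?r * z = 0"
    then have "cmod (?r * z) = 1" by simp
    moreover have "r * cmod z \<le> r * 1" using that r by (intro mult_left_mono) auto
    ultimately show False using r by (simp add: norm_mult)
  qed
  have ne2: "cis t - ?r \<noteq> 0" for t
  proof
    assume "cis t - ?r = 0"
    then have "cmod (cis t) = r" using r by simp
    then show False using r by simp
  qed
  have c1: "continuous_on UNIV (\<lambda>t. F (cis t) * (cis t / (cis t - ?r)\<^sup>2))"
    using ne2 by (intro continuous_intros continuous_on_circle assms) auto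
  have c2: "continuous_on UNIV (\<lambda>t. F (cis t) * (?r * cis t / (1 - ?r * cis t)\<^sup>2))"
    using ne by (intro continuous_intros continuous_on_circle assms) auto
  have 2: "integral\<^sup>L TT (\<lambda>t. F (cis t) * (?r * cis t / (1 - ?r * cis t)\<^sup>2)) = 2 * pi * (F 0 * (?r * 0 / (1 - ?r * 0)\<^sup>2))"
    by (rule mean_value_circle[of "\<lambda>z. F z * (?r * z / (1 - ?r * z)\<^sup>2)"])
      (use assms ne in \<open>auto intro!: continuous_intros holomorphic_intros\<close>)
  have "integral\<^sup>L TT (\<lambda>t. F (cis t) * of_real (dpoisson r t)) =
     integral\<^sup>L TT (\<lambda>t. (\<i> * ?r) * (F (cis t) * (cis t / (cis t - ?r)\<^sup>2)) - \<i> * (F (cis t) * (?r * cis t / (1 - ?r * cis t)\<^sup>2)))"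
    by (simp only: dpoisson_eq[OF r]) (simp add: algebra_simps)
  also have "\<dots> = (\<i> * ?r) * integral\<^sup>L TT (\<lambda>t. F (cis t) * (cis t / (cis t - ?r)\<^sup>2)) - \<i> * integral\<^sup>L TT (\<lambda>t. F (cis t) * (?r * cis t / (1 - ?r * cis t)\<^sup>2))"
    by (subst Bochner_Integration.integral_diff)
      (intro integrable_mult_right integrable_TT_continuous c1 c2, intro integrable_mult_right integrable_TT_continuous c1 c2,
       simp only: integral_mult_right_zero)
  also have "\<dots> = (\<i> * ?r) * (2 * pi * deriv F ?r)"
    using cauchy_circle_deriv[OF assms(1,2), of ?r] r 2 by simp
  finally show ?thesis by (simp add: mult_ac)
qed

text \<open>The number \<open>1 - 2 * r * c + r\<^sup>2\<close> exceeds \<open>1 - c\<^sup>2\<close>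
  by the square of \<open>r - c\<close>. The bound does not depend on \<open>r\<close>, so
  \<open>dpoisson\<close> tends to zero uniformly away from \<open>t = 0\<close> as \<open>r\<close>
  tends to 1.\<close>

lemma one_minus_r_cis_lower:
  assumes "0 \<le> r" "cos t \<le> c" shows "1 - c\<^sup>2 \<le> (cmod (1 - of_real r * cis t))\<^sup>2"
proof -
  have "(cmod (1 - of_real r * cis t))\<^sup>2 = (1 - r * cos t)\<^sup>2 + (r * sin t)\<^sup>2"
    by (simp add: cmod_power2)
  also have "\<dots> = 1 - 2 * r * cos t + r\<^sup>2 * ((sin t)\<^sup>2 + (cos t)\<^sup>2)" unfolding power2_diff power_mult_distrib distrib_left power_one mult_1_right by linarith
  also have "\<dots> = 1 - 2 * r * cos t + r\<^sup>2" by simp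
  also have "1 - c\<^sup>2 \<le> \<dots>"
  proof -
    have "1 - c\<^sup>2 \<le> (r - c)\<^sup>2 + (1 - c\<^sup>2)" by simp
    also have "\<dots> = 1 - 2 * r * c + r\<^sup>2" by (simp add: power2_eq_square algebra_simps)
    also have "\<dots> \<le> 1 - 2 * r * cos t + r\<^sup>2" using mult_left_mono[OF assms(2,1)] by simp
    finally show ?thesis .
  qed
  finally show ?thesis .
qed

lemma vector_derivative_zero_bound:
  assumes "(\<psi> has_vector_derivative 0) (at (0::real))" "0 < \<epsilon>"
  shows "\<exists>d>0. \<forall>t. \<bar>t\<bar> < d \<longrightarrow> norm (\<psi> t - \<psi> 0) \<le> \<epsilon> * \<bar>t\<bar>"
  using assms unfolding has_vector_derivative_def has_derivative_at_alt by simp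

lemma divide_le_mult_left: "0 < c \<Longrightarrow> x \<le> c * y \<Longrightarrow> x / c \<le> (y::real)"
  by (simp add: field_simps)

text \<open>Subtract from \<open>F (cis t)\<close> the first-order part
  \<open>F 1 + D sin t\<close>, whose pairing with \<open>dpoisson\<close> is known exactly. Near
  zero the remainder is at most \<open>\<epsilon> / 2\<close> times \<open>|sin t|\<close>, and
  \<open>sin t * dpoisson r t\<close> is nonnegative with integral \<open>2 * pi * r\<close>.
  Elsewhere the kernel is of order \<open>1 - r\<close>.\<close>

lemma fatou_at_one:
  fixes F :: "complex \<Rightarrow> complex"
  assumes F: "continuous_on (cball 0 1) F" "F holomorphic_on ball 0 1"
    and D: "((\<lambda>t. F (cis t)) has_vector_derivative D) (at 0)"
  shows "((\<lambda>r. deriv F (complex_of_real r)) \<longlongrightarrow> D / \<i>) (at_left 1)"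
proof -
  \<comment> \<open>Using \<open>sin t\<close> in place of \<open>t\<close> keeps the remainder
    periodic, so that the end of the interval near \<open>2 * pi\<close> is handled like its
    start.\<close>
  define \<psi> where "\<psi> = (\<lambda>t. F (cis t) - F 1 - D * of_real (sin t))"
  have cpsi: "continuous_on UNIV \<psi>"
    unfolding \<psi>_def by (intro continuous_intros continuous_on_circle F)
  have "(\<psi> has_vector_derivative (D - 0 - D * of_real (cos 0))) (at 0)"
    unfolding \<psi>_def
    by (intro has_vector_derivative_diff D has_vector_derivative_const has_vector_derivative_mult_right
         has_vector_derivative_of_real) (use DERIV_sin[of "0::real"] in \<open>simp only: has_real_derivative_iff_has_vector_derivative\<close>)
  then have dpsi: "(\<psi> has_vector_derivative 0) (at 0)" by simp
  have psi0: "\<psi> 0 = 0" by (simp add: \<psi>_def)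
  have psi_per: "\<psi> (t - 2 * pi) = \<psi> t" for t
    by (simp add: \<psi>_def cis_divide[symmetric] sin_diff)
  obtain M where M: "\<And>t. cmod (\<psi> t) \<le> M"
  proof -
    have "compact (\<psi> ` {0..2*pi})"
      by (intro compact_continuous_image continuous_on_subset[OF cpsi]) auto
    have "compact (F ` cball 0 1)" using F(1) by (intro compact_continuous_image) auto
    then obtain A where A: "\<And>z. cmod z \<le> 1 \<Longrightarrow> cmod (F z) \<le> A"
      by (fastforce dest!: compact_imp_bounded simp: bounded_iff)
    have "cmod (\<psi> t) \<le> A + A + cmod D" for t
    proof -
      have "cmod (\<psi> t) \<le> cmod (F (cis t)) + cmod (F 1) + cmod (D * of_real (sin t))"
        unfolding \<psi>_def by (meson add_mono norm_triangle_ineq4 order_refl order_trans)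
      also have "cmod (D * of_real (sin t)) \<le> cmod D" using abs_sin_le_one[of t]
        by (simp add: norm_mult mult_left_le)
      finally show ?thesis using A[of "cis t"] A[of 1] by simp
    qed
    then show ?thesis by (rule that)
  qed
  have M0: "0 \<le> M" using order_trans[OF norm_ge_zero M] .
  have ident: "\<i> * r * deriv F (of_real r) - D * r = integral\<^sup>L TT (\<lambda>t. \<psi> t * of_real (dpoisson r t)) / (2 * pi)"
    if r: "0 \<le> r" "r < 1" for r
  proof -
    note cd = continuous_dpoisson[OF r]
    have i1: "integrable TT (\<lambda>t. F (cis t) * of_real (dpoisson r t))"
      by (intro integrable_TT_continuous continuous_intros continuous_on_circle F cd)
    have i2: "integrable TT (\<lambda>t. complex_of_real (dpoisson r t))"
      by (intro integrable_TT_continuous continuous_intros cd)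
    have i3: "integrable TT (\<lambda>t. cis t * of_real (dpoisson r t))"
      by (intro integrable_TT_continuous continuous_intros cd)
    have i4: "integrable TT (\<lambda>t. complex_of_real (sin t * dpoisson r t))"
      by (intro integrable_TT_continuous continuous_intros cd)
    have z2: "integral\<^sup>L TT (\<lambda>t. complex_of_real (dpoisson r t)) = 0"
      using dpoisson_integral[of "\<lambda>_. 1", OF _ _ r] by simp
    have z3: "integral\<^sup>L TT (\<lambda>t. cis t * of_real (dpoisson r t)) = 2 * pi * (\<i> * r)"
      using dpoisson_integral[of "\<lambda>z. z", OF _ _ r] by (simp add: holomorphic_on_ident)
    have "integral\<^sup>L TT (\<lambda>t. Im (cis t * of_real (dpoisson r t))) = Im (2 * pi * (\<i> * r))"
      unfolding z3[symmetric] by (rule integral_Im[OF i3])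
    then have "integral\<^sup>L TT (\<lambda>t. sin t * dpoisson r t) = 2 * pi * r" by simp
    then have z4: "integral\<^sup>L TT (\<lambda>t. complex_of_real (sin t * dpoisson r t)) = 2 * pi * r"
      by (simp only: integral_complex_of_real)
    have "integral\<^sup>L TT (\<lambda>t. \<psi> t * of_real (dpoisson r t)) =
       integral\<^sup>L TT (\<lambda>t. F (cis t) * of_real (dpoisson r t) - F 1 * of_real (dpoisson r t) - D * complex_of_real (sin t * dpoisson r t))"
      by (simp add: \<psi>_def algebra_simps)
    also have "\<dots> = 2 * pi * (\<i> * r * deriv F (of_real r)) - F 1 * 0 - D * (2 * pi * r)"
      using i1 i2 i4 by (simp only: Bochner_Integration.integral_diff integrable_mult_right Bochner_Integration.integrable_diff
           integral_mult_right_zero z2 z4 dpoisson_integral[OF F r])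
    finally show ?thesis by (simp add: field_simps)
  qed
  have small: "\<exists>\<delta>>0. \<forall>r. 1 - \<delta> < r \<and> r < 1 \<longrightarrow> cmod (\<i> * r * deriv F (of_real r) - D * r) \<le> \<epsilon>" if "\<epsilon> > 0" for \<epsilon>
  proof -
    have "\<exists>d>0. \<forall>t. \<bar>t\<bar> < d \<longrightarrow> cmod (\<psi> t) \<le> (\<epsilon> / 4) * \<bar>t\<bar>"
      using vector_derivative_zero_bound[OF dpsi, of "\<epsilon> / 4"] \<open>\<epsilon> > 0\<close> psi0 by simp
    then obtain d1 where d1: "d1 > 0" "\<And>t. \<bar>t\<bar> < d1 \<Longrightarrow> cmod (\<psi> t) \<le> (\<epsilon> / 4) * \<bar>t\<bar>" by blast
    have "((\<lambda>t. sin t - t) has_vector_derivative 0) (at (0::real))"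
      unfolding has_real_derivative_iff_has_vector_derivative[symmetric] by (auto intro!: derivative_eq_intros)
    then have "\<exists>d>0. \<forall>t::real. \<bar>t\<bar> < d \<longrightarrow> \<bar>sin t - t\<bar> \<le> (1 / 2) * \<bar>t\<bar>"
      using vector_derivative_zero_bound[of "\<lambda>t. sin t - t" "1/2"] by simp
    then obtain d2 where d2: "d2 > 0" "\<And>t::real. \<bar>t\<bar> < d2 \<Longrightarrow> \<bar>sin t - t\<bar> \<le> (1 / 2) * \<bar>t\<bar>" by blast
    define d where "d = min 1 (min d1 d2) / 2"
    have d: "0 < d" "d < d1" "d < d2" "d < 1" using d1 d2 by (auto simp: d_def min_def)
    have near: "cmod (\<psi> t) \<le> (\<epsilon> / 2) * \<bar>sin t\<bar>" if "\<bar>t\<bar> \<le> d" for t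
    proof -
      have "cmod (\<psi> t) \<le> (\<epsilon> / 4) * \<bar>t\<bar>" using d1(2)[of t] that d by auto
      moreover have "\<bar>sin t - t\<bar> \<le> (1 / 2) * \<bar>t\<bar>" using d2(2)[of t] that d by auto
      then have "\<bar>t\<bar> \<le> 2 * \<bar>sin t\<bar>" by linarith
      then have "(\<epsilon> / 4) * \<bar>t\<bar> \<le> (\<epsilon> / 4) * (2 * \<bar>sin t\<bar>)" using \<open>\<epsilon> > 0\<close> by (intro mult_left_mono) auto
      ultimately show ?thesis by simp
    qed
    define c where "c = cos d"
    have "cos d < cos 0" using d pi_gt3 by (intro cos_monotone_0_pi) auto
    moreover have "0 < cos d" using d pi_gt3 by (intro cos_gt_zero) auto
    ultimately have c: "0 < c" "c < 1" by (auto simp: c_def)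
    define m where "m = 1 - c\<^sup>2"
    have m: "0 < m" using c by (simp add: m_def power_less_one_iff abs_square_less_1)
    have far: "cos t \<le> c" if "d \<le> t" "t \<le> 2 * pi - d" for t
    proof (cases "t \<le> pi")
      case True
      then show ?thesis unfolding c_def using that d by (intro cos_monotone_0_pi_le) auto
    next
      case False
      have "cos (2 * pi - t) \<le> cos d" using that d False by (intro cos_monotone_0_pi_le) auto
      then show ?thesis by (simp add: c_def)
    qed
    have pt: "cmod (\<psi> t * of_real (dpoisson r t)) \<le> (\<epsilon> / 2) * (sin t * dpoisson r t) + M * (4 * (1 - r) / m\<^sup>2)"
      if r: "0 \<le> r" "r < 1" and t: "t \<in> {0..2*pi}" for r t
    proof -
      have r2: "0 \<le> 1 - r\<^sup>2" "1 - r\<^sup>2 \<le> 2 * (1 - r)"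
        using r by (simp_all add: power_le_one abs_square_le_1) (use zero_le_power2[of "1 - r"] in \<open>simp add: power2_eq_square algebra_simps\<close>)
      have W0: "0 \<le> sin t * dpoisson r t"
      proof -
        have "sin t * dpoisson r t = 2 * r * (1 - r\<^sup>2) * (sin t)\<^sup>2 / (cmod (1 - of_real r * cis t)) ^ 4"
          by (simp add: dpoisson_def power2_eq_square)
        also have "\<dots> \<ge> 0" using r r2 by (intro divide_nonneg_nonneg mult_nonneg_nonneg) auto
        finally show ?thesis .
      qed
      have W1: "\<bar>sin t\<bar> * \<bar>dpoisson r t\<bar> = sin t * dpoisson r t" using W0 by (metis abs_mult abs_of_nonneg)
      have Mp: "0 \<le> M * (4 * (1 - r) / m\<^sup>2)" using M0 r by (intro mult_nonneg_nonneg divide_nonneg_nonneg) auto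
      consider "t \<le> d" | "2 * pi - d \<le> t" | "d \<le> t" "t \<le> 2 * pi - d" by linarith
      then show ?thesis
      proof cases
        case 1
        then have "cmod (\<psi> t) \<le> (\<epsilon> / 2) * \<bar>sin t\<bar>" using near[of t] t by auto
        then have "cmod (\<psi> t) * \<bar>dpoisson r t\<bar> \<le> (\<epsilon> / 2) * \<bar>sin t\<bar> * \<bar>dpoisson r t\<bar>" by (intro mult_right_mono) auto
        then show ?thesis using W1 Mp by (simp add: norm_mult mult.assoc)
      next
        case 2
        then have "cmod (\<psi> (t - 2 * pi)) \<le> (\<epsilon> / 2) * \<bar>sin (t - 2 * pi)\<bar>" using near[of "t - 2*pi"] t by auto
        then have "cmod (\<psi> t) \<le> (\<epsilon> / 2) * \<bar>sin t\<bar>" by (simp add: psi_per sin_diff)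
        then have "cmod (\<psi> t) * \<bar>dpoisson r t\<bar> \<le> (\<epsilon> / 2) * \<bar>sin t\<bar> * \<bar>dpoisson r t\<bar>" by (intro mult_right_mono) auto
        then show ?thesis using W1 Mp by (simp add: norm_mult mult.assoc)
      next
        case 3
        have low: "m \<le> (cmod (1 - of_real r * cis t))\<^sup>2"
          unfolding m_def using one_minus_r_cis_lower[OF r(1) far[OF 3]] .
        then have low2: "m\<^sup>2 \<le> (cmod (1 - of_real r * cis t)) ^ 4"
          using power_mono[OF low, of 2] m by (simp flip: power_mult)
        have "\<bar>dpoisson r t\<bar> = 2 * r * (1 - r\<^sup>2) * \<bar>sin t\<bar> / (cmod (1 - of_real r * cis t)) ^ 4"
          using r r2 by (simp add: dpoisson_def abs_mult)
        also have "\<dots> \<le> 2 * 1 * (2 * (1 - r)) * 1 / m\<^sup>2"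
          using r r2 m low2 by (intro frac_le mult_mono mult_nonneg_nonneg) auto
        finally have "\<bar>dpoisson r t\<bar> \<le> 4 * (1 - r) / m\<^sup>2" by simp
        then have "cmod (\<psi> t) * \<bar>dpoisson r t\<bar> \<le> M * (4 * (1 - r) / m\<^sup>2)"
          using M[of t] M0 by (intro mult_mono) auto
        moreover have "0 \<le> (\<epsilon> / 2) * (sin t * dpoisson r t)" using W0 \<open>\<epsilon> > 0\<close> by simp
        ultimately show ?thesis by (simp add: norm_mult)
      qed
    qed
    have bound: "cmod (\<i> * r * deriv F (of_real r) - D * r) \<le> \<epsilon> / 2 * r + M * (4 * (1 - r) / m\<^sup>2)"
      if r: "0 \<le> r" "r < 1" for r
    proof -
      note cd = continuous_dpoisson[OF r]
      have i1: "integrable TT (\<lambda>t. \<psi> t * of_real (dpoisson r t))"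
        by (intro integrable_TT_continuous continuous_intros cpsi cd)
      have i4: "integrable TT (\<lambda>t. sin t * dpoisson r t)"
        by (intro integrable_TT_continuous continuous_intros cd)
      have i3: "integrable TT (\<lambda>t. cis t * of_real (dpoisson r t))"
        by (intro integrable_TT_continuous continuous_intros cd)
      have z3: "integral\<^sup>L TT (\<lambda>t. cis t * of_real (dpoisson r t)) = 2 * pi * (\<i> * r)"
        using dpoisson_integral[of "\<lambda>z. z", OF _ _ r] by (simp add: holomorphic_on_ident)
      have "integral\<^sup>L TT (\<lambda>t. Im (cis t * of_real (dpoisson r t))) = Im (2 * pi * (\<i> * r))"
        unfolding z3[symmetric] by (rule integral_Im[OF i3])
      then have z4: "integral\<^sup>L TT (\<lambda>t. sin t * dpoisson r t) = 2 * pi * r" by simp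
      have i5: "integrable TT (\<lambda>t. (\<epsilon> / 2) * (sin t * dpoisson r t) + M * (4 * (1 - r) / m\<^sup>2))"
        by (intro integrable_TT_continuous continuous_intros cd)
      have "cmod (integral\<^sup>L TT (\<lambda>t. \<psi> t * of_real (dpoisson r t))) \<le> integral\<^sup>L TT (\<lambda>t. (\<epsilon> / 2) * (sin t * dpoisson r t) + M * (4 * (1 - r) / m\<^sup>2))"
        by (rule norm_integral_TT_le[OF i1 i5 pt[OF r]])
      also have "\<dots> = (\<epsilon> / 2) * (2 * pi * r) + 2 * pi * (M * (4 * (1 - r) / m\<^sup>2))"
        by (subst Bochner_Integration.integral_add) (use i4 in \<open>simp_all only: integral_mult_right_zero z4 integral_TT_const integrable_mult_right integrable_TT_continuous continuous_on_const real_scaleR_def mult.left_commute[of M]\<close>)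
      also have "\<dots> = (2 * pi) * (\<epsilon> / 2 * r + M * (4 * (1 - r) / m\<^sup>2))" by (simp add: algebra_simps)
      finally have "cmod (integral\<^sup>L TT (\<lambda>t. \<psi> t * of_real (dpoisson r t))) / (2 * pi) \<le> \<epsilon> / 2 * r + M * (4 * (1 - r) / m\<^sup>2)"
        by (rule divide_le_mult_left[rotated]) simp
      then show ?thesis unfolding ident[OF r] by (simp add: norm_divide norm_mult)
    qed
    \<comment> \<open>The shift allows \<open>M = 0\<close>. The number \<open>\<delta>\<close>
      below makes the contribution away from \<open>t = 0\<close> at most
      \<open>\<epsilon> / 2\<close>.\<close>
    define N where "N = M + 1"
    have N: "N > 0" using M0 by (simp add: N_def)
    define \<delta> where "\<delta> = min 1 (\<epsilon> / 2 * m\<^sup>2 / (4 * (M + 1)))"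
    have "\<delta> > 0" using \<open>\<epsilon> > 0\<close> m M0 by (auto simp: \<delta>_def)
    moreover have "cmod (\<i> * r * deriv F (of_real r) - D * r) \<le> \<epsilon>" if "1 - \<delta> < r" "r < 1" for r
    proof -
      have r: "0 \<le> r" "r < 1" using that by (auto simp: \<delta>_def min_def split: if_splits)
      have "1 - r \<le> \<epsilon> / 2 * m\<^sup>2 / (4 * (M + 1))" using that by (auto simp: \<delta>_def min_def split: if_splits)
      then have "M * (4 * (1 - r) / m\<^sup>2) \<le> M * (4 * (\<epsilon> / 2 * m\<^sup>2 / (4 * N)) / m\<^sup>2)" unfolding N_def
        using M0 by (intro mult_left_mono divide_right_mono) auto
      also have "\<dots> = \<epsilon> / 2 * (M / N)" using m N by (simp add: field_simps)
      also have "\<dots> \<le> \<epsilon> / 2 * 1" using \<open>\<epsilon> > 0\<close> M0 unfolding N_def by (intro mult_left_mono) auto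
      finally have "M * (4 * (1 - r) / m\<^sup>2) \<le> \<epsilon> / 2" by simp
      moreover have "\<epsilon> / 2 * r \<le> \<epsilon> / 2" using r \<open>\<epsilon> > 0\<close> by (simp add: mult_left_le)
      ultimately show ?thesis using bound[OF r] by linarith
    qed
    ultimately show ?thesis by blast
  qed
  have "((\<lambda>r::real. \<i> * r * deriv F (of_real r) - D * r) \<longlongrightarrow> 0) (at_left 1)"
  proof (rule tendstoI)
    fix e :: real assume "e > 0"
    then obtain \<delta> where \<delta>: "\<delta> > 0" "\<And>r. 1 - \<delta> < r \<Longrightarrow> r < 1 \<Longrightarrow> cmod (\<i> * of_real r * deriv F (of_real r) - D * of_real r) \<le> e / 2"
      using small[of "e/2"] by auto
    have "eventually (\<lambda>r. r \<in> {1 - \<delta> <..< 1}) (at_left (1::real))"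
      by (rule eventually_at_left_real) (use \<delta> in auto)
    then show "eventually (\<lambda>r::real. dist (\<i> * r * deriv F (of_real r) - D * r) 0 < e) (at_left 1)"
    proof (rule eventually_mono)
      fix r assume "r \<in> {1 - \<delta> <..< 1}"
      then show "dist (\<i> * of_real r * deriv F (of_real r) - D * of_real r) 0 < e" using \<delta>(2)[of r] \<open>e > 0\<close> by simp
    qed
  qed
  then have "((\<lambda>r::real. ((\<i> * r * deriv F (of_real r) - D * r) + D * r) / (\<i> * r)) \<longlongrightarrow> (0 + D * of_real 1) / (\<i> * of_real 1)) (at_left 1)"
    by (intro tendsto_intros) auto
  moreover have "eventually (\<lambda>r. r \<in> {0<..<1}) (at_left (1::real))"
    by (rule eventually_at_left_real) auto
  then have "eventually (\<lambda>r::real. ((\<i> * r * deriv F (of_real r) - D * r) + D * r) / (\<i> * r) = deriv F (of_real r)) (at_left 1)"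
    by (rule eventually_mono) auto
  ultimately have "((\<lambda>r. deriv F (complex_of_real r)) \<longlongrightarrow> (0 + D * of_real 1) / (\<i> * of_real 1)) (at_left 1)"
    by (rule Lim_transform_eventually)
  then show ?thesis by simp
qed

lemma cmod_cis_diff_le: "cmod (cis s - cis t) \<le> \<bar>s - t\<bar>"
proof -
  have "cis s - cis t = cis t * (cis (s - t) - 1)"
    by (simp add: right_diff_distrib cis_mult)
  moreover have "cmod (cis (s - t) - 1) = 2 * \<bar>sin ((s - t) / 2)\<bar>"
    using dist_exp_i_1[of "s - t"] by (simp only: cis_conv_exp)
  ultimately have "cmod (cis s - cis t) = 2 * \<bar>sin ((s - t) / 2)\<bar>"
    by (simp only: norm_mult norm_cis mult_1_left)
  also have "\<dots> \<le> 2 * \<bar>(s - t) / 2\<bar>" by (intro mult_left_mono abs_sin_x_le_abs_x) auto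
  finally show ?thesis by simp
qed

lemma holomorphic_on_compose_mult:
  assumes "f holomorphic_on ball 0 1" "cmod c \<le> 1"
  shows "(\<lambda>z. f (c * z)) holomorphic_on ball 0 1"
proof -
  have "c * z \<in> ball 0 1" if "z \<in> ball 0 1" for z
    using that assms(2) mult_mono[of "cmod c" 1 "cmod z" "cmod z"] by (auto simp: norm_mult)
  then have "f \<circ> (\<lambda>z. c * z) holomorphic_on ball 0 1"
    by (intro holomorphic_on_compose_gen[OF _ assms(1)] holomorphic_intros) auto
  then show ?thesis by (simp add: o_def)
qed

text \<open>A primitive of a bounded holomorphic function is Lipschitz up to the circle, hence a.e.
  differentiable along it; the radial limit of its derivative is read off the derivative of the
  Poisson kernel.\<close>
lemma fatou_radial_limits:
  assumes hol: "f holomorphic_on ball 0 1" and bd: "\<And>z. z \<in> ball 0 1 \<Longrightarrow> cmod (f z) \<le> B"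
  shows "negligible {t \<in> {a<..<b}. \<not> (\<exists>l. ((\<lambda>r. f (complex_of_real r * cis t)) \<longlongrightarrow> l) (at_left 1))}"
proof -
  obtain F where F: "\<And>z. z \<in> ball 0 1 \<Longrightarrow> (F has_field_derivative f z) (at z within ball 0 1)"
  proof (rule holomorphic_convex_primitive'[OF convex_ball open_ball hol])
    fix g assume g: "\<And>x. x \<in> ball 0 1 \<Longrightarrow> (g has_field_derivative f x) (at x within ball 0 1)"
    show thesis by (rule that[OF g])
  qed
  have B0: "0 \<le> B" using order_trans[OF norm_ge_zero bd[of 0]] by simp
  have lipF: "B-lipschitz_on (ball 0 1) F"
  proof (rule lipschitz_onI[OF _ B0])
    fix x y :: complex assume "x \<in> ball 0 1" "y \<in> ball 0 1"
    then show "dist (F x) (F y) \<le> B * dist x y"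
      unfolding dist_norm by (intro field_differentiable_bound[OF convex_ball F bd])
  qed
  from lipschitz_extend_closure[OF lipF] obtain g where
    g: "B-lipschitz_on (closure (ball 0 1)) g" "\<And>z. z \<in> ball 0 1 \<Longrightarrow> g z = F z" by auto
  have clo: "closure (ball 0 1) = (cball 0 1 :: complex set)" by simp
  have contg: "continuous_on (cball 0 1) g" using g(1) unfolding clo by (rule lipschitz_on_continuous_on)
  have dg: "(g has_field_derivative f z) (at z)" if z: "z \<in> ball 0 1" for z
  proof -
    have "(F has_field_derivative f z) (at z)" using F[OF z] unfolding at_within_open[OF z open_ball] .
    then show ?thesis
      by (rule has_field_derivative_transform_within_open[OF _ open_ball z]) (rule g(2)[symmetric])
  qed
  have holg: "g holomorphic_on ball 0 1" unfolding holomorphic_on_open[OF open_ball] using dg by meson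
  have "B-lipschitz_on UNIV (\<lambda>t. g (cis t))"
  proof (rule lipschitz_onI[OF _ B0])
    fix s t :: real
    have "dist (g (cis s)) (g (cis t)) \<le> B * dist (cis s) (cis t)"
      by (rule lipschitz_onD[OF g(1)]) auto
    also have "\<dots> \<le> B * dist s t"
      using B0 cmod_cis_diff_le[of s t] by (intro mult_left_mono) (auto simp: dist_norm)
    finally show "dist (g (cis s)) (g (cis t)) \<le> B * dist s t" .
  qed
  then have neg: "negligible {x \<in> {a<..<b}. \<not> (\<exists>D. ((\<lambda>t. g (cis t)) has_vector_derivative D) (at x))}"
    by (rule lipschitz_ae_vector_derivative)
  have ex: "\<exists>l. ((\<lambda>r. f (complex_of_real r * cis t)) \<longlongrightarrow> l) (at_left 1)"
    if D: "((\<lambda>t. g (cis t)) has_vector_derivative D) (at t)" for t D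
  proof -
    define G where "G = (\<lambda>z. g (cis t * z))"
    have "continuous_on (cball 0 1) G"
      unfolding G_def by (rule continuous_on_compose2[OF contg]) (auto intro!: continuous_intros simp: norm_mult)
    moreover have "G holomorphic_on ball 0 1"
      unfolding G_def by (rule holomorphic_on_compose_mult[OF holg]) simp
    moreover have "((\<lambda>s. G (cis s)) has_vector_derivative D) (at 0)"
    proof -
      have "((\<lambda>s. (\<lambda>t. g (cis t)) (s + t)) has_vector_derivative (1 *\<^sub>R D)) (at 0)"
        by (rule vector_diff_chain_at[unfolded o_def, where f = "\<lambda>s. s + t" and g = "\<lambda>t. g (cis t)"])
          (use D in \<open>auto intro!: derivative_eq_intros\<close>)
      then show ?thesis by (simp add: G_def cis_mult add.commute)
    qed
    ultimately have lim: "((\<lambda>r. deriv G (complex_of_real r)) \<longlongrightarrow> D / \<i>) (at_left 1)" by (rule fatou_at_one)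
    have dG: "deriv G (of_real r) = cis t * f (of_real r * cis t)" if "r \<in> {0<..<1}" for r :: real
    proof (rule DERIV_imp_deriv)
      have "(g has_field_derivative f (cis t * of_real r)) (at (cis t * of_real r))"
        by (rule dg) (use that in \<open>simp add: norm_mult\<close>)
      then have "(G has_field_derivative f (cis t * of_real r) * cis t) (at (of_real r))"
        unfolding G_def by (rule DERIV_chain2) (auto intro!: derivative_eq_intros)
      then show "(G has_field_derivative cis t * f (of_real r * cis t)) (at (of_real r))" by (simp add: mult_ac)
    qed
    have "eventually (\<lambda>r. r \<in> {0<..<1}) (at_left (1::real))" by (rule eventually_at_left_real) auto
    then have "eventually (\<lambda>r::real. cis (-t) * deriv G (of_real r) = f (of_real r * cis t)) (at_left 1)"
      by (rule eventually_mono) (simp add: dG cis_mult flip: mult.assoc)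
    moreover have "((\<lambda>r. cis (-t) * deriv G (complex_of_real r)) \<longlongrightarrow> cis (-t) * (D / \<i>)) (at_left 1)"
      by (intro tendsto_intros lim)
    ultimately show ?thesis by (auto simp: tendsto_cong)
  qed
  show ?thesis by (rule negligible_subset[OF neg]) (use ex in blast)
qed

text \<open>\<open>bdry\<close> is a \<open>Lim\<close>, hence an unspecified value where no limit
  exists. Setting it to zero there gives a version that is bounded everywhere, and measurable as a
  limit along the radii \<open>\<rho> n\<close>.\<close>

lemma boundary_function:
  assumes hol: "f holomorphic_on ball 0 1" and bd: "\<And>z. z \<in> ball 0 1 \<Longrightarrow> cmod (f z) \<le> B"
  obtains fs where "fs \<in> borel_measurable TT" "\<And>t. cmod (fs t) \<le> B"
    "AE t in TT. bdry f t = fs t" "AE t in TT. ((\<lambda>r. f (complex_of_real r * cis t)) \<longlongrightarrow> fs t) (at_left 1)"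
proof -
  define S where "S = {t. \<exists>l. ((\<lambda>r. f (complex_of_real r * cis t)) \<longlongrightarrow> l) (at_left 1)}"
  have "negligible {t \<in> {-1<..<2*pi+1}. t \<notin> S}"
    unfolding S_def mem_Collect_eq by (rule fatou_radial_limits[OF hol bd])
  then have N: "negligible ({0..2*pi} - S)" by (rule negligible_subset) auto
  have AES: "AE t in TT. t \<in> S"
    using N by (subst AE_restrict_space_iff) (auto simp: negligible_iff_null_sets eventually_ae_filter intro!: bexI[of _ "{0..2*pi} - S"])
  have Sm: "S \<inter> {0..2*pi} \<in> sets lebesgue"
  proof -
    have eq: "S \<inter> {0..2*pi} = {0..2*pi} - ({0..2*pi} - S)" by auto
    have "{0..2*pi} - S \<in> sets lebesgue" using N by (simp add: negligible_imp_sets)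
    then show ?thesis by (subst eq) (rule sets.Diff, simp)
  qed
  have B0: "0 \<le> B" using order_trans[OF norm_ge_zero bd[of 0]] by simp
  define fs where "fs = (\<lambda>t. if t \<in> S then Lim (at_left (1::real)) (\<lambda>r. f (complex_of_real r * cis t)) else 0)"
  have lim: "((\<lambda>r. f (complex_of_real r * cis t)) \<longlongrightarrow> fs t) (at_left 1)" if "t \<in> S" for t
    using that tendsto_Lim[of "at_left (1::real)"] unfolding S_def fs_def by (auto simp: trivial_limit_at_left_real)
  have fsB: "cmod (fs t) \<le> B" for t
  proof (cases "t \<in> S")
    case True
    have "eventually (\<lambda>r. r \<in> {0<..<1}) (at_left (1::real))" by (rule eventually_at_left_real) auto
    then have "eventually (\<lambda>r. cmod (f (complex_of_real r * cis t)) \<le> B) (at_left 1)"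
      by (rule eventually_mono) (use bd in \<open>auto simp: norm_mult\<close>)
    then show ?thesis
      by (rule tendsto_upperbound[OF tendsto_norm[OF lim[OF True]]]) simp
  next
    case False
    then show ?thesis using B0 by (simp add: fs_def)
  qed
  define \<rho> where "\<rho> = (\<lambda>n. 1 - 1 / (real n + 2))"
  have rho: "0 \<le> \<rho> n" "\<rho> n < 1" for n by (auto simp: \<rho>_def field_simps)
  have rholim: "filterlim \<rho> (at_left 1) sequentially"
    unfolding \<rho>_def by real_asymp
  have meas: "fs \<in> borel_measurable TT"
  proof (rule borel_measurable_LIMSEQ_metric)
    fix n
    have "continuous_on UNIV (\<lambda>t. f (complex_of_real (\<rho> n) * cis t))"
      by (rule continuous_on_compose2[OF holomorphic_on_imp_continuous_on[OF hol]])
        (use rho in \<open>auto intro!: continuous_intros simp: norm_mult\<close>)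
    then have "(\<lambda>t. f (complex_of_real (\<rho> n) * cis t)) \<in> borel_measurable TT"
      using borel_measurable_integrable integrable_TT_continuous by blast
    moreover have "S \<inter> space TT \<in> sets TT"
      using Sm by (simp add: sets_restrict_space_iff Int_commute)
    ultimately show "(\<lambda>t. if t \<in> S then f (complex_of_real (\<rho> n) * cis t) else 0) \<in> borel_measurable TT"
      by (intro measurable_If_set) auto
  next
    fix t
    show "(\<lambda>n. if t \<in> S then f (complex_of_real (\<rho> n) * cis t) else 0) \<longlonglongrightarrow> fs t"
    proof (cases "t \<in> S")
      case True
      then show ?thesis using filterlim_compose[OF lim[OF True] rholim] by simp
    qed (simp add: fs_def)
  qed
  show thesis
  proof (rule that[OF meas fsB])
    show "AE t in TT. bdry f t = fs t" using AES by eventually_elim (simp add: fs_def bdry_def)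
    show "AE t in TT. ((\<lambda>r. f (complex_of_real r * cis t)) \<longlongrightarrow> fs t) (at_left 1)"
      using AES by eventually_elim (rule lim)
  qed
qed

section \<open>Bounded functions on the circle\<close>

text \<open>The bound is demanded at every real \<open>t\<close> and not almost everywhere, so that
  sums and products inherit it without exceptional sets. On the finite measure \<open>TT\<close> it
  yields integrability.\<close>

definition bmf :: "(real \<Rightarrow> 'a::{real_normed_algebra, second_countable_topology, banach}) \<Rightarrow> bool" where
  "bmf u \<longleftrightarrow> u \<in> borel_measurable TT \<and> (\<exists>B. \<forall>t. norm (u t) \<le> B)"

lemma bmfI: "u \<in> borel_measurable TT \<Longrightarrow> (\<And>t. norm (u t) \<le> B) \<Longrightarrow> bmf u"
  by (auto simp: bmf_def)

lemma bmf_meas: "bmf u \<Longrightarrow> u \<in> borel_measurable TT"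
  by (simp add: bmf_def)

lemma bmf_integrable:
  assumes "bmf u" shows "integrable TT u"
proof -
  obtain B where "\<And>t. norm (u t) \<le> B" using assms by (auto simp: bmf_def)
  then show ?thesis
    by (intro finite_measure.integrable_const_bound[OF finite_measure_TT]) (use assms in \<open>auto simp: bmf_def\<close>)
qed

lemma bmf_const: "bmf (\<lambda>t. c)"
  by (rule bmfI[of _ "norm c"]) auto

lemma bmf_add: assumes "bmf u" "bmf v" shows "bmf (\<lambda>t. u t + v t)"
proof -
  obtain A B where "\<And>t. norm (u t) \<le> A" "\<And>t. norm (v t) \<le> B" using assms by (auto simp: bmf_def)
  then have "norm (u t + v t) \<le> A + B" for t by (meson add_mono norm_triangle_ineq order_trans)
  then show ?thesis using assms by (intro bmfI) (auto simp: bmf_def)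
qed

lemma bmf_mult: assumes "bmf u" "bmf v" shows "bmf (\<lambda>t. u t * v t)"
proof -
  obtain A B where AB: "\<And>t. norm (u t) \<le> A" "\<And>t. norm (v t) \<le> B" using assms by (auto simp: bmf_def)
  have "norm (u t * v t) \<le> A * B" for t
    using AB[of t] by (intro order_trans[OF norm_mult_ineq] mult_mono) (auto intro: order_trans[OF norm_ge_zero])
  then show ?thesis using assms by (intro bmfI) (auto simp: bmf_def)
qed

lemma bmf_minus: assumes "bmf u" shows "bmf (\<lambda>t. - u t)"
  using assms by (auto simp: bmf_def)

lemma bmf_diff: assumes "bmf u" "bmf v" shows "bmf (\<lambda>t. u t - v t)"
  using bmf_add[OF assms(1) bmf_minus[OF assms(2)]] by simp

lemma bmf_norm: fixes u :: "real \<Rightarrow> complex" shows "bmf u \<Longrightarrow> bmf (\<lambda>t. cmod (u t))"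
  by (auto simp: bmf_def)

lemma bmf_cnj: fixes u :: "real \<Rightarrow> complex" shows "bmf u \<Longrightarrow> bmf (\<lambda>t. cnj (u t))"
  unfolding bmf_def by (auto intro!: borel_measurable_continuous_on[of cnj, OF continuous_on_cnj[OF continuous_on_id]])

lemma bmf_of_real: fixes u :: "real \<Rightarrow> real" shows "bmf u \<Longrightarrow> bmf (\<lambda>t. complex_of_real (u t))"
  unfolding bmf_def by auto

lemma bmf_power2: fixes u :: "real \<Rightarrow> 'a::{real_normed_field, second_countable_topology, banach}"
  shows "bmf u \<Longrightarrow> bmf (\<lambda>t. (u t)\<^sup>2)"
  unfolding power2_eq_square by (rule bmf_mult)

lemma bmf_sum: "(\<And>i. i \<in> I \<Longrightarrow> bmf (u i)) \<Longrightarrow> bmf (\<lambda>t. \<Sum>i\<in>I. u i t)"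
  by (induction I rule: infinite_finite_induct) (auto intro: bmf_const bmf_add)

lemma bmf_circle:
  fixes G :: "complex \<Rightarrow> 'a::{real_normed_field, euclidean_space}"
  assumes "continuous_on (sphere 0 1) G" shows "bmf (\<lambda>t. G (cis t))"
proof -
  have "compact (G ` sphere 0 1)" using assms by (intro compact_continuous_image) auto
  then have "bounded (G ` sphere 0 1)" by (rule compact_imp_bounded)
  then obtain B where B: "\<And>x. x \<in> G ` sphere 0 1 \<Longrightarrow> norm x \<le> B" by (auto simp only: bounded_iff)
  have "continuous_on UNIV (\<lambda>t. G (cis t))"
    by (rule continuous_on_compose2[OF assms]) (auto intro!: continuous_intros)
  then have "(\<lambda>t. G (cis t)) \<in> borel_measurable TT"
    using borel_measurable_integrable[OF integrable_TT_continuous] by blast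
  then show ?thesis by (rule bmfI[where B = B]) (use B in auto)
qed

lemma bmf_circle_radius:
  fixes f :: "complex \<Rightarrow> complex"
  assumes "continuous_on (ball 0 1) f" "0 \<le> r" "r < 1" shows "bmf (\<lambda>t. f (complex_of_real r * cis t))"
  by (rule bmf_circle, rule continuous_on_compose2[OF assms(1)])
    (use assms in \<open>auto intro!: continuous_intros simp: norm_mult\<close>)

lemma bmf_radius_factor: "0 \<le> r \<Longrightarrow> r < 1 \<Longrightarrow> f holomorphic_on ball 0 1 \<Longrightarrow> bmf (\<lambda>t. f (complex_of_real r * cis t))"
  by (rule bmf_circle_radius[OF holomorphic_on_imp_continuous_on])

lemma Cauchy_Schwarz_TT:
  fixes u v :: "real \<Rightarrow> real"
  assumes "bmf u" "bmf v"
  shows "(integral\<^sup>L TT (\<lambda>t. u t * v t))\<^sup>2 \<le> integral\<^sup>L TT (\<lambda>t. (u t)\<^sup>2) * integral\<^sup>L TT (\<lambda>t. (v t)\<^sup>2)"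
proof -
  define \<alpha> where "\<alpha> = integral\<^sup>L TT (\<lambda>t. (u t)\<^sup>2)"
  define \<beta> where "\<beta> = integral\<^sup>L TT (\<lambda>t. u t * v t)"
  define \<gamma> where "\<gamma> = integral\<^sup>L TT (\<lambda>t. (v t)\<^sup>2)"
  have i1: "integrable TT (\<lambda>t. (u t)\<^sup>2)" and i2: "integrable TT (\<lambda>t. u t * v t)" and i3: "integrable TT (\<lambda>t. (v t)\<^sup>2)"
    using assms by (auto intro!: bmf_integrable bmf_power2 bmf_mult)
  have q: "0 \<le> \<alpha> - 2 * x * \<beta> + x\<^sup>2 * \<gamma>" for x
  proof -
    have "0 \<le> integral\<^sup>L TT (\<lambda>t. (u t - x * v t)\<^sup>2)" by simp
    also have "(\<lambda>t. (u t - x * v t)\<^sup>2) = (\<lambda>t. (u t)\<^sup>2 - (2 * x) * (u t * v t) + x\<^sup>2 * (v t)\<^sup>2)"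
      by (auto simp: power2_eq_square algebra_simps)
    also have "integral\<^sup>L TT \<dots> = \<alpha> - 2 * x * \<beta> + x\<^sup>2 * \<gamma>"
      unfolding \<alpha>_def \<beta>_def \<gamma>_def
      by (simp only: Bochner_Integration.integral_add Bochner_Integration.integral_diff Bochner_Integration.integrable_diff
          integrable_mult_right integral_mult_right_zero i1 i2 i3)
    finally show ?thesis .
  qed
  have a0: "0 \<le> \<alpha>" "0 \<le> \<gamma>" by (auto simp: \<alpha>_def \<gamma>_def)
  have "\<beta>\<^sup>2 \<le> \<alpha> * \<gamma>"
  proof (cases "\<gamma> = 0")
    case True
    have "\<beta> = 0"
    proof (rule ccontr)
      assume "\<beta> \<noteq> 0"
      then show False using q[of "(\<alpha> + 1) / (2 * \<beta>)"] True by simp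
    qed
    then show ?thesis using True by simp
  next
    case False
    then have "\<gamma> > 0" using a0 by simp
    have "\<alpha> - 2 * (\<beta> / \<gamma>) * \<beta> + (\<beta> / \<gamma>)\<^sup>2 * \<gamma> = \<alpha> - \<beta>\<^sup>2 / \<gamma>"
      using False by (simp add: power2_eq_square field_simps)
    then have "\<beta>\<^sup>2 / \<gamma> \<le> \<alpha>" using q[of "\<beta> / \<gamma>"] by simp
    then show ?thesis using \<open>\<gamma> > 0\<close> by (simp add: pos_divide_le_eq)
  qed
  then show ?thesis by (simp add: \<alpha>_def \<beta>_def \<gamma>_def)
qed

text \<open>The squared norm for the measure \<open>dt\<close> and not for
  \<open>dt / (2 pi)\<close>; this is the origin of the factors \<open>2 * pi\<close> in the
  identities that follow.\<close>

definition nrm2 :: "(real \<Rightarrow> complex) \<Rightarrow> real" where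
  "nrm2 u = integral\<^sup>L TT (\<lambda>t. (cmod (u t))\<^sup>2)"

lemma nrm2_nonneg: "0 \<le> nrm2 u"
  by (simp add: nrm2_def)

lemma Cauchy_Schwarz_norms:
  assumes "bmf u" "bmf v"
  shows "integral\<^sup>L TT (\<lambda>t. cmod (u t) * cmod (v t)) \<le> sqrt (nrm2 u) * sqrt (nrm2 v)"
proof -
  have "(integral\<^sup>L TT (\<lambda>t. cmod (u t) * cmod (v t)))\<^sup>2 \<le> nrm2 u * nrm2 v"
    unfolding nrm2_def by (rule Cauchy_Schwarz_TT) (use assms in \<open>auto intro: bmf_norm\<close>)
  then show ?thesis by (simp add: real_le_rsqrt flip: real_sqrt_mult)
qed

lemma Cauchy_Schwarz_integral:
  assumes "bmf u" "bmf v"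
  shows "cmod (integral\<^sup>L TT (\<lambda>t. u t * v t)) \<le> sqrt (nrm2 u) * sqrt (nrm2 v)"
proof -
  have "cmod (integral\<^sup>L TT (\<lambda>t. u t * v t)) \<le> integral\<^sup>L TT (\<lambda>t. cmod (u t) * cmod (v t))"
    by (rule norm_integral_TT_le) (use assms in \<open>auto intro!: bmf_integrable bmf_mult bmf_norm simp: norm_mult\<close>)
  also note Cauchy_Schwarz_norms[OF assms]
  finally show ?thesis .
qed

lemma nrm2_mono:
  assumes "bmf u" "bmf v" "AE t in TT. cmod (u t) \<le> C * cmod (v t)"
  shows "nrm2 u \<le> C\<^sup>2 * nrm2 v"
proof -
  have "nrm2 u \<le> integral\<^sup>L TT (\<lambda>t. C\<^sup>2 * (cmod (v t))\<^sup>2)"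
    unfolding nrm2_def
  proof (rule integral_mono_AE)
    show "AE t in TT. (cmod (u t))\<^sup>2 \<le> C\<^sup>2 * (cmod (v t))\<^sup>2"
      using assms(3)
    proof eventually_elim
      case (elim t)
      then have "(cmod (u t))\<^sup>2 \<le> (C * cmod (v t))\<^sup>2" by (intro power_mono) auto
      then show ?case by (simp add: power_mult_distrib)
    qed
  qed (use assms in \<open>auto intro!: bmf_integrable bmf_power2 bmf_norm bmf_mult bmf_const\<close>)
  then show ?thesis by (simp add: nrm2_def)
qed

lemma dct_TT:
  fixes s :: "nat \<Rightarrow> real \<Rightarrow> 'a::euclidean_space"
  assumes "\<And>n. s n \<in> borel_measurable TT" "f \<in> borel_measurable TT"
    "AE t in TT. (\<lambda>n. s n t) \<longlonglongrightarrow> f t" "\<And>n t. norm (s n t) \<le> B"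
  shows "(\<lambda>n. integral\<^sup>L TT (s n)) \<longlonglongrightarrow> integral\<^sup>L TT f"
  by (rule integral_dominated_convergence[where w = "\<lambda>_. B"])
    (use assms in \<open>auto intro!: finite_measure.integrable_const[OF finite_measure_TT]\<close>)

section \<open>Boundary values of bounded holomorphic functions\<close>

definition rad :: "nat \<Rightarrow> real" where "rad n = 1 - 1 / (real n + 2)"

lemma rad: "0 \<le> rad n" "rad n < 1" by (auto simp: rad_def field_simps)

lemma rad_lim: "filterlim rad (at_left 1) sequentially"
  unfolding rad_def by real_asymp

text \<open>The second component is a parameter, so that it may be any bounded version of the radial
  limits: a product of two versions, or the restriction to the circle of a continuous
  function.\<close>

definition bfun :: "(complex \<Rightarrow> complex) \<Rightarrow> (real \<Rightarrow> complex) \<Rightarrow> bool" where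
  "bfun f fs \<longleftrightarrow> f holomorphic_on ball 0 1 \<and> (\<exists>B. \<forall>z\<in>ball 0 1. cmod (f z) \<le> B) \<and> bmf fs \<and>
     (AE t in TT. ((\<lambda>r. f (complex_of_real r * cis t)) \<longlongrightarrow> fs t) (at_left 1))"

lemma bfunI:
  assumes "f holomorphic_on ball 0 1" "\<And>z. z \<in> ball 0 1 \<Longrightarrow> cmod (f z) \<le> B" "bmf fs"
    "AE t in TT. ((\<lambda>r. f (complex_of_real r * cis t)) \<longlongrightarrow> fs t) (at_left 1)"
  shows "bfun f fs"
  using assms unfolding bfun_def by blast

lemma bfun_hol: "bfun f fs \<Longrightarrow> f holomorphic_on ball 0 1"
  by (simp add: bfun_def)

lemma bfun_bmf: "bfun f fs \<Longrightarrow> bmf fs"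
  by (simp add: bfun_def)

lemma bfun_bound: "bfun f fs \<Longrightarrow> \<exists>B. \<forall>z\<in>ball 0 1. cmod (f z) \<le> B"
  by (simp add: bfun_def)

lemma bfun_mult: assumes "bfun f fs" "bfun g gs" shows "bfun (\<lambda>z. f z * g z) (\<lambda>t. fs t * gs t)"
proof -
  obtain A B where "\<forall>z\<in>ball 0 1. cmod (f z) \<le> A" "\<forall>z\<in>ball 0 1. cmod (g z) \<le> B"
    using assms[THEN bfun_bound] by blast
  note AB = this[rule_format]
  have "cmod (f z * g z) \<le> A * B" if "z \<in> ball 0 1" for z
    unfolding norm_mult using AB[OF that] by (intro mult_mono) (auto intro: order_trans[OF norm_ge_zero])
  moreover have "AE t in TT. ((\<lambda>r. f (complex_of_real r * cis t) * g (complex_of_real r * cis t)) \<longlongrightarrow> fs t * gs t) (at_left 1)"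
  proof -
    have "AE t in TT. ((\<lambda>r. f (complex_of_real r * cis t)) \<longlongrightarrow> fs t) (at_left 1)"
      "AE t in TT. ((\<lambda>r. g (complex_of_real r * cis t)) \<longlongrightarrow> gs t) (at_left 1)"
      using assms by (auto simp: bfun_def)
    then show ?thesis by eventually_elim (rule tendsto_mult)
  qed
  ultimately show ?thesis
    by (intro bfunI[where B = "A * B"] holomorphic_on_mult bmf_mult assms[THEN bfun_hol] assms[THEN bfun_bmf])
qed

lemma bfun_const: "bfun (\<lambda>z. c) (\<lambda>t. c)"
  unfolding bfun_def by (auto intro!: bmf_const)

lemma bfun_add: assumes "bfun f fs" "bfun g gs" shows "bfun (\<lambda>z. f z + g z) (\<lambda>t. fs t + gs t)"
proof -
  obtain A B where "\<forall>z\<in>ball 0 1. cmod (f z) \<le> A" "\<forall>z\<in>ball 0 1. cmod (g z) \<le> B"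
    using assms[THEN bfun_bound] by blast
  note AB = this[rule_format]
  have "cmod (f z + g z) \<le> A + B" if "z \<in> ball 0 1" for z
    using AB[OF that] by (meson add_mono norm_triangle_ineq order_trans)
  moreover have "AE t in TT. ((\<lambda>r. f (complex_of_real r * cis t) + g (complex_of_real r * cis t)) \<longlongrightarrow> fs t + gs t) (at_left 1)"
  proof -
    have "AE t in TT. ((\<lambda>r. f (complex_of_real r * cis t)) \<longlongrightarrow> fs t) (at_left 1)"
      "AE t in TT. ((\<lambda>r. g (complex_of_real r * cis t)) \<longlongrightarrow> gs t) (at_left 1)"
      using assms by (auto simp: bfun_def)
    then show ?thesis by eventually_elim (rule tendsto_add)
  qed
  ultimately show ?thesis
    by (intro bfunI[where B = "A + B"] holomorphic_on_add bmf_add assms[THEN bfun_hol] assms[THEN bfun_bmf])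
qed

lemma bfun_sum: "(\<And>i. i \<in> I \<Longrightarrow> bfun (f i) (fs i)) \<Longrightarrow> bfun (\<lambda>z. \<Sum>i\<in>I. f i z) (\<lambda>t. \<Sum>i\<in>I. fs i t)"
  by (induction I rule: infinite_finite_induct) (auto intro: bfun_const bfun_add)

lemma bfun_continuous:
  assumes "f holomorphic_on ball 0 1" "continuous_on (cball 0 1) f" shows "bfun f (\<lambda>t. f (cis t))"
proof -
  have "compact (f ` cball 0 1)" using assms by (intro compact_continuous_image) auto
  then have "bounded (f ` cball 0 1)" by (rule compact_imp_bounded)
  then obtain B where B: "\<And>x. x \<in> f ` cball 0 1 \<Longrightarrow> cmod x \<le> B" by (auto simp only: bounded_iff)
  have "((\<lambda>r. f (complex_of_real r * cis t)) \<longlongrightarrow> f (cis t)) (at_left 1)" for t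
  proof -
    have "continuous_on {0..1} (\<lambda>r. f (complex_of_real r * cis t))"
      by (rule continuous_on_compose2[OF assms(2)]) (auto intro!: continuous_intros simp: norm_mult)
    then have "((\<lambda>r. f (complex_of_real r * cis t)) \<longlongrightarrow> f (complex_of_real 1 * cis t)) (at 1 within {0..1})"
      unfolding continuous_on_def by (elim ballE[of _ _ 1]) auto
    moreover have "at 1 within {0..1::real} = at_left 1" by (rule at_within_Icc_at_left) simp
    ultimately show ?thesis by simp
  qed
  moreover have "bmf (\<lambda>t. f (cis t))" by (rule bmf_circle, rule continuous_on_subset[OF assms(2)]) auto
  ultimately show ?thesis using assms B unfolding bfun_def by (auto intro!: exI[of _ B])
qed

lemma bfun_seq:
  assumes "bfun f fs"
  shows "AE t in TT. (\<lambda>n. f (complex_of_real (rad n) * cis t)) \<longlonglongrightarrow> fs t"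
proof -
  have "AE t in TT. ((\<lambda>r. f (complex_of_real r * cis t)) \<longlongrightarrow> fs t) (at_left 1)"
    using assms by (simp add: bfun_def)
  then show ?thesis by eventually_elim (rule filterlim_compose[OF _ rad_lim])
qed

lemma bfun_integral_lim:
  assumes f: "bfun f fs" and u: "bmf u"
  shows "(\<lambda>n. integral\<^sup>L TT (\<lambda>t. f (complex_of_real (rad n) * cis t) * u t)) \<longlonglongrightarrow> integral\<^sup>L TT (\<lambda>t. fs t * u t)"
proof -
  obtain A where "\<forall>z\<in>ball 0 1. cmod (f z) \<le> A" using bfun_bound[OF f] by blast
  note A = this[rule_format]
  obtain B where B: "\<And>t. cmod (u t) \<le> B" using u by (auto simp: bmf_def)
  have hol: "f holomorphic_on ball 0 1" "bmf fs" using f by (auto simp: bfun_def)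
  have m: "bmf (\<lambda>t. f (complex_of_real (rad n) * cis t))" for n by (rule bmf_radius_factor[OF rad hol(1)])
  have A0: "0 \<le> A" using order_trans[OF norm_ge_zero A[of 0]] by simp
  show ?thesis
  proof (rule dct_TT)
    show "AE t in TT. (\<lambda>n. f (complex_of_real (rad n) * cis t) * u t) \<longlonglongrightarrow> fs t * u t"
      using bfun_seq[OF f] by eventually_elim (intro tendsto_intros)
    show "cmod (f (complex_of_real (rad n) * cis t) * u t) \<le> A * B" for n t
      unfolding norm_mult using A0 rad[of n] by (intro mult_mono A B) (auto simp: norm_mult)
  qed (auto intro!: bmf_meas bmf_mult m u hol)
qed

text \<open>Cauchy's formula for the dilates of \<open>f\<close> by \<open>rad n\<close>, which are
  continuous up to the circle, followed by dominated convergence.\<close>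

lemma cauchy_boundary:
  fixes f :: "complex \<Rightarrow> complex"
  assumes f: "bfun f fs" and w: "cmod w < 1"
  shows "integral\<^sup>L TT (\<lambda>t. fs t * cnj (szego w (cis t))) = 2 * pi * f w"
proof -
  have hol: "f holomorphic_on ball 0 1" using f by (simp add: bfun_def)
  have ne: "1 - cnj w * z \<noteq> 0" if "cmod z \<le> 1" for z
  proof
    assume "1 - cnj w * z = 0"
    then have "cmod (cnj w * z) = 1" by simp
    moreover have "cmod w * cmod z \<le> cmod w * 1" using that by (intro mult_left_mono) auto
    ultimately show False using w by (simp add: norm_mult)
  qed
  have "bmf (\<lambda>t. szego w (cis t))"
    by (rule bmf_circle) (auto simp: szego_def intro!: continuous_intros ne)
  then have b: "bmf (\<lambda>t. cnj (szego w (cis t)))" by (rule bmf_cnj)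
  have eq: "integral\<^sup>L TT (\<lambda>t. f (complex_of_real (rad n) * cis t) * cnj (szego w (cis t))) = 2 * pi * f (complex_of_real (rad n) * w)" for n
  proof (rule cauchy_circle[OF _ _ w, of "\<lambda>z. f (complex_of_real (rad n) * z)"])
    show "continuous_on (cball 0 1) (\<lambda>z. f (complex_of_real (rad n) * z))"
    proof (rule continuous_on_compose2[OF holomorphic_on_imp_continuous_on[OF hol]])
      show "(*) (complex_of_real (rad n)) ` cball 0 1 \<subseteq> ball 0 1"
      proof safe
        fix z :: complex assume "z \<in> cball 0 1"
        then have "rad n * cmod z \<le> rad n * 1" using rad[of n] by (intro mult_left_mono) auto
        then show "complex_of_real (rad n) * z \<in> ball 0 1" using rad[of n] by (simp add: norm_mult)
      qed
    qed (auto intro!: continuous_intros)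
    show "(\<lambda>z. f (complex_of_real (rad n) * z)) holomorphic_on ball 0 1"
      by (rule holomorphic_on_compose_mult[OF hol]) (use rad[of n] in auto)
  qed
  have "(\<lambda>n. 2 * pi * f (complex_of_real (rad n) * w)) \<longlonglongrightarrow> integral\<^sup>L TT (\<lambda>t. fs t * cnj (szego w (cis t)))"
    using bfun_integral_lim[OF f b] by (simp only: eq)
  moreover have "(\<lambda>n. 2 * pi * f (complex_of_real (rad n) * w)) \<longlonglongrightarrow> 2 * pi * f (complex_of_real 1 * w)"
  proof -
    have "isCont f w"
      by (rule field_differentiable_imp_continuous_at, rule holomorphic_on_imp_differentiable_at[OF hol]) (use w in auto)
    moreover have "rad \<longlonglongrightarrow> 1" unfolding rad_def by real_asymp
    ultimately show ?thesis
      by (intro tendsto_intros isCont_tendsto_compose[where g = f]) (auto intro!: tendsto_eq_intros)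
  qed
  ultimately have "integral\<^sup>L TT (\<lambda>t. fs t * cnj (szego w (cis t))) = 2 * pi * f (complex_of_real 1 * w)"
    by (rule LIMSEQ_unique)
  then show ?thesis by simp
qed

section \<open>Taylor coefficients and Parseval's formula\<close>

definition tc :: "(complex \<Rightarrow> complex) \<Rightarrow> nat \<Rightarrow> complex" where
  "tc f n = (deriv ^^ n) f 0 / fact n"

lemma tc_sums:
  assumes "f holomorphic_on ball 0 1" "cmod z < 1"
  shows "(\<lambda>n. tc f n * z ^ n) sums f z"
  using holomorphic_power_series[OF assms(1), of z] assms(2) by (simp add: tc_def)

lemma integral_cis_power:
  "integral\<^sup>L TT (\<lambda>t. cis t ^ n * cnj (cis t ^ m)) = (if n = m then 2 * pi else 0)"
proof (cases "m \<le> n")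
  case True
  have eq: "cis t ^ n * cnj (cis t ^ m) = cis t ^ (n - m)" for t
  proof -
    have "cis t ^ n * cnj (cis t ^ m) = cis t ^ (n - m) * (cis t ^ m * cnj (cis t ^ m))"
      using True by (simp flip: power_add mult.assoc)
    also have "cis t ^ m * cnj (cis t ^ m) = 1" by (simp add: power_mult_distrib[symmetric] cis_cnj cis_mult)
    finally show ?thesis by simp
  qed
  have "integral\<^sup>L TT (\<lambda>t. cis t ^ (n - m)) = complex_of_real (2 * pi) * 0 ^ (n - m)"
    by (rule mean_value_circle[of "\<lambda>z. z ^ (n - m)"]) (auto intro!: continuous_intros holomorphic_intros)
  then show ?thesis using True unfolding eq by (simp add: power_0_left)
next
  case False
  have eq: "cis t ^ n * cnj (cis t ^ m) = cnj (cis t ^ (m - n))" for t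
  proof -
    have "cis t ^ n * cnj (cis t ^ m) = cnj (cis t ^ (m - n)) * (cis t ^ n * cnj (cis t ^ n))"
      using False by (simp flip: power_add complex_cnj_mult)
    also have "cis t ^ n * cnj (cis t ^ n) = 1" by (simp add: power_mult_distrib[symmetric] cis_cnj cis_mult)
    finally show ?thesis by simp
  qed
  have "integral\<^sup>L TT (\<lambda>t. cis t ^ (m - n)) = complex_of_real (2 * pi) * 0 ^ (m - n)"
    by (rule mean_value_circle[of "\<lambda>z. z ^ (m - n)"]) (auto intro!: continuous_intros holomorphic_intros)
  then have "integral\<^sup>L TT (\<lambda>t. cnj (cis t ^ (m - n))) = cnj (complex_of_real (2 * pi) * 0 ^ (m - n))"
    by (simp only: Bochner_Integration.integral_cnj)
  then show ?thesis using False unfolding eq by (simp add: power_0_left)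
qed

lemma bmf_cis_power: "bmf (\<lambda>t. cis t ^ n)"
  by (rule bmf_circle[of "\<lambda>z. z ^ n"]) (auto intro!: continuous_intros)

lemma nrm2_polynomial:
  "nrm2 (\<lambda>t. \<Sum>n<N. c n * cis t ^ n) = 2 * pi * (\<Sum>n<N. (cmod (c n))\<^sup>2)"
proof -
  have "complex_of_real (nrm2 (\<lambda>t. \<Sum>n<N. c n * cis t ^ n)) =
     integral\<^sup>L TT (\<lambda>t. complex_of_real ((cmod (\<Sum>n<N. c n * cis t ^ n))\<^sup>2))"
    unfolding nrm2_def by (rule integral_complex_of_real[symmetric])
  also have "\<dots> = integral\<^sup>L TT (\<lambda>t. \<Sum>n<N. \<Sum>m<N. (c n * cnj (c m)) * (cis t ^ n * cnj (cis t ^ m)))"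
    by (simp only: complex_norm_square cnj_sum sum_product complex_cnj_mult) (simp add: mult_ac)
  also have "\<dots> = (\<Sum>n<N. \<Sum>m<N. (c n * cnj (c m)) * integral\<^sup>L TT (\<lambda>t. cis t ^ n * cnj (cis t ^ m)))"
    by (subst Bochner_Integration.integral_sum,
        intro bmf_integrable bmf_sum bmf_mult bmf_const bmf_cnj bmf_cis_power,
        intro sum.cong refl, subst Bochner_Integration.integral_sum,
        intro bmf_integrable bmf_sum bmf_mult bmf_const bmf_cnj bmf_cis_power,
        intro sum.cong refl integral_mult_right_zero)
  also have "\<dots> = (\<Sum>n<N. (c n * cnj (c n)) * (2 * pi))"
    by (simp only: integral_cis_power) (simp add: if_distrib cong: if_cong)
  also have "\<dots> = complex_of_real (2 * pi * (\<Sum>n<N. (cmod (c n))\<^sup>2))"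
    by (simp only: complex_norm_square[symmetric]) (simp add: sum_distrib_left mult_ac)
  finally show ?thesis by (simp only: of_real_eq_iff)
qed

text \<open>The Taylor polynomials converge boundedly on the circle through \<open>w\<close>, so
  orthogonality of the powers of \<open>cis t\<close> passes to the limit. Here \<open>w\<close> is
  a point and not a radius because the area integral below averages over the rotations of a given
  point.\<close>

lemma parseval_circle:
  assumes hol: "f holomorphic_on ball 0 1" and r: "cmod w < 1"
  shows "(\<lambda>n. (cmod (tc f n))\<^sup>2 * cmod w ^ (2 * n)) sums (nrm2 (\<lambda>t. f (w * cis t)) / (2 * pi))"
proof -
  define s where "s = (\<lambda>N t. \<Sum>n<N. (tc f n * w ^ n) * cis t ^ n)"
  have sm: "summable (\<lambda>n. cmod (tc f n * w ^ n))"
  proof -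
    define R where "R = (1 + cmod w) / 2"
    have R: "cmod w < R" "R < 1" using r by (auto simp: R_def)
    then have R0: "0 \<le> R" using norm_ge_zero[of w] by linarith
    have "summable (\<lambda>n. tc f n * complex_of_real R ^ n)"
      using tc_sums[OF hol, of "of_real R"] R R0 by (auto simp: sums_iff)
    then show ?thesis by (rule powser_insidea) (use R R0 in auto)
  qed
  define B where "B = (\<Sum>n. cmod (tc f n * w ^ n))"
  have sB: "cmod (s N t) \<le> B" for N t
  proof -
    have "cmod (s N t) \<le> (\<Sum>n<N. cmod (tc f n * w ^ n))"
      unfolding s_def by (rule sum_norm_le) (simp add: norm_mult norm_power)
    also have "\<dots> \<le> B" unfolding B_def by (rule sum_le_suminf[OF sm]) auto
    finally show ?thesis .
  qed
  have slim: "(\<lambda>N. s N t) \<longlonglongrightarrow> f (w * cis t)" for t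
  proof -
    have "(\<lambda>n. tc f n * (w * cis t) ^ n) sums f (w * cis t)"
      by (rule tc_sums[OF hol]) (use r in \<open>simp add: norm_mult\<close>)
    then show ?thesis by (simp add: sums_def s_def power_mult_distrib mult.assoc)
  qed
  have cont: "continuous_on (sphere 0 1) (\<lambda>z. f (w * z))"
    by (rule continuous_on_compose2[OF holomorphic_on_imp_continuous_on[OF hol]])
      (use r in \<open>auto intro!: continuous_intros simp: norm_mult\<close>)
  have bs: "bmf (s N)" for N unfolding s_def by (intro bmf_sum bmf_mult bmf_const bmf_cis_power)
  have "(\<lambda>N. integral\<^sup>L TT (\<lambda>t. (cmod (s N t))\<^sup>2)) \<longlonglongrightarrow> integral\<^sup>L TT (\<lambda>t. (cmod (f (w * cis t)))\<^sup>2)"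
  proof (rule dct_TT)
    show "norm ((cmod (s N t))\<^sup>2) \<le> B\<^sup>2" for N t using sB[of N t] by (simp add: power_mono)
    show "AE t in TT. (\<lambda>N. (cmod (s N t))\<^sup>2) \<longlonglongrightarrow> (cmod (f (w * cis t)))\<^sup>2"
      by (intro AE_I2 tendsto_intros slim)
  qed (intro bmf_meas bmf_power2 bmf_norm bs bmf_circle[of "\<lambda>z. f (w * z)"] cont)+
  then have "(\<lambda>N. nrm2 (s N)) \<longlonglongrightarrow> nrm2 (\<lambda>t. f (w * cis t))" by (simp add: nrm2_def)
  moreover have "nrm2 (s N) = 2 * pi * (\<Sum>n<N. (cmod (tc f n))\<^sup>2 * cmod w ^ (2 * n))" for N
    unfolding s_def nrm2_polynomial using r by (simp add: norm_mult norm_power power_mult_distrib power_mult mult.commute[of 2] flip: power_mult)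
  ultimately have "(\<lambda>N. 2 * pi * (\<Sum>n<N. (cmod (tc f n))\<^sup>2 * cmod w ^ (2 * n)) / (2 * pi)) \<longlonglongrightarrow> nrm2 (\<lambda>t. f (w * cis t)) / (2 * pi)"
    by (intro tendsto_divide) auto
  then show ?thesis by (simp add: sums_def)
qed

lemma parseval_radius:
  assumes "f holomorphic_on ball 0 1" "0 \<le> r" "r < 1"
  shows "(\<lambda>n. (cmod (tc f n))\<^sup>2 * r ^ (2 * n)) sums (nrm2 (\<lambda>t. f (complex_of_real r * cis t)) / (2 * pi))"
  using parseval_circle[OF assms(1), of "complex_of_real r"] assms(2,3) by simp

lemma nrm2_radius_mono:
  assumes hol: "f holomorphic_on ball 0 1" and r: "0 \<le> r" "r \<le> R" "R < 1"
  shows "nrm2 (\<lambda>t. f (complex_of_real r * cis t)) \<le> nrm2 (\<lambda>t. f (complex_of_real R * cis t))"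
proof -
  have "nrm2 (\<lambda>t. f (complex_of_real r * cis t)) / (2 * pi) \<le> nrm2 (\<lambda>t. f (complex_of_real R * cis t)) / (2 * pi)"
    by (rule sums_le[OF _ parseval_radius[OF hol] parseval_radius[OF hol]])
      (use r in \<open>auto intro!: mult_left_mono power_mono\<close>)
  then show ?thesis by (simp add: divide_le_cancel)
qed

text \<open>The quadratic means increase with the radius by Parseval's formula, and along
  \<open>rad\<close> they converge to the boundary norm.\<close>

lemma nrm2_radius_le_boundary:
  assumes f: "bfun f fs" and r: "0 \<le> r" "r < 1"
  shows "nrm2 (\<lambda>t. f (complex_of_real r * cis t)) \<le> nrm2 fs"
proof -
  have hol: "f holomorphic_on ball 0 1" "bmf fs" using f by (auto simp: bfun_def)
  obtain A where "\<forall>z\<in>ball 0 1. cmod (f z) \<le> A" using bfun_bound[OF f] by blast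
  note A = this[rule_format]
  have "(\<lambda>n. integral\<^sup>L TT (\<lambda>t. (cmod (f (complex_of_real (rad n) * cis t)))\<^sup>2)) \<longlonglongrightarrow> integral\<^sup>L TT (\<lambda>t. (cmod (fs t))\<^sup>2)"
  proof (rule dct_TT)
    show "AE t in TT. (\<lambda>n. (cmod (f (complex_of_real (rad n) * cis t)))\<^sup>2) \<longlonglongrightarrow> (cmod (fs t))\<^sup>2"
      using bfun_seq[OF f] by eventually_elim (intro tendsto_intros)
    show "norm ((cmod (f (complex_of_real (rad n) * cis t)))\<^sup>2) \<le> A\<^sup>2" for n t
      using A[of "complex_of_real (rad n) * cis t"] rad[of n] by (simp add: power_mono norm_mult)
  qed (intro bmf_meas bmf_power2 bmf_norm bmf_radius_factor[OF rad hol(1)] hol(2))+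
  then have lim: "(\<lambda>n. nrm2 (\<lambda>t. f (complex_of_real (rad n) * cis t))) \<longlonglongrightarrow> nrm2 fs" by (simp add: nrm2_def)
  have "eventually (\<lambda>x. x \<in> {r<..<1}) (at_left (1::real))" by (rule eventually_at_left_real) (use r in auto)
  then have "eventually (\<lambda>n. rad n \<in> {r<..<1}) sequentially" using rad_lim by (rule eventually_compose_filterlim)
  then have "eventually (\<lambda>n. nrm2 (\<lambda>t. f (complex_of_real r * cis t)) \<le> nrm2 (\<lambda>t. f (complex_of_real (rad n) * cis t))) sequentially"
    by (rule eventually_mono) (use r in \<open>auto intro!: nrm2_radius_mono[OF hol(1)]\<close>)
  then show ?thesis by (rule tendsto_lowerbound[OF lim]) simp
qed

section \<open>The kernel form\<close>

definition kf :: "nat \<Rightarrow> (nat \<Rightarrow> complex) \<Rightarrow> (nat \<Rightarrow> complex) \<Rightarrow> complex \<Rightarrow> complex" where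
  "kf n w c z = (\<Sum>i<n. c i * szego (w i) z)"

text \<open>The squared norm in \<open>H(b)\<close> of the combination of the kernels
  \<open>kb b (w i)\<close> with coefficients \<open>c i\<close>; \<open>kf n w c\<close> is the
  same combination of Szego kernels.\<close>

definition Qb :: "(complex \<Rightarrow> complex) \<Rightarrow> nat \<Rightarrow> (nat \<Rightarrow> complex) \<Rightarrow> (nat \<Rightarrow> complex) \<Rightarrow> real" where
  "Qb b n w c = Re (\<Sum>i<n. \<Sum>j<n. c j * cnj (c i) * kb b (w j) (w i))"

lemma one_minus_cnj_mult_nz:
  assumes "cmod w < 1" "cmod z \<le> 1" shows "1 - cnj w * z \<noteq> 0"
proof
  assume "1 - cnj w * z = 0"
  then have "cmod (cnj w * z) = 1" by simp
  moreover have "cmod w * cmod z \<le> cmod w * 1" using assms by (intro mult_left_mono) auto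
  ultimately show False using assms by (simp add: norm_mult)
qed

lemma szego_hol: "cmod w < 1 \<Longrightarrow> szego w holomorphic_on cball 0 1"
  unfolding szego_def using one_minus_cnj_mult_nz by (intro holomorphic_intros) auto

lemma kf_hol:
  assumes "\<And>i. i < n \<Longrightarrow> w i \<in> ball 0 1" shows "kf n w c holomorphic_on cball 0 1"
  unfolding kf_def using assms by (intro holomorphic_intros szego_hol) auto

lemma bfun_kf:
  assumes "\<And>i. i < n \<Longrightarrow> w i \<in> ball 0 1" shows "bfun (kf n w c) (\<lambda>t. kf n w c (cis t))"
  by (rule bfun_continuous, rule holomorphic_on_subset[OF kf_hol[OF assms]])
    (auto intro: holomorphic_on_imp_continuous_on[OF kf_hol[OF assms]])

text \<open>The bridge between \<open>in_Hb\<close> and integrals: the evaluation functional tested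
  there is the pairing with a combination of Szego kernels.\<close>

lemma integral_cnj_kf:
  fixes F :: "complex \<Rightarrow> complex"
  assumes w: "\<And>i. i < n \<Longrightarrow> w i \<in> ball 0 1" and F: "bfun F Fs"
  shows "integral\<^sup>L TT (\<lambda>t. Fs t * cnj (kf n w c (cis t))) = 2 * pi * (\<Sum>i<n. cnj (c i) * F (w i))"
proof -
  have bs: "bmf (\<lambda>t. Fs t * cnj (szego (w i) (cis t)))" if "i < n" for i
    by (intro bmf_mult bfun_bmf[OF F] bmf_cnj bmf_circle continuous_on_subset[OF holomorphic_on_imp_continuous_on[OF szego_hol]])
      (use w[OF that] in auto)
  have "integral\<^sup>L TT (\<lambda>t. Fs t * cnj (kf n w c (cis t))) = integral\<^sup>L TT (\<lambda>t. \<Sum>i<n. cnj (c i) * (Fs t * cnj (szego (w i) (cis t))))"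
    by (simp add: kf_def sum_distrib_left mult_ac)
  also have "\<dots> = (\<Sum>i<n. integral\<^sup>L TT (\<lambda>t. cnj (c i) * (Fs t * cnj (szego (w i) (cis t)))))"
    by (rule Bochner_Integration.integral_sum) (auto intro!: bmf_integrable bmf_mult[OF bmf_const] bs)
  also have "\<dots> = (\<Sum>i<n. cnj (c i) * (2 * pi * F (w i)))"
    by (intro sum.cong refl) (use w cauchy_boundary[OF F] in simp)
  finally show ?thesis by (simp add: sum_distrib_left mult_ac)
qed

lemma nrm2_complex: "complex_of_real (nrm2 u) = integral\<^sup>L TT (\<lambda>t. u t * cnj (u t))"
proof -
  have "integral\<^sup>L TT (\<lambda>t. u t * cnj (u t)) = integral\<^sup>L TT (\<lambda>t. complex_of_real ((cmod (u t))\<^sup>2))"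
    by (simp only: complex_norm_square)
  also have "\<dots> = complex_of_real (nrm2 u)" unfolding nrm2_def by (rule integral_complex_of_real)
  finally show ?thesis ..
qed

lemma cmod_diff_power2: "(cmod (u - v))\<^sup>2 = (cmod u)\<^sup>2 - 2 * Re (cnj u * v) + (cmod v)\<^sup>2"
  unfolding cmod_power2 by (simp add: power2_eq_square algebra_simps)

lemma nrm2_diff:
  assumes "bmf u" "bmf v"
  shows "nrm2 (\<lambda>t. u t - v t) = nrm2 u - 2 * Re (integral\<^sup>L TT (\<lambda>t. cnj (u t) * v t)) + nrm2 v"
proof -
  have i: "integrable TT (\<lambda>t. cnj (u t) * v t)" using assms by (intro bmf_integrable bmf_mult bmf_cnj)
  have i1: "integrable TT (\<lambda>t. (cmod (u t))\<^sup>2)" "integrable TT (\<lambda>t. (cmod (v t))\<^sup>2)"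
    using assms by (auto intro!: bmf_integrable bmf_power2 bmf_norm)
  have i2: "integrable TT (\<lambda>t. Re (cnj (u t) * v t))" using i by (rule integrable_Re)
  have "nrm2 (\<lambda>t. u t - v t) = integral\<^sup>L TT (\<lambda>t. (cmod (u t))\<^sup>2 - 2 * Re (cnj (u t) * v t) + (cmod (v t))\<^sup>2)"
    by (simp only: nrm2_def cmod_diff_power2)
  also have "\<dots> = nrm2 u - 2 * integral\<^sup>L TT (\<lambda>t. Re (cnj (u t) * v t)) + nrm2 v"
    unfolding nrm2_def
    by (simp only: Bochner_Integration.integral_add Bochner_Integration.integral_diff Bochner_Integration.integrable_diff
          integrable_mult_right integral_mult_right_zero i1 i2)
  also have "integral\<^sup>L TT (\<lambda>t. Re (cnj (u t) * v t)) = Re (integral\<^sup>L TT (\<lambda>t. cnj (u t) * v t))"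
    by (rule integral_Re[OF i])
  finally show ?thesis .
qed

text \<open>The complement \<open>\<rho> = cnj b k - T k\<close> of the co-analytic Toeplitz operator \<open>T\<close> of symbol \<open>cnj b\<close>, which maps
  \<open>szego w\<close> to \<open>cnj (b w) szego w\<close>. Its conjugate is again the boundary function of a bounded holomorphic function.\<close>
definition rsd :: "(complex \<Rightarrow> complex) \<Rightarrow> (real \<Rightarrow> complex) \<Rightarrow> nat \<Rightarrow> (nat \<Rightarrow> complex) \<Rightarrow> (nat \<Rightarrow> complex) \<Rightarrow> real \<Rightarrow> complex" where
  "rsd b bs n w c t = cnj (bs t) * kf n w c (cis t) - kf n w (\<lambda>i. c i * cnj (b (w i))) (cis t)"

text \<open>Here \<open>g\<close> is \<open>T k\<close>, and the identity says that \<open>T\<close>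
  is adjoint to multiplication by \<open>b\<close>, applied to the pair \<open>g\<close>,
  \<open>k\<close>. Both sides are evaluated at the points \<open>w i\<close>.\<close>

lemma toeplitz_pairing:
  fixes b :: "complex \<Rightarrow> complex" and c :: "nat \<Rightarrow> complex"
  assumes w: "\<And>i. i < n \<Longrightarrow> w i \<in> ball 0 1" and b: "bfun b bs"
  defines "g \<equiv> kf n w (\<lambda>i. c i * cnj (b (w i)))"
  shows "integral\<^sup>L TT (\<lambda>t. (bs t * g (cis t)) * cnj (kf n w c (cis t))) = nrm2 (\<lambda>t. g (cis t))"
proof -
  have g: "bfun g (\<lambda>t. g (cis t))" unfolding g_def by (rule bfun_kf[OF w])
  have "integral\<^sup>L TT (\<lambda>t. (bs t * g (cis t)) * cnj (kf n w c (cis t))) = 2 * pi * (\<Sum>i<n. cnj (c i) * (b (w i) * g (w i)))"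
    by (rule integral_cnj_kf[OF w bfun_mult[OF b g]])
  also have "\<dots> = 2 * pi * (\<Sum>i<n. cnj (c i * cnj (b (w i))) * g (w i))" by (simp add: mult.assoc)
  also have "\<dots> = integral\<^sup>L TT (\<lambda>t. g (cis t) * cnj (kf n w (\<lambda>i. c i * cnj (b (w i))) (cis t)))"
    by (rule integral_cnj_kf[OF w g, symmetric])
  also have "\<dots> = nrm2 (\<lambda>t. g (cis t))" unfolding nrm2_complex g_def ..
  finally show ?thesis .
qed

text \<open>By the reproducing property \<open>2 * pi * Qb\<close> is the difference of the squared
  norms of \<open>k\<close> and \<open>T k\<close>. Insert the squared norm of
  \<open>cnj b k\<close> between them: the residual is orthogonal to \<open>T k\<close> by
  \<open>toeplitz_pairing\<close>, so what remains after the weighted integral is the squared norm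
  of the residual.\<close>

lemma kernel_form_identity:
  fixes b :: "complex \<Rightarrow> complex"
  assumes w: "\<And>i. i < n \<Longrightarrow> w i \<in> ball 0 1" and b: "bfun b bs"
  shows "2 * pi * Qb b n w c =
    integral\<^sup>L TT (\<lambda>t. (1 - (cmod (bs t))\<^sup>2) * (cmod (kf n w c (cis t)))\<^sup>2) + nrm2 (rsd b bs n w c)"
proof -
  define k where "k = kf n w c"
  define g where "g = kf n w (\<lambda>i. c i * cnj (b (w i)))"
  have k: "bfun k (\<lambda>t. k (cis t))" and g: "bfun g (\<lambda>t. g (cis t))" unfolding k_def g_def by (auto intro: bfun_kf[OF w])
  note bk = bfun_bmf[OF k] and bg = bfun_bmf[OF g] and bb = bfun_bmf[OF b]
  have A: "complex_of_real (nrm2 (\<lambda>t. k (cis t))) = 2 * pi * (\<Sum>i<n. cnj (c i) * k (w i))"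
    unfolding nrm2_complex using integral_cnj_kf[where n = n and w = w and c = c, OF w k] by (simp add: k_def)
  have B: "complex_of_real (nrm2 (\<lambda>t. g (cis t))) = 2 * pi * (\<Sum>i<n. cnj (c i) * (b (w i) * g (w i)))"
    using toeplitz_pairing[where n = n and w = w and c = c, OF w b] integral_cnj_kf[where n = n and w = w and c = c, OF w bfun_mult[OF b g]] by (simp add: g_def)
  have "2 * pi * (\<Sum>i<n. \<Sum>j<n. c j * cnj (c i) * kb b (w j) (w i)) =
      2 * pi * (\<Sum>i<n. cnj (c i) * k (w i)) - 2 * pi * (\<Sum>i<n. cnj (c i) * (b (w i) * g (w i)))"
  proof -
    have eq: "(\<Sum>j<n. c j * cnj (c i) * kb b (w j) (w i)) = cnj (c i) * k (w i) - cnj (c i) * (b (w i) * g (w i))" for i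
      unfolding k_def g_def kf_def kb_def szego_def sum_distrib_left sum_subtractf[symmetric]
      by (intro sum.cong refl) (simp add: algebra_simps diff_divide_distrib)
    show ?thesis by (simp only: eq sum_subtractf right_diff_distrib)
  qed
  also have "\<dots> = complex_of_real (nrm2 (\<lambda>t. k (cis t)) - nrm2 (\<lambda>t. g (cis t)))" by (simp only: A B of_real_diff)
  finally have "complex_of_real (2 * pi) * (\<Sum>i<n. \<Sum>j<n. c j * cnj (c i) * kb b (w j) (w i)) = complex_of_real (nrm2 (\<lambda>t. k (cis t)) - nrm2 (\<lambda>t. g (cis t)))"
    by simp
  from arg_cong[OF this, of Re] have Q: "2 * pi * Qb b n w c = nrm2 (\<lambda>t. k (cis t)) - nrm2 (\<lambda>t. g (cis t))"
    unfolding Qb_def by (simp del: Re_sum)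
  have bbk: "bmf (\<lambda>t. cnj (bs t) * k (cis t))" by (intro bmf_mult bmf_cnj bb bk)
  have "nrm2 (rsd b bs n w c) = nrm2 (\<lambda>t. cnj (bs t) * k (cis t)) - 2 * Re (integral\<^sup>L TT (\<lambda>t. cnj (cnj (bs t) * k (cis t)) * g (cis t))) + nrm2 (\<lambda>t. g (cis t))"
    unfolding rsd_def k_def[symmetric] g_def[symmetric] by (rule nrm2_diff[OF bbk bg])
  also have "integral\<^sup>L TT (\<lambda>t. cnj (cnj (bs t) * k (cis t)) * g (cis t)) = nrm2 (\<lambda>t. g (cis t))"
    using toeplitz_pairing[where n = n and w = w and c = c, OF w b] unfolding g_def[symmetric] k_def[symmetric] by (simp add: mult_ac)
  finally have R: "nrm2 (rsd b bs n w c) = nrm2 (\<lambda>t. cnj (bs t) * k (cis t)) - nrm2 (\<lambda>t. g (cis t))" by simp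
  have "integral\<^sup>L TT (\<lambda>t. (1 - (cmod (bs t))\<^sup>2) * (cmod (k (cis t)))\<^sup>2) = nrm2 (\<lambda>t. k (cis t)) - nrm2 (\<lambda>t. cnj (bs t) * k (cis t))"
  proof -
    have "integral\<^sup>L TT (\<lambda>t. (1 - (cmod (bs t))\<^sup>2) * (cmod (k (cis t)))\<^sup>2) =
       integral\<^sup>L TT (\<lambda>t. (cmod (k (cis t)))\<^sup>2 - (cmod (cnj (bs t) * k (cis t)))\<^sup>2)"
      by (simp add: norm_mult power_mult_distrib algebra_simps)
    also have "\<dots> = nrm2 (\<lambda>t. k (cis t)) - nrm2 (\<lambda>t. cnj (bs t) * k (cis t))"
      unfolding nrm2_def by (rule Bochner_Integration.integral_diff) (intro bmf_integrable bmf_power2 bmf_norm bk bbk)+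
    finally show ?thesis .
  qed
  then show ?thesis using Q R by (simp add: k_def)
qed

text \<open>The singularity at \<open>w\<close> is removable, and the quotient is bounded by
  compactness close to \<open>w\<close> and by \<open>2 * A / \<delta>\<close> elsewhere. The
  conjugate of the residual is built from these quotients.\<close>

lemma bfun_difference_quotient:
  fixes b :: "complex \<Rightarrow> complex"
  assumes b: "bfun b bs" and w: "cmod w < 1"
  shows "bfun (\<lambda>z. if z = w then deriv b w else (b z - b w) / (z - w)) (\<lambda>t. (bs t - b w) / (cis t - w))"
proof -
  define q where "q = (\<lambda>z. if z = w then deriv b w else (b z - b w) / (z - w))"
  have hol: "b holomorphic_on ball 0 1" by (rule bfun_hol[OF b])
  have qh: "q holomorphic_on ball 0 1"
    unfolding q_def by (rule pole_lemma[OF hol]) (use w in simp)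
  obtain A where "\<forall>z\<in>ball 0 1. cmod (b z) \<le> A" using bfun_bound[OF b] by blast
  note A = this[rule_format]
  define \<delta> where "\<delta> = (1 - cmod w) / 2"
  have d: "\<delta> > 0" using w by (simp add: \<delta>_def)
  have sub: "cball w \<delta> \<subseteq> ball 0 1"
  proof
    fix z assume "z \<in> cball w \<delta>"
    then have "cmod (z - w) \<le> (1 - cmod w) / 2" by (simp add: dist_norm norm_minus_commute \<delta>_def)
    then have "cmod z \<le> cmod w + (1 - cmod w) / 2" using norm_triangle_sub[of z w] by linarith
    also have "\<dots> < 1" using w by (simp add: field_simps)
    finally have "cmod z < 1" .
    then show "z \<in> ball 0 1" by simp
  qed
  have "compact (q ` cball w \<delta>)"
    using holomorphic_on_imp_continuous_on[OF qh] sub by (intro compact_continuous_image continuous_on_subset[OF _ sub]) auto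
  then have "bounded (q ` cball w \<delta>)" by (rule compact_imp_bounded)
  then obtain M where M: "\<And>x. x \<in> q ` cball w \<delta> \<Longrightarrow> cmod x \<le> M" by (auto simp only: bounded_iff)
  have bd: "cmod (q z) \<le> max M ((A + A) / \<delta>)" if z: "z \<in> ball 0 1" for z
  proof (cases "z \<in> cball w \<delta>")
    case True
    then show ?thesis using M by (intro max.coboundedI1) blast
  next
    case False
    then have dz: "\<delta> \<le> cmod (z - w)" by (simp add: dist_norm norm_minus_commute)
    then have "z \<noteq> w" using d by auto
    then have "cmod (q z) = cmod (b z - b w) / cmod (z - w)" by (simp add: q_def norm_divide)
    also have "\<dots> \<le> (A + A) / \<delta>"
      using A[OF z] A[of w] w d dz by (intro frac_le order_trans[OF norm_triangle_ineq4 add_mono]) (auto intro: order_trans[OF norm_ge_zero])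
    finally show ?thesis by simp
  qed
  have ne: "cis t - w \<noteq> 0" for t
    using w by (metis norm_cis less_irrefl right_minus_eq)
  have bm: "bmf (\<lambda>t. (bs t - b w) / (cis t - w))"
  proof -
    have "bmf (\<lambda>t. inverse (cis t - w))"
      using ne by (intro bmf_circle[of "\<lambda>z. inverse (z - w)"] continuous_intros) (use w in auto)
    then show ?thesis unfolding divide_inverse by (intro bmf_mult bmf_diff bmf_const bfun_bmf[OF b])
  qed
  show ?thesis
    unfolding q_def[symmetric]
  proof (rule bfunI[OF qh bd bm])
    have "AE t in TT. ((\<lambda>r. b (complex_of_real r * cis t)) \<longlongrightarrow> bs t) (at_left 1)" using b by (simp add: bfun_def)
    then show "AE t in TT. ((\<lambda>r. q (complex_of_real r * cis t)) \<longlongrightarrow> (bs t - b w) / (cis t - w)) (at_left 1)"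
    proof eventually_elim
      case (elim t)
      have "((\<lambda>r. (b (complex_of_real r * cis t) - b w) / (complex_of_real r * cis t - w)) \<longlongrightarrow> (bs t - b w) / (complex_of_real 1 * cis t - w)) (at_left 1)"
        by (intro tendsto_intros elim) (use ne in auto)
      moreover have "eventually (\<lambda>r. r \<in> {cmod w<..<1}) (at_left (1::real))" by (rule eventually_at_left_real[OF w])
      then have "eventually (\<lambda>r. (b (complex_of_real r * cis t) - b w) / (complex_of_real r * cis t - w) = q (complex_of_real r * cis t)) (at_left 1)"
      proof (rule eventually_mono)
        fix r assume r: "r \<in> {cmod w<..<1}"
        then have "0 \<le> r" using norm_ge_zero[of w] by (simp only: greaterThanLessThan_iff) linarith
        then have "cmod (complex_of_real r * cis t) = r" by (simp add: norm_mult)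
        then have "complex_of_real r * cis t \<noteq> w" using r by auto
        then show "(b (complex_of_real r * cis t) - b w) / (complex_of_real r * cis t - w) = q (complex_of_real r * cis t)"
          by (simp add: q_def)
      qed
      ultimately show ?case using Lim_transform_eventually by fastforce
    qed
  qed
qed

text \<open>For a single kernel the conjugate residual is, up to the conjugated coefficient, the
  boundary function of \<open>z * (b z - b w) / (z - w)\<close>.\<close>

lemma rsd_bfun:
  fixes b :: "complex \<Rightarrow> complex"
  assumes w: "\<And>i. i < n \<Longrightarrow> w i \<in> ball 0 1" and b: "bfun b bs"
  shows "\<exists>h. bfun h (\<lambda>t. cnj (rsd b bs n w c t))"
proof -
  define q where "q = (\<lambda>w z. if z = w then deriv b w else (b z - b w) / (z - w))"
  have "bfun (\<lambda>z. \<Sum>i<n. cnj (c i) * (z * q (w i) z)) (\<lambda>t. \<Sum>i<n. cnj (c i) * (cis t * ((bs t - b (w i)) / (cis t - w i))))"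
    unfolding q_def using w
    by (intro bfun_sum bfun_mult bfun_const bfun_continuous[of "\<lambda>z. z"] bfun_difference_quotient[OF b] holomorphic_intros continuous_intros) auto
  moreover have "(\<Sum>i<n. cnj (c i) * (cis t * ((bs t - b (w i)) / (cis t - w i)))) = cnj (rsd b bs n w c t)" for t
  proof -
    have "cnj (rsd b bs n w c t) = (\<Sum>i<n. bs t * (cnj (c i) * cnj (szego (w i) (cis t)))) - (\<Sum>i<n. cnj (c i) * b (w i) * cnj (szego (w i) (cis t)))"
      by (simp add: rsd_def kf_def sum_distrib_left)
    also have "\<dots> = (\<Sum>i<n. cnj (c i) * ((bs t - b (w i)) * cnj (szego (w i) (cis t))))"
      by (simp add: sum_subtractf[symmetric] algebra_simps)
    also have "\<dots> = (\<Sum>i<n. cnj (c i) * (cis t * ((bs t - b (w i)) / (cis t - w i))))"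
      by (intro sum.cong refl) (use w in \<open>simp add: cnj_szego_cis\<close>)
    finally show ?thesis ..
  qed
  ultimately show ?thesis by auto
qed

text \<open>The residual is orthogonal to \<open>T k\<close>, so its squared norm is its pairing
  with \<open>cnj b k\<close>. In this form only the product of \<open>k\<close> with the conjugate
  residual enters, which extends holomorphically to the disc as the Hankel estimate
  requires.\<close>

lemma nrm2_rsd:
  fixes b :: "complex \<Rightarrow> complex"
  assumes w: "\<And>i. i < n \<Longrightarrow> w i \<in> ball 0 1" and b: "bfun b bs"
  shows "complex_of_real (nrm2 (rsd b bs n w c)) =
    integral\<^sup>L TT (\<lambda>t. cnj (bs t) * (kf n w c (cis t) * cnj (rsd b bs n w c t)))"
proof -
  define k where "k = kf n w c"
  define g where "g = kf n w (\<lambda>i. c i * cnj (b (w i)))"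
  have k: "bfun k (\<lambda>t. k (cis t))" and g: "bfun g (\<lambda>t. g (cis t))" unfolding k_def g_def by (auto intro: bfun_kf[OF w])
  note bk = bfun_bmf[OF k] and bg = bfun_bmf[OF g] and bb = bfun_bmf[OF b]
  have br: "bmf (\<lambda>t. cnj (rsd b bs n w c t))" using rsd_bfun[where n = n and w = w and c = c, OF w b] bfun_bmf by blast
  have z: "integral\<^sup>L TT (\<lambda>t. g (cis t) * cnj (rsd b bs n w c t)) = 0"
  proof -
    have "integral\<^sup>L TT (\<lambda>t. g (cis t) * cnj (rsd b bs n w c t)) =
      integral\<^sup>L TT (\<lambda>t. (bs t * g (cis t)) * cnj (k (cis t)) - g (cis t) * cnj (g (cis t)))"
      by (simp add: rsd_def k_def[symmetric] g_def[symmetric] algebra_simps)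
    also have "\<dots> = integral\<^sup>L TT (\<lambda>t. (bs t * g (cis t)) * cnj (k (cis t))) - integral\<^sup>L TT (\<lambda>t. g (cis t) * cnj (g (cis t)))"
      by (rule Bochner_Integration.integral_diff) (intro bmf_integrable bmf_mult bmf_cnj bb bg bk)+
    also have "\<dots> = 0" using toeplitz_pairing[where n = n and w = w and c = c, OF w b] unfolding g_def[symmetric] k_def[symmetric] by (simp add: nrm2_complex)
    finally show ?thesis .
  qed
  have "complex_of_real (nrm2 (rsd b bs n w c)) = integral\<^sup>L TT (\<lambda>t. rsd b bs n w c t * cnj (rsd b bs n w c t))"
    by (rule nrm2_complex)
  also have "\<dots> = integral\<^sup>L TT (\<lambda>t. cnj (bs t) * (k (cis t) * cnj (rsd b bs n w c t)) - g (cis t) * cnj (rsd b bs n w c t))"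
    by (simp add: rsd_def[of b bs n w c] k_def[symmetric] g_def[symmetric] left_diff_distrib mult.assoc)
  also have "\<dots> = integral\<^sup>L TT (\<lambda>t. cnj (bs t) * (k (cis t) * cnj (rsd b bs n w c t))) - integral\<^sup>L TT (\<lambda>t. g (cis t) * cnj (rsd b bs n w c t))"
    by (rule Bochner_Integration.integral_diff) (intro bmf_integrable bmf_mult bmf_cnj[OF bb] br bg bk)+
  finally show ?thesis using z by (simp add: k_def)
qed

section \<open>A Hankel estimate\<close>

lemma cis_vderiv: "(cis has_vector_derivative \<i> * cis t) (at t)"
proof -
  have "((\<lambda>z. exp (\<i> * z)) has_field_derivative \<i> * exp (\<i> * of_real t)) (at (of_real t))"
    by (auto intro!: derivative_eq_intros)
  then have "((\<lambda>t. exp (\<i> * of_real t)) has_vector_derivative \<i> * exp (\<i> * of_real t)) (at t)"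
    by (rule has_vector_derivative_real_field)
  then show ?thesis by (simp only: cis_conv_exp[abs_def, symmetric] flip: cis_conv_exp)
qed

text \<open>\<open>G\<close> is controlled on \<open>V\<close> only. For \<open>t\<close> in
  \<open>K\<close> the point lies in \<open>V\<close>; off the closed set \<open>K\<close> the
  product vanishes in a whole neighbourhood, whatever \<open>G\<close> does there.\<close>

lemma continuous_cutoff_times:
  fixes \<eta> :: "real \<Rightarrow> real" and G :: "complex \<Rightarrow> complex"
  assumes V: "open V" "continuous_on V G" and K: "closed K"
    and sub: "\<And>t r. t \<in> K \<Longrightarrow> r \<in> I \<Longrightarrow> complex_of_real r * cis t \<in> V"
    and \<eta>: "continuous_on UNIV \<eta>" "\<And>t. t \<notin> K \<Longrightarrow> \<eta> t = 0"
  shows "continuous_on (I \<times> UNIV) (\<lambda>(r, t). complex_of_real (\<eta> t) * G (complex_of_real r * cis t))"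
  unfolding continuous_on_eq_continuous_within
proof
  fix p :: "real \<times> real" assume "p \<in> I \<times> UNIV"
  then obtain r t where p: "p = (r, t)" "r \<in> I" by auto
  have "isCont (\<lambda>p. complex_of_real (\<eta> (snd p)) * G (complex_of_real (fst p) * cis (snd p))) (r, t)"
  proof (cases "t \<in> K")
    case True
    have "isCont G (complex_of_real r * cis t)"
      using V sub[OF True p(2)] by (simp add: continuous_on_eq_continuous_at)
    moreover have "continuous_on UNIV (\<lambda>p. complex_of_real (fst p) * cis (snd p))"
      by (intro continuous_intros)
    then have "isCont (\<lambda>p. complex_of_real (fst p) * cis (snd p)) (r, t)"
      by (simp add: continuous_on_eq_continuous_at)
    ultimately have "isCont (\<lambda>p. G (complex_of_real (fst p) * cis (snd p))) (r, t)"
      by (intro isCont_o2[where g = G and f = "\<lambda>p. complex_of_real (fst p) * cis (snd p)"]) simp_all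
    moreover have "isCont \<eta> t" using \<eta>(1) by (simp add: continuous_on_eq_continuous_at)
    then have "isCont (\<lambda>p. \<eta> (snd p)) (r, t)"
      by (intro isCont_o2[where g = \<eta> and f = snd]) (simp_all add: continuous_snd)
    ultimately show ?thesis by (intro continuous_intros)
  next
    case False
    have "open (UNIV \<times> (- K))" using K by (intro open_Times) auto
    then have "eventually (\<lambda>p. p \<in> (UNIV::real set) \<times> (- K)) (nhds (r, t))"
      using False by (intro eventually_nhds_in_open) auto
    then have "eventually (\<lambda>p. complex_of_real (\<eta> (snd p)) * G (complex_of_real (fst p) * cis (snd p)) = 0) (nhds (r, t))"
      by (rule eventually_mono) (auto simp: \<eta>(2))
    then have "eventually (\<lambda>p. complex_of_real (\<eta> (snd p)) * G (complex_of_real (fst p) * cis (snd p)) = 0) (at (r, t))"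
      by (simp add: eventually_nhds_conv_at)
    then have "(\<lambda>p. complex_of_real (\<eta> (snd p)) * G (complex_of_real (fst p) * cis (snd p))) \<midarrow>(r, t)\<rightarrow> 0"
      by (rule tendsto_eventually)
    then show ?thesis unfolding isCont_def using \<eta>(2)[OF False] by simp
  qed
  then show "continuous (at p within I \<times> UNIV) (\<lambda>(r, t). complex_of_real (\<eta> t) * G (complex_of_real r * cis t))"
    unfolding p(1) case_prod_unfold by (rule continuous_at_imp_continuous_at_within)
qed

text \<open>For holomorphic functions the radial derivative is \<open>- \<i> / r\<close> times the
  angular one. Partial integration in \<open>t\<close> therefore moves the derivative onto the
  cutoff, and no derivative of \<open>\<Psi>\<close> has to be estimated. The condition
  \<open>\<eta> (2 * pi) = \<eta> 0\<close> removes the boundary term.\<close>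

lemma radial_shift:
  fixes \<eta> \<eta>d :: "real \<Rightarrow> real" and \<Psi> :: "complex \<Rightarrow> complex"
  assumes V: "open V" "\<Psi> holomorphic_on V" and K: "closed K" and r: "0 < \<rho>" "\<rho> \<le> R"
    and sub: "\<And>t r. t \<in> K \<Longrightarrow> r \<in> {\<rho>..R} \<Longrightarrow> complex_of_real r * cis t \<in> V"
    and \<eta>: "\<And>t. (\<eta> has_real_derivative \<eta>d t) (at t)" "continuous_on UNIV \<eta>d"
      "\<And>t. t \<notin> K \<Longrightarrow> \<eta> t = 0" "\<And>t. t \<notin> K \<Longrightarrow> \<eta>d t = 0" "\<eta> (2 * pi) = \<eta> 0"
  shows "integral {0..2*pi} (\<lambda>t. \<eta> t * \<Psi> (complex_of_real R * cis t)) - integral {0..2*pi} (\<lambda>t. \<eta> t * \<Psi> (complex_of_real \<rho> * cis t)) =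
    integral {\<rho>..R} (\<lambda>r. (\<i> / of_real r) * integral {0..2*pi} (\<lambda>t. \<eta>d t * \<Psi> (complex_of_real r * cis t)))"
proof -
  have c\<eta>: "continuous_on UNIV \<eta>"
    using \<eta>(1) by (meson DERIV_continuous_on has_field_derivative_at_within)
  have hd: "deriv \<Psi> holomorphic_on V" by (rule holomorphic_deriv[OF V(2,1)])
  have d\<Psi>: "(\<Psi> has_field_derivative deriv \<Psi> z) (at z)" if "z \<in> V" for z
    by (rule holomorphic_derivI[OF V(2,1) that])
  define f where "f = (\<lambda>r t. complex_of_real (\<eta> t) * (cis t * deriv \<Psi> (complex_of_real r * cis t)))"
  have cf: "continuous_on ({\<rho>..R} \<times> UNIV) (\<lambda>(r, t). f r t)"
  proof -
    have "continuous_on ({\<rho>..R} \<times> UNIV) (\<lambda>(r, t). complex_of_real (\<eta> t) * deriv \<Psi> (complex_of_real r * cis t))"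
      by (rule continuous_cutoff_times[OF V(1) holomorphic_on_imp_continuous_on[OF hd] K sub c\<eta> \<eta>(3)])
    then have "continuous_on ({\<rho>..R} \<times> UNIV) (\<lambda>p. cis (snd p) * (\<lambda>(r, t). complex_of_real (\<eta> t) * deriv \<Psi> (complex_of_real r * cis t)) p)"
      by (intro continuous_intros)
    then show ?thesis by (simp add: f_def case_prod_unfold mult_ac)
  qed
  have c0: "continuous_on {0..2*pi} (\<lambda>t. complex_of_real (\<eta> t) * \<Psi> (complex_of_real s * cis t))"
    and c1: "continuous_on {0..2*pi} (\<lambda>t. complex_of_real (\<eta>d t) * \<Psi> (complex_of_real s * cis t))"
    and c2: "continuous_on {0..2*pi} (\<lambda>t. f s t)" if s: "s \<in> {\<rho>..R}" for s
  proof -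
    have P: "continuous_on {0..2*pi} (\<lambda>t. (s, t))" by (intro continuous_intros)
    have im: "Pair s ` {0..2*pi} \<subseteq> {\<rho>..R} \<times> UNIV" using s by auto
    show "continuous_on {0..2*pi} (\<lambda>t. complex_of_real (\<eta> t) * \<Psi> (complex_of_real s * cis t))"
      using continuous_on_compose2[OF continuous_cutoff_times[OF V(1) holomorphic_on_imp_continuous_on[OF V(2)] K sub c\<eta> \<eta>(3)] P] s by auto
    show "continuous_on {0..2*pi} (\<lambda>t. complex_of_real (\<eta>d t) * \<Psi> (complex_of_real s * cis t))"
      using continuous_on_compose2[OF continuous_cutoff_times[OF V(1) holomorphic_on_imp_continuous_on[OF V(2)] K sub \<eta>(2) \<eta>(4)] P] s by auto
    show "continuous_on {0..2*pi} (\<lambda>t. f s t)"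
      using continuous_on_compose2[OF cf P im] by simp
  qed
  have ftc: "integral {\<rho>..R} (\<lambda>s. f s t) = complex_of_real (\<eta> t) * \<Psi> (complex_of_real R * cis t) - complex_of_real (\<eta> t) * \<Psi> (complex_of_real \<rho> * cis t)" for t
  proof (cases "t \<in> K")
    case True
    have "((\<lambda>s. f s t) has_integral (complex_of_real (\<eta> t) * \<Psi> (complex_of_real R * cis t) - complex_of_real (\<eta> t) * \<Psi> (complex_of_real \<rho> * cis t))) {\<rho>..R}"
    proof (rule fundamental_theorem_of_calculus[OF r(2), where
          f = "\<lambda>s. complex_of_real (\<eta> t) * \<Psi> (complex_of_real s * cis t)"])
      fix s assume s: "s \<in> {\<rho>..R}"
      have "((\<lambda>z. \<Psi> (z * cis t)) has_field_derivative deriv \<Psi> (complex_of_real s * cis t) * cis t) (at (complex_of_real s))"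
        by (rule DERIV_chain2[where f = \<Psi> and g = "\<lambda>z. z * cis t" and x = "complex_of_real s", OF d\<Psi>[OF sub[OF True s]]]) (auto intro!: derivative_eq_intros)
      then have "((\<lambda>s. \<Psi> (complex_of_real s * cis t)) has_vector_derivative deriv \<Psi> (complex_of_real s * cis t) * cis t) (at s)"
        by (rule has_vector_derivative_real_field)
      then have "((\<lambda>s. complex_of_real (\<eta> t) * \<Psi> (complex_of_real s * cis t)) has_vector_derivative complex_of_real (\<eta> t) * (deriv \<Psi> (complex_of_real s * cis t) * cis t)) (at s)"
        by (rule has_vector_derivative_mult_right)
      then show "((\<lambda>s. complex_of_real (\<eta> t) * \<Psi> (complex_of_real s * cis t)) has_vector_derivative f s t) (at s within {\<rho>..R})"
        unfolding f_def by (subst mult.commute[of "cis t"]) (rule has_vector_derivative_at_within)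
    qed
    then show ?thesis by (rule integral_unique)
  qed (simp add: f_def \<eta>(3))
  have ibp: "integral {0..2*pi} (\<lambda>t. f s t) = (\<i> / of_real s) * integral {0..2*pi} (\<lambda>t. \<eta>d t * \<Psi> (complex_of_real s * cis t))" if s: "s \<in> {\<rho>..R}" for s
  proof -
    have s0: "s \<noteq> 0" using s r by auto
    have "((\<lambda>t. complex_of_real (\<eta>d t) * \<Psi> (complex_of_real s * cis t) + (\<i> * of_real s) * f s t) has_integral
       (complex_of_real (\<eta> (2 * pi)) * \<Psi> (complex_of_real s * cis (2 * pi)) - complex_of_real (\<eta> 0) * \<Psi> (complex_of_real s * cis 0))) {0..2*pi}"
    proof (rule fundamental_theorem_of_calculus[where a = 0 and b = "2 * pi" and
          f = "\<lambda>t. complex_of_real (\<eta> t) * \<Psi> (complex_of_real s * cis t)"])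
      fix t :: real assume "t \<in> {0..2*pi}"
      have "((\<lambda>t. complex_of_real (\<eta> t) * \<Psi> (complex_of_real s * cis t)) has_vector_derivative
        complex_of_real (\<eta>d t) * \<Psi> (complex_of_real s * cis t) + (\<i> * of_real s) * f s t) (at t)"
      proof (cases "t \<in> K")
        case True
        note cis_vderiv[of t]
        then have "((\<lambda>t. complex_of_real s * cis t) has_vector_derivative complex_of_real s * (\<i> * cis t)) (at t)"
          by (rule has_vector_derivative_mult_right)
        then have "((\<Psi> \<circ> (\<lambda>t. complex_of_real s * cis t)) has_vector_derivative complex_of_real s * (\<i> * cis t) * deriv \<Psi> (complex_of_real s * cis t)) (at t)"
          by (rule field_vector_diff_chain_at) (rule d\<Psi>[OF sub[OF True s]])
        then have 1: "((\<lambda>t. \<Psi> (complex_of_real s * cis t)) has_vector_derivative complex_of_real s * (\<i> * cis t) * deriv \<Psi> (complex_of_real s * cis t)) (at t)"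
          by (simp add: o_def)
        have 2: "((\<lambda>t. complex_of_real (\<eta> t)) has_vector_derivative complex_of_real (\<eta>d t)) (at t)"
          by (rule has_vector_derivative_of_real) (use \<eta>(1) in \<open>simp add: has_real_derivative_iff_has_vector_derivative\<close>)
        have "((\<lambda>t. complex_of_real (\<eta> t) * \<Psi> (complex_of_real s * cis t)) has_vector_derivative
          complex_of_real (\<eta> t) * (complex_of_real s * (\<i> * cis t) * deriv \<Psi> (complex_of_real s * cis t)) + complex_of_real (\<eta>d t) * \<Psi> (complex_of_real s * cis t)) (at t)"
          by (rule has_vector_derivative_mult[OF 2 1])
        then show ?thesis by (simp add: f_def algebra_simps)
      next
        case False
        have "((\<lambda>t. 0) has_vector_derivative (0::complex)) (at t)" by (rule has_vector_derivative_const)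
        then have "((\<lambda>t. complex_of_real (\<eta> t) * \<Psi> (complex_of_real s * cis t)) has_vector_derivative 0) (at t)"
          by (rule has_vector_derivative_transform_within_open[of _ _ _ "- K"]) (use K False \<eta>(3) in auto)
        then show ?thesis using False by (simp add: f_def \<eta>(3,4))
      qed
      then show "((\<lambda>t. complex_of_real (\<eta> t) * \<Psi> (complex_of_real s * cis t)) has_vector_derivative
        complex_of_real (\<eta>d t) * \<Psi> (complex_of_real s * cis t) + (\<i> * of_real s) * f s t) (at t within {0..2*pi})"
        by (rule has_vector_derivative_at_within)
    qed simp
    then have "integral {0..2*pi} (\<lambda>t. complex_of_real (\<eta>d t) * \<Psi> (complex_of_real s * cis t) + (\<i> * of_real s) * f s t) = 0"
      using \<eta>(5) by (auto dest: integral_unique)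
    moreover have "integral {0..2*pi} (\<lambda>t. complex_of_real (\<eta>d t) * \<Psi> (complex_of_real s * cis t) + (\<i> * of_real s) * f s t) =
       integral {0..2*pi} (\<lambda>t. complex_of_real (\<eta>d t) * \<Psi> (complex_of_real s * cis t)) + (\<i> * of_real s) * integral {0..2*pi} (\<lambda>t. f s t)"
      by (subst Henstock_Kurzweil_Integration.integral_add)
        (auto intro!: integrable_continuous_real c1[OF s] c2[OF s] continuous_intros)
    ultimately have "(\<i> * of_real s) * integral {0..2*pi} (\<lambda>t. f s t) = - integral {0..2*pi} (\<lambda>t. complex_of_real (\<eta>d t) * \<Psi> (complex_of_real s * cis t))"
      by (simp add: add_eq_0_iff)
    then have "(- \<i> / of_real s) * ((\<i> * of_real s) * integral {0..2*pi} (\<lambda>t. f s t)) = (- \<i> / of_real s) * (- integral {0..2*pi} (\<lambda>t. complex_of_real (\<eta>d t) * \<Psi> (complex_of_real s * cis t)))"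
      by (simp only:)
    moreover have "(- \<i> / of_real s) * ((\<i> * of_real s) * X) = X" for X using s0 by simp
    ultimately show ?thesis by simp
  qed
  have "integral {0..2*pi} (\<lambda>t. \<eta> t * \<Psi> (complex_of_real R * cis t)) - integral {0..2*pi} (\<lambda>t. \<eta> t * \<Psi> (complex_of_real \<rho> * cis t)) =
     integral {0..2*pi} (\<lambda>t. \<eta> t * \<Psi> (complex_of_real R * cis t) - \<eta> t * \<Psi> (complex_of_real \<rho> * cis t))"
    by (rule Henstock_Kurzweil_Integration.integral_diff[symmetric]) (use r in \<open>auto intro!: integrable_continuous_real c0\<close>)
  also have "\<dots> = integral {0..2*pi} (\<lambda>t. integral {\<rho>..R} (\<lambda>s. f s t))" by (simp only: ftc)
  also have "\<dots> = integral {\<rho>..R} (\<lambda>s. integral {0..2*pi} (\<lambda>t. f s t))"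
  proof -
    have "continuous_on (cbox (\<rho>, 0) (R, 2 * pi)) (\<lambda>(s, t). f s t)"
      by (rule continuous_on_subset[OF cf]) (auto simp: cbox_Pair_eq)
    then have "integral (cbox \<rho> R) (\<lambda>s. integral (cbox 0 (2 * pi)) (f s)) = integral (cbox 0 (2 * pi)) (\<lambda>t. integral (cbox \<rho> R) (\<lambda>s. f s t))"
      by (rule integral_swap_continuous)
    then show ?thesis by simp
  qed
  also have "\<dots> = integral {\<rho>..R} (\<lambda>r. (\<i> / of_real r) * integral {0..2*pi} (\<lambda>t. \<eta>d t * \<Psi> (complex_of_real r * cis t)))"
    by (rule Henstock_Kurzweil_Integration.integral_cong) (rule ibp)
  finally show ?thesis .
qed

text \<open>The square makes the positive part continuously differentiable, which is the smoothness
  that \<open>radial_shift\<close> asks of the cutoff.\<close>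

lemma cutoff_profile_deriv: "((\<lambda>x. (max 0 x)\<^sup>2) has_real_derivative 2 * max 0 x) (at (x::real))"
proof -
  consider "x > 0" | "x < 0" | "x = 0" by linarith
  then show ?thesis
  proof cases
    case 1
    have "((\<lambda>x::real. x\<^sup>2) has_real_derivative 2 * x) (at x)" by (auto intro!: derivative_eq_intros)
    then have "((\<lambda>x. (max 0 x)\<^sup>2) has_real_derivative 2 * x) (at x)"
      by (rule has_field_derivative_transform_within_open[of _ _ _ "{0<..}"]) (use 1 in auto)
    then show ?thesis using 1 by simp
  next
    case 2
    have "((\<lambda>x::real. 0::real) has_real_derivative 0) (at x)" by auto
    then have "((\<lambda>x. (max 0 x)\<^sup>2) has_real_derivative 0) (at x)"
      by (rule has_field_derivative_transform_within_open[of _ _ _ "{..<0}"]) (use 2 in auto)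
    then show ?thesis using 2 by simp
  next
    case 3
    have "(\<lambda>y. ((max 0 y)\<^sup>2 - (max 0 0)\<^sup>2) / (y - 0)) \<midarrow>0\<rightarrow> (0::real)"
    proof (rule Lim_null_comparison[of _ "\<lambda>y. \<bar>y\<bar>"])
      show "\<forall>\<^sub>F y in at 0. norm (((max 0 y)\<^sup>2 - (max 0 0)\<^sup>2) / (y - 0)) \<le> \<bar>y::real\<bar>"
        by (rule always_eventually) (auto simp: max_def power2_eq_square)
      show "(\<lambda>y. \<bar>y::real\<bar>) \<midarrow>0\<rightarrow> 0" by (auto intro!: tendsto_eq_intros)
    qed
    then show ?thesis unfolding has_field_derivative_iff using 3 by simp
  qed
qed

section \<open>The product with simple zeros in a finite subset of the circle\<close>

definition pz :: "complex set \<Rightarrow> complex \<Rightarrow> complex" where "pz Z z = (\<Prod>\<zeta>\<in>Z. z - \<zeta>)"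

lemma pz_hol: "pz Z holomorphic_on S"
  unfolding pz_def by (intro holomorphic_intros)

lemma pz_cont: "continuous_on S (pz Z)"
  by (rule holomorphic_on_imp_continuous_on[OF pz_hol])

lemma cmod_pz: "cmod (pz Z z) = (\<Prod>\<zeta>\<in>Z. cmod (z - \<zeta>))"
  unfolding pz_def by (simp add: prod_norm)

text \<open>The distance from \<open>r * cis t\<close> to \<open>\<zeta>\<close> is at least
  \<open>1 - r\<close>, which is also the distance from \<open>r * cis t\<close> to
  \<open>cis t\<close>. So each factor at most doubles when moved out to the circle, and a weight on
  the circle can be replaced by its value inside.\<close>

lemma pz_circle_le:
  assumes Z: "Z \<subseteq> sphere 0 1" and r: "0 \<le> r" "r \<le> 1"
  shows "cmod (pz Z (cis t)) \<le> 2 ^ card Z * cmod (pz Z (complex_of_real r * cis t))"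
proof -
  have "(\<Prod>\<zeta>\<in>Z. cmod (cis t - \<zeta>)) \<le> (\<Prod>\<zeta>\<in>Z. 2 * cmod (complex_of_real r * cis t - \<zeta>))"
  proof (rule prod_mono, safe)
    fix \<zeta> assume "\<zeta> \<in> Z"
    then have z: "cmod \<zeta> = 1" using Z by auto
    have "1 - r \<le> cmod (complex_of_real r * cis t - \<zeta>)"
      using norm_triangle_ineq3[of \<zeta> "complex_of_real r * cis t"] z r by (simp add: norm_mult norm_minus_commute)
    moreover have "cmod (cis t - \<zeta>) \<le> cmod (cis t - complex_of_real r * cis t) + cmod (complex_of_real r * cis t - \<zeta>)"
      by (rule norm_diff_triangle_ineq[of "cis t" "complex_of_real r * cis t" "complex_of_real r * cis t" \<zeta>, simplified])
    moreover have "cmod (cis t - complex_of_real r * cis t) = 1 - r"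
    proof -
      have "cis t - complex_of_real r * cis t = complex_of_real (1 - r) * cis t" by (simp add: algebra_simps)
      then show ?thesis using r by (simp only: norm_mult norm_of_real norm_cis) simp
    qed
    ultimately show "cmod (cis t - \<zeta>) \<le> 2 * cmod (complex_of_real r * cis t - \<zeta>)" by linarith
  qed auto
  then show ?thesis by (simp add: cmod_pz prod.distrib)
qed

lemma pz_lower:
  assumes Z: "Z \<subseteq> sphere 0 1" and z: "cmod z \<le> 1"
  shows "(1 - cmod z) ^ card Z \<le> cmod (pz Z z)"
proof -
  have "(\<Prod>\<zeta>\<in>Z. 1 - cmod z) \<le> (\<Prod>\<zeta>\<in>Z. cmod (z - \<zeta>))"
  proof (rule prod_mono, safe)
    fix \<zeta> assume "\<zeta> \<in> Z"
    then have "cmod \<zeta> = 1" using Z by auto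
    then show "1 - cmod z \<le> cmod (z - \<zeta>)" using norm_triangle_ineq3[of \<zeta> z] by (simp add: norm_minus_commute)
  qed (use z in auto)
  then show ?thesis by (simp add: cmod_pz)
qed

lemma pz_upper:
  assumes Z: "Z \<subseteq> sphere 0 1" and z: "cmod z \<le> 1"
  shows "cmod (pz Z z) \<le> 2 ^ card Z"
proof -
  have "(\<Prod>\<zeta>\<in>Z. cmod (z - \<zeta>)) \<le> (\<Prod>\<zeta>\<in>Z. 2)"
  proof (rule prod_mono, safe)
    fix \<zeta> assume "\<zeta> \<in> Z"
    then have "cmod \<zeta> = 1" using Z by auto
    then show "cmod (z - \<zeta>) \<le> 2" using norm_triangle_ineq4[of z \<zeta>] z by simp
  qed auto
  then show ?thesis by (simp add: cmod_pz)
qed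

lemma pz_small_near:
  assumes "0 \<le> \<epsilon>" "cmod (pz Z z) < \<epsilon> ^ card Z" shows "\<exists>\<zeta>\<in>Z. dist z \<zeta> < \<epsilon>"
proof (rule ccontr)
  assume "\<not> (\<exists>\<zeta>\<in>Z. dist z \<zeta> < \<epsilon>)"
  then have "(\<Prod>\<zeta>\<in>Z. \<epsilon>) \<le> (\<Prod>\<zeta>\<in>Z. cmod (z - \<zeta>))"
    using assms(1) by (intro prod_mono) (auto simp: dist_norm not_less)
  then show False using assms(2) by (simp add: cmod_pz)
qed

lemma bfun_pz: "bfun (pz Z) (\<lambda>t. pz Z (cis t))"
  by (rule bfun_continuous) (auto intro: pz_hol pz_cont)

text \<open>The integral is split by a cutoff function of \<open>cmod (pz Z (cis t))\<close>. Away from \<open>Z\<close> the factor \<open>pz Z\<close> is bounded below. Near \<open>Z\<close>,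
  \<open>cnj (bs t)\<close> is replaced by \<open>1 / bs t\<close> at the cost \<open>mate\<close>, and the integral of the holomorphic function \<open>k h / b\<close>
  against the cutoff is moved to a smaller circle; the derivative of the cutoff is \<open>O(cmod (pz Z (cis t)))\<close>.\<close>
lemma hankel_bound:
  fixes b :: "complex \<Rightarrow> complex"
  assumes Z: "finite Z" "Z \<subseteq> sphere 0 1" and b: "bfun b bs"
    and bs1: "\<And>t. cmod (bs t) \<le> 1"
    and low: "\<And>\<zeta>. \<zeta> \<in> Z \<Longrightarrow> \<exists>\<epsilon>>0. \<forall>z\<in>ball 0 1. dist z \<zeta> < \<epsilon> \<longrightarrow> 1 / 2 \<le> cmod (b z)"
    and A: "0 \<le> A" and mate: "AE t in TT. 1 - (cmod (bs t))\<^sup>2 \<le> A * cmod (pz Z (cis t))"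
  shows "\<exists>C\<ge>0. \<forall>k ks h hs. bfun k ks \<longrightarrow> bfun h hs \<longrightarrow>
     cmod (integral\<^sup>L TT (\<lambda>t. cnj (bs t) * (ks t * hs t))) \<le> C * (sqrt (nrm2 (\<lambda>t. pz Z (cis t) * ks t)) * sqrt (nrm2 hs))"
proof -
  have hol: "b holomorphic_on ball 0 1" by (rule bfun_hol[OF b])
  have "\<exists>\<epsilon>>0. \<epsilon> \<le> 1 \<and> (\<forall>\<zeta>\<in>Z. \<forall>z\<in>ball 0 1. dist z \<zeta> < \<epsilon> \<longrightarrow> 1 / 2 \<le> cmod (b z))"
  proof -
    have "\<forall>\<zeta>\<in>Z. \<exists>\<epsilon>>0. \<forall>z\<in>ball 0 1. dist z \<zeta> < \<epsilon> \<longrightarrow> 1 / 2 \<le> cmod (b z)" using low by blast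
    from bchoice[OF this] obtain e where e: "\<forall>\<zeta>\<in>Z. e \<zeta> > 0 \<and> (\<forall>z\<in>ball 0 1. dist z \<zeta> < e \<zeta> \<longrightarrow> 1 / 2 \<le> cmod (b z))" ..
    show ?thesis
    proof (intro exI[of _ "Min (insert 1 (e ` Z))"] conjI ballI impI)
      show "0 < Min (insert 1 (e ` Z))" using e Z by (subst Min_gr_iff) auto
      show "Min (insert 1 (e ` Z)) \<le> 1" using Z by (intro Min_le) auto
      fix \<zeta> z assume h: "\<zeta> \<in> Z" "z \<in> ball 0 1" "dist z \<zeta> < Min (insert 1 (e ` Z))"
      then have "dist z \<zeta> < e \<zeta>" using Z by (subst (asm) Min_gr_iff) auto
      then show "1 / 2 \<le> cmod (b z)" using e h by blast
    qed
  qed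
  then obtain \<epsilon> where eps: "\<epsilon> > 0" "\<epsilon> \<le> 1" "\<And>\<zeta> z. \<zeta> \<in> Z \<Longrightarrow> z \<in> ball 0 1 \<Longrightarrow> dist z \<zeta> < \<epsilon> \<Longrightarrow> 1 / 2 \<le> cmod (b z)"
    by blast
  define q where "q = (\<lambda>t. pz Z (cis t))"
  define N where "N = card Z"
  \<comment> \<open>So small that \<open>cmod (q t) \<le> \<delta>\<close> puts a point of
    \<open>Z\<close> within \<open>\<epsilon> / 2\<close> of \<open>cis t\<close>; the last halving
    makes the inequality of \<open>pz_small_near\<close> strict.\<close>
  define \<delta> where "\<delta> = (\<epsilon> / 2) ^ N / 2"
  have d0: "\<delta> > 0" using eps by (simp add: \<delta>_def)
  define K where "K = {t. cmod (q t) \<le> \<delta>}"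
  have cq: "continuous_on UNIV q" unfolding q_def by (rule continuous_on_circle[OF pz_cont])
  have Kc: "closed K" unfolding K_def using cq by (intro closed_Collect_le continuous_intros)
  \<comment> \<open>Moving \<open>cis t\<close> radially as far as the radius \<open>\<rho>\<close>
    adds at most \<open>\<epsilon> / 4\<close>, which together with \<open>\<epsilon> / 2\<close>
    stays below \<open>\<epsilon>\<close>.\<close>
  define \<rho> where "\<rho> = 1 - \<epsilon> / 4"
  have rho: "0 < \<rho>" "\<rho> < 1" using eps by (auto simp: \<rho>_def)
  have blow: "1 / 2 \<le> cmod (b (complex_of_real r * cis t))" if "t \<in> K" "\<rho> \<le> r" "r < 1" for t r
  proof -
    have r0: "0 \<le> r" using that rho by linarith
    have "cmod (pz Z (cis t)) < (\<epsilon> / 2) ^ card Z"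
      using that(1) d0 unfolding K_def q_def \<delta>_def N_def by simp
    from pz_small_near[OF _ this] eps obtain \<zeta> where z: "\<zeta> \<in> Z" "dist (cis t) \<zeta> < \<epsilon> / 2" by auto
    have "dist (complex_of_real r * cis t) (cis t) = 1 - r"
    proof -
      have "complex_of_real r * cis t - cis t = complex_of_real (r - 1) * cis t" by (simp add: algebra_simps)
      then show ?thesis using that unfolding dist_norm by (simp only: norm_mult norm_of_real norm_cis) simp
    qed
    then have "dist (complex_of_real r * cis t) \<zeta> < \<epsilon>"
      using dist_triangle[of "complex_of_real r * cis t" \<zeta> "cis t"] z(2) that eps by (simp add: \<rho>_def)
    moreover have "complex_of_real r * cis t \<in> ball 0 1" using that r0 by (simp add: norm_mult)
    ultimately show ?thesis using eps(3)[OF z(1)] by blast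
  qed
  \<comment> \<open>The cutoff equals 1 on \<open>Z\<close>. It is a function of the square of
    \<open>cmod (q t)\<close>, so its derivative carries a factor \<open>q t\<close>, and this
    factor becomes the weight.\<close>
  define \<eta> where "\<eta> = (\<lambda>t. (max 0 (1 - (cmod (q t))\<^sup>2 / \<delta>\<^sup>2))\<^sup>2)"
  define q' where "q' = (\<lambda>t. \<i> * cis t * deriv (pz Z) (cis t))"
  define \<eta>d where "\<eta>d = (\<lambda>t. 2 * max 0 (1 - (cmod (q t))\<^sup>2 / \<delta>\<^sup>2) * (- (2 * (q t \<bullet> q' t)) / \<delta>\<^sup>2))"
  have qd: "(q has_vector_derivative q' t) (at t)" for t
  proof -
    have "(pz Z has_field_derivative deriv (pz Z) (cis t)) (at (cis t))"
      by (rule holomorphic_derivI[OF pz_hol open_UNIV]) simp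
    from field_vector_diff_chain_at[OF cis_vderiv this] show ?thesis by (simp add: q_def q'_def o_def)
  qed
  have cq': "continuous_on UNIV q'"
  proof -
    have "continuous_on UNIV (deriv (pz Z))"
      by (rule holomorphic_on_imp_continuous_on[OF holomorphic_deriv[OF pz_hol open_UNIV]])
    then have "continuous_on UNIV (\<lambda>t. deriv (pz Z) (cis t))"
      by (rule continuous_on_compose2) (auto intro!: continuous_intros)
    then show ?thesis unfolding q'_def by (intro continuous_intros)
  qed
  obtain D where D: "\<And>t. cmod (q' t) \<le> D"
  proof -
    have "continuous_on UNIV (deriv (pz Z))"
      by (rule holomorphic_on_imp_continuous_on[OF holomorphic_deriv[OF pz_hol open_UNIV]])
    then have "bmf (\<lambda>t. deriv (pz Z) (cis t))" by (intro bmf_circle) (auto intro: continuous_on_subset)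
    then obtain D where "\<forall>t. cmod (deriv (pz Z) (cis t)) \<le> D" unfolding bmf_def by blast
    then show thesis by (intro that[of D]) (simp add: q'_def norm_mult)
  qed
  have D0: "0 \<le> D" using order_trans[OF norm_ge_zero D[of 0]] .
  have etad: "(\<eta> has_real_derivative \<eta>d t) (at t)" for t
  proof -
    have "((\<lambda>t. q t \<bullet> q t) has_vector_derivative (q t \<bullet> q' t + q' t \<bullet> q t)) (at t)"
      by (rule bounded_bilinear.has_vector_derivative[OF bounded_bilinear_inner qd qd])
    then have "((\<lambda>t. (cmod (q t))\<^sup>2) has_real_derivative 2 * (q t \<bullet> q' t)) (at t)"
      by (simp add: has_real_derivative_iff_has_vector_derivative power2_norm_eq_inner inner_commute)
    then have "((\<lambda>t. 1 - (cmod (q t))\<^sup>2 / \<delta>\<^sup>2) has_real_derivative 0 - (2 * (q t \<bullet> q' t)) / \<delta>\<^sup>2) (at t)"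
      by (intro DERIV_diff DERIV_const DERIV_cdivide)
    then have "((\<lambda>t. 1 - (cmod (q t))\<^sup>2 / \<delta>\<^sup>2) has_real_derivative - (2 * (q t \<bullet> q' t)) / \<delta>\<^sup>2) (at t)"
      by simp
    from DERIV_chain2[OF cutoff_profile_deriv this] show ?thesis by (simp add: \<eta>_def \<eta>d_def)
  qed
  have cetad: "continuous_on UNIV \<eta>d" unfolding \<eta>d_def by (intro continuous_intros cq cq') (use d0 in auto)
  have ceta: "continuous_on UNIV \<eta>" unfolding \<eta>_def by (intro continuous_intros cq) (use d0 in auto)
  have off: "max 0 (1 - (cmod (q t))\<^sup>2 / \<delta>\<^sup>2) = 0" if "t \<notin> K" for t
  proof -
    have "\<delta>\<^sup>2 \<le> (cmod (q t))\<^sup>2" using that d0 by (intro power_mono) (auto simp: K_def)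
    then show ?thesis using d0 by (simp add: max_def divide_simps)
  qed
  have eta0: "\<eta> t = 0" and etad0: "\<eta>d t = 0" if "t \<notin> K" for t using off[OF that] by (simp_all add: \<eta>_def \<eta>d_def)
  have mx: "0 \<le> max 0 (1 - (cmod (q t))\<^sup>2 / \<delta>\<^sup>2)" "max 0 (1 - (cmod (q t))\<^sup>2 / \<delta>\<^sup>2) \<le> 1" for t
    using d0 by auto
  have eta1: "0 \<le> \<eta> t" "\<eta> t \<le> 1" for t
    using mx[of t] unfolding \<eta>_def by (auto intro: power_le_one)
  \<comment> \<open>Omitting the cutoff near \<open>Z\<close> costs a term of order two in
    \<open>cmod (q t)\<close>. On \<open>K\<close> one factor is bounded by \<open>\<delta>\<close>
    and the other one is the weight.\<close>
  have etalow: "1 - \<eta> t \<le> 2 * (cmod (q t))\<^sup>2 / \<delta>\<^sup>2" for t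
  proof -
    define x where "x = (cmod (q t))\<^sup>2 / \<delta>\<^sup>2"
    have x: "0 \<le> x" by (simp add: x_def)
    have "1 - (max 0 (1 - x))\<^sup>2 \<le> 2 * x"
    proof (cases "x \<le> 1")
      case True
      then have "(max 0 (1 - x))\<^sup>2 = 1 - 2 * x + x\<^sup>2" by (simp add: power2_eq_square algebra_simps)
      then show ?thesis using zero_le_power2[of x] by linarith
    qed (use x in \<open>simp add: max_def\<close>)
    then show ?thesis by (simp add: \<eta>_def x_def)
  qed
  define D1 where "D1 = 4 * D / \<delta>\<^sup>2"
  have D1: "0 \<le> D1" using D0 by (simp add: D1_def)
  have etadb: "\<bar>\<eta>d t\<bar> \<le> D1 * cmod (q t)" for t
  proof -
    have "\<bar>q t \<bullet> q' t\<bar> \<le> cmod (q t) * D"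
      by (rule order_trans[OF Cauchy_Schwarz_ineq2]) (intro mult_left_mono D norm_ge_zero)
    then have "\<bar>- (2 * (q t \<bullet> q' t)) / \<delta>\<^sup>2\<bar> \<le> 2 * (cmod (q t) * D) / \<delta>\<^sup>2"
      by (simp add: divide_right_mono)
    then have "\<bar>\<eta>d t\<bar> \<le> (2 * 1) * (2 * (cmod (q t) * D) / \<delta>\<^sup>2)"
      unfolding \<eta>d_def abs_mult using mx[of t] by (intro mult_mono) (auto intro: D0)
    then show ?thesis by (simp add: D1_def mult_ac)
  qed
  define V where "V = ball 0 1 \<inter> b -` (- {0})"
  have V: "open V" unfolding V_def
    by (rule continuous_open_preimage[OF holomorphic_on_imp_continuous_on[OF hol]]) auto
  have KV: "complex_of_real r * cis t \<in> V" if "t \<in> K" "\<rho> \<le> r" "r < 1" for t r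
    using blow[OF that] that rho by (auto simp: V_def norm_mult)
  have per: "\<eta> (2 * pi) = \<eta> 0" by (simp add: \<eta>_def q_def)
  \<comment> \<open>The first term bounds the integral over the circle of radius
    \<open>\<rho>\<close>, where \<open>pz\<close> is at least \<open>(1 - \<rho>) ^ N\<close> in
    modulus. The second bounds the radial integral: \<open>1 / \<rho>\<close> comes from
    \<open>\<i> / r\<close>, the factor 2 from the lower bound 1/2 of \<open>b\<close>,
    \<open>D1\<close> from the derivative of the cutoff, and \<open>2 ^ N\<close> from
    \<open>pz_circle_le\<close>.\<close>
  define C0 where "C0 = 2 / (1 - \<rho>) ^ N + (1 / \<rho>) * (2 * D1 * 2 ^ N)"
  \<comment> \<open>On \<open>K\<close> the error requires \<open>2 * A + 4 / \<delta>\<close>,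
    doubled because of the division by \<open>bs t\<close>; off \<open>K\<close> it requires
    \<open>1 / \<delta>\<close>. The constant dominates both.\<close>
  define C3 where "C3 = 2 * A + 5 / \<delta>"
  have C0: "0 \<le> C0" unfolding C0_def using rho D1 by (intro add_nonneg_nonneg mult_nonneg_nonneg divide_nonneg_nonneg) auto
  have C3: "0 \<le> C3" using A d0 by (simp add: C3_def)
  have main: "cmod (integral\<^sup>L TT (\<lambda>t. cnj (bs t) * (ks t * hs t))) \<le> (C0 + C3) * (sqrt (nrm2 (\<lambda>t. pz Z (cis t) * ks t)) * sqrt (nrm2 hs))"
    if k: "bfun k ks" and h: "bfun h hs" for k ks h hs
  proof -
    define S where "S = sqrt (nrm2 (\<lambda>t. pz Z (cis t) * ks t)) * sqrt (nrm2 hs)"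
    have S0: "0 \<le> S" by (simp add: S_def nrm2_nonneg)
    note hk = bfun_hol[OF k] and hh = bfun_hol[OF h]
    have pk: "bfun (\<lambda>z. pz Z z * k z) (\<lambda>t. pz Z (cis t) * ks t)" by (rule bfun_mult[OF bfun_pz k])
    obtain Bk Bh where "\<forall>z\<in>ball 0 1. cmod (k z) \<le> Bk" "\<forall>z\<in>ball 0 1. cmod (h z) \<le> Bh"
      using bfun_bound[OF k] bfun_bound[OF h] by blast
    note Bkh = this[rule_format]
    have B0: "0 \<le> Bk" "0 \<le> Bh" using order_trans[OF norm_ge_zero Bkh(1)[of 0]] order_trans[OF norm_ge_zero Bkh(2)[of 0]] by auto
    define PK where "PK = (\<lambda>r t. cmod (pz Z (complex_of_real r * cis t) * k (complex_of_real r * cis t)) * cmod (h (complex_of_real r * cis t)))"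
    have iPK: "integrable TT (PK r)" if "0 \<le> r" "r < 1" for r
      unfolding PK_def by (intro bmf_integrable bmf_mult[OF bmf_norm bmf_norm] bmf_radius_factor[OF that bfun_hol[OF pk]] bmf_radius_factor[OF that hh])
    have PKS: "integral\<^sup>L TT (PK r) \<le> S" if r: "0 \<le> r" "r < 1" for r
    proof -
      have "integral\<^sup>L TT (PK r) \<le> sqrt (nrm2 (\<lambda>t. pz Z (complex_of_real r * cis t) * k (complex_of_real r * cis t))) * sqrt (nrm2 (\<lambda>t. h (complex_of_real r * cis t)))"
        unfolding PK_def by (intro Cauchy_Schwarz_norms bmf_radius_factor[OF r bfun_hol[OF pk]] bmf_radius_factor[OF r hh])
      also have "\<dots> \<le> S" unfolding S_def
        using nrm2_radius_le_boundary[OF pk r] nrm2_radius_le_boundary[OF h r] by (intro mult_mono) (auto simp: nrm2_nonneg)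
      finally show ?thesis .
    qed
    define \<Psi> where "\<Psi> = (\<lambda>z. k z * h z / b z)"
    have holP: "\<Psi> holomorphic_on V" unfolding \<Psi>_def
      by (intro holomorphic_intros holomorphic_on_subset[OF hk] holomorphic_on_subset[OF hh] holomorphic_on_subset[OF hol]) (auto simp: V_def)
    have Psi_le: "cmod (\<Psi> (complex_of_real r * cis t)) \<le> 2 * (cmod (k (complex_of_real r * cis t)) * cmod (h (complex_of_real r * cis t)))"
      if "t \<in> K" "\<rho> \<le> r" "r < 1" for t r
    proof -
      have "cmod (\<Psi> (complex_of_real r * cis t)) = (cmod (k (complex_of_real r * cis t)) * cmod (h (complex_of_real r * cis t))) / cmod (b (complex_of_real r * cis t))"
        by (simp add: \<Psi>_def norm_divide norm_mult)
      also have "\<dots> \<le> (cmod (k (complex_of_real r * cis t)) * cmod (h (complex_of_real r * cis t))) / (1 / 2)"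
        using blow[OF that] by (intro divide_left_mono) auto
      finally show ?thesis by simp
    qed
    have cont: "continuous_on UNIV (\<lambda>t. complex_of_real (\<eta> t) * \<Psi> (complex_of_real r * cis t))"
      "continuous_on UNIV (\<lambda>t. complex_of_real (\<eta>d t) * \<Psi> (complex_of_real r * cis t))" if r: "\<rho> \<le> r" "r < 1" for r
    proof -
      have P: "continuous_on UNIV (\<lambda>t::real. (r, t))" by (intro continuous_intros)
      have im: "Pair r ` UNIV \<subseteq> {r} \<times> UNIV" by auto
      have KV': "complex_of_real s * cis t \<in> V" if "t \<in> K" "s \<in> {r}" for t s using KV[OF that(1), of r] that(2) r by simp
      show "continuous_on UNIV (\<lambda>t. complex_of_real (\<eta> t) * \<Psi> (complex_of_real r * cis t))"
        using continuous_on_compose2[OF continuous_cutoff_times[OF V holomorphic_on_imp_continuous_on[OF holP] Kc KV' ceta eta0] P im] by simp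
      show "continuous_on UNIV (\<lambda>t. complex_of_real (\<eta>d t) * \<Psi> (complex_of_real r * cis t))"
        using continuous_on_compose2[OF continuous_cutoff_times[OF V holomorphic_on_imp_continuous_on[OF holP] Kc KV' cetad etad0] P im] by simp
    qed
    define J where "J = (\<lambda>r. integral {0..2*pi} (\<lambda>t. complex_of_real (\<eta> t) * \<Psi> (complex_of_real r * cis t)))"
    have Jrho: "cmod (J \<rho>) \<le> 2 / (1 - \<rho>) ^ N * S"
    proof -
      have "J \<rho> = integral\<^sup>L TT (\<lambda>t. complex_of_real (\<eta> t) * \<Psi> (complex_of_real \<rho> * cis t))"
        unfolding J_def by (rule integral_TT[OF cont(1), symmetric]) (use rho in auto)
      also have "cmod \<dots> \<le> integral\<^sup>L TT (\<lambda>t. 2 / (1 - \<rho>) ^ N * PK \<rho> t)"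
      proof (rule norm_integral_TT_le)
        show "integrable TT (\<lambda>t. complex_of_real (\<eta> t) * \<Psi> (complex_of_real \<rho> * cis t))"
          by (rule integrable_TT_continuous[OF cont(1)]) (use rho in auto)
        show "integrable TT (\<lambda>t. 2 / (1 - \<rho>) ^ N * PK \<rho> t)" using iPK[of \<rho>] rho by (intro integrable_mult_right) auto
        fix t :: real
        show "cmod (complex_of_real (\<eta> t) * \<Psi> (complex_of_real \<rho> * cis t)) \<le> 2 / (1 - \<rho>) ^ N * PK \<rho> t"
        proof (cases "t \<in> K")
          case True
          have pl: "(1 - \<rho>) ^ N \<le> cmod (pz Z (complex_of_real \<rho> * cis t))"
            using pz_lower[OF Z(2), of "complex_of_real \<rho> * cis t"] rho by (simp add: N_def norm_mult)
          let ?x = "cmod (k (complex_of_real \<rho> * cis t)) * cmod (h (complex_of_real \<rho> * cis t))"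
          have "cmod (complex_of_real (\<eta> t) * \<Psi> (complex_of_real \<rho> * cis t)) \<le> 1 * (2 * ?x)"
            unfolding norm_mult using Psi_le[OF True, of \<rho>] rho eta1[of t] by (intro mult_mono) auto
          also have "\<dots> = 2 / (1 - \<rho>) ^ N * ((1 - \<rho>) ^ N * ?x)" using rho by simp
          also have "\<dots> \<le> 2 / (1 - \<rho>) ^ N * (cmod (pz Z (complex_of_real \<rho> * cis t)) * ?x)"
            using rho pl by (intro mult_left_mono mult_right_mono) auto
          finally show ?thesis by (simp add: PK_def norm_mult mult.assoc)
        next
          case False
          then show ?thesis using rho by (simp add: eta0 PK_def)
        qed
      qed
      also have "\<dots> = 2 / (1 - \<rho>) ^ N * integral\<^sup>L TT (PK \<rho>)" by (rule integral_mult_right_zero)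
      also have "\<dots> \<le> 2 / (1 - \<rho>) ^ N * S" using PKS[of \<rho>] rho by (intro mult_left_mono) auto
      finally show ?thesis .
    qed
    have Jd: "cmod (integral {0..2*pi} (\<lambda>t. complex_of_real (\<eta>d t) * \<Psi> (complex_of_real r * cis t))) \<le> 2 * D1 * 2 ^ N * S"
      if r: "\<rho> \<le> r" "r < 1" for r
    proof -
      have r0: "0 \<le> r" using r rho by linarith
      have "integral {0..2*pi} (\<lambda>t. complex_of_real (\<eta>d t) * \<Psi> (complex_of_real r * cis t)) = integral\<^sup>L TT (\<lambda>t. complex_of_real (\<eta>d t) * \<Psi> (complex_of_real r * cis t))"
        by (rule integral_TT[OF cont(2)[OF r], symmetric])
      also have "cmod \<dots> \<le> integral\<^sup>L TT (\<lambda>t. 2 * D1 * 2 ^ N * PK r t)"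
      proof (rule norm_integral_TT_le)
        show "integrable TT (\<lambda>t. complex_of_real (\<eta>d t) * \<Psi> (complex_of_real r * cis t))"
          by (rule integrable_TT_continuous[OF cont(2)[OF r]])
        show "integrable TT (\<lambda>t. 2 * D1 * 2 ^ N * PK r t)" using iPK[OF r0 r(2)] by (intro integrable_mult_right) auto
        fix t :: real
        show "cmod (complex_of_real (\<eta>d t) * \<Psi> (complex_of_real r * cis t)) \<le> 2 * D1 * 2 ^ N * PK r t"
        proof (cases "t \<in> K")
          case True
          let ?x = "cmod (k (complex_of_real r * cis t)) * cmod (h (complex_of_real r * cis t))"
          have ql: "cmod (q t) \<le> 2 ^ N * cmod (pz Z (complex_of_real r * cis t))"
            unfolding q_def N_def using pz_circle_le[OF Z(2) r0] r by simp
          have "\<bar>\<eta>d t\<bar> \<le> D1 * (2 ^ N * cmod (pz Z (complex_of_real r * cis t)))"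
            by (rule order_trans[OF etadb mult_left_mono[OF ql D1]])
          then have "cmod (complex_of_real (\<eta>d t) * \<Psi> (complex_of_real r * cis t)) \<le> (D1 * (2 ^ N * cmod (pz Z (complex_of_real r * cis t)))) * (2 * ?x)"
            unfolding norm_mult[of "complex_of_real (\<eta>d t)"] using Psi_le[OF True r] D1 by (intro mult_mono) auto
          then show ?thesis by (simp add: PK_def norm_mult mult_ac)
        next
          case False
          then show ?thesis using D1 by (simp add: etad0 PK_def)
        qed
      qed
      also have "\<dots> = 2 * D1 * 2 ^ N * integral\<^sup>L TT (PK r)" by (rule integral_mult_right_zero)
      also have "\<dots> \<le> 2 * D1 * 2 ^ N * S" using PKS[OF r0 r(2)] D1 by (intro mult_left_mono) auto
      finally show ?thesis .
    qed
    have JR: "cmod (J R) \<le> C0 * S" if R: "\<rho> \<le> R" "R < 1" for R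
    proof -
      have KV': "complex_of_real r * cis t \<in> V" if "t \<in> K" "r \<in> {\<rho>..R}" for t r using KV[OF that(1), of r] that(2) R by simp
      define I where "I = integral {\<rho>..R} (\<lambda>r. (\<i> / of_real r) * integral {0..2*pi} (\<lambda>t. complex_of_real (\<eta>d t) * \<Psi> (complex_of_real r * cis t)))"
      have eq: "J R - J \<rho> = I"
        unfolding J_def I_def by (rule radial_shift[OF V holP Kc rho(1) R(1) KV' etad cetad eta0 etad0 per])
      define B where "B = (1 / \<rho>) * (2 * D1 * 2 ^ N * S)"
      have B: "0 \<le> B" unfolding B_def using rho D1 S0 by (intro mult_nonneg_nonneg divide_nonneg_nonneg) auto
      have bd: "cmod ((\<i> / of_real r) * integral {0..2*pi} (\<lambda>t. complex_of_real (\<eta>d t) * \<Psi> (complex_of_real r * cis t))) \<le> B"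
        if r: "r \<in> {\<rho>..R}" for r
      proof -
        have "cmod (\<i> / of_real r) \<le> 1 / \<rho>" using r rho by (simp add: norm_divide frac_le)
        then show ?thesis unfolding B_def norm_mult[of "\<i> / complex_of_real r"]
          using Jd[of r] r R rho by (intro mult_mono) auto
      qed
      \<comment> \<open>If the integrand in \<open>r\<close> were not integrable, \<open>I\<close>
        would be 0 by convention; the case split stands in for a proof of continuity in
        \<open>r\<close>.\<close>
      have "cmod I \<le> B"
      proof (cases "(\<lambda>r. (\<i> / of_real r) * integral {0..2*pi} (\<lambda>t. complex_of_real (\<eta>d t) * \<Psi> (complex_of_real r * cis t))) integrable_on {\<rho>..R}")
        case True
        then have "((\<lambda>r. (\<i> / of_real r) * integral {0..2*pi} (\<lambda>t. complex_of_real (\<eta>d t) * \<Psi> (complex_of_real r * cis t))) has_integral I) (cbox \<rho> R)"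
          unfolding I_def by (simp add: integrable_integral)
        then have "cmod I \<le> B * measure lborel (cbox \<rho> R)"
          by (rule has_integral_bound[OF B]) (use bd in auto)
        also have "\<dots> \<le> B * 1" using R rho B by (intro mult_left_mono) auto
        finally show ?thesis by simp
      next
        case False
        then show ?thesis using B by (simp add: I_def not_integrable_integral)
      qed
      moreover have "cmod (J R) \<le> cmod (J \<rho>) + cmod I" using eq norm_triangle_ineq[of "J \<rho>" I] by (simp add: algebra_simps)
      ultimately have "cmod (J R) \<le> 2 / (1 - \<rho>) ^ N * S + B" using Jrho by linarith
      also have "\<dots> = C0 * S" by (simp add: C0_def B_def algebra_simps)
      finally show ?thesis .
    qed
    \<comment> \<open>The boundary function of \<open>\<Psi>\<close> times the cutoff. The case
      distinction makes it bounded everywhere, whereas \<open>1 / 2 \<le> cmod (bs t)\<close> on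
      \<open>K\<close> is known almost everywhere.\<close>
    define u where "u = (\<lambda>t. if 1 / 2 \<le> cmod (bs t) then complex_of_real (\<eta> t) * (ks t * hs t / bs t) else 0)"
    note mb = bmf_meas[OF bfun_bmf[OF b]] and mk = bmf_meas[OF bfun_bmf[OF k]] and mh = bmf_meas[OF bfun_bmf[OF h]]
    have bks: "bmf (\<lambda>t. ks t * hs t)" by (intro bmf_mult bfun_bmf[OF k] bfun_bmf[OF h])
    have meta: "\<eta> \<in> borel_measurable TT" using borel_measurable_integrable[OF integrable_TT_continuous[OF ceta]] .
    have mu: "u \<in> borel_measurable TT" unfolding u_def using mb mk mh meta by measurable
    have bu: "bmf u"
    proof -
      obtain B where B: "\<forall>t. cmod (ks t * hs t) \<le> B" using bks unfolding bmf_def by blast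
      have "0 \<le> B" using order_trans[OF norm_ge_zero B[rule_format, of 0]] .
      have "cmod (u t) \<le> 2 * B" for t
      proof (cases "1 / 2 \<le> cmod (bs t)")
        case True
        then have "cmod (u t) = \<eta> t * (cmod (ks t * hs t) / cmod (bs t))" using eta1 by (simp add: u_def norm_mult norm_divide)
        also have "\<dots> \<le> 1 * (B / (1 / 2))" using True B eta1[of t] \<open>0 \<le> B\<close> by (intro mult_mono frac_le) auto
        finally show ?thesis by simp
      qed (use \<open>0 \<le> B\<close> in \<open>simp add: u_def\<close>)
      then show ?thesis by (rule bmfI[OF mu])
    qed
    have AEb: "AE t in TT. t \<in> K \<longrightarrow> 1 / 2 \<le> cmod (bs t)"
    proof -
      have "AE t in TT. ((\<lambda>r. b (complex_of_real r * cis t)) \<longlongrightarrow> bs t) (at_left 1)" using b by (simp add: bfun_def)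
      then show ?thesis
      proof eventually_elim
        case (elim t)
        have "1 / 2 \<le> cmod (bs t)" if "t \<in> K"
        proof -
          have "eventually (\<lambda>r. r \<in> {\<rho><..<1}) (at_left (1::real))" by (rule eventually_at_left_real[OF rho(2)])
          then have "eventually (\<lambda>r. 1 / 2 \<le> cmod (b (complex_of_real r * cis t))) (at_left 1)"
            by (rule eventually_mono) (use blow[OF that] in auto)
          then show ?thesis by (rule tendsto_lowerbound[OF tendsto_norm[OF elim]]) simp
        qed
        then show ?case by blast
      qed
    qed
    have "cmod (integral\<^sup>L TT u) \<le> C0 * S"
    proof -
      have "eventually (\<lambda>x. x \<in> {\<rho><..<1}) (at_left (1::real))" by (rule eventually_at_left_real[OF rho(2)])
      then have "eventually (\<lambda>n. rad n \<in> {\<rho><..<1}) sequentially" using rad_lim by (rule eventually_compose_filterlim)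
      then obtain m where m: "\<And>n. n \<ge> m \<Longrightarrow> rad n \<in> {\<rho><..<1}" by (auto simp: eventually_sequentially)
      have rm: "\<rho> \<le> rad (n + m)" "rad (n + m) < 1" for n using m[of "n + m"] by auto
      define s where "s = (\<lambda>n t. complex_of_real (\<eta> t) * \<Psi> (complex_of_real (rad (n + m)) * cis t))"
      have "(\<lambda>n. integral\<^sup>L TT (s n)) \<longlonglongrightarrow> integral\<^sup>L TT u"
      proof (rule dct_TT)
        show "s n \<in> borel_measurable TT" for n
          unfolding s_def using borel_measurable_integrable[OF integrable_TT_continuous[OF cont(1)[OF rm]]] .
        show "u \<in> borel_measurable TT" by (rule mu)
        show "norm (s n t) \<le> 2 * (Bk * Bh)" for n t
        proof (cases "t \<in> K")
          case True
          have in1: "complex_of_real (rad (n + m)) * cis t \<in> ball 0 1" using rm[of n] rad[of "n + m"] by (simp add: norm_mult)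
          have "cmod (s n t) \<le> 1 * (2 * (cmod (k (complex_of_real (rad (n + m)) * cis t)) * cmod (h (complex_of_real (rad (n + m)) * cis t))))"
            unfolding s_def norm_mult using Psi_le[OF True rm] eta1[of t] by (intro mult_mono) auto
          also have "\<dots> \<le> 1 * (2 * (Bk * Bh))" using Bkh[OF in1] B0 by (intro mult_mono) auto
          finally show ?thesis by simp
        qed (use B0 in \<open>simp add: s_def eta0\<close>)
        have "AE t in TT. ((\<lambda>n. b (complex_of_real (rad n) * cis t)) \<longlonglongrightarrow> bs t) \<and> ((\<lambda>n. k (complex_of_real (rad n) * cis t)) \<longlonglongrightarrow> ks t)
           \<and> ((\<lambda>n. h (complex_of_real (rad n) * cis t)) \<longlonglongrightarrow> hs t) \<and> (t \<in> K \<longrightarrow> 1 / 2 \<le> cmod (bs t))"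
          using bfun_seq[OF b] bfun_seq[OF k] bfun_seq[OF h] AEb by eventually_elim blast
        then show "AE t in TT. (\<lambda>n. s n t) \<longlonglongrightarrow> u t"
        proof eventually_elim
          case (elim t)
          show ?case
          proof (cases "t \<in> K")
            case True
            with elim have nz: "1 / 2 \<le> cmod (bs t)" "bs t \<noteq> 0" by auto
            have "(\<lambda>n. complex_of_real (\<eta> t) * \<Psi> (complex_of_real (rad n) * cis t)) \<longlonglongrightarrow> complex_of_real (\<eta> t) * (ks t * hs t / bs t)"
              unfolding \<Psi>_def using elim nz by (intro tendsto_intros) auto
            then have "(\<lambda>n. s n t) \<longlonglongrightarrow> complex_of_real (\<eta> t) * (ks t * hs t / bs t)"
              unfolding s_def by (rule LIMSEQ_ignore_initial_segment)
            then show ?thesis using nz by (simp add: u_def)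
          qed (simp add: s_def u_def eta0)
        qed
      qed
      then have "(\<lambda>n. cmod (integral\<^sup>L TT (s n))) \<longlonglongrightarrow> cmod (integral\<^sup>L TT u)" by (rule tendsto_norm)
      moreover have "cmod (integral\<^sup>L TT (s n)) \<le> C0 * S" for n
        using JR[OF rm, of n] integral_TT[OF cont(1)[OF rm], of n] by (simp add: s_def J_def)
      ultimately show ?thesis by (intro LIMSEQ_le_const2) auto
    qed
    moreover have "cmod (integral\<^sup>L TT (\<lambda>t. cnj (bs t) * (ks t * hs t) - u t)) \<le> C3 * S"
    proof -
      have bq: "bmf (\<lambda>t. q t * ks t)" unfolding q_def by (rule bfun_bmf[OF pk])
      have "cmod (integral\<^sup>L TT (\<lambda>t. cnj (bs t) * (ks t * hs t) - u t)) \<le> integral\<^sup>L TT (\<lambda>t. cmod (cnj (bs t) * (ks t * hs t) - u t))"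
        by (rule integral_norm_bound)
      also have "\<dots> \<le> integral\<^sup>L TT (\<lambda>t. C3 * (cmod (q t * ks t) * cmod (hs t)))"
      proof (rule integral_mono_AE)
        show "integrable TT (\<lambda>t. cmod (cnj (bs t) * (ks t * hs t) - u t))"
          by (intro bmf_integrable bmf_norm bmf_diff bu bmf_mult[OF bmf_cnj[OF bfun_bmf[OF b]] bks])
        show "integrable TT (\<lambda>t. C3 * (cmod (q t * ks t) * cmod (hs t)))"
          by (intro bmf_integrable bmf_mult[OF bmf_const] bmf_mult[OF bmf_norm bmf_norm] bq bfun_bmf[OF h])
        show "AE t in TT. cmod (cnj (bs t) * (ks t * hs t) - u t) \<le> C3 * (cmod (q t * ks t) * cmod (hs t))"
          using AEb mate
        proof eventually_elim
          case (elim t)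
          show ?case
          proof (cases "t \<in> K")
            case True
            with elim have nz: "1 / 2 \<le> cmod (bs t)" "bs t \<noteq> 0" by auto
            have qd: "cmod (q t) \<le> \<delta>" using True by (simp add: K_def)
            \<comment> \<open>Since \<open>cnj (bs t)\<close> is
              \<open>(cmod (bs t))\<^sup>2 / bs t\<close>, passing to \<open>1 / bs t\<close> costs
              \<open>1 - (cmod (bs t))\<^sup>2\<close>, and inserting the cutoff costs
              \<open>1 - \<eta> t\<close>.\<close>
            have "cnj (bs t) * (ks t * hs t) - u t = (ks t * hs t) * (((complex_of_real ((cmod (bs t))\<^sup>2)) - complex_of_real (\<eta> t)) / bs t)"
            proof -
              have "cnj (bs t) = complex_of_real ((cmod (bs t))\<^sup>2) / bs t" using nz by (simp only: complex_norm_square) simp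
              then show ?thesis using nz by (simp add: u_def diff_divide_distrib algebra_simps)
            qed
            also have "cmod \<dots> = cmod (ks t * hs t) * (\<bar>(cmod (bs t))\<^sup>2 - \<eta> t\<bar> / cmod (bs t))"
              by (simp only: norm_mult norm_divide norm_of_real flip: of_real_diff)
            also have "\<dots> \<le> cmod (ks t * hs t) * (C3 * cmod (q t))"
            proof (rule mult_left_mono)
              have b1: "(cmod (bs t))\<^sup>2 \<le> 1" using bs1[of t] by (simp add: power_le_one)
              have "\<bar>(cmod (bs t))\<^sup>2 - \<eta> t\<bar> \<le> (1 - (cmod (bs t))\<^sup>2) + (1 - \<eta> t)" using b1 eta1[of t] by (simp add: abs_if)
              also have "\<dots> \<le> A * cmod (q t) + 2 * (cmod (q t))\<^sup>2 / \<delta>\<^sup>2" using elim etalow[of t] by (simp add: q_def)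
              also have "2 * (cmod (q t))\<^sup>2 / \<delta>\<^sup>2 \<le> 2 * (\<delta> * cmod (q t)) / \<delta>\<^sup>2"
                using qd by (intro divide_right_mono mult_left_mono) (auto simp: power2_eq_square intro: mult_right_mono)
              also have "2 * (\<delta> * cmod (q t)) / \<delta>\<^sup>2 = 2 / \<delta> * cmod (q t)" using d0 by (simp add: power2_eq_square)
              finally have "\<bar>(cmod (bs t))\<^sup>2 - \<eta> t\<bar> \<le> (A + 2 / \<delta>) * cmod (q t)" by (simp add: algebra_simps)
              then have "\<bar>(cmod (bs t))\<^sup>2 - \<eta> t\<bar> / cmod (bs t) \<le> ((A + 2 / \<delta>) * cmod (q t)) / (1 / 2)"
                using nz A d0 by (intro frac_le) auto
              also have "\<dots> \<le> C3 * cmod (q t)"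
              proof -
                have "2 * A + 4 / \<delta> \<le> C3" using d0 by (simp add: C3_def divide_right_mono)
                then have "(2 * A + 4 / \<delta>) * cmod (q t) \<le> C3 * cmod (q t)" by (rule mult_right_mono) simp
                then show ?thesis by (simp add: algebra_simps)
              qed
              finally show "\<bar>(cmod (bs t))\<^sup>2 - \<eta> t\<bar> / cmod (bs t) \<le> C3 * cmod (q t)" .
            qed simp
            finally show ?thesis by (simp add: norm_mult mult_ac)
          next
            case False
            then have qd: "\<delta> < cmod (q t)" by (simp add: K_def)
            have u0: "u t = 0" using eta0[OF False] by (simp add: u_def)
            have "1 \<le> cmod (q t) / \<delta>" using qd d0 by simp
            also have "\<dots> \<le> C3 * cmod (q t)"
            proof -
              have "1 / \<delta> \<le> C3" using d0 A by (simp add: C3_def add_nonneg_nonneg divide_right_mono add_increasing)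
              then have "(1 / \<delta>) * cmod (q t) \<le> C3 * cmod (q t)" by (rule mult_right_mono) simp
              then show ?thesis by simp
            qed
            finally have c1: "1 \<le> C3 * cmod (q t)" .
            have "cmod (cnj (bs t) * (ks t * hs t) - u t) \<le> 1 * cmod (ks t * hs t)"
              unfolding u0 diff_0_right norm_mult[of "cnj (bs t)"] using bs1[of t] by (intro mult_right_mono) auto
            also have "\<dots> \<le> (C3 * cmod (q t)) * cmod (ks t * hs t)" by (rule mult_right_mono[OF c1]) simp
            finally show ?thesis by (simp add: norm_mult mult_ac)
          qed
        qed
      qed
      also have "\<dots> = C3 * integral\<^sup>L TT (\<lambda>t. cmod (q t * ks t) * cmod (hs t))" by (rule integral_mult_right_zero)
      also have "\<dots> \<le> C3 * S"
        unfolding S_def q_def by (intro mult_left_mono Cauchy_Schwarz_norms C3 bfun_bmf[OF pk] bfun_bmf[OF h])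
      finally show ?thesis .
    qed
    moreover have "integral\<^sup>L TT (\<lambda>t. cnj (bs t) * (ks t * hs t)) = integral\<^sup>L TT u + integral\<^sup>L TT (\<lambda>t. cnj (bs t) * (ks t * hs t) - u t)"
      by (subst Bochner_Integration.integral_diff) (auto intro!: bmf_integrable bu bmf_mult[OF bmf_cnj[OF bfun_bmf[OF b]] bks])
    ultimately have "cmod (integral\<^sup>L TT (\<lambda>t. cnj (bs t) * (ks t * hs t))) \<le> C0 * S + C3 * S"
      using norm_triangle_ineq[of "integral\<^sup>L TT u" "integral\<^sup>L TT (\<lambda>t. cnj (bs t) * (ks t * hs t) - u t)"] by simp
    then show ?thesis by (simp add: S_def algebra_simps)
  qed
  then show ?thesis using C0 C3 by (intro exI[of _ "C0 + C3"]) auto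
qed

section \<open>Area integrals\<close>

text \<open>The product measure transported by \<open>Complex\<close> agrees with
  \<open>lborel\<close> on boxes, which determine it.\<close>

lemma nn_integral_complex:
  assumes [measurable]: "h \<in> borel_measurable borel"
  shows "(\<integral>\<^sup>+ z. h z \<partial>lborel) = (\<integral>\<^sup>+ x. (\<integral>\<^sup>+ y. h (Complex x y) \<partial>lborel) \<partial>lborel)"
proof -
  have cC: "continuous_on UNIV (\<lambda>p. Complex (fst p) (snd p))"
    by (simp add: Complex_eq) (intro continuous_intros)
  then have mC[measurable]: "(\<lambda>p. Complex (fst p) (snd p)) \<in> borel_measurable borel"
    by (rule borel_measurable_continuous_onI)
  have "distr (lborel :: (real \<times> real) measure) borel (\<lambda>p. Complex (fst p) (snd p)) = lborel"
  proof (rule lborel_eqI[symmetric])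
    fix l u :: complex assume lu: "\<And>b. b \<in> Basis \<Longrightarrow> l \<bullet> b \<le> u \<bullet> b"
    have le: "Re l \<le> Re u" "Im l \<le> Im u" using lu[of 1] lu[of \<i>] by (auto simp: Basis_complex_def)
    have pre: "(\<lambda>p. Complex (fst p) (snd p)) -` box l u = box (Re l, Im l) (Re u, Im u)"
      by (auto simp: box_def Basis_complex_def Basis_prod_def)
    have "emeasure (distr (lborel :: (real \<times> real) measure) borel (\<lambda>p. Complex (fst p) (snd p))) (box l u) =
        emeasure lborel (box (Re l, Im l) (Re u, Im u))"
      by (subst emeasure_distr) (auto simp: pre)
    also have "\<dots> = (\<Prod>b\<in>Basis. ((Re u, Im u) - (Re l, Im l)) \<bullet> b)"
      by (rule emeasure_lborel_box) (use le in \<open>auto simp: Basis_prod_def\<close>)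
    also have "\<dots> = (\<Prod>b\<in>Basis. (u - l) \<bullet> b)"
      by (simp add: Basis_prod_def Basis_complex_def mult.commute)
    finally show "emeasure (distr (lborel :: (real \<times> real) measure) borel (\<lambda>p. Complex (fst p) (snd p))) (box l u) = (\<Prod>b\<in>Basis. (u - l) \<bullet> b)" .
  qed simp
  then have "(\<integral>\<^sup>+ z. h z \<partial>lborel) = (\<integral>\<^sup>+ z. h z \<partial>distr (lborel :: (real \<times> real) measure) borel (\<lambda>p. Complex (fst p) (snd p)))" by simp
  also have "\<dots> = (\<integral>\<^sup>+ p. h (Complex (fst p) (snd p)) \<partial>lborel)" by (rule nn_integral_distr) auto
  also have "\<dots> = (\<integral>\<^sup>+ p. h (Complex (fst p) (snd p)) \<partial>(lborel \<Otimes>\<^sub>M lborel))" by (simp add: lborel_prod)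
  also have "\<dots> = (\<integral>\<^sup>+ x. (\<integral>\<^sup>+ y. h (Complex x y) \<partial>lborel) \<partial>lborel)"
    by (subst lborel.nn_integral_fst[symmetric]) (auto simp: lborel_prod)
  finally show ?thesis .
qed

text \<open>A rotation is composed of two substitutions, each affine in one real variable with the
  other held fixed. Their Jacobians \<open>1 / C\<close> and \<open>C\<close> cancel; the first
  substitution divides by \<open>cos t\<close>.\<close>

lemma nn_integral_rotate:
  assumes [measurable]: "h \<in> borel_measurable borel" and c: "cos t \<noteq> 0"
  shows "(\<integral>\<^sup>+ z. h (cis t * z) \<partial>lborel) = (\<integral>\<^sup>+ z. h z \<partial>lborel)"
proof -
  define C where "C = cos t"
  define S where "S = sin t"
  have CS: "S\<^sup>2 + C\<^sup>2 = 1" by (simp add: C_def S_def)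
  have C0: "C \<noteq> 0" using c by (simp add: C_def)
  have cC: "continuous_on UNIV (\<lambda>p. Complex (f p) (g p))" if "continuous_on UNIV f" "continuous_on UNIV g" for f g :: "real \<times> real \<Rightarrow> real"
    using that by (simp add: Complex_eq) (intro continuous_intros)
  have mC: "(\<lambda>p. h (Complex (f p) (g p))) \<in> borel_measurable (borel \<Otimes>\<^sub>M borel)"
    if "continuous_on UNIV f" "continuous_on UNIV g" for f g :: "real \<times> real \<Rightarrow> real"
    by (rule measurable_compose[OF _ assms(1)]) (use borel_measurable_continuous_onI[OF cC[OF that]] in \<open>simp add: borel_prod\<close>)
  have mC1: "(\<lambda>x. h (Complex (f x) (g x))) \<in> borel_measurable borel"
    if "continuous_on UNIV f" "continuous_on UNIV g" for f g :: "real \<Rightarrow> real"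
    by (rule measurable_compose[OF _ assms(1)], rule borel_measurable_continuous_onI)
      (use that in \<open>simp add: Complex_eq, intro continuous_intros\<close>)
  have swap: "(\<integral>\<^sup>+ x. (\<integral>\<^sup>+ y. h (Complex (f (x, y)) (g (x, y))) \<partial>lborel) \<partial>lborel) = (\<integral>\<^sup>+ y. (\<integral>\<^sup>+ x. h (Complex (f (x, y)) (g (x, y))) \<partial>lborel) \<partial>lborel)"
    if "continuous_on UNIV f" "continuous_on UNIV g" for f g :: "real \<times> real \<Rightarrow> real"
    by (rule lborel_pair.Fubini'[symmetric]) (use mC[OF that] in \<open>simp add: case_prod_unfold\<close>)
  have hm: "(\<lambda>z. h (cis t * z)) \<in> borel_measurable borel"
    by (rule measurable_compose[OF _ assms(1)], rule borel_measurable_continuous_onI) (intro continuous_intros)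
  have "(\<integral>\<^sup>+ z. h (cis t * z) \<partial>lborel) = (\<integral>\<^sup>+ x. (\<integral>\<^sup>+ y. h (cis t * Complex x y) \<partial>lborel) \<partial>lborel)"
    by (rule nn_integral_complex[OF hm])
  also have "\<dots> = (\<integral>\<^sup>+ x. (\<integral>\<^sup>+ y. h (Complex (C * x - S * y) (S * x + C * y)) \<partial>lborel) \<partial>lborel)"
  proof -
    have "cis t * Complex x y = Complex (C * x - S * y) (S * x + C * y)" for x y
      by (simp add: complex_eq_iff C_def S_def)
    then show ?thesis by simp
  qed
  also have "\<dots> = (\<integral>\<^sup>+ y. (\<integral>\<^sup>+ x. h (Complex (C * x - S * y) (S * x + C * y)) \<partial>lborel) \<partial>lborel)"
    using swap[of "\<lambda>p. C * fst p - S * snd p" "\<lambda>p. S * fst p + C * snd p"] by (simp add: continuous_intros)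
  also have "\<dots> = (\<integral>\<^sup>+ y. ennreal \<bar>1 / C\<bar> * (\<integral>\<^sup>+ u. h (Complex u (S / C * u + y / C)) \<partial>lborel) \<partial>lborel)"
  proof (rule nn_integral_cong)
    fix y
    have "(\<integral>\<^sup>+ x. h (Complex (C * x - S * y) (S * x + C * y)) \<partial>lborel) =
       ennreal \<bar>1 / C\<bar> * (\<integral>\<^sup>+ u. h (Complex (C * (S * y / C + 1 / C * u) - S * y) (S * (S * y / C + 1 / C * u) + C * y)) \<partial>lborel)"
      by (rule nn_integral_real_affine[OF mC1]) (use C0 in \<open>auto intro!: continuous_intros\<close>)
    also have "\<dots> = ennreal \<bar>1 / C\<bar> * (\<integral>\<^sup>+ u. h (Complex u (S / C * u + y / C)) \<partial>lborel)"
    proof -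
      have "C * (S * y / C + 1 / C * u) - S * y = u" for u using C0 by (simp add: field_simps)
      moreover have "S * (S * y / C + 1 / C * u) + C * y = S / C * u + y / C" for u
      proof -
        have "S * (S * y / C + 1 / C * u) + C * y = S / C * u + (S\<^sup>2 + C\<^sup>2) * y / C" using C0 by (simp add: field_simps power2_eq_square)
        then show ?thesis by (simp add: CS)
      qed
      ultimately show ?thesis by simp
    qed
    finally show "(\<integral>\<^sup>+ x. h (Complex (C * x - S * y) (S * x + C * y)) \<partial>lborel) = ennreal \<bar>1 / C\<bar> * (\<integral>\<^sup>+ u. h (Complex u (S / C * u + y / C)) \<partial>lborel)" .
  qed
  also have "\<dots> = ennreal \<bar>1 / C\<bar> * (\<integral>\<^sup>+ y. (\<integral>\<^sup>+ u. h (Complex u (S / C * u + y / C)) \<partial>lborel) \<partial>lborel)"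
  proof (rule nn_integral_cmult)
    have "(\<lambda>p. h (Complex (snd p) (S / C * snd p + fst p / C))) \<in> borel_measurable (borel \<Otimes>\<^sub>M borel)"
      by (rule mC) (use C0 in \<open>auto intro!: continuous_intros\<close>)
    then have "(\<lambda>(y, u). h (Complex u (S / C * u + y / C))) \<in> borel_measurable (lborel \<Otimes>\<^sub>M lborel)" by (simp add: case_prod_unfold)
    then show "(\<lambda>y. \<integral>\<^sup>+ u. h (Complex u (S / C * u + y / C)) \<partial>lborel) \<in> borel_measurable lborel"
      by (rule lborel.borel_measurable_nn_integral)
  qed
  also have "(\<integral>\<^sup>+ y. (\<integral>\<^sup>+ u. h (Complex u (S / C * u + y / C)) \<partial>lborel) \<partial>lborel) = (\<integral>\<^sup>+ u. (\<integral>\<^sup>+ y. h (Complex u (S / C * u + y / C)) \<partial>lborel) \<partial>lborel)"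
    using swap[of "\<lambda>p. snd p" "\<lambda>p. S / C * snd p + fst p / C"] C0 by (simp add: continuous_intros)
  also have "\<dots> = (\<integral>\<^sup>+ u. ennreal \<bar>C\<bar> * (\<integral>\<^sup>+ v. h (Complex u v) \<partial>lborel) \<partial>lborel)"
  proof (rule nn_integral_cong)
    fix u
    have "(\<integral>\<^sup>+ y. h (Complex u (S / C * u + y / C)) \<partial>lborel) = ennreal \<bar>C\<bar> * (\<integral>\<^sup>+ v. h (Complex u (S / C * u + (- S * u + C * v) / C)) \<partial>lborel)"
      by (rule nn_integral_real_affine[OF mC1]) (use C0 in \<open>auto intro!: continuous_intros\<close>)
    also have "\<dots> = ennreal \<bar>C\<bar> * (\<integral>\<^sup>+ v. h (Complex u v) \<partial>lborel)"
    proof -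
      have "S / C * u + (- S * u + C * v) / C = v" for v using C0 by (simp add: field_simps)
      then show ?thesis by simp
    qed
    finally show "(\<integral>\<^sup>+ y. h (Complex u (S / C * u + y / C)) \<partial>lborel) = ennreal \<bar>C\<bar> * (\<integral>\<^sup>+ v. h (Complex u v) \<partial>lborel)" .
  qed
  also have "\<dots> = ennreal \<bar>C\<bar> * (\<integral>\<^sup>+ u. (\<integral>\<^sup>+ v. h (Complex u v) \<partial>lborel) \<partial>lborel)"
  proof (rule nn_integral_cmult)
    have "(\<lambda>p. h (Complex (fst p) (snd p))) \<in> borel_measurable (borel \<Otimes>\<^sub>M borel)" by (rule mC) (auto intro!: continuous_intros)
    then have "(\<lambda>(y, u). h (Complex y u)) \<in> borel_measurable (lborel \<Otimes>\<^sub>M lborel)" by (simp add: case_prod_unfold)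
    then show "(\<lambda>y. \<integral>\<^sup>+ u. h (Complex y u) \<partial>lborel) \<in> borel_measurable lborel"
      by (rule lborel.borel_measurable_nn_integral)
  qed
  also have "(\<integral>\<^sup>+ u. (\<integral>\<^sup>+ v. h (Complex u v) \<partial>lborel) \<partial>lborel) = (\<integral>\<^sup>+ z. h z \<partial>lborel)"
    by (rule nn_integral_complex[symmetric]) simp
  also have "ennreal \<bar>1 / C\<bar> * (ennreal \<bar>C\<bar> * (\<integral>\<^sup>+ z. h z \<partial>lborel)) = (\<integral>\<^sup>+ z. h z \<partial>lborel)"
    using C0 by (simp add: ennreal_mult[symmetric] mult.assoc[symmetric])
  finally show ?thesis .
qed

text \<open>Layer-cake argument: \<open>cmod z ^ (2 * n)\<close> is the integral of
  \<open>n * s ^ (n - 1)\<close> over \<open>s\<close> between 0 and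
  \<open>(cmod z)\<^sup>2\<close>, and the points of the disc with
  \<open>s \<le> (cmod z)\<^sup>2\<close> form an annulus of area \<open>pi - pi * s\<close>. For
  \<open>n = 0\<close> this representation breaks down and the area of the disc is used.\<close>

lemma area_power: "(\<integral>\<^sup>+ z. indicator (ball 0 1) z * ennreal (cmod z ^ (2 * n)) \<partial>lborel) = ennreal (pi / (real n + 1))"
proof (cases n)
  case 0
  have "emeasure lborel (ball (0::complex) 1) = ennreal pi"
    by (simp add: emeasure_ball unit_ball_vol_2)
  then show ?thesis using 0 by simp
next
  case (Suc m)
  define c where "c = real n / real (Suc n)"
  define P where "P = (\<lambda>s. pi * s ^ n - pi * (c * s ^ Suc n))"
  have pw: "ennreal (x ^ n) = (\<integral>\<^sup>+ s. indicator {0..x} s * ennreal (n * s ^ (n - 1)) \<partial>lborel)" if "0 \<le> x" for x :: real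
  proof -
    have "(\<integral>\<^sup>+ s. ennreal (n * s ^ (n - 1)) * indicator {0..x} s \<partial>lborel) = ennreal (x ^ n - 0 ^ n)"
      by (rule nn_integral_FTC_Icc) (use that in \<open>auto intro!: derivative_eq_intros\<close>)
    then show ?thesis using Suc by (simp add: mult.commute)
  qed
  have "(\<integral>\<^sup>+ z. indicator (ball 0 1) z * ennreal (cmod z ^ (2 * n)) \<partial>lborel) =
     (\<integral>\<^sup>+ z. (\<integral>\<^sup>+ s. indicator (ball 0 1) z * (indicator {0..(cmod z)\<^sup>2} s * ennreal (n * s ^ (n - 1))) \<partial>lborel) \<partial>(lborel :: complex measure))"
  proof (rule nn_integral_cong)
    fix z :: complex
    have m: "(\<lambda>s. indicator {0..(cmod z)\<^sup>2} s * ennreal (n * s ^ (n - 1))) \<in> borel_measurable lborel" by measurable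
    have "ennreal (cmod z ^ (2 * n)) = (\<integral>\<^sup>+ s. indicator {0..(cmod z)\<^sup>2} s * ennreal (n * s ^ (n - 1)) \<partial>lborel)"
      using pw[of "(cmod z)\<^sup>2"] by (simp add: power_mult)
    then show "indicator (ball 0 1) z * ennreal (cmod z ^ (2 * n)) =
      (\<integral>\<^sup>+ s. indicator (ball 0 1) z * (indicator {0..(cmod z)\<^sup>2} s * ennreal (n * s ^ (n - 1))) \<partial>lborel)"
      by (simp only: nn_integral_cmult[OF m])
  qed
  also have "\<dots> = (\<integral>\<^sup>+ s. (\<integral>\<^sup>+ z. indicator (ball 0 1) z * (indicator {0..(cmod z)\<^sup>2} s * ennreal (n * s ^ (n - 1))) \<partial>(lborel :: complex measure)) \<partial>lborel)"
  proof (rule lborel_pair.Fubini')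
    have m: "(\<lambda>p :: real \<times> complex. indicator (UNIV \<times> ball 0 1) p * (indicator {p. 0 \<le> fst p \<and> fst p \<le> (cmod (snd p))\<^sup>2} p * ennreal (n * (fst p) ^ (n - 1))) :: ennreal) \<in> borel_measurable borel"
    proof -
      have [measurable]: "(UNIV \<times> ball 0 1 :: (real \<times> complex) set) \<in> sets borel" by (intro borel_open open_Times) auto
      have [measurable]: "{p :: real \<times> complex. 0 \<le> fst p \<and> fst p \<le> (cmod (snd p))\<^sup>2} \<in> sets borel"
        by (intro borel_closed closed_Collect_conj closed_Collect_le continuous_intros)
      have [measurable]: "(\<lambda>p :: real \<times> complex. fst p) \<in> borel_measurable borel"
        by (intro borel_measurable_continuous_onI continuous_intros)
      show ?thesis by measurable
    qed
    show "(\<lambda>(s, z). indicator (ball 0 1) z * (indicator {0..(cmod z)\<^sup>2} s * ennreal (n * s ^ (n - 1)))) \<in> borel_measurable (lborel \<Otimes>\<^sub>M (lborel :: complex measure))"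
    proof -
      have "(\<lambda>(s, z). indicator (ball 0 1) z * (indicator {0..(cmod z)\<^sup>2} s * ennreal (n * s ^ (n - 1)))) \<in> borel_measurable (lborel \<Otimes>\<^sub>M (lborel :: complex measure)) \<longleftrightarrow>
        (\<lambda>p :: real \<times> complex. indicator (UNIV \<times> ball 0 1) p * (indicator {p. 0 \<le> fst p \<and> fst p \<le> (cmod (snd p))\<^sup>2} p * ennreal (n * (fst p) ^ (n - 1))) :: ennreal) \<in> borel_measurable (lborel \<Otimes>\<^sub>M (lborel :: complex measure))"
        by (rule measurable_cong) (auto simp: indicator_def)
      then show ?thesis using m by (simp add: lborel_prod)
    qed
  qed
  also have "\<dots> = (\<integral>\<^sup>+ s. indicator {0..1} s * ennreal (pi * (n * s ^ (n - 1)) - pi * (n * s ^ n)) \<partial>lborel)"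
  proof (rule nn_integral_cong)
    fix s :: real
    show "(\<integral>\<^sup>+ z. indicator (ball 0 1) z * (indicator {0..(cmod z)\<^sup>2} s * ennreal (n * s ^ (n - 1))) \<partial>(lborel :: complex measure)) =
       indicator {0..1} s * ennreal (pi * (n * s ^ (n - 1)) - pi * (n * s ^ n))"
    proof (cases "0 \<le> s \<and> s \<le> 1")
      case True
      have eq: "indicator (ball 0 1) z * (indicator {0..(cmod z)\<^sup>2} s * ennreal (n * s ^ (n - 1))) =
         ennreal (n * s ^ (n - 1)) * indicator (ball 0 1 - ball 0 (sqrt s)) z" for z :: complex
        using True by (auto simp: indicator_def real_le_lsqrt sqrt_le_D not_less)
      have sub: "ball 0 (sqrt s) \<subseteq> ball (0::complex) 1" using True by (intro subset_ball) simp
      have "emeasure lborel (ball 0 1 - ball (0::complex) (sqrt s)) = emeasure lborel (ball (0::complex) 1) - emeasure lborel (ball (0::complex) (sqrt s))"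
        by (rule emeasure_Diff[OF _ _ _ sub]) (auto simp: emeasure_ball True)
      also have "\<dots> = ennreal (pi - pi * s)"
        using True by (simp add: emeasure_ball unit_ball_vol_2 ennreal_minus)
      finally have em: "emeasure lborel (ball 0 1 - ball (0::complex) (sqrt s)) = ennreal (pi - pi * s)" .
      have "(\<integral>\<^sup>+ z. indicator (ball 0 1) z * (indicator {0..(cmod z)\<^sup>2} s * ennreal (n * s ^ (n - 1))) \<partial>(lborel :: complex measure)) =
          ennreal (n * s ^ (n - 1)) * ennreal (pi - pi * s)"
        unfolding eq by (subst nn_integral_cmult_indicator) (auto simp: em)
      also have "\<dots> = ennreal (n * s ^ (n - 1) * (pi - pi * s))" using True by (simp add: ennreal_mult')
      also have "n * s ^ (n - 1) * (pi - pi * s) = pi * (n * s ^ (n - 1)) - pi * (n * s ^ n)"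
        using Suc by (simp add: algebra_simps)
      finally show ?thesis using True by simp
    next
      case False
      have e0: "indicator (ball 0 1) z * (indicator {0..(cmod z)\<^sup>2} s * ennreal (n * s ^ (n - 1))) = 0" for z :: complex
      proof (cases "z \<in> ball 0 1 \<and> s \<in> {0..(cmod z)\<^sup>2}")
        case True
        then have "(cmod z)\<^sup>2 \<le> 1" by (simp add: power_le_one)
        with True have "0 \<le> s \<and> s \<le> 1" by auto
        with False show ?thesis by simp
      qed (auto simp: indicator_def)
      show ?thesis unfolding e0 using False by simp
    qed
  qed
  also have "\<dots> = (\<integral>\<^sup>+ s. ennreal (pi * (n * s ^ (n - 1)) - pi * (n * s ^ n)) * indicator {0..1} s \<partial>lborel)"
    by (simp add: mult.commute)
  also have "\<dots> = ennreal (P 1 - P 0)"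
  proof (rule nn_integral_FTC_Icc[where F = P and a = 0 and b = 1])
    show "(P has_real_derivative pi * (n * s ^ (n - 1)) - pi * (n * s ^ n)) (at s)" for s :: real
    proof -
      have 1: "((\<lambda>s. s ^ n) has_real_derivative n * s ^ (n - 1)) (at s)" using DERIV_pow[of n s] by simp
      have 2: "((\<lambda>s. s ^ Suc n) has_real_derivative real (Suc n) * s ^ n) (at s)" using DERIV_pow[of "Suc n" s] by simp
      have "(P has_real_derivative pi * (n * s ^ (n - 1)) - pi * (c * (real (Suc n) * s ^ n))) (at s)"
        unfolding P_def by (intro DERIV_diff DERIV_cmult 1 2)
      moreover have "c * (real (Suc n) * s ^ n) = n * s ^ n" by (simp add: c_def)
      ultimately show ?thesis by (simp only:)
    qed
    show "0 \<le> pi * (n * s ^ (n - 1)) - pi * (n * s ^ n)" if s: "s \<in> {0..1}" for s :: real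
    proof -
      have "s ^ n \<le> s ^ (n - 1)" using s by (intro power_decreasing) auto
      then show ?thesis by (simp add: mult_left_mono)
    qed
  qed auto
  also have "P 1 - P 0 = pi / (real n + 1)"
    using Suc by (simp add: P_def c_def field_simps)
  finally show ?thesis .
qed

text \<open>The weight produces a difference of two consecutive even powers. It is first written as
  a sum, because subtraction in \<open>ennreal\<close> is reliable only for finite terms.\<close>

lemma area_weight:
  "(\<integral>\<^sup>+ z. indicator (ball 0 1) z * ennreal ((1 - (cmod z)\<^sup>2) * cmod z ^ (2 * n)) \<partial>lborel) = ennreal (pi / ((real n + 1) * (real n + 2)))"
proof -
  have [measurable]: "ball 0 1 \<in> sets (borel :: complex measure)" by simp
  define c where "c = (\<integral>\<^sup>+ z. indicator (ball 0 1) z * ennreal ((1 - (cmod z)\<^sup>2) * cmod z ^ (2 * n)) \<partial>lborel)"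
  have "c + (\<integral>\<^sup>+ z. indicator (ball 0 1) z * ennreal (cmod z ^ (2 * Suc n)) \<partial>lborel) =
     (\<integral>\<^sup>+ z. indicator (ball 0 1) z * ennreal ((1 - (cmod z)\<^sup>2) * cmod z ^ (2 * n)) + indicator (ball 0 1) z * ennreal (cmod z ^ (2 * Suc n)) \<partial>lborel)"
    unfolding c_def by (rule nn_integral_add[symmetric]) measurable
  also have "\<dots> = (\<integral>\<^sup>+ z. indicator (ball 0 1) z * ennreal (cmod z ^ (2 * n)) \<partial>lborel)"
  proof (rule nn_integral_cong)
    fix z :: complex
    show "indicator (ball 0 1) z * ennreal ((1 - (cmod z)\<^sup>2) * cmod z ^ (2 * n)) + indicator (ball 0 1) z * ennreal (cmod z ^ (2 * Suc n)) = indicator (ball 0 1) z * ennreal (cmod z ^ (2 * n))"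
    proof (cases "z \<in> ball 0 1")
      case True
      then have "(cmod z)\<^sup>2 \<le> 1" by (simp add: power_le_one)
      then have "ennreal ((1 - (cmod z)\<^sup>2) * cmod z ^ (2 * n)) + ennreal (cmod z ^ (2 * Suc n)) = ennreal ((1 - (cmod z)\<^sup>2) * cmod z ^ (2 * n) + cmod z ^ (2 * Suc n))"
        by (simp add: ennreal_plus del: power_Suc)
      also have "(1 - (cmod z)\<^sup>2) * cmod z ^ (2 * n) + cmod z ^ (2 * Suc n) = cmod z ^ (2 * n)"
        by (simp add: algebra_simps power2_eq_square)
      finally show ?thesis using True by simp
    qed simp
  qed
  finally have "c + ennreal (pi / (real (Suc n) + 1)) = ennreal (pi / (real n + 1))" unfolding area_power .
  then have "c = ennreal (pi / (real n + 1)) - ennreal (pi / (real (Suc n) + 1))"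
    by (metis ennreal_add_diff_cancel_right ennreal_neq_top)
  also have "\<dots> = ennreal (pi / (real n + 1) - pi / (real (Suc n) + 1))" by (rule ennreal_minus) simp
  also have "pi / (real n + 1) - pi / (real (Suc n) + 1) = pi / ((real n + 1) * (real n + 2))"
  proof -
    have "real n + 1 \<noteq> 0" "real n + 2 \<noteq> 0" by linarith+
    then show ?thesis by (simp add: field_simps)
  qed
  finally show ?thesis by (simp add: c_def)
qed

lemma nn_integral_circle:
  fixes u :: "real \<Rightarrow> real"
  assumes "continuous_on UNIV u" "\<And>t. 0 \<le> u t"
  shows "(\<integral>\<^sup>+ t. indicator {0..2*pi} t * ennreal (u t) \<partial>lborel) = ennreal (integral\<^sup>L TT u)"
proof -
  have [measurable]: "u \<in> borel_measurable borel" by (rule borel_measurable_continuous_onI[OF assms(1)])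
  have "ennreal (integral\<^sup>L TT u) = (\<integral>\<^sup>+ t. ennreal (u t) \<partial>TT)"
    by (rule nn_integral_eq_integral[symmetric]) (use assms in \<open>auto intro: integrable_TT_continuous\<close>)
  also have "\<dots> = (\<integral>\<^sup>+ t. ennreal (u t) * indicator {0..2*pi} t \<partial>lebesgue)"
    by (rule nn_integral_restrict_space) auto
  also have "\<dots> = (\<integral>\<^sup>+ t. ennreal (u t) * indicator {0..2*pi} t \<partial>lborel)"
    by (rule nn_integral_completion)
  finally show ?thesis by (simp add: mult.commute)
qed

text \<open>Polar coordinates are avoided: the integrand is averaged over rotations, which turns the circular mean
  into Parseval's sum.\<close>
lemma weighted_area_integral:
  assumes hol: "g holomorphic_on ball 0 1"
  shows "(\<integral>\<^sup>+ z. indicator (ball 0 1) z * ennreal ((1 - (cmod z)\<^sup>2) * (cmod (g z))\<^sup>2) \<partial>lborel) =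
    (\<Sum>n. ennreal ((cmod (tc g n))\<^sup>2 * (pi / ((real n + 1) * (real n + 2)))))"
proof -
  have [measurable]: "ball 0 1 \<in> sets (borel :: complex measure)" by simp
  define h where "h = (\<lambda>z. indicator (ball 0 1) z * ennreal ((1 - (cmod z)\<^sup>2) * (cmod (g z))\<^sup>2))"
  have hm[measurable]: "h \<in> borel_measurable borel"
  proof -
    have [measurable]: "(\<lambda>z. indicator (ball 0 1) z *\<^sub>R g z) \<in> borel_measurable borel"
      by (rule borel_measurable_continuous_on_indicator[OF _ holomorphic_on_imp_continuous_on[OF hol]]) simp
    have "(\<lambda>z. indicator (ball 0 1) z * ennreal ((1 - (cmod z)\<^sup>2) * (cmod (indicator (ball 0 1) z *\<^sub>R g z))\<^sup>2)) \<in> borel_measurable borel"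
      by measurable
    moreover have "(\<lambda>z. indicator (ball 0 1) z * ennreal ((1 - (cmod z)\<^sup>2) * (cmod (indicator (ball 0 1) z *\<^sub>R g z))\<^sup>2)) = h"
      by (auto simp: h_def fun_eq_iff indicator_def)
    ultimately show ?thesis by simp
  qed
  define I where "I = (\<integral>\<^sup>+ z. h z \<partial>lborel)"
  have circ: "(\<integral>\<^sup>+ t. indicator {0..2*pi} t * h (cis t * z) \<partial>lborel) =
     ennreal (2 * pi) * (\<Sum>n. ennreal ((cmod (tc g n))\<^sup>2) * (indicator (ball 0 1) z * ennreal ((1 - (cmod z)\<^sup>2) * cmod z ^ (2 * n))))" for z
  proof (cases "z \<in> ball 0 1")
    case True
    then have z1: "cmod z < 1" by simp
    then have w0: "0 \<le> 1 - (cmod z)\<^sup>2" by (simp add: power_le_one)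
    have ct: "continuous_on UNIV (\<lambda>t. g (z * cis t))"
      by (rule continuous_on_compose2[OF holomorphic_on_imp_continuous_on[OF hol]]) (use z1 in \<open>auto intro!: continuous_intros simp: norm_mult\<close>)
    have "(\<integral>\<^sup>+ t. indicator {0..2*pi} t * h (cis t * z) \<partial>lborel) =
       (\<integral>\<^sup>+ t. indicator {0..2*pi} t * ennreal ((1 - (cmod z)\<^sup>2) * (cmod (g (z * cis t)))\<^sup>2) \<partial>lborel)"
      using z1 by (intro nn_integral_cong) (simp add: h_def norm_mult mult.commute)
    also have "\<dots> = ennreal (integral\<^sup>L TT (\<lambda>t. (1 - (cmod z)\<^sup>2) * (cmod (g (z * cis t)))\<^sup>2))"
      by (rule nn_integral_circle) (use ct w0 in \<open>auto intro!: continuous_intros\<close>)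
    also have "integral\<^sup>L TT (\<lambda>t. (1 - (cmod z)\<^sup>2) * (cmod (g (z * cis t)))\<^sup>2) = (1 - (cmod z)\<^sup>2) * nrm2 (\<lambda>t. g (z * cis t))"
      by (simp add: nrm2_def)
    also have "\<dots> = (1 - (cmod z)\<^sup>2) * (2 * pi) * (\<Sum>n. (cmod (tc g n))\<^sup>2 * cmod z ^ (2 * n))"
      using parseval_circle[OF hol z1] by (simp add: sums_iff)
    also have "ennreal \<dots> = ennreal ((1 - (cmod z)\<^sup>2) * (2 * pi)) * (\<Sum>n. ennreal ((cmod (tc g n))\<^sup>2 * cmod z ^ (2 * n)))"
    proof -
      have sm: "summable (\<lambda>n. (cmod (tc g n))\<^sup>2 * cmod z ^ (2 * n))" using parseval_circle[OF hol z1] by (simp add: sums_iff)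
      show ?thesis by (subst suminf_ennreal2[OF _ sm], simp, rule ennreal_mult') (use w0 in simp)
    qed
    also have "\<dots> = ennreal (2 * pi) * (ennreal (1 - (cmod z)\<^sup>2) * (\<Sum>n. ennreal ((cmod (tc g n))\<^sup>2 * cmod z ^ (2 * n))))"
      by (subst mult.commute[of "1 - (cmod z)\<^sup>2"], subst ennreal_mult') (simp_all only: mult.assoc, simp)
    also have "\<dots> = ennreal (2 * pi) * (\<Sum>n. ennreal (1 - (cmod z)\<^sup>2) * ennreal ((cmod (tc g n))\<^sup>2 * cmod z ^ (2 * n)))"
      by simp
    also have "\<dots> = ennreal (2 * pi) * (\<Sum>n. ennreal ((cmod (tc g n))\<^sup>2) * (indicator (ball 0 1) z * ennreal ((1 - (cmod z)\<^sup>2) * cmod z ^ (2 * n))))"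
      using True w0 by (simp add: ennreal_mult mult_ac)
    finally show ?thesis .
  next
    case False
    then show ?thesis by (simp add: h_def norm_mult)
  qed
  \<comment> \<open>The angles excluded in \<open>nn_integral_rotate\<close> are countably many, so
    they do not affect the average.\<close>
  have null: "AE t in lborel. t \<in> {0..2*pi} \<longrightarrow> cos t \<noteq> 0"
  proof -
    have "{t. cos t = 0} \<subseteq> range (\<lambda>i::int. real_of_int i * (pi / 2))" by (auto simp: cos_zero_iff_int)
    then have "countable {t :: real. cos t = 0}" by (rule countable_subset) simp
    then have "AE t in lborel. t \<notin> {t :: real. cos t = 0}"
      by (intro AE_not_in countable_imp_null_set_lborel)
    then show ?thesis by eventually_elim auto
  qed
  have tp: "ennreal (2 * pi) \<noteq> top" "ennreal (2 * pi) \<noteq> 0"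
    using pi_gt_zero unfolding ennreal_eq_0_iff by (simp, linarith)
  have "ennreal (2 * pi) * I = (\<integral>\<^sup>+ t. indicator {0..2*pi} t * I \<partial>(lborel :: real measure))"
    by (subst nn_integral_multc) auto
  also have "\<dots> = (\<integral>\<^sup>+ t. (\<integral>\<^sup>+ z. indicator {0..2*pi} t * h (cis t * z) \<partial>lborel) \<partial>lborel)"
  proof (rule nn_integral_cong_AE)
    show "AE t in lborel. indicator {0..2*pi} t * I = (\<integral>\<^sup>+ z. indicator {0..2*pi} t * h (cis t * z) \<partial>lborel)"
      using null
    proof eventually_elim
      case (elim t)
      have m: "(\<lambda>z. h (cis t * z)) \<in> borel_measurable lborel"
      proof -
        have "(\<lambda>z. cis t * z) \<in> borel_measurable borel"
          by (rule borel_measurable_continuous_onI) (intro continuous_intros)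
        from measurable_compose[OF this hm] show ?thesis by simp
      qed
      have "(\<integral>\<^sup>+ z. indicator {0..2*pi} t * h (cis t * z) \<partial>lborel) = indicator {0..2*pi} t * (\<integral>\<^sup>+ z. h (cis t * z) \<partial>lborel)"
        by (rule nn_integral_cmult[OF m])
      then show ?case using elim nn_integral_rotate[OF hm, of t] by (auto simp: I_def indicator_def)
    qed
  qed
  also have "\<dots> = (\<integral>\<^sup>+ z. (\<integral>\<^sup>+ t. indicator {0..2*pi} t * h (cis t * z) \<partial>lborel) \<partial>lborel)"
  proof (rule lborel_pair.Fubini')
    have "(\<lambda>p. h (cis (snd p) * fst p)) \<in> borel_measurable (borel :: (complex \<times> real) measure)"
      by (rule measurable_compose[OF _ hm]) (rule borel_measurable_continuous_onI, intro continuous_intros)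
    moreover have "(\<lambda>p. indicator {0..2*pi} (snd p) :: ennreal) \<in> borel_measurable (borel :: (complex \<times> real) measure)"
      by (rule measurable_compose[of snd _ borel]) (auto intro!: borel_measurable_continuous_onI continuous_intros)
    ultimately have "(\<lambda>p. indicator {0..2*pi} (snd p) * h (cis (snd p) * fst p)) \<in> borel_measurable (borel :: (complex \<times> real) measure)"
      by measurable
    then show "(\<lambda>(z, t). indicator {0..2*pi} t * h (cis t * z)) \<in> borel_measurable (lborel \<Otimes>\<^sub>M lborel)"
      by (simp add: lborel_prod case_prod_unfold)
  qed
  also have "\<dots> = ennreal (2 * pi) * (\<integral>\<^sup>+ z. (\<Sum>n. ennreal ((cmod (tc g n))\<^sup>2) * (indicator (ball 0 1) z * ennreal ((1 - (cmod z)\<^sup>2) * cmod z ^ (2 * n)))) \<partial>lborel)"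
    unfolding circ by (rule nn_integral_cmult) measurable
  also have "(\<integral>\<^sup>+ z. (\<Sum>n. ennreal ((cmod (tc g n))\<^sup>2) * (indicator (ball 0 1) z * ennreal ((1 - (cmod z)\<^sup>2) * cmod z ^ (2 * n)))) \<partial>lborel) =
      (\<Sum>n. (\<integral>\<^sup>+ z. ennreal ((cmod (tc g n))\<^sup>2) * (indicator (ball 0 1) z * ennreal ((1 - (cmod z)\<^sup>2) * cmod z ^ (2 * n))) \<partial>lborel))"
    by (rule nn_integral_suminf) measurable
  also have "\<dots> = (\<Sum>n. ennreal ((cmod (tc g n))\<^sup>2 * (pi / ((real n + 1) * (real n + 2)))))"
  proof (rule suminf_cong)
    fix n
    have "(\<integral>\<^sup>+ z. ennreal ((cmod (tc g n))\<^sup>2) * (indicator (ball 0 1) z * ennreal ((1 - (cmod z)\<^sup>2) * cmod z ^ (2 * n))) \<partial>lborel) =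
       ennreal ((cmod (tc g n))\<^sup>2) * ennreal (pi / ((real n + 1) * (real n + 2)))"
      unfolding area_weight[symmetric] by (rule nn_integral_cmult) measurable
    then show "(\<integral>\<^sup>+ z. ennreal ((cmod (tc g n))\<^sup>2) * (indicator (ball 0 1) z * ennreal ((1 - (cmod z)\<^sup>2) * cmod z ^ (2 * n))) \<partial>lborel) =
       ennreal ((cmod (tc g n))\<^sup>2 * (pi / ((real n + 1) * (real n + 2))))" by (simp add: ennreal_mult'[symmetric])
  qed
  finally have "ennreal (2 * pi) * I = ennreal (2 * pi) * (\<Sum>n. ennreal ((cmod (tc g n))\<^sup>2 * (pi / ((real n + 1) * (real n + 2)))))" .
  then have "I = (\<Sum>n. ennreal ((cmod (tc g n))\<^sup>2 * (pi / ((real n + 1) * (real n + 2)))))"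
    unfolding ennreal_mult_cancel_left using tp by blast
  then show ?thesis by (simp add: I_def h_def)
qed

section \<open>Hardy space and local Dirichlet integrals\<close>

lemma tc_unique:
  assumes "\<And>z. cmod z < 1 \<Longrightarrow> (\<lambda>n. a n * z ^ n) sums f z" shows "tc f n = a n"
proof -
  have "eventually (\<lambda>u. u \<in> ball 0 1) (nhds (0::complex))" by (rule eventually_nhds_in_open) auto
  then have "eventually (\<lambda>u. (\<lambda>n. fps_nth (Abs_fps a) n * u ^ n) sums f u) (nhds 0)"
    by (rule eventually_mono) (use assms in simp)
  then have "f has_fps_expansion Abs_fps a" by (rule has_fps_expansionI)
  then have "fps_nth (Abs_fps a) n = (deriv ^^ n) f 0 / fact n" by (rule fps_nth_fps_expansion)
  then show ?thesis by (simp add: tc_def)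
qed

lemma tc_deriv: "tc (deriv f) n = of_nat (Suc n) * tc f (Suc n)"
  by (simp add: tc_def funpow_swap1 field_simps del: of_nat_Suc)

lemma sums_mult_id:
  fixes a :: "nat \<Rightarrow> complex"
  assumes "(\<lambda>n. a n * z ^ n) sums s"
  shows "(\<lambda>n. (case n of 0 \<Rightarrow> 0 | Suc m \<Rightarrow> a m) * z ^ n) sums (z * s)"
proof -
  have "(\<lambda>n. z * (a n * z ^ n)) sums (z * s)" by (rule sums_mult[OF assms])
  then have "(\<lambda>n. (case Suc n of 0 \<Rightarrow> 0 | Suc m \<Rightarrow> a m) * z ^ Suc n) sums (z * s)" by (simp add: mult_ac)
  from sums_Suc[OF this] show ?thesis by simp
qed

lemma integral_eq_nrm2:
  assumes hol: "f holomorphic_on ball 0 1" and r: "0 \<le> r" "r < 1"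
  shows "integral {0..2*pi} (\<lambda>t. (cmod (f (complex_of_real r * cis t)))\<^sup>2) = nrm2 (\<lambda>t. f (complex_of_real r * cis t))"
proof -
  have "continuous_on UNIV (\<lambda>t. f (complex_of_real r * cis t))"
    by (rule continuous_on_compose2[OF holomorphic_on_imp_continuous_on[OF hol]]) (use r in \<open>auto intro!: continuous_intros simp: norm_mult\<close>)
  then have "continuous_on UNIV (\<lambda>t. (cmod (f (complex_of_real r * cis t)))\<^sup>2)" by (intro continuous_intros)
  from integral_TT[OF this] show ?thesis by (simp add: nrm2_def)
qed

text \<open>By Parseval's formula the circular means are power series in the squared radius with
  nonnegative coefficients. A bound uniform in the radius passes to finite partial sums as the
  radius tends to 1.\<close>

lemma H2_iff: "H2 f \<longleftrightarrow> f holomorphic_on ball 0 1 \<and> summable (\<lambda>n. (cmod (tc f n))\<^sup>2)"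
proof
  assume H: "H2 f"
  then have hol: "f holomorphic_on ball 0 1" by (simp add: H2_def)
  obtain M where M: "\<And>r. 0 \<le> r \<Longrightarrow> r < 1 \<Longrightarrow> integral {0..2*pi} (\<lambda>t. (cmod (f (complex_of_real r * cis t)))\<^sup>2) \<le> M"
    using H unfolding H2_def by auto
  have nr: "nrm2 (\<lambda>t. f (complex_of_real r * cis t)) \<le> M" if "0 \<le> r" "r < 1" for r
  proof -
    show ?thesis using M[OF that] integral_eq_nrm2[OF hol that] by simp
  qed
  have "(\<Sum>n<N. (cmod (tc f n))\<^sup>2) \<le> M / (2 * pi)" for N
  proof -
    have "(\<lambda>k. \<Sum>n<N. (cmod (tc f n))\<^sup>2 * rad k ^ (2 * n)) \<longlonglongrightarrow> (\<Sum>n<N. (cmod (tc f n))\<^sup>2 * 1 ^ (2 * n))"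
      unfolding rad_def by (intro tendsto_intros) real_asymp
    moreover have "(\<Sum>n<N. (cmod (tc f n))\<^sup>2 * rad k ^ (2 * n)) \<le> M / (2 * pi)" for k
    proof -
      have p: "(\<lambda>n. (cmod (tc f n))\<^sup>2 * rad k ^ (2 * n)) sums (nrm2 (\<lambda>t. f (complex_of_real (rad k) * cis t)) / (2 * pi))"
        by (rule parseval_radius[OF hol rad])
      have "(\<Sum>n<N. (cmod (tc f n))\<^sup>2 * rad k ^ (2 * n)) \<le> nrm2 (\<lambda>t. f (complex_of_real (rad k) * cis t)) / (2 * pi)"
        using sum_le_suminf[OF sums_summable[OF p], of "{..<N}"] sums_unique[OF p] rad[of k] by simp
      also have "\<dots> \<le> M / (2 * pi)" using nr[OF rad] by (simp add: divide_right_mono)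
      finally show ?thesis .
    qed
    ultimately show ?thesis by (intro LIMSEQ_le_const2) auto
  qed
  then have "summable (\<lambda>n. (cmod (tc f n))\<^sup>2)" by (intro summableI_nonneg_bounded) auto
  with hol show "f holomorphic_on ball 0 1 \<and> summable (\<lambda>n. (cmod (tc f n))\<^sup>2)" by blast
next
  assume "f holomorphic_on ball 0 1 \<and> summable (\<lambda>n. (cmod (tc f n))\<^sup>2)"
  then have hol: "f holomorphic_on ball 0 1" and sm: "summable (\<lambda>n. (cmod (tc f n))\<^sup>2)" by auto
  have "integral {0..2*pi} (\<lambda>t. (cmod (f (complex_of_real r * cis t)))\<^sup>2) \<le> 2 * pi * (\<Sum>n. (cmod (tc f n))\<^sup>2)"
    if r: "0 \<le> r" "r < 1" for r
  proof -
    have "integral {0..2*pi} (\<lambda>t. (cmod (f (complex_of_real r * cis t)))\<^sup>2) = nrm2 (\<lambda>t. f (complex_of_real r * cis t))"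
      by (rule integral_eq_nrm2[OF hol r])
    moreover have "nrm2 (\<lambda>t. f (complex_of_real r * cis t)) / (2 * pi) \<le> (\<Sum>n. (cmod (tc f n))\<^sup>2)"
    proof (rule sums_le[OF _ parseval_radius[OF hol r] summable_sums[OF sm]])
      show "(cmod (tc f n))\<^sup>2 * r ^ (2 * n) \<le> (cmod (tc f n))\<^sup>2" for n
        using r by (intro mult_left_le) (auto intro: power_le_one)
    qed
    ultimately show ?thesis by (simp add: pos_divide_le_eq mult.commute)
  qed
  then show "H2 f" unfolding H2_def using hol by blast
qed

lemma H2_hol: "H2 f \<Longrightarrow> f holomorphic_on ball 0 1" by (simp add: H2_iff)

lemma H2_nrm2: "H2 f \<longleftrightarrow> f holomorphic_on ball 0 1 \<and> (\<exists>M. \<forall>r. 0 \<le> r \<and> r < 1 \<longrightarrow> nrm2 (\<lambda>t. f (complex_of_real r * cis t)) \<le> M)"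
proof (cases "f holomorphic_on ball 0 1")
  case True
  show ?thesis unfolding H2_def by (simp add: integral_eq_nrm2[OF True] cong: imp_cong conj_cong)
qed (simp add: H2_def)

lemma H2_mult_bounded:
  assumes f: "H2 f" and u: "u holomorphic_on ball 0 1" and B: "\<And>z. z \<in> ball 0 1 \<Longrightarrow> cmod (u z) \<le> B"
  shows "H2 (\<lambda>z. u z * f z)"
proof -
  obtain M where M: "\<And>r. 0 \<le> r \<Longrightarrow> r < 1 \<Longrightarrow> nrm2 (\<lambda>t. f (complex_of_real r * cis t)) \<le> M"
    using f unfolding H2_nrm2 by auto
  have hf: "f holomorphic_on ball 0 1" using f by (rule H2_hol)
  have huf: "(\<lambda>z. u z * f z) holomorphic_on ball 0 1" by (intro holomorphic_on_mult u hf)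
  have "nrm2 (\<lambda>t. u (complex_of_real r * cis t) * f (complex_of_real r * cis t)) \<le> B\<^sup>2 * M" if r: "0 \<le> r" "r < 1" for r
  proof -
    have "nrm2 (\<lambda>t. u (complex_of_real r * cis t) * f (complex_of_real r * cis t)) \<le> B\<^sup>2 * nrm2 (\<lambda>t. f (complex_of_real r * cis t))"
    proof (rule nrm2_mono)
      show "bmf (\<lambda>t. u (complex_of_real r * cis t) * f (complex_of_real r * cis t))" by (rule bmf_radius_factor[OF r huf])
      show "bmf (\<lambda>t. f (complex_of_real r * cis t))" by (rule bmf_radius_factor[OF r hf])
      show "AE t in TT. cmod (u (complex_of_real r * cis t) * f (complex_of_real r * cis t)) \<le> B * cmod (f (complex_of_real r * cis t))"
        unfolding norm_mult using r by (intro AE_I2 mult_right_mono B) (auto simp: norm_mult)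
    qed
    also have "\<dots> \<le> B\<^sup>2 * M" using M[OF r] by (intro mult_left_mono) auto
    finally show ?thesis .
  qed
  then show ?thesis unfolding H2_nrm2 using huf by blast
qed

lemma H2_add:
  assumes f: "H2 f" and g: "H2 g" shows "H2 (\<lambda>z. f z + g z)"
proof -
  obtain M where M: "\<And>r. 0 \<le> r \<Longrightarrow> r < 1 \<Longrightarrow> nrm2 (\<lambda>t. f (complex_of_real r * cis t)) \<le> M"
    using f unfolding H2_nrm2 by auto
  obtain N where N: "\<And>r. 0 \<le> r \<Longrightarrow> r < 1 \<Longrightarrow> nrm2 (\<lambda>t. g (complex_of_real r * cis t)) \<le> N"
    using g unfolding H2_nrm2 by auto
  have hf: "f holomorphic_on ball 0 1" and hg: "g holomorphic_on ball 0 1" using f g by (auto intro: H2_hol)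
  have "nrm2 (\<lambda>t. f (complex_of_real r * cis t) + g (complex_of_real r * cis t)) \<le> 2 * M + 2 * N" if r: "0 \<le> r" "r < 1" for r
  proof -
    note bf = bmf_radius_factor[OF r hf] and bg = bmf_radius_factor[OF r hg]
    have i1: "integrable TT (\<lambda>t. (cmod (f (complex_of_real r * cis t)))\<^sup>2)" by (rule bmf_integrable[OF bmf_power2[OF bmf_norm[OF bf]]])
    have i2: "integrable TT (\<lambda>t. (cmod (g (complex_of_real r * cis t)))\<^sup>2)" by (rule bmf_integrable[OF bmf_power2[OF bmf_norm[OF bg]]])
    have i3: "integrable TT (\<lambda>t. (cmod (f (complex_of_real r * cis t) + g (complex_of_real r * cis t)))\<^sup>2)"
      by (rule bmf_integrable[OF bmf_power2[OF bmf_norm[OF bmf_add[OF bf bg]]]])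
    have "nrm2 (\<lambda>t. f (complex_of_real r * cis t) + g (complex_of_real r * cis t)) \<le>
       integral\<^sup>L TT (\<lambda>t. 2 * (cmod (f (complex_of_real r * cis t)))\<^sup>2 + 2 * (cmod (g (complex_of_real r * cis t)))\<^sup>2)"
      unfolding nrm2_def
    proof (rule integral_mono)
      fix t
      show "(cmod (f (complex_of_real r * cis t) + g (complex_of_real r * cis t)))\<^sup>2 \<le> 2 * (cmod (f (complex_of_real r * cis t)))\<^sup>2 + 2 * (cmod (g (complex_of_real r * cis t)))\<^sup>2"
      proof -
        have "(cmod (x + y))\<^sup>2 \<le> 2 * (cmod x)\<^sup>2 + 2 * (cmod y)\<^sup>2" for x y
        proof -
          have "(cmod (x + y))\<^sup>2 \<le> (cmod x + cmod y)\<^sup>2" by (intro power_mono norm_triangle_ineq) auto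
          also have "\<dots> \<le> 2 * (cmod x)\<^sup>2 + 2 * (cmod y)\<^sup>2"
            using zero_le_power2[of "cmod x - cmod y"] by (simp add: power2_eq_square algebra_simps)
          finally show ?thesis .
        qed
        then show ?thesis .
      qed
    qed (simp_all only: i1 i2 i3 Bochner_Integration.integrable_add integrable_mult_right)
    also have "\<dots> = 2 * nrm2 (\<lambda>t. f (complex_of_real r * cis t)) + 2 * nrm2 (\<lambda>t. g (complex_of_real r * cis t))"
      unfolding nrm2_def by (simp only: Bochner_Integration.integral_add integrable_mult_right integral_mult_right_zero i1 i2)
    also have "\<dots> \<le> 2 * M + 2 * N" using M[OF r] N[OF r] by simp
    finally show ?thesis .
  qed
  then show ?thesis unfolding H2_nrm2
    by (intro conjI holomorphic_on_add hf hg exI[of _ "2 * M + 2 * N"]) simp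
qed

lemma bounded_on_disc_entire:
  assumes "q holomorphic_on UNIV" shows "\<exists>B. \<forall>z\<in>ball 0 1. cmod (q z) \<le> B"
proof -
  have "compact (q ` cball 0 1)"
    by (rule compact_continuous_image[OF continuous_on_subset[OF holomorphic_on_imp_continuous_on[OF assms]]]) auto
  then have "bounded (q ` cball 0 1)" by (rule compact_imp_bounded)
  then obtain B where "\<forall>x\<in>q ` cball 0 1. cmod x \<le> B" unfolding bounded_iff by blast
  then show ?thesis by (intro exI[of _ B]) auto
qed

lemma H2_mult_entire:
  assumes "H2 f" "q holomorphic_on UNIV" shows "H2 (\<lambda>z. q z * f z)"
proof -
  obtain B where "\<forall>z\<in>ball 0 1. cmod (q z) \<le> B" using bounded_on_disc_entire[OF assms(2)] by blast
  then show ?thesis using assms by (intro H2_mult_bounded[where B = B] holomorphic_on_subset[OF assms(2)]) auto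
qed

lemma H2_const: "H2 (\<lambda>z. c)"
  unfolding H2_nrm2 by (auto intro!: exI[of _ "2 * pi * (cmod c)\<^sup>2"] simp: nrm2_def integral_TT_const simp del: lebesgue_integral_const)

lemma H2_entire: "q holomorphic_on UNIV \<Longrightarrow> H2 q"
  using H2_mult_entire[OF H2_const[of 1], of q] by simp

lemma H2_series:
  fixes a :: "nat \<Rightarrow> complex"
  assumes sm: "summable (\<lambda>n. (cmod (a n))\<^sup>2)"
  shows "\<exists>G. H2 G \<and> (\<forall>z. cmod z < 1 \<longrightarrow> (\<lambda>n. a n * z ^ n) sums G z)"
proof -
  define G where "G = (\<lambda>z. \<Sum>n. a n * z ^ n)"
  have "(\<lambda>n. (cmod (a n))\<^sup>2) \<longlonglongrightarrow> 0" by (rule summable_LIMSEQ_zero[OF sm])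
  then have "Bseq (\<lambda>n. (cmod (a n))\<^sup>2)" by (intro convergent_imp_Bseq convergentI)
  then obtain K where K: "K > 0" "\<And>n. norm ((cmod (a n))\<^sup>2) \<le> K" by (auto simp: Bseq_def)
  have aK: "cmod (a n) \<le> K + 1" for n
  proof (rule ccontr)
    assume "\<not> cmod (a n) \<le> K + 1"
    then have h: "K + 1 < cmod (a n)" by simp
    then have "1 * (K + 1) \<le> cmod (a n) * cmod (a n)" using K(1) by (intro mult_mono) auto
    then show False using K(2)[of n] by (simp add: power2_eq_square)
  qed
  have sums: "(\<lambda>n. a n * z ^ n) sums G z" if z: "cmod z < 1" for z
  proof -
    have "summable (\<lambda>n. (K + 1) * cmod z ^ n)" using z by (intro summable_mult summable_geometric) auto
    then have "summable (\<lambda>n. a n * z ^ n)"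
      by (rule summable_comparison_test') (use aK in \<open>auto simp: norm_mult norm_power intro!: mult_right_mono\<close>)
    then show ?thesis unfolding G_def by (rule summable_sums)
  qed
  have hol: "G holomorphic_on ball 0 1"
    by (rule power_series_holomorphic[where a = a]) (use sums in auto)
  have "tc G n = a n" for n by (rule tc_unique[OF sums])
  then have "H2 G" using hol sm by (simp add: H2_iff)
  then show ?thesis using sums by blast
qed

section \<open>The variance of a sequence of complex numbers\<close>

lemma divide_le_cross: "0 < b \<Longrightarrow> 0 < d \<Longrightarrow> a * d \<le> c * b \<Longrightarrow> a / b \<le> c / d" for a b c d :: real
  by (simp add: divide_simps mult.commute)

lemma divide_split_Suc: "0 < x \<Longrightarrow> a / x = a / (x + 1) + a / (x * (x + 1))" for x a :: real
proof -
  assume "0 < x"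
  then have "a / (x + 1) + a / (x * (x + 1)) = (a * x + a) / (x * (x + 1))" by (simp add: add_divide_distrib)
  also have "\<dots> = (a * (x + 1)) / (x * (x + 1))" by (simp add: distrib_left)
  also have "\<dots> = a / x" using \<open>0 < x\<close> by (intro nonzero_mult_divide_mult_cancel_right) simp
  finally show ?thesis ..
qed

text \<open>With \<open>E J\<close> the sum of \<open>|F k - F J|\<^sup>2\<close> over \<open>k < J\<close>, partial summation expresses \<open>E J\<close> through
  the sums of \<open>|T j|\<^sup>2 / (j (j + 1))\<close>; the boundary term is small along a subsequence.\<close>
lemma variance_identity:
  fixes F :: "nat \<Rightarrow> complex"
  defines "T \<equiv> \<lambda>j. \<Sum>k<j. F k - F j"
  shows "(\<Sum>k<Suc J. (cmod (F k - F (Suc J)))\<^sup>2) = (cmod (T (Suc J)))\<^sup>2 / real (Suc J) + (\<Sum>j<J. (cmod (T (Suc j)))\<^sup>2 / (real (Suc j) * real (Suc (Suc j))))"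
proof (induction J)
  case 0
  show ?case by (simp add: T_def)
next
  case (Suc J)
  define n where "n = Suc J"
  define d where "d = F n - F (Suc n)"
  have T1: "T (Suc n) = T n + of_nat (Suc n) * d"
  proof -
    have "T (Suc n) = (\<Sum>k<n. (F k - F n) + d) + d" by (simp add: T_def d_def)
    also have "\<dots> = T n + of_nat n * d + d" by (simp add: sum.distrib T_def)
    finally show ?thesis by (simp add: algebra_simps)
  qed
  have sq: "(cmod (x + y))\<^sup>2 = (cmod x)\<^sup>2 + 2 * (x \<bullet> y) + (cmod y)\<^sup>2" for x y :: complex
    by (simp add: power2_norm_eq_inner inner_add_left inner_add_right inner_commute)
  have "(\<Sum>k<Suc n. (cmod (F k - F (Suc n)))\<^sup>2) = (\<Sum>k<n. (cmod ((F k - F n) + d))\<^sup>2) + (cmod d)\<^sup>2"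
    by (simp add: d_def)
  also have "(\<Sum>k<n. (cmod ((F k - F n) + d))\<^sup>2) = (\<Sum>k<n. (cmod (F k - F n))\<^sup>2) + 2 * (T n \<bullet> d) + n * (cmod d)\<^sup>2"
    unfolding sq by (simp add: sum.distrib T_def inner_sum_left sum_distrib_left)
  finally have 1: "(\<Sum>k<Suc n. (cmod (F k - F (Suc n)))\<^sup>2) = (\<Sum>k<n. (cmod (F k - F n))\<^sup>2) + 2 * (T n \<bullet> d) + real (Suc n) * (cmod d)\<^sup>2"
    by (simp add: algebra_simps)
  have 2: "(cmod (T (Suc n)))\<^sup>2 = (cmod (T n))\<^sup>2 + real (Suc n) * (2 * (T n \<bullet> d) + real (Suc n) * (cmod d)\<^sup>2)"
  proof -
    have "(cmod (T (Suc n)))\<^sup>2 = (cmod (T n))\<^sup>2 + 2 * (T n \<bullet> (of_nat (Suc n) * d)) + (cmod (of_nat (Suc n) * d))\<^sup>2"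
      unfolding T1 sq ..
    also have "T n \<bullet> (of_nat (Suc n) * d) = real (Suc n) * (T n \<bullet> d)"
    proof -
      have "of_nat (Suc n) * d = real (Suc n) *\<^sub>R d" by (simp add: scaleR_conv_of_real)
      then show ?thesis by (simp only: inner_scaleR_right)
    qed
    also have "(cmod (of_nat (Suc n) * d))\<^sup>2 = real (Suc n) * (real (Suc n) * (cmod d)\<^sup>2)"
      by (simp add: norm_mult power_mult_distrib power2_eq_square del: of_nat_Suc)
    finally show ?thesis by (simp add: algebra_simps del: of_nat_Suc)
  qed
  have n0: "real n > 0" by (simp add: n_def)
  have "(cmod (T (Suc n)))\<^sup>2 / real (Suc n) = (cmod (T n))\<^sup>2 / real (Suc n) + (2 * (T n \<bullet> d) + real (Suc n) * (cmod d)\<^sup>2)"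
    unfolding 2 by (simp add: add_divide_distrib del: of_nat_Suc)
  moreover have "(cmod (T n))\<^sup>2 / real n = (cmod (T n))\<^sup>2 / real (Suc n) + (cmod (T n))\<^sup>2 / (real n * real (Suc n))"
    using divide_split_Suc[OF n0, of "(cmod (T n))\<^sup>2"] by (simp add: add.commute)
  ultimately show ?case using Suc 1 by (simp add: n_def del: of_nat_Suc)
qed

text \<open>Otherwise the series would dominate the harmonic series from \<open>N\<close>
  on.\<close>

lemma frequently_le_inverse:
  fixes x :: "nat \<Rightarrow> real"
  assumes sm: "summable (\<lambda>n. x n / (real n + 1))" shows "\<exists>n\<ge>N. x n \<le> 1"
proof (rule ccontr)
  assume "\<not> (\<exists>n\<ge>N. x n \<le> 1)"
  then have h: "\<And>n. n \<ge> N \<Longrightarrow> 1 < x n" by (meson not_le)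
  have "summable (\<lambda>n. 1 / (real n + 1))"
  proof (rule summable_comparison_test'[OF sm, of N])
    fix n assume "n \<ge> N"
    then have "1 \<le> x n" using h by (intro less_imp_le)
    then show "norm (1 / (real n + 1)) \<le> x n / (real n + 1)" by (simp add: divide_right_mono)
  qed
  then have "summable (\<lambda>n. 1 / real (Suc n))" by (simp add: add.commute)
  then have "summable (\<lambda>n. 1 / real n)" using summable_Suc_iff[of "\<lambda>n. 1 / real n"] by blast
  then have "summable (\<lambda>n. inverse (real n))" by (simp only: inverse_eq_divide)
  then show False using not_summable_harmonic[where 'a = real] by blast
qed

text \<open>If the weighted sums converge, the boundary term of \<open>variance_identity\<close> is
  at most 1 infinitely often. Along such indices the left side is bounded, hence so are the values
  of \<open>F\<close>, and one of their limit points serves as \<open>L\<close>. Conversely,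
  replacing \<open>F (Suc n)\<close> by \<open>L\<close> in the variance costs twice
  \<open>Suc n * (cmod (F (Suc n) - L))\<^sup>2\<close>, and this quantity without the factor 2 is
  again at most 1 infinitely often.\<close>

lemma variance_criterion:
  fixes F :: "nat \<Rightarrow> complex"
  defines "T \<equiv> \<lambda>j. \<Sum>k<j. F k - F j"
  shows "summable (\<lambda>j. (cmod (T (Suc j)))\<^sup>2 / (real (Suc j) * real (Suc (Suc j)))) \<longleftrightarrow> (\<exists>L. summable (\<lambda>n. (cmod (F n - L))\<^sup>2))"
proof
  define S where "S = (\<lambda>j. (cmod (T (Suc j)))\<^sup>2 / (real (Suc j) * real (Suc (Suc j))))"
  have id: "(\<Sum>k<Suc J. (cmod (F k - F (Suc J)))\<^sup>2) = (cmod (T (Suc J)))\<^sup>2 / real (Suc J) + (\<Sum>j<J. S j)" for J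
    using variance_identity[of F J] by (simp only: T_def S_def)
  assume sm: "summable (\<lambda>j. (cmod (T (Suc j)))\<^sup>2 / (real (Suc j) * real (Suc (Suc j))))"
  then have smS: "summable S" by (simp add: S_def)
  have "summable (\<lambda>n. ((cmod (T (Suc n)))\<^sup>2 / real (Suc n)) / (real n + 1))"
  proof (rule summable_comparison_test'[of "\<lambda>n. 2 * S n" 0])
    show "summable (\<lambda>n. 2 * S n)" using smS by (rule summable_mult)
    fix n :: nat
    have "(cmod (T (Suc n)))\<^sup>2 / (real (Suc n) * (real n + 1)) \<le> 2 * ((cmod (T (Suc n)))\<^sup>2 / (real (Suc n) * real (Suc (Suc n))))"
    proof -
      have "(cmod (T (Suc n)))\<^sup>2 * (1 / (real (Suc n) * (real n + 1))) \<le> (cmod (T (Suc n)))\<^sup>2 * (2 / (real (Suc n) * real (Suc (Suc n))))"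
      proof (rule mult_left_mono)
        have "real (Suc n) * real (Suc (Suc n)) \<le> 2 * (real (Suc n) * (real n + 1))"
          by (simp add: algebra_simps)
        then show "1 / (real (Suc n) * (real n + 1)) \<le> 2 / (real (Suc n) * real (Suc (Suc n)))"
          by (intro divide_le_cross) auto
      qed simp
      then show ?thesis by (simp only: times_divide_eq_right mult.commute[of _ 2] mult_1_right)
    qed
    then show "norm ((cmod (T (Suc n)))\<^sup>2 / real (Suc n) / (real n + 1)) \<le> 2 * S n" by (simp add: S_def)
  qed
  note fr = frequently_le_inverse[OF this]
  define B where "B = 1 + suminf S"
  have sumS: "(\<Sum>j<J. S j) \<le> suminf S" for J
    by (rule sum_le_suminf[OF smS]) (auto simp: S_def)
  have EB: "(\<Sum>k<Suc J. (cmod (F k - F (Suc J)))\<^sup>2) \<le> B" if "(cmod (T (Suc J)))\<^sup>2 / real (Suc J) \<le> 1" for J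
    unfolding id B_def using that sumS[of J] by linarith
  have "\<forall>N. \<exists>n. N \<le> n \<and> (cmod (T (Suc n)))\<^sup>2 / real (Suc n) \<le> 1" using fr by blast
  from choice[OF this] obtain I where "\<forall>N. N \<le> I N \<and> (cmod (T (Suc (I N))))\<^sup>2 / real (Suc (I N)) \<le> 1" ..
  then have I: "N \<le> I N" "(cmod (T (Suc (I N))))\<^sup>2 / real (Suc (I N)) \<le> 1" for N by auto
  have B0: "0 \<le> B" using EB[OF I(2)[of 0]] by (meson order_trans sum_nonneg zero_le_power2)
  have bnd: "cmod (F (Suc (I N))) \<le> cmod (F 0) + (B + 1)" for N
  proof -
    have "(cmod (F 0 - F (Suc (I N))))\<^sup>2 \<le> (\<Sum>k<Suc (I N). (cmod (F k - F (Suc (I N))))\<^sup>2)"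
      by (rule member_le_sum) auto
    also have "\<dots> \<le> B" by (rule EB[OF I(2)])
    also have "\<dots> \<le> (B + 1)\<^sup>2"
    proof -
      have "(B + 1)\<^sup>2 = B\<^sup>2 + 2 * B + 1" by (simp add: power2_eq_square distrib_left distrib_right)
      then show ?thesis using B0 zero_le_power2[of B] by linarith
    qed
    finally have "cmod (F 0 - F (Suc (I N))) \<le> B + 1" by (rule power2_le_imp_le) (use B0 in simp)
    then show ?thesis using norm_triangle_ineq2[of "F (Suc (I N))" "F 0"] by (simp add: norm_minus_commute)
  qed
  have bdd: "bounded (range (\<lambda>N. F (Suc (I N))))"
    by (rule boundedI[where B = "cmod (F 0) + (B + 1)"]) (use bnd in auto)
  obtain L r where r: "strict_mono r" "((\<lambda>N. F (Suc (I N))) \<circ> r) \<longlonglongrightarrow> L"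
  proof -
    from bounded_imp_convergent_subsequence[OF bdd]
    have "\<exists>L r. strict_mono r \<and> ((\<lambda>N. F (Suc (I N))) \<circ> r) \<longlonglongrightarrow> L" by auto
    then show thesis using that by auto
  qed
  have "(\<Sum>k<K. (cmod (F k - L))\<^sup>2) \<le> B" for K
  proof -
    have lim: "(\<lambda>N. \<Sum>k<K. (cmod (F k - F (Suc (I (r N)))))\<^sup>2) \<longlonglongrightarrow> (\<Sum>k<K. (cmod (F k - L))\<^sup>2)"
      using r(2) by (intro tendsto_intros) (simp add: o_def)
    have le: "(\<Sum>k<K. (cmod (F k - F (Suc (I (r N)))))\<^sup>2) \<le> B" if "N \<ge> K" for N
    proof -
      have "K \<le> I (r N)" using that seq_suble[OF r(1), of N] I(1)[of "r N"] by linarith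
      then have "(\<Sum>k<K. (cmod (F k - F (Suc (I (r N)))))\<^sup>2) \<le> (\<Sum>k<Suc (I (r N)). (cmod (F k - F (Suc (I (r N)))))\<^sup>2)"
        by (intro sum_mono2) auto
      also have "\<dots> \<le> B" by (rule EB[OF I(2)])
      finally show ?thesis .
    qed
    show ?thesis by (rule LIMSEQ_le_const2[OF lim]) (intro exI[of _ K] allI impI le)
  qed
  then have "summable (\<lambda>n. (cmod (F n - L))\<^sup>2)" by (intro summableI_nonneg_bounded) auto
  then show "\<exists>L. summable (\<lambda>n. (cmod (F n - L))\<^sup>2)" by blast
next
  define S where "S = (\<lambda>j. (cmod (T (Suc j)))\<^sup>2 / (real (Suc j) * real (Suc (Suc j))))"
  have id: "(\<Sum>k<Suc J. (cmod (F k - F (Suc J)))\<^sup>2) = (cmod (T (Suc J)))\<^sup>2 / real (Suc J) + (\<Sum>j<J. S j)" for J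
    using variance_identity[of F J] by (simp only: T_def S_def)
  assume "\<exists>L. summable (\<lambda>n. (cmod (F n - L))\<^sup>2)"
  then obtain L where sm: "summable (\<lambda>n. (cmod (F n - L))\<^sup>2)" by blast
  define x where "x = (\<lambda>n. real (Suc n) * (cmod (F (Suc n) - L))\<^sup>2)"
  have "summable (\<lambda>n. x n / (real n + 1))"
  proof -
    have "(\<lambda>n. x n / (real n + 1)) = (\<lambda>n. (cmod (F (Suc n) - L))\<^sup>2)"
    proof
      fix n
      have e: "real n + 1 = real (Suc n)" by simp
      show "x n / (real n + 1) = (cmod (F (Suc n) - L))\<^sup>2"
        unfolding x_def e by (rule nonzero_mult_div_cancel_left) simp
    qed
    then show ?thesis using sm by (simp add: summable_Suc_iff[of "\<lambda>n. (cmod (F n - L))\<^sup>2"])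
  qed
  note fr = frequently_le_inverse[OF this]
  define B where "B = 2 * (\<Sum>n. (cmod (F n - L))\<^sup>2) + 2"
  have "(\<Sum>j<J. S j) \<le> B" for J
  proof -
    obtain n where n: "n \<ge> J" "x n \<le> 1" using fr[of J] by blast
    have "(\<Sum>j<J. S j) \<le> (\<Sum>j<n. S j)" using n(1) by (intro sum_mono2) (auto simp: S_def)
    also have "\<dots> \<le> (cmod (T (Suc n)))\<^sup>2 / real (Suc n) + (\<Sum>j<n. S j)" by simp
    also have "\<dots> = (\<Sum>k<Suc n. (cmod (F k - F (Suc n)))\<^sup>2)" by (rule id[symmetric])
    also have "\<dots> \<le> (\<Sum>k<Suc n. 2 * (cmod (F k - L))\<^sup>2 + 2 * (cmod (F (Suc n) - L))\<^sup>2)"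
    proof (rule sum_mono)
      fix k
      have "(cmod (x - y))\<^sup>2 \<le> 2 * (cmod x)\<^sup>2 + 2 * (cmod y)\<^sup>2" for x y
      proof -
        have "(cmod (x - y))\<^sup>2 \<le> (cmod x + cmod y)\<^sup>2" by (intro power_mono norm_triangle_ineq4) auto
        also have "\<dots> \<le> 2 * (cmod x)\<^sup>2 + 2 * (cmod y)\<^sup>2"
          using zero_le_power2[of "cmod x - cmod y"] by (simp add: power2_eq_square algebra_simps)
        finally show ?thesis .
      qed
      from this[of "F k - L" "F (Suc n) - L"]
      show "(cmod (F k - F (Suc n)))\<^sup>2 \<le> 2 * (cmod (F k - L))\<^sup>2 + 2 * (cmod (F (Suc n) - L))\<^sup>2" by simp
    qed
    also have "\<dots> = 2 * (\<Sum>k<Suc n. (cmod (F k - L))\<^sup>2) + 2 * x n"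
      by (simp only: sum.distrib sum_distrib_left[symmetric] sum_constant card_lessThan x_def)
    also have "\<dots> \<le> B" unfolding B_def using n(2) sum_le_suminf[OF sm, of "{..<Suc n}"] by (intro add_mono) auto
    finally show ?thesis .
  qed
  then have "summable S" by (intro summableI_nonneg_bounded) (auto simp: S_def)
  then show "summable (\<lambda>j. (cmod (T (Suc j)))\<^sup>2 / (real (Suc j) * real (Suc (Suc j))))" by (simp add: S_def)
qed

text \<open>Finiteness of the local Dirichlet integral at \<open>\<zeta>\<close>, the contribution
  of one point mass to \<open>in_Dmu\<close>.\<close>

definition dirfin :: "complex \<Rightarrow> (complex \<Rightarrow> complex) \<Rightarrow> bool" where
  "dirfin \<zeta> f \<longleftrightarrow> (\<integral>\<^sup>+ z. indicator (ball 0 1) z * ennreal ((cmod (deriv f z))\<^sup>2 * ((1 - (cmod z)\<^sup>2) / (cmod (\<zeta> - z))\<^sup>2)) \<partial>lborel) < \<infinity>"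

text \<open>If \<open>f z = c + (z - \<zeta>) * G z\<close> with \<open>cmod \<zeta> = 1\<close>, then \<open>\<zeta> ^ Suc n * tc G n = psum \<zeta> f n + \<zeta> * tc G 0\<close>.\<close>
definition psum :: "complex \<Rightarrow> (complex \<Rightarrow> complex) \<Rightarrow> nat \<Rightarrow> complex" where
  "psum \<zeta> f n = - (\<Sum>i<n. tc f (Suc i) * \<zeta> ^ Suc i)"

lemma tc_linear_factor:
  assumes g: "g holomorphic_on ball 0 1" and f: "\<And>z. z \<in> ball 0 1 \<Longrightarrow> f z = c + (a * z + b) * g z"
  shows "tc f 0 = c + b * tc g 0" "tc f (Suc n) = a * tc g n + b * tc g (Suc n)"
proof -
  have "(\<lambda>n. ((if n = 0 then c else 0) + a * (case n of 0 \<Rightarrow> 0 | Suc m \<Rightarrow> tc g m) + b * tc g n) * z ^ n) sums f z" if z: "cmod z < 1" for z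
  proof -
    have 1: "(\<lambda>n. (if n = 0 then c else 0) * z ^ n) sums c"
      using sums_If_finite_set[of "{0}" "\<lambda>n. c"] by (simp add: if_distrib[of "\<lambda>x. x * _"] cong: if_cong)
    have 2: "(\<lambda>n. a * ((case n of 0 \<Rightarrow> 0 | Suc m \<Rightarrow> tc g m) * z ^ n)) sums (a * (z * g z))"
      by (intro sums_mult sums_mult_id tc_sums[OF g z])
    have 3: "(\<lambda>n. b * (tc g n * z ^ n)) sums (b * g z)"
      by (intro sums_mult tc_sums[OF g z])
    have "(\<lambda>n. (if n = 0 then c else 0) * z ^ n + a * ((case n of 0 \<Rightarrow> 0 | Suc m \<Rightarrow> tc g m) * z ^ n) + b * (tc g n * z ^ n)) sums (c + a * (z * g z) + b * g z)"
      by (rule sums_add[OF sums_add[OF 1 2] 3])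
    moreover have "c + a * (z * g z) + b * g z = f z" using f[of z] z by (simp add: algebra_simps)
    ultimately show ?thesis by (simp add: algebra_simps)
  qed
  then have u: "tc f n = (if n = 0 then c else 0) + a * (case n of 0 \<Rightarrow> 0 | Suc m \<Rightarrow> tc g m) + b * tc g n" for n
    by (rule tc_unique)
  show "tc f 0 = c + b * tc g 0" "tc f (Suc n) = a * tc g n + b * tc g (Suc n)" by (simp_all add: u)
qed

text \<open>As \<open>cmod \<zeta> = 1\<close>, the weight can be absorbed into
  \<open>g z = deriv f z / (1 - cnj \<zeta> * z)\<close>. The coefficients of \<open>g\<close>,
  multiplied by powers of \<open>\<zeta>\<close>, are the sums \<open>T\<close> of
  \<open>variance_criterion\<close> for the sequence \<open>psum\<close>, and the area weights
  \<open>1 / ((n + 1) * (n + 2))\<close> are exactly the ones occurring there.\<close>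

lemma dirfin_iff_summable:
  assumes hol: "f holomorphic_on ball 0 1" and \<zeta>: "cmod \<zeta> = 1"
  shows "dirfin \<zeta> f \<longleftrightarrow> (\<exists>L. summable (\<lambda>n. (cmod (psum \<zeta> f n - L))\<^sup>2))"
proof -
  define g where "g = (\<lambda>z. deriv f z / (1 - cnj \<zeta> * z))"
  define T where "T = (\<lambda>j. \<Sum>k<j. psum \<zeta> f k - psum \<zeta> f j)"
  have zz: "cnj \<zeta> * \<zeta> = 1" "\<zeta> * cnj \<zeta> = 1" using \<zeta> complex_norm_square[of \<zeta>] by (simp_all add: mult.commute)
  have ne: "1 - cnj \<zeta> * z \<noteq> 0" if "z \<in> ball 0 1" for z
  proof
    assume "1 - cnj \<zeta> * z = 0"
    then have "cmod (cnj \<zeta> * z) = 1" by simp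
    then show False using \<zeta> that by (simp add: norm_mult)
  qed
  have hd: "deriv f holomorphic_on ball 0 1" by (rule holomorphic_deriv[OF hol open_ball])
  have hg: "g holomorphic_on ball 0 1" unfolding g_def using ne by (intro holomorphic_intros hd) auto
  have eq: "indicator (ball 0 1) z * ennreal ((cmod (deriv f z))\<^sup>2 * ((1 - (cmod z)\<^sup>2) / (cmod (\<zeta> - z))\<^sup>2)) =
     indicator (ball 0 1) z * ennreal ((1 - (cmod z)\<^sup>2) * (cmod (g z))\<^sup>2)" for z
  proof -
    have "\<zeta> - z = \<zeta> * (1 - cnj \<zeta> * z)" using zz by (simp add: right_diff_distrib mult.assoc[symmetric])
    then have "cmod (\<zeta> - z) = cmod (1 - cnj \<zeta> * z)" using \<zeta> by (simp only: norm_mult mult_1_left)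
    then show ?thesis by (simp add: g_def norm_divide power_divide mult.commute)
  qed
  have fg: "deriv f z = 0 + ((- cnj \<zeta>) * z + 1) * g z" if "z \<in> ball 0 1" for z
    using ne[OF that] by (simp add: g_def)
  note tl = tc_linear_factor[OF hg fg]
  have tcg: "tc g n * \<zeta> ^ Suc n = T (Suc n)" for n
  proof (induction n)
    case 0
    then show ?case using tl(1) by (simp add: tc_deriv T_def psum_def)
  next
    case (Suc n)
    have "tc g (Suc n) = of_nat (Suc (Suc n)) * tc f (Suc (Suc n)) + cnj \<zeta> * tc g n"
      using tl(2)[of n] by (simp add: tc_deriv algebra_simps del: of_nat_Suc)
    then have "tc g (Suc n) * \<zeta> ^ Suc (Suc n) = of_nat (Suc (Suc n)) * (tc f (Suc (Suc n)) * \<zeta> ^ Suc (Suc n)) + (cnj \<zeta> * \<zeta>) * (tc g n * \<zeta> ^ Suc n)"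
      by (simp add: algebra_simps del: of_nat_Suc)
    also have "\<dots> = of_nat (Suc (Suc n)) * (tc f (Suc (Suc n)) * \<zeta> ^ Suc (Suc n)) + T (Suc n)"
      by (simp only: zz Suc mult_1_left)
    also have "\<dots> = T (Suc (Suc n))"
    proof -
      define d where "d = tc f (Suc (Suc n)) * \<zeta> ^ Suc (Suc n)"
      have p: "psum \<zeta> f (Suc (Suc n)) = psum \<zeta> f (Suc n) - d" by (simp add: psum_def d_def)
      have "T (Suc (Suc n)) = (\<Sum>k<Suc n. (psum \<zeta> f k - psum \<zeta> f (Suc n)) + d) + d"
        unfolding T_def p by (simp add: algebra_simps)
      also have "\<dots> = T (Suc n) + of_nat (Suc n) * d + d" by (simp only: sum.distrib T_def sum_constant card_lessThan)
      finally show ?thesis by (simp add: d_def algebra_simps)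
    qed
    finally show ?case .
  qed
  have nm: "(cmod (tc g n))\<^sup>2 = (cmod (T (Suc n)))\<^sup>2" for n
    unfolding tcg[symmetric] using \<zeta> by (simp add: norm_mult norm_power)
  define x where "x = (\<lambda>n. (cmod (T (Suc n)))\<^sup>2 * (pi / ((real n + 1) * (real n + 2))))"
  have x0: "0 \<le> x n" for n by (simp add: x_def)
  have "dirfin \<zeta> f \<longleftrightarrow> (\<Sum>n. ennreal (x n)) \<noteq> top"
    unfolding dirfin_def eq weighted_area_integral[OF hg] nm x_def by (simp only: infinity_ennreal_def less_top)
  also have "\<dots> \<longleftrightarrow> summable x"
  proof
    show "summable x" if "(\<Sum>n. ennreal (x n)) \<noteq> top" by (rule summable_suminf_not_top[OF x0 that])
    show "(\<Sum>n. ennreal (x n)) \<noteq> top" if "summable x" by (rule ennreal_suminf_neq_top[OF that x0])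
  qed
  also have "x = (\<lambda>n. pi * ((cmod (T (Suc n)))\<^sup>2 / (real (Suc n) * real (Suc (Suc n)))))"
    by (simp add: x_def add.commute fun_eq_iff)
  also have "summable \<dots> \<longleftrightarrow> summable (\<lambda>n. (cmod (T (Suc n)))\<^sup>2 / (real (Suc n) * real (Suc (Suc n))))"
    by (subst summable_cmult_iff) simp
  also have "\<dots> \<longleftrightarrow> (\<exists>L. summable (\<lambda>n. (cmod (psum \<zeta> f n - L))\<^sup>2))"
    using variance_criterion[of "psum \<zeta> f"] by (simp only: T_def)
  finally show ?thesis .
qed

text \<open>Formal division of \<open>f - c\<close> by \<open>z - \<zeta>\<close> determines the
  coefficients of the quotient up to one free constant. That some choice makes them square summable
  is the condition of \<open>dirfin_iff_summable\<close>.\<close>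

lemma dirfin_iff:
  assumes hol: "f holomorphic_on ball 0 1" and \<zeta>: "cmod \<zeta> = 1"
  shows "dirfin \<zeta> f \<longleftrightarrow> (\<exists>c G. H2 G \<and> (\<forall>z\<in>ball 0 1. f z = c + (z - \<zeta>) * G z))"
proof -
  have zz: "cnj \<zeta> * \<zeta> = 1" "\<zeta> * cnj \<zeta> = 1" using \<zeta> complex_norm_square[of \<zeta>] by (simp_all add: mult.commute)
  have zp: "cnj \<zeta> ^ n * \<zeta> ^ n = 1" for n by (simp add: power_mult_distrib[symmetric] zz)
  show ?thesis
    unfolding dirfin_iff_summable[OF hol \<zeta>]
  proof
    assume "\<exists>L. summable (\<lambda>n. (cmod (psum \<zeta> f n - L))\<^sup>2)"
    then obtain L where L: "summable (\<lambda>n. (cmod (psum \<zeta> f n - L))\<^sup>2)" by blast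
    \<comment> \<open>For every \<open>L\<close> these numbers solve
      \<open>tc f (Suc n) = a n - \<zeta> * a (Suc n)\<close>. The chosen \<open>L\<close> makes
      them square summable, and the coefficient of order 0 then fixes \<open>c\<close>.\<close>
    define a where "a = (\<lambda>n. cnj \<zeta> ^ Suc n * (psum \<zeta> f n - L))"
    have "(cmod (a n))\<^sup>2 = (cmod (psum \<zeta> f n - L))\<^sup>2" for n using \<zeta> by (simp add: a_def norm_mult norm_power)
    then have "summable (\<lambda>n. (cmod (a n))\<^sup>2)" using L by simp
    from H2_series[OF this] obtain G where G: "H2 G" "\<And>z. cmod z < 1 \<Longrightarrow> (\<lambda>n. a n * z ^ n) sums G z" by blast
    have tG: "tc G n = a n" for n by (rule tc_unique[OF G(2)])
    define c where "c = tc f 0 + \<zeta> * a 0"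
    define f2 where "f2 = (\<lambda>z. c + (1 * z + (- \<zeta>)) * G z)"
    have hf2: "f2 holomorphic_on ball 0 1" unfolding f2_def by (intro holomorphic_intros H2_hol[OF G(1)])
    have f2e: "f2 z = c + (1 * z + (- \<zeta>)) * G z" for z by (simp only: f2_def)
    have t0: "tc f2 0 = c + (- \<zeta>) * tc G 0" by (rule tc_linear_factor(1)[OF H2_hol[OF G(1)] f2e])
    have tS: "tc f2 (Suc n) = 1 * tc G n + (- \<zeta>) * tc G (Suc n)" for n
      by (rule tc_linear_factor(2)[OF H2_hol[OF G(1)] f2e])
    have "tc f2 n = tc f n" for n
    proof (cases n)
      case 0
      then show ?thesis using t0 by (simp add: tG c_def)
    next
      case (Suc m)
      have "tc f2 (Suc m) = a m - \<zeta> * a (Suc m)" using tS[of m] by (simp add: tG)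
      also have "\<zeta> * a (Suc m) = (cnj \<zeta> * \<zeta>) * (cnj \<zeta> ^ Suc m * (psum \<zeta> f (Suc m) - L))" by (simp add: a_def mult_ac)
      also have "a m - (cnj \<zeta> * \<zeta>) * (cnj \<zeta> ^ Suc m * (psum \<zeta> f (Suc m) - L)) = cnj \<zeta> ^ Suc m * (psum \<zeta> f m - psum \<zeta> f (Suc m))"
        by (simp only: zz a_def) (simp add: algebra_simps)
      also have "psum \<zeta> f m - psum \<zeta> f (Suc m) = tc f (Suc m) * \<zeta> ^ Suc m" by (simp add: psum_def)
      also have "cnj \<zeta> ^ Suc m * (tc f (Suc m) * \<zeta> ^ Suc m) = tc f (Suc m) * (cnj \<zeta> ^ Suc m * \<zeta> ^ Suc m)" by (simp only: mult_ac)
      also have "\<dots> = tc f (Suc m)" by (simp only: zp mult_1_right)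
      finally show ?thesis using Suc by simp
    qed
    then have "f z = f2 z" if "z \<in> ball 0 1" for z
      using tc_sums[OF hol, of z] tc_sums[OF hf2, of z] that by (auto intro: sums_unique2)
    then show "\<exists>c G. H2 G \<and> (\<forall>z\<in>ball 0 1. f z = c + (z - \<zeta>) * G z)"
      using G(1) by (intro exI[of _ c] exI[of _ G]) (simp add: f2_def)
  next
    assume "\<exists>c G. H2 G \<and> (\<forall>z\<in>ball 0 1. f z = c + (z - \<zeta>) * G z)"
    then obtain c G where G: "H2 G" "\<And>z. z \<in> ball 0 1 \<Longrightarrow> f z = c + (z - \<zeta>) * G z" by blast
    have tS: "tc f (Suc n) = 1 * tc G n + (- \<zeta>) * tc G (Suc n)" for n
      by (rule tc_linear_factor(2)[OF H2_hol[OF G(1)]]) (simp add: G(2))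
    have "psum \<zeta> f n - (- \<zeta> * tc G 0) = \<zeta> ^ Suc n * tc G n" for n
    proof (induction n)
      case 0
      then show ?case by (simp add: psum_def)
    next
      case (Suc n)
      have "psum \<zeta> f (Suc n) = psum \<zeta> f n - tc f (Suc n) * \<zeta> ^ Suc n" by (simp add: psum_def)
      then have "psum \<zeta> f (Suc n) - (- \<zeta> * tc G 0) = \<zeta> ^ Suc n * tc G n - tc f (Suc n) * \<zeta> ^ Suc n"
        using Suc by (simp add: algebra_simps)
      also have "\<dots> = \<zeta> ^ Suc (Suc n) * tc G (Suc n)" unfolding tS by (simp add: algebra_simps)
      finally show ?case .
    qed
    then have "(cmod (psum \<zeta> f n - (- \<zeta> * tc G 0)))\<^sup>2 = (cmod (tc G n))\<^sup>2" for n
      using \<zeta> by (simp only: norm_mult norm_power) simp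
    moreover have "summable (\<lambda>n. (cmod (tc G n))\<^sup>2)" using G(1) by (simp add: H2_iff)
    ultimately have "summable (\<lambda>n. (cmod (psum \<zeta> f n - (- \<zeta> * tc G 0)))\<^sup>2)" by simp
    then show "\<exists>L. summable (\<lambda>n. (cmod (psum \<zeta> f n - L))\<^sup>2)" by blast
  qed
qed

section \<open>The structure of the Dirichlet space of a finite sum of point masses\<close>

lemma in_Dmu_iff:
  assumes Z: "finite Z" shows "in_Dmu Z f \<longleftrightarrow> H2 f \<and> (\<forall>\<zeta>\<in>Z. dirfin \<zeta> f)"
proof (cases "H2 f")
  case True
  then have hol: "f holomorphic_on ball 0 1" by (rule H2_hol)
  have hd: "continuous_on (ball 0 1) (deriv f)"
    by (rule holomorphic_on_imp_continuous_on[OF holomorphic_deriv[OF hol open_ball]])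
  define u where "u = (\<lambda>\<zeta> z. indicator (ball 0 1) z * ennreal ((cmod (deriv f z))\<^sup>2 * ((1 - (cmod z)\<^sup>2) / (cmod (\<zeta> - z))\<^sup>2)))"
  have um: "u \<zeta> \<in> borel_measurable borel" for \<zeta>
  proof -
    have [measurable]: "ball 0 1 \<in> sets (borel :: complex measure)" by simp
    have [measurable]: "(\<lambda>z. indicator (ball 0 1) z *\<^sub>R deriv f z) \<in> borel_measurable borel"
      by (rule borel_measurable_continuous_on_indicator[OF _ hd]) simp
    have "(\<lambda>z. indicator (ball 0 1) z * ennreal ((cmod (indicator (ball 0 1) z *\<^sub>R deriv f z))\<^sup>2 * ((1 - (cmod z)\<^sup>2) / (cmod (\<zeta> - z))\<^sup>2))) \<in> borel_measurable borel"
      by measurable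
    moreover have "(\<lambda>z. indicator (ball 0 1) z * ennreal ((cmod (indicator (ball 0 1) z *\<^sub>R deriv f z))\<^sup>2 * ((1 - (cmod z)\<^sup>2) / (cmod (\<zeta> - z))\<^sup>2))) = u \<zeta>"
      by (auto simp: u_def fun_eq_iff indicator_def)
    ultimately show ?thesis by simp
  qed
  have "indicator (ball 0 1) z * ennreal ((cmod (deriv f z))\<^sup>2 * Poisson_mu Z z) = (\<Sum>\<zeta>\<in>Z. u \<zeta> z)" for z
  proof (cases "z \<in> ball 0 1")
    case z: True
    then have w0: "0 \<le> 1 - (cmod z)\<^sup>2" by (simp add: power_le_one)
    have "ennreal ((cmod (deriv f z))\<^sup>2 * Poisson_mu Z z) = ennreal (\<Sum>\<zeta>\<in>Z. (cmod (deriv f z))\<^sup>2 * ((1 - (cmod z)\<^sup>2) / (cmod (\<zeta> - z))\<^sup>2))"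
      by (simp add: Poisson_mu_def sum_distrib_left)
    also have "\<dots> = (\<Sum>\<zeta>\<in>Z. ennreal ((cmod (deriv f z))\<^sup>2 * ((1 - (cmod z)\<^sup>2) / (cmod (\<zeta> - z))\<^sup>2)))"
      by (rule sum_ennreal[symmetric]) (intro mult_nonneg_nonneg divide_nonneg_nonneg w0, auto)
    finally show ?thesis using z by (simp add: u_def)
  qed (simp add: u_def)
  then have "(\<integral>\<^sup>+ z. indicator (ball 0 1) z * ennreal ((cmod (deriv f z))\<^sup>2 * Poisson_mu Z z) \<partial>lborel) = (\<Sum>\<zeta>\<in>Z. (\<integral>\<^sup>+ z. u \<zeta> z \<partial>lborel))"
    using um by (simp add: nn_integral_sum)
  also have "\<dots> < \<infinity> \<longleftrightarrow> (\<forall>\<zeta>\<in>Z. (\<integral>\<^sup>+ z. u \<zeta> z \<partial>lborel) < \<infinity>)"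
    using Z by (simp add: less_top[symmetric] ennreal_sum_eq_top)
  finally show ?thesis using True by (simp add: in_Dmu_def dirfin_def u_def)
qed (simp add: in_Dmu_def)

lemma entire_difference_quotient:
  assumes "q holomorphic_on UNIV"
  shows "\<exists>s. s holomorphic_on UNIV \<and> (\<forall>z. (z - \<zeta>) * s z = q z - q \<zeta>)"
proof -
  have "(\<lambda>z. if z = \<zeta> then deriv q \<zeta> else (q z - q \<zeta>) / (z - \<zeta>)) holomorphic_on UNIV"
    by (rule pole_lemma[OF assms]) simp
  then show ?thesis by (intro exI[of _ "\<lambda>z. if z = \<zeta> then deriv q \<zeta> else (q z - q \<zeta>) / (z - \<zeta>)"]) auto
qed

text \<open>Partial fractions: \<open>1 / (p(z) (z - \<zeta>))\<close> is a combination of \<open>1 / (z - \<zeta>)\<close> and \<open>1 / p(z)\<close> with entire coefficients.\<close>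
lemma dirichlet_decomposition:
  assumes Z: "finite Z" and sph: "Z \<subseteq> sphere 0 1" and f: "H2 f" and d: "\<And>\<zeta>. \<zeta> \<in> Z \<Longrightarrow> dirfin \<zeta> f"
  shows "\<exists>q G. q holomorphic_on UNIV \<and> H2 G \<and> (\<forall>z\<in>ball 0 1. f z = q z + pz Z z * G z)"
  using Z sph d
proof (induction Z rule: finite_induct)
  case empty
  show ?case using f by (intro exI[of _ "\<lambda>_. 0"] exI[of _ f]) (auto simp: pz_def)
next
  case (insert \<zeta> Z)
  obtain q G where q: "q holomorphic_on UNIV" and G: "H2 G" and fq: "\<And>z. z \<in> ball 0 1 \<Longrightarrow> f z = q z + pz Z z * G z"
    using insert by auto
  have z1: "cmod \<zeta> = 1" using insert by auto
  obtain c K where K: "H2 K" and fK: "\<And>z. z \<in> ball 0 1 \<Longrightarrow> f z = c + (z - \<zeta>) * K z"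
    using dirfin_iff[OF H2_hol[OF f] z1] insert.prems(2)[of \<zeta>] by auto
  have pn: "pz Z \<zeta> \<noteq> 0" using insert by (auto simp: pz_def)
  \<comment> \<open>This makes \<open>q2\<close> take the value \<open>c\<close> at
    \<open>\<zeta>\<close>. Then \<open>f - q2\<close> is both \<open>pz Z\<close> times
    \<open>G1\<close> and \<open>z - \<zeta>\<close> times \<open>K'\<close>, with \<open>G1\<close>
    and \<open>K'\<close> in \<open>H^2\<close>.\<close>
  define \<alpha> where "\<alpha> = (c - q \<zeta>) / pz Z \<zeta>"
  define q2 where "q2 = (\<lambda>z. q z + \<alpha> * pz Z z)"
  have q2h: "q2 holomorphic_on UNIV" unfolding q2_def by (intro holomorphic_intros q pz_hol)
  have q2z: "q2 \<zeta> = c" using pn by (simp add: q2_def \<alpha>_def)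
  obtain s where s: "s holomorphic_on UNIV" "\<And>z. (z - \<zeta>) * s z = pz Z z - pz Z \<zeta>"
    using entire_difference_quotient[where q = "pz Z" and \<zeta> = \<zeta>, OF pz_hol] by auto
  obtain s2 where s2: "s2 holomorphic_on UNIV" "\<And>z. (z - \<zeta>) * s2 z = q2 z - c"
    using entire_difference_quotient[where q = q2 and \<zeta> = \<zeta>, OF q2h] q2z by auto
  define K' where "K' = (\<lambda>z. K z + (- 1) * s2 z)"
  define G1 where "G1 = (\<lambda>z. G z + (- \<alpha>))"
  \<comment> \<open>From \<open>pz Z \<zeta> = pz Z z - (z - \<zeta>) * s z\<close>, multiplied by
    \<open>f - q2\<close>: use the factorization with \<open>K'\<close> in the first product and the
    one with \<open>G1\<close> in the second. Both then contain
    \<open>(z - \<zeta>) * pz Z z\<close>.\<close>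
  define G' where "G' = (\<lambda>z. (1 / pz Z \<zeta>) * (K' z + (- s z) * G1 z))"
  have HK': "H2 K'" unfolding K'_def by (intro H2_add K H2_mult_entire H2_entire s2 holomorphic_intros)
  have HG1: "H2 G1" unfolding G1_def by (intro H2_add G H2_const)
  have HG': "H2 G'" unfolding G'_def
    by (rule H2_mult_entire[OF H2_add[OF HK' H2_mult_entire[OF HG1]]]) (intro holomorphic_intros s)+
  have fz: "f z = q2 z + pz (insert \<zeta> Z) z * G' z" if z: "z \<in> ball 0 1" for z
  proof -
    have 1: "f z - q2 z = pz Z z * G1 z" using fq[OF z] by (simp add: q2_def G1_def algebra_simps)
    have 2: "f z - q2 z = (z - \<zeta>) * K' z"
    proof -
      have e: "q2 z = (z - \<zeta>) * s2 z + c" using s2(2)[of z] by simp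
      show ?thesis unfolding fK[OF z] e K'_def by (simp add: algebra_simps)
    qed
    have "pz Z \<zeta> * ((z - \<zeta>) * pz Z z * G' z) = pz Z z * ((z - \<zeta>) * K' z) - ((z - \<zeta>) * s z) * (pz Z z * G1 z)"
      using pn by (simp add: G'_def algebra_simps)
    also have "\<dots> = pz Z \<zeta> * (f z - q2 z)"
      unfolding 1[symmetric] 2[symmetric] s(2) by (simp add: algebra_simps)
    finally have "(z - \<zeta>) * pz Z z * G' z = f z - q2 z" using pn by simp
    moreover have "pz (insert \<zeta> Z) z = (z - \<zeta>) * pz Z z" using insert by (simp add: pz_def)
    ultimately show ?thesis by simp
  qed
  show ?case by (intro exI[of _ q2] exI[of _ G'] conjI q2h HG' ballI fz)
qed

lemma in_Dmu_decomposition: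
  assumes "finite Z" "Z \<subseteq> sphere 0 1" "in_Dmu Z f"
  shows "\<exists>q G. q holomorphic_on UNIV \<and> H2 G \<and> (\<forall>z\<in>ball 0 1. f z = q z + pz Z z * G z)"
  using assms dirichlet_decomposition[of Z f] by (simp add: in_Dmu_iff)

lemma pz_remove: "finite Z \<Longrightarrow> \<zeta> \<in> Z \<Longrightarrow> pz Z z = (z - \<zeta>) * pz (Z - {\<zeta>}) z"
  unfolding pz_def by (rule prod.remove)

lemma in_Dmu_multiple:
  assumes Z: "finite Z" "Z \<subseteq> sphere 0 1" and G: "H2 G"
  shows "in_Dmu Z (\<lambda>z. pz Z z * G z)"
proof -
  have H: "H2 (\<lambda>z. pz Z z * G z)" by (rule H2_mult_entire[OF G pz_hol])
  have "dirfin \<zeta> (\<lambda>z. pz Z z * G z)" if "\<zeta> \<in> Z" for \<zeta>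
  proof -
    have z1: "cmod \<zeta> = 1" using Z(2) that by auto
    have eq: "pz Z z * G z = 0 + (z - \<zeta>) * (pz (Z - {\<zeta>}) z * G z)" for z
      unfolding pz_remove[OF Z(1) that] by simp
    show ?thesis unfolding dirfin_iff[OF H2_hol[OF H] z1]
      by (intro exI[of _ 0] exI[of _ "\<lambda>z. pz (Z - {\<zeta>}) z * G z"] conjI ballI eq H2_mult_entire[OF G pz_hol])
  qed
  then show ?thesis using H Z by (simp add: in_Dmu_iff)
qed

section \<open>Functionals bounded by a weighted Szego norm\<close>

text \<open>Difference quotients of \<open>f\<close> are Lipschitz in the increment, because those of the Szego kernels are.\<close>
lemma holomorphic_from_szego_bound:
  assumes B: "\<And>n w c. (\<forall>i<n. w i \<in> ball 0 1) \<Longrightarrow> (cmod (\<Sum>i<n. cnj (c i) * f (w i)))\<^sup>2 \<le> B * nrm2 (\<lambda>t. kf n w c (cis t))"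
    and B0: "0 \<le> B"
  shows "f holomorphic_on ball 0 1"
  unfolding holomorphic_on_def
proof
  fix w :: complex assume "w \<in> ball 0 1"
  then have w1: "cmod w < 1" by simp
  define \<delta> where "\<delta> = (1 - cmod w) / 2"
  have d: "0 < \<delta>" "cmod w + \<delta> = 1 - \<delta>" using w1 by (auto simp: \<delta>_def field_simps)
  have inb: "w + h \<in> ball 0 1" if "cmod h < \<delta>" for h
    using that d norm_triangle_ineq[of w h] by simp
  have low: "\<delta> \<le> cmod (1 - cnj (w + h) * z)" if "cmod h < \<delta>" "cmod z = 1" for h z
  proof -
    have "cmod (cnj (w + h) * z) \<le> cmod w + \<delta>" using that norm_triangle_ineq[of w h] by (simp add: norm_mult del: complex_cnj_add)
    then show ?thesis using norm_triangle_ineq2[of 1 "cnj (w + h) * z"] d by (simp del: complex_cnj_add)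
  qed
  define q where "q = (\<lambda>h. (f (w + h) - f w) / h)"
  \<comment> \<open>The cube accounts for the three denominators of the kernel combination below,
    each at least \<open>\<delta>\<close> in modulus on the circle; \<open>2 * pi\<close> is the
    length of the circle.\<close>
  define C where "C = sqrt (B * (2 * pi)) / \<delta> ^ 3"
  have C0: "0 \<le> C" using d B0 by (simp add: C_def)
  have lip: "cmod (q h - q h') \<le> C * cmod (h - h')" if h: "h \<noteq> 0" "cmod h < \<delta>" and h': "h' \<noteq> 0" "cmod h' < \<delta>" for h h'
  proof -
    \<comment> \<open>A functional at three points whose value is \<open>q h - q h'\<close>. The
      corresponding combination of Szego kernels contains the factor
      \<open>cnj (h - h')\<close>.\<close>
    define v where "v = (\<lambda>i::nat. if i = 0 then w + h else if i = 1 then w else w + h')"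
    define c where "c = (\<lambda>i::nat. if i = 0 then 1 / cnj h else if i = 1 then 1 / cnj h' - 1 / cnj h else - 1 / cnj h')"
    have vin: "\<forall>i<3. v i \<in> ball 0 1" using inb[OF h(2)] inb[OF h'(2)] w1 by (simp add: v_def)
    have 1: "(\<Sum>i<3. cnj (c i) * f (v i)) = q h - q h'"
      by (simp add: numeral_3_eq_3 c_def v_def q_def diff_divide_distrib algebra_simps)
    have kz: "kf 3 v c z = z\<^sup>2 * cnj (h - h') / ((1 - cnj (w + h) * z) * (1 - cnj (w + h') * z) * (1 - cnj w * z))" if z: "cmod z = 1" for z
    proof -
      define A where "A = 1 - cnj (w + h) * z"
      define A' where "A' = 1 - cnj (w + h') * z"
      define A0 where "A0 = 1 - cnj w * z"
      have ne: "A \<noteq> 0" "A' \<noteq> 0" "A0 \<noteq> 0"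
        using low[OF h(2) z] low[OF h'(2) z] low[of 0 z] z d by (auto simp: A_def A'_def A0_def)
      have e1: "A0 - A = cnj h * z" "A0 - A' = cnj h' * z" by (simp_all add: A_def A'_def A0_def algebra_simps)
      have hn: "cnj h \<noteq> 0" "cnj h' \<noteq> 0" using h h' by auto
      have s1: "(1 / A - 1 / A0) / cnj h = z / (A * A0)"
      proof -
        have "1 / A - 1 / A0 = (A0 - A) / (A * A0)" using ne by (simp add: field_simps)
        then show ?thesis using hn by (simp add: e1)
      qed
      have s2: "(1 / A' - 1 / A0) / cnj h' = z / (A' * A0)"
      proof -
        have "1 / A' - 1 / A0 = (A0 - A') / (A' * A0)" using ne by (simp add: field_simps)
        then show ?thesis using hn by (simp add: e1)
      qed
      have "kf 3 v c z = (1 / A - 1 / A0) / cnj h - (1 / A' - 1 / A0) / cnj h'"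
        by (simp add: kf_def numeral_3_eq_3 c_def v_def szego_def A_def A'_def A0_def diff_divide_distrib algebra_simps)
      also have "\<dots> = z / (A * A0) - z / (A' * A0)" by (simp only: s1 s2)
      also have "\<dots> = z * (A' - A) / (A * A' * A0)" using ne by (simp add: field_simps)
      also have "A' - A = cnj (h - h') * z" by (simp add: A_def A'_def algebra_simps)
      finally show ?thesis by (simp add: A_def A'_def A0_def power2_eq_square mult_ac)
    qed
    have kb: "cmod (kf 3 v c (cis t)) \<le> cmod (h - h') / \<delta> ^ 3" for t
    proof -
      have "cmod (kf 3 v c (cis t)) = cmod (h - h') / (cmod (1 - cnj (w + h) * cis t) * cmod (1 - cnj (w + h') * cis t) * cmod (1 - cnj w * cis t))"
        by (simp add: kz norm_divide norm_mult norm_power del: complex_cnj_add complex_cnj_diff)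
      also have "\<dots> \<le> cmod (h - h') / (\<delta> * \<delta> * \<delta>)"
        using low[OF h(2), of "cis t"] low[OF h'(2), of "cis t"] low[of 0 "cis t"] d
        by (intro divide_left_mono mult_mono mult_pos_pos) auto
      finally show ?thesis by (simp add: power3_eq_cube)
    qed
    have "nrm2 (\<lambda>t. kf 3 v c (cis t)) \<le> integral\<^sup>L TT (\<lambda>t. (cmod (h - h') / \<delta> ^ 3)\<^sup>2)"
      unfolding nrm2_def
    proof (rule integral_mono)
      have "bmf (\<lambda>t. kf 3 v c (cis t))" by (rule bfun_bmf[OF bfun_kf]) (use vin in blast)
      then show "integrable TT (\<lambda>t. (cmod (kf 3 v c (cis t)))\<^sup>2)" by (intro bmf_integrable bmf_power2 bmf_norm)
      show "integrable TT (\<lambda>t. (cmod (h - h') / \<delta> ^ 3)\<^sup>2)" by (intro bmf_integrable bmf_const)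
      show "(cmod (kf 3 v c (cis t)))\<^sup>2 \<le> (cmod (h - h') / \<delta> ^ 3)\<^sup>2" for t by (rule power_mono[OF kb norm_ge_zero])
    qed
    also have "\<dots> = 2 * pi * (cmod (h - h') / \<delta> ^ 3)\<^sup>2" by (simp only: integral_TT_const real_scaleR_def)
    finally have "B * nrm2 (\<lambda>t. kf 3 v c (cis t)) \<le> B * (2 * pi * (cmod (h - h') / \<delta> ^ 3)\<^sup>2)" using B0 by (rule mult_left_mono)
    then have "(cmod (q h - q h'))\<^sup>2 \<le> B * (2 * pi * (cmod (h - h') / \<delta> ^ 3)\<^sup>2)"
      using B[OF vin, of c] unfolding 1 by linarith
    also have "\<dots> = (C * cmod (h - h'))\<^sup>2"
    proof -
      have "C\<^sup>2 = B * (2 * pi) / (\<delta> ^ 3)\<^sup>2" unfolding C_def power_divide using B0 by (subst real_sqrt_pow2) auto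
      then show ?thesis unfolding power_mult_distrib power_divide by simp
    qed
    finally show ?thesis by (rule power2_le_imp_le) (intro mult_nonneg_nonneg C0 norm_ge_zero)
  qed
  have "C-lipschitz_on (ball 0 \<delta> - {0}) q"
    by (rule lipschitz_onI[OF _ C0]) (use lip in \<open>auto simp: dist_norm\<close>)
  \<comment> \<open>The value at 0 of the continuous extension of \<open>q\<close> is the derivative
    of \<open>f\<close> at \<open>w\<close>.\<close>
  from lipschitz_extend_closure[OF this] obtain g where g: "C-lipschitz_on (closure (ball 0 \<delta> - {0})) g" "\<forall>x\<in>ball 0 \<delta> - {0}. g x = q x" by auto
  have cl: "ball 0 \<delta> \<subseteq> closure (ball 0 \<delta> - {0::complex})"
  proof
    fix x :: complex assume x: "x \<in> ball 0 \<delta>"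
    have "at 0 within ball 0 \<delta> = at (0::complex)" by (rule at_within_open) (use d in auto)
    then have "\<not> trivial_limit (at (0::complex) within ball 0 \<delta>)" by simp
    then have "0 \<in> closure (ball 0 \<delta> - {0::complex})" using not_trivial_limit_within[of "0::complex" "ball 0 \<delta>"] by blast
    then show "x \<in> closure (ball 0 \<delta> - {0})" using x closure_subset[of "ball 0 \<delta> - {0}"] by (cases "x = 0") auto
  qed
  have "continuous_on (ball 0 \<delta>) g"
    by (rule continuous_on_subset[OF lipschitz_on_continuous_on[OF g(1)] cl])
  then have "isCont g 0" using d by (simp add: continuous_on_eq_continuous_at)
  then have "g \<midarrow>0\<rightarrow> g 0" by (simp add: isCont_def)
  moreover have "eventually (\<lambda>h. h \<in> ball 0 \<delta> - {0}) (at (0::complex))"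
    by (rule eventually_at_in_open) (use d in auto)
  then have "eventually (\<lambda>h. g h = q h) (at 0)" by (rule eventually_mono) (use g(2) in blast)
  ultimately have "q \<midarrow>0\<rightarrow> g 0" by (rule Lim_transform_eventually)
  then have "(f has_field_derivative g 0) (at w)" by (simp add: q_def DERIV_def)
  then show "f field_differentiable at w within ball 0 1"
    by (meson field_differentiable_at_within field_differentiable_def)
qed

section \<open>Taylor coefficients by means of roots of unity\<close>

definition rt :: "nat \<Rightarrow> nat \<Rightarrow> complex" where "rt M j = cis (2 * pi * real j / real M)"

lemma rt_power_M: "M > 0 \<Longrightarrow> rt M j ^ M = 1"
proof -
  assume "M > 0"
  have "rt M j ^ M = cis (real M * (2 * pi * real j / real M))" unfolding rt_def by (rule Complex.DeMoivre)
  also have "real M * (2 * pi * real j / real M) = 2 * pi * real j" using \<open>M > 0\<close> by simp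
  finally show ?thesis by (simp add: cis_multiple_2pi)
qed

lemma rt_swap: "rt M j ^ n = rt M n ^ j"
  unfolding rt_def by (simp add: Complex.DeMoivre mult_ac)

lemma sum_rt:
  assumes "n < M" "m < M" shows "(\<Sum>j<M. rt M j ^ n * cnj (rt M j ^ m)) = (if n = m then of_nat M else 0)"
proof -
  define x where "x = rt M n * cnj (rt M m)"
  have M0: "M > 0" using assms by simp
  have eq: "rt M j ^ n * cnj (rt M j ^ m) = x ^ j" for j
    unfolding rt_swap[of M j] x_def by (simp add: power_mult_distrib)
  have xc: "x = cis (2 * pi * (real n - real m) / real M)"
    unfolding x_def rt_def by (simp add: cis_cnj cis_mult right_diff_distrib diff_divide_distrib)
  show ?thesis
  proof (cases "n = m")
    case True
    then have "x = 1" by (simp add: xc)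
    then show ?thesis using True unfolding eq by simp
  next
    case False
    have "x \<noteq> 1"
    proof
      assume "x = 1"
      then have "cos (2 * pi * (real n - real m) / real M) = 1" by (simp add: xc complex_eq_iff)
      then obtain k :: int where k: "2 * pi * (real n - real m) / real M = of_int k * 2 * pi"
        by (auto simp: cos_one_2pi_int)
      then have "(2 * pi) * (real n - real m) = (2 * pi) * (of_int k * real M)" using M0 by (simp add: divide_eq_eq mult_ac)
      then have "real n - real m = of_int k * real M" by (rule iffD1[OF mult_left_cancel, rotated]) simp
      then have e: "int n - int m = k * int M" by (metis of_int_diff of_int_eq_iff of_int_mult of_int_of_nat_eq)
      have "\<bar>int n - int m\<bar> < int M" using assms by linarith
      then have "\<bar>k\<bar> * int M < 1 * int M" unfolding e abs_mult using M0 by simp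
      then have "k = 0" using M0 by simp
      then show False using e False by simp
    qed
    moreover have "x ^ M = 1"
      by (simp only: x_def power_mult_distrib complex_cnj_power[symmetric] rt_power_M[OF M0] complex_cnj_one mult_1)
    ultimately show ?thesis using False unfolding eq by (simp add: geometric_sum)
  qed
qed

text \<open>Averaging over the \<open>M\<close>-th roots of unity on the circle of radius \<open>r\<close> extracts Taylor coefficients up to an
  error that vanishes as \<open>M\<close> grows.\<close>
lemma coefficient_bound:
  assumes B: "\<And>n w c. (\<forall>i<n. w i \<in> ball 0 1) \<Longrightarrow> (cmod (\<Sum>i<n. cnj (c i) * f (w i)))\<^sup>2 \<le> B * nrm2 (\<lambda>t. p (cis t) * kf n w c (cis t))"
    and B0: "0 \<le> B" and f: "f holomorphic_on ball 0 1" and p: "continuous_on (sphere 0 1) p"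
  shows "(cmod (\<Sum>n<J. cnj (c n) * tc f n))\<^sup>2 \<le> B * nrm2 (\<lambda>t. p (cis t) * (\<Sum>n<J. c n * cis t ^ n))"
proof -
  \<comment> \<open>Any radius strictly between 0 and 1 serves; its powers cancel in the
    limit.\<close>
  define r :: real where "r = 1 / 2"
  have r0: "complex_of_real r \<noteq> 0" by (simp add: r_def)
  define P where "P = (\<lambda>z. \<Sum>n<J. c n * z ^ n)"
  define w where "w = (\<lambda>M j. complex_of_real r * rt M j)"
  define d where "d = (\<lambda>M j. (1 / of_nat M) * (\<Sum>n<J. c n / complex_of_real r ^ n * rt M j ^ n))"
  have win: "\<forall>j<M. w M j \<in> ball 0 1" for M by (simp add: w_def rt_def r_def norm_mult)
  \<comment> \<open>Expand the kernels in powers and sum over the roots of unity: orthogonality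
    leaves \<open>P\<close>, and the periodicity of the roots collects the remaining powers into the
    factor \<open>1 / (1 - (r * z) ^ M)\<close>, which tends to 1 uniformly on the circle.\<close>
  have kfM: "kf M (w M) (d M) z = P z / (1 - (complex_of_real r * z) ^ M)" if M: "J \<le> M" "0 < M" and z: "cmod z = 1" for M z
  proof -
    let ?x = "complex_of_real r * z"
    have nx: "cmod ?x = r" using z by (simp add: norm_mult r_def)
    have nzM: "1 - ?x ^ M \<noteq> 0"
    proof
      assume "1 - ?x ^ M = 0"
      then have "cmod (?x ^ M) = 1" by simp
      then have "r ^ M = 1" by (simp only: norm_power nx)
      moreover have "r ^ M < 1" using M by (simp add: r_def power_less_one_iff)
      ultimately show False by simp
    qed
    have sz: "szego (w M j) z = (\<Sum>m<M. cnj (rt M j ^ m) * ?x ^ m) / (1 - ?x ^ M)" for j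
    proof -
      define y where "y = cnj (rt M j) * ?x"
      have "cmod y = r" using nx by (simp add: y_def norm_mult rt_def)
      then have y1: "y \<noteq> 1" by (auto simp: r_def)
      have yM: "y ^ M = ?x ^ M"
        unfolding y_def power_mult_distrib[of "cnj (rt M j)"] using rt_power_M[OF M(2)] by (simp flip: complex_cnj_power)
      have S: "(1 - y) * (\<Sum>m<M. y ^ m) = 1 - y ^ M" by (rule one_diff_power_eq[symmetric])
      then have Sn: "(\<Sum>m<M. y ^ m) \<noteq> 0" using nzM yM by auto
      have g: "1 / (1 - y) = (\<Sum>m<M. y ^ m) / (1 - ?x ^ M)"
        unfolding yM[symmetric] S[symmetric] using Sn by simp
      have "szego (w M j) z = 1 / (1 - y)" by (simp add: szego_def w_def y_def mult_ac)
      also note g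
      also have "(\<Sum>m<M. y ^ m) = (\<Sum>m<M. cnj (rt M j ^ m) * ?x ^ m)"
        by (intro sum.cong refl) (simp add: y_def power_mult_distrib)
      finally show ?thesis .
    qed
    have "(1 - ?x ^ M) * kf M (w M) (d M) z = (\<Sum>j<M. d M j * (\<Sum>m<M. cnj (rt M j ^ m) * ?x ^ m))"
    proof -
      have "(1 - ?x ^ M) * (d M j * szego (w M j) z) = d M j * (\<Sum>m<M. cnj (rt M j ^ m) * ?x ^ m)" for j
        unfolding sz times_divide_eq_right by (rule nonzero_mult_div_cancel_left[OF nzM])
      then show ?thesis unfolding kf_def sum_distrib_left[of "1 - ?x ^ M"] by (intro sum.cong refl)
    qed
    also have "\<dots> = (\<Sum>j<M. \<Sum>n<J. \<Sum>m<M. (1 / of_nat M) * (c n / complex_of_real r ^ n) * ?x ^ m * (rt M j ^ n * cnj (rt M j ^ m)))"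
      unfolding d_def sum_distrib_left[of "1 / of_nat M"] sum_product by (intro sum.cong refl) (simp only: mult_ac)
    also have "\<dots> = (\<Sum>n<J. \<Sum>m<M. (1 / of_nat M) * (c n / complex_of_real r ^ n) * ?x ^ m * (\<Sum>j<M. rt M j ^ n * cnj (rt M j ^ m)))"
      unfolding sum_distrib_left by (rule trans[OF sum.swap], rule sum.cong[OF refl], rule sum.swap)
    also have "\<dots> = (\<Sum>n<J. \<Sum>m<M. if m = n then c n * z ^ n else 0)"
    proof (intro sum.cong refl)
      fix n m assume "n \<in> {..<J}" "m \<in> {..<M}"
      then have nm: "n < M" "m < M" using M by auto
      show "(1 / of_nat M) * (c n / complex_of_real r ^ n) * ?x ^ m * (\<Sum>j<M. rt M j ^ n * cnj (rt M j ^ m)) = (if m = n then c n * z ^ n else 0)"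
        unfolding sum_rt[OF nm] using M r0 by (auto simp: power_mult_distrib)
    qed
    also have "\<dots> = P z" unfolding P_def using M by (intro sum.cong refl) (simp add: sum.delta)
    finally show ?thesis using nzM by (simp add: field_simps)
  qed
  have lim1: "(\<lambda>M. \<Sum>j<M. cnj (d M j) * f (w M j)) \<longlonglongrightarrow> (\<Sum>n<J. cnj (c n) * tc f n)"
  proof -
    \<comment> \<open>A discrete Fourier coefficient of \<open>f\<close> on the circle of radius
      \<open>r\<close>. It differs from the true coefficient by at most a tail of the Taylor series
      starting at order \<open>M\<close>.\<close>
    define e where "e = (\<lambda>M n. (1 / of_nat M) * (\<Sum>j<M. cnj (rt M j ^ n) * f (w M j)))"
    have eq: "(\<Sum>j<M. cnj (d M j) * f (w M j)) = (\<Sum>n<J. cnj (c n) / complex_of_real r ^ n * e M n)" for M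
    proof -
      have "(\<Sum>j<M. cnj (d M j) * f (w M j)) = (\<Sum>j<M. \<Sum>n<J. cnj (c n) / complex_of_real r ^ n * ((1 / of_nat M) * (cnj (rt M j ^ n) * f (w M j))))"
        unfolding d_def by (simp add: sum_distrib_left sum_distrib_right mult_ac)
      also have "\<dots> = (\<Sum>n<J. cnj (c n) / complex_of_real r ^ n * e M n)"
        unfolding e_def sum_distrib_left by (subst sum.swap) (rule refl)
      finally show ?thesis .
    qed
    have sm: "summable (\<lambda>m. cmod (tc f m) * r ^ m)"
    proof -
      have "summable (\<lambda>n. tc f n * complex_of_real (3 / 4) ^ n)"
        using tc_sums[OF f, of "complex_of_real (3 / 4)"] by (auto simp: sums_iff norm_divide)
      then have "summable (\<lambda>n. cmod (tc f n * complex_of_real r ^ n))" by (rule powser_insidea) (simp add: r_def norm_divide)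
      then show ?thesis by (simp add: norm_mult norm_power r_def)
    qed
    have elim: "(\<lambda>M. e M n) \<longlonglongrightarrow> tc f n * complex_of_real r ^ n" for n
    proof -
      have tail: "(\<lambda>M. \<Sum>m. cmod (tc f (m + M)) * r ^ (m + M)) \<longlonglongrightarrow> 0"
        using suminf_exist_split2[OF sm] by simp
      have "cmod (e M n - tc f n * complex_of_real r ^ n) \<le> (\<Sum>m. cmod (tc f (m + M)) * r ^ (m + M))" if M: "n < M" for M
      proof -
        define S where "S = (\<lambda>z. \<Sum>m<M. tc f m * z ^ m)"
        have fS: "cmod (f (w M j) - S (w M j)) \<le> (\<Sum>m. cmod (tc f (m + M)) * r ^ (m + M))" for j
        proof -
          have cw: "cmod (w M j) = r" by (simp add: w_def rt_def r_def norm_mult)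
          have su: "(\<lambda>m. tc f m * w M j ^ m) sums f (w M j)" by (rule tc_sums[OF f]) (simp add: cw r_def)
          have "(\<lambda>m. tc f (m + M) * w M j ^ (m + M)) sums (f (w M j) - S (w M j))"
            unfolding S_def by (rule sums_split_initial_segment[OF su])
          then have "f (w M j) - S (w M j) = (\<Sum>m. tc f (m + M) * w M j ^ (m + M))" by (simp add: sums_iff)
          also have "cmod \<dots> \<le> (\<Sum>m. cmod (tc f (m + M) * w M j ^ (m + M)))"
            by (rule summable_norm) (use summable_ignore_initial_segment[OF sm, of M] in \<open>simp add: norm_mult norm_power cw\<close>)
          finally show ?thesis by (simp add: norm_mult norm_power cw)
        qed
        have eS: "(1 / of_nat M) * (\<Sum>j<M. cnj (rt M j ^ n) * S (w M j)) = tc f n * complex_of_real r ^ n"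
        proof -
          have "(\<Sum>j<M. cnj (rt M j ^ n) * S (w M j)) = (\<Sum>j<M. \<Sum>m<M. (tc f m * complex_of_real r ^ m) * (rt M j ^ m * cnj (rt M j ^ n)))"
            unfolding S_def sum_distrib_left by (intro sum.cong refl) (simp add: w_def power_mult_distrib mult_ac)
          also have "\<dots> = (\<Sum>m<M. (tc f m * complex_of_real r ^ m) * (\<Sum>j<M. rt M j ^ m * cnj (rt M j ^ n)))"
            unfolding sum_distrib_left by (rule sum.swap)
          also have "\<dots> = (\<Sum>m<M. if m = n then tc f n * complex_of_real r ^ n * of_nat M else 0)"
            by (intro sum.cong refl, subst sum_rt) (use M in auto)
          also have "\<dots> = tc f n * complex_of_real r ^ n * of_nat M" using M by (simp add: sum.delta)
          finally show ?thesis using M by simp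
        qed
        have "e M n - tc f n * complex_of_real r ^ n = (1 / of_nat M) * (\<Sum>j<M. cnj (rt M j ^ n) * (f (w M j) - S (w M j)))"
          unfolding eS[symmetric] e_def by (simp add: right_diff_distrib sum_subtractf)
        also have "cmod \<dots> \<le> (1 / real M) * (\<Sum>j<M. (\<Sum>m. cmod (tc f (m + M)) * r ^ (m + M)))"
          unfolding norm_mult
        proof (intro mult_mono)
          show "cmod (\<Sum>j<M. cnj (rt M j ^ n) * (f (w M j) - S (w M j))) \<le> (\<Sum>j<M. (\<Sum>m. cmod (tc f (m + M)) * r ^ (m + M)))"
            by (rule sum_norm_le) (use fS in \<open>simp add: norm_mult norm_power rt_def\<close>)
        qed (auto simp: norm_divide)
        also have "\<dots> = (\<Sum>m. cmod (tc f (m + M)) * r ^ (m + M))" using M by simp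
        finally show ?thesis .
      qed
      then have "eventually (\<lambda>M. cmod (e M n - tc f n * complex_of_real r ^ n) \<le> (\<Sum>m. cmod (tc f (m + M)) * r ^ (m + M))) sequentially"
        by (intro eventually_sequentiallyI[of "Suc n"]) simp
      from Lim_null_comparison[OF this tail] show ?thesis by (simp add: LIM_zero_iff)
    qed
    have "(\<lambda>M. \<Sum>n<J. cnj (c n) / complex_of_real r ^ n * e M n) \<longlonglongrightarrow> (\<Sum>n<J. cnj (c n) / complex_of_real r ^ n * (tc f n * complex_of_real r ^ n))"
      by (intro tendsto_intros elim)
    then show ?thesis unfolding eq using r0 by simp
  qed
  \<comment> \<open>The index \<open>Suc (M + J)\<close> guarantees that there are at least
    \<open>J\<close> nodes and at least one, as \<open>kfM\<close> demands.\<close>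
  have lim2: "(\<lambda>M. nrm2 (\<lambda>t. p (cis t) * kf (Suc (M + J)) (w (Suc (M + J))) (d (Suc (M + J))) (cis t))) \<longlonglongrightarrow> nrm2 (\<lambda>t. p (cis t) * P (cis t))"
  proof -
    have bp: "bmf (\<lambda>t. p (cis t))" by (rule bmf_circle[OF p])
    have bP: "bmf (\<lambda>t. P (cis t))" unfolding P_def by (intro bmf_sum bmf_mult bmf_const bmf_cis_power)
    obtain K where K: "\<forall>t. cmod (p (cis t) * P (cis t)) \<le> K" using bmf_mult[OF bp bP] unfolding bmf_def by blast
    define u where "u = (\<lambda>M t. p (cis t) * P (cis t) / (1 - (complex_of_real r * cis t) ^ Suc (M + J)))"
    have ueq: "p (cis t) * kf (Suc (M + J)) (w (Suc (M + J))) (d (Suc (M + J))) (cis t) = u M t" for M t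
      by (subst kfM) (auto simp: u_def)
    have rn: "cmod ((complex_of_real r * cis t) ^ Suc (M + J)) \<le> 1 / 2" for M t
    proof -
      have "cmod ((complex_of_real r * cis t) ^ Suc (M + J)) = r ^ Suc (M + J)" by (simp add: norm_power norm_mult r_def del: power_Suc)
      also have "\<dots> \<le> r ^ 1" by (intro power_decreasing) (auto simp: r_def)
      finally show ?thesis by (simp add: r_def)
    qed
    have den: "1 / 2 \<le> cmod (1 - (complex_of_real r * cis t) ^ Suc (M + J))" for M t
      using norm_triangle_ineq2[of 1 "(complex_of_real r * cis t) ^ Suc (M + J)"] rn[of t M] by (simp del: power_Suc)
    have ub: "cmod (u M t) \<le> 2 * K" for M t
    proof -
      have "cmod (u M t) \<le> K / (1 / 2)" unfolding u_def norm_divide using K den[of t M]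
        by (intro frac_le) (auto intro: order_trans[OF norm_ge_zero] simp del: power_Suc)
      then show ?thesis by simp
    qed
    have um: "u M \<in> borel_measurable TT" for M
    proof -
      have "(\<lambda>t. (complex_of_real r * cis t) ^ Suc (M + J)) \<in> borel_measurable TT"
        using bmf_meas[OF bmf_circle[of "\<lambda>z. (complex_of_real r * z) ^ Suc (M + J)"]] by (simp add: continuous_intros)
      then show ?thesis unfolding u_def using bmf_meas[OF bmf_mult[OF bp bP]] by (intro borel_measurable_divide borel_measurable_diff) auto
    qed
    have "(\<lambda>M. integral\<^sup>L TT (\<lambda>t. (cmod (u M t))\<^sup>2)) \<longlonglongrightarrow> integral\<^sup>L TT (\<lambda>t. (cmod (p (cis t) * P (cis t)))\<^sup>2)"
    proof (rule dct_TT)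
      show "(\<lambda>t. (cmod (u M t))\<^sup>2) \<in> borel_measurable TT" for M using um[of M] by measurable
      show "(\<lambda>t. (cmod (p (cis t) * P (cis t)))\<^sup>2) \<in> borel_measurable TT" by (intro bmf_meas bmf_power2 bmf_norm bmf_mult bp bP)
      show "norm ((cmod (u M t))\<^sup>2) \<le> (2 * K)\<^sup>2" for M t using power_mono[OF ub[of M t] norm_ge_zero, of 2] by simp
      show "AE t in TT. (\<lambda>M. (cmod (u M t))\<^sup>2) \<longlonglongrightarrow> (cmod (p (cis t) * P (cis t)))\<^sup>2"
      proof (rule AE_I2)
        fix t :: real
        have "(\<lambda>M. (complex_of_real r * cis t) ^ M) \<longlonglongrightarrow> 0"
          by (rule LIMSEQ_power_zero) (simp add: norm_mult r_def)
        then have "(\<lambda>M. (complex_of_real r * cis t) ^ (M + Suc J)) \<longlonglongrightarrow> 0" by (rule LIMSEQ_ignore_initial_segment)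
        then have "(\<lambda>M. u M t) \<longlonglongrightarrow> p (cis t) * P (cis t) / (1 - 0)"
          unfolding u_def by (intro tendsto_intros) (simp_all del: power_Suc)
        then show "(\<lambda>M. (cmod (u M t))\<^sup>2) \<longlonglongrightarrow> (cmod (p (cis t) * P (cis t)))\<^sup>2" by (intro tendsto_intros) simp
      qed
    qed
    then show ?thesis unfolding ueq nrm2_def .
  qed
  have lim1': "(\<lambda>M. (cmod (\<Sum>j<Suc (M + J). cnj (d (Suc (M + J)) j) * f (w (Suc (M + J)) j)))\<^sup>2) \<longlonglongrightarrow> (cmod (\<Sum>n<J. cnj (c n) * tc f n))\<^sup>2"
    using LIMSEQ_ignore_initial_segment[OF lim1, of "Suc J"] by (intro tendsto_intros) simp
  have "(cmod (\<Sum>n<J. cnj (c n) * tc f n))\<^sup>2 \<le> B * nrm2 (\<lambda>t. p (cis t) * P (cis t))"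
    by (rule LIMSEQ_le[OF lim1' tendsto_mult[OF tendsto_const lim2]]) (use B[OF win] in blast)
  then show ?thesis by (simp add: P_def)
qed

text \<open>Summation by parts with \<open>T (Suc n) - T n = D n\<close>, keeping the boundary
  term.\<close>

lemma abel_sum_of_squares:
  fixes D :: "nat \<Rightarrow> complex"
  defines "T \<equiv> \<lambda>k. \<Sum>n<k. D n"
  shows "(\<Sum>n<k. cnj (T (Suc n)) * (D n - D (Suc n))) = of_real (\<Sum>n<k. (cmod (D n))\<^sup>2) - cnj (T k) * D k"
proof (induction k)
  case 0
  then show ?case by (simp add: T_def)
next
  case (Suc k)
  have "cnj (T (Suc k)) = cnj (T k) + cnj (D k)" by (simp add: T_def)
  moreover have "of_real ((cmod (D k))\<^sup>2) = cnj (D k) * D k" by (simp only: complex_norm_square mult.commute)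
  ultimately show ?case unfolding sum.lessThan_Suc Suc of_real_add by (simp add: algebra_simps)
qed

text \<open>Forming partial sums divides a power series in \<open>y\<close> by \<open>1 - y\<close>,
  and \<open>z - \<zeta>\<close> is \<open>- \<zeta> * (1 - y)\<close>. So the linear factor
  recovers the numbers \<open>D n\<close>, up to one boundary term.\<close>

lemma linear_factor_times_partial_sums:
  fixes D :: "nat \<Rightarrow> complex"
  defines "T \<equiv> \<lambda>k. \<Sum>n<k. D n"
  assumes "z = \<zeta> * y"
  shows "(z - \<zeta>) * (\<Sum>n<k. T (Suc n) * y ^ n) = \<zeta> * (T k * y ^ k - (\<Sum>n<k. D n * y ^ n))"
proof (induction k)
  case 0
  then show ?case by (simp add: T_def)
next
  case (Suc k)
  have "T (Suc k) = T k + D k" by (simp add: T_def)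
  then show ?case unfolding sum.lessThan_Suc distrib_left Suc by (simp add: assms(2) algebra_simps)
qed

lemma le_of_square_le:
  fixes x K :: real assumes "x\<^sup>2 \<le> K * x" "0 \<le> x" "0 \<le> K" shows "x \<le> K"
proof (cases "x = 0")
  case False
  with assms show ?thesis by (simp add: power2_eq_square)
qed (use assms in simp)

text \<open>Testing against the partial sums of \<open>\<Phi> n - \<mu>\<close>, with \<open>\<mu>\<close> the mean of the \<open>\<Phi> n\<close>, turns the bound into
  one for the variance of the \<open>\<Phi> n\<close>.\<close>
lemma variance_bound:
  fixes x :: "nat \<Rightarrow> complex" and \<Phi> :: "nat \<Rightarrow> complex"
  assumes B: "\<And>J c. (cmod (\<Sum>n<J. cnj (c n) * x n))\<^sup>2 \<le> B * nrm2 (\<lambda>t. (cis t - \<zeta>) * (\<Sum>n<J. c n * cis t ^ n))"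
    and B0: "0 \<le> B" and z: "cmod \<zeta> = 1"
    and \<Phi>: "\<And>n. x n * \<zeta> ^ n = \<Phi> n - \<Phi> (Suc n)"
  shows "\<exists>\<mu>. (\<Sum>n<Suc J. (cmod (\<Phi> n - \<mu>))\<^sup>2) \<le> B * (2 * pi)"
proof -
  define \<mu> where "\<mu> = (\<Sum>n<Suc J. \<Phi> n) / of_nat (Suc J)"
  define D where "D = (\<lambda>n. \<Phi> n - \<mu>)"
  define T where "T = (\<lambda>k. \<Sum>n<k. D n)"
  \<comment> \<open>The powers of \<open>cnj \<zeta>\<close> rotate \<open>\<zeta>\<close> to 1, so
    that the factor \<open>cis t - \<zeta>\<close> undoes the partial summation.\<close>
  define c where "c = (\<lambda>n. T (Suc n) * cnj \<zeta> ^ n)"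
  define S where "S = (\<Sum>n<Suc J. (cmod (D n))\<^sup>2)"
  have zz: "\<zeta> * cnj \<zeta> = 1" using complex_norm_square[of \<zeta>] z by simp
  have "T (Suc J) = (\<Sum>n<Suc J. \<Phi> n) - of_nat (Suc J) * \<mu>" by (simp only: T_def D_def sum_subtractf sum_constant card_lessThan)
  also have "\<dots> = 0" unfolding \<mu>_def by (simp del: of_nat_Suc sum.lessThan_Suc)
  \<comment> \<open>Subtracting the mean makes the sum of all \<open>D n\<close> vanish. As a
    consequence the boundary terms of both summation lemmas supply exactly the missing summand with
    \<open>n = J\<close>.\<close>
  finally have TJ: "T J = - D J" by (simp add: T_def eq_neg_iff_add_eq_0)
  have "(\<Sum>n<J. cnj (c n) * x n) = (\<Sum>n<J. cnj (T (Suc n)) * (D n - D (Suc n)))"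
  proof (intro sum.cong refl)
    fix n
    have "cnj (c n) * x n = cnj (T (Suc n)) * (x n * \<zeta> ^ n)" by (simp add: c_def mult_ac)
    then show "cnj (c n) * x n = cnj (T (Suc n)) * (D n - D (Suc n))" unfolding \<Phi> by (simp add: D_def)
  qed
  also have "\<dots> = of_real (\<Sum>n<J. (cmod (D n))\<^sup>2) - cnj (T J) * D J" unfolding T_def by (rule abel_sum_of_squares)
  also have "\<dots> = of_real (\<Sum>n<J. (cmod (D n))\<^sup>2) + of_real ((cmod (D J))\<^sup>2)"
    unfolding TJ using complex_norm_square[of "D J"] by (simp add: mult.commute)
  also have "\<dots> = of_real S" by (simp add: S_def)
  finally have 1: "(\<Sum>n<J. cnj (c n) * x n) = of_real S" .
  have S0: "0 \<le> S" unfolding S_def by (intro sum_nonneg) simp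
  have 2: "(cis t - \<zeta>) * (\<Sum>n<J. c n * cis t ^ n) = (\<Sum>n<Suc J. (- (\<zeta> * D n * cnj \<zeta> ^ n)) * cis t ^ n)" for t
  proof -
    have y: "cis t = \<zeta> * (cnj \<zeta> * cis t)" using zz by (simp add: mult.assoc[symmetric])
    have "(\<Sum>n<J. c n * cis t ^ n) = (\<Sum>n<J. T (Suc n) * (cnj \<zeta> * cis t) ^ n)"
      by (intro sum.cong refl) (simp add: c_def power_mult_distrib)
    then have "(cis t - \<zeta>) * (\<Sum>n<J. c n * cis t ^ n) = \<zeta> * (T J * (cnj \<zeta> * cis t) ^ J - (\<Sum>n<J. D n * (cnj \<zeta> * cis t) ^ n))"
      unfolding T_def using linear_factor_times_partial_sums[OF y, of D J] by simp
    also have "\<dots> = - \<zeta> * (\<Sum>n<Suc J. D n * (cnj \<zeta> * cis t) ^ n)" unfolding TJ by (simp add: algebra_simps)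
    also have "\<dots> = (\<Sum>n<Suc J. (- (\<zeta> * D n * cnj \<zeta> ^ n)) * cis t ^ n)"
      unfolding sum_distrib_left by (intro sum.cong refl) (simp add: power_mult_distrib)
    finally show ?thesis .
  qed
  have "nrm2 (\<lambda>t. (cis t - \<zeta>) * (\<Sum>n<J. c n * cis t ^ n)) = 2 * pi * (\<Sum>n<Suc J. (cmod (- (\<zeta> * D n * cnj \<zeta> ^ n)))\<^sup>2)"
    unfolding 2 by (rule nrm2_polynomial)
  also have "(\<Sum>n<Suc J. (cmod (- (\<zeta> * D n * cnj \<zeta> ^ n)))\<^sup>2) = S"
    unfolding S_def by (intro sum.cong refl) (simp add: norm_mult norm_power z)
  finally have 3: "nrm2 (\<lambda>t. (cis t - \<zeta>) * (\<Sum>n<J. c n * cis t ^ n)) = 2 * pi * S" .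
  \<comment> \<open>The functional and the squared norm of the test polynomial are governed by the
    same sum of squares, which stands squared on the left only.\<close>
  have "S\<^sup>2 \<le> B * (2 * pi) * S" using B[of c J] unfolding 1 3 by (simp add: mult_ac)
  then have "S \<le> B * (2 * pi)" by (rule le_of_square_le) (use S0 B0 in auto)
  then show ?thesis unfolding S_def D_def by (intro exI[of _ \<mu>])
qed

text \<open>The centres stay bounded because of the summand with \<open>n = 0\<close>, so they have
  a limit point \<open>L\<close>; in finite sums the passage to the limit is harmless.\<close>

lemma summable_variance:
  fixes \<Phi> :: "nat \<Rightarrow> complex"
  assumes "\<And>J. \<exists>\<mu>. (\<Sum>n<Suc J. (cmod (\<Phi> n - \<mu>))\<^sup>2) \<le> K"
  shows "\<exists>L. summable (\<lambda>n. (cmod (\<Phi> n - L))\<^sup>2)"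
proof -
  obtain \<mu> where \<mu>: "\<And>J. (\<Sum>n<Suc J. (cmod (\<Phi> n - \<mu> J))\<^sup>2) \<le> K" using choice[of "\<lambda>J \<mu>. (\<Sum>n<Suc J. (cmod (\<Phi> n - \<mu>))\<^sup>2) \<le> K"] assms by auto
  have b: "cmod (\<mu> J) \<le> cmod (\<Phi> 0) + sqrt K" for J
  proof -
    have "(cmod (\<Phi> 0 - \<mu> J))\<^sup>2 \<le> (\<Sum>n<Suc J. (cmod (\<Phi> n - \<mu> J))\<^sup>2)" by (rule member_le_sum) auto
    also note \<mu>
    finally have "cmod (\<Phi> 0 - \<mu> J) \<le> sqrt K" by (rule real_le_rsqrt)
    then show ?thesis using norm_triangle_ineq2[of "\<mu> J" "\<Phi> 0"] by (simp add: norm_minus_commute)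
  qed
  then have "\<forall>J. \<mu> J \<in> cball 0 (cmod (\<Phi> 0) + sqrt K)" by simp
  then obtain L r where r: "strict_mono r" "(\<mu> \<circ> r) \<longlonglongrightarrow> L"
    using compact_cball[of "0::complex" "cmod (\<Phi> 0) + sqrt K"] unfolding compact_def by metis
  have "(\<Sum>n<N. (cmod (\<Phi> n - L))\<^sup>2) \<le> K" for N
  proof (rule LIMSEQ_le_const2)
    show "(\<lambda>j. \<Sum>n<N. (cmod (\<Phi> n - (\<mu> \<circ> r) j))\<^sup>2) \<longlonglongrightarrow> (\<Sum>n<N. (cmod (\<Phi> n - L))\<^sup>2)"
      by (intro tendsto_intros r)
    have "(\<Sum>n<N. (cmod (\<Phi> n - (\<mu> \<circ> r) j))\<^sup>2) \<le> K" if "N \<le> j" for j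
    proof -
      have "N \<le> Suc (r j)" using that seq_suble[OF r(1), of j] by simp
      then have "(\<Sum>n<N. (cmod (\<Phi> n - \<mu> (r j)))\<^sup>2) \<le> (\<Sum>n<Suc (r j). (cmod (\<Phi> n - \<mu> (r j)))\<^sup>2)"
        by (intro sum_mono2) auto
      also note \<mu>
      finally show ?thesis by simp
    qed
    then show "\<exists>M. \<forall>j\<ge>M. (\<Sum>n<N. (cmod (\<Phi> n - (\<mu> \<circ> r) j))\<^sup>2) \<le> K" by blast
  qed
  then have "summable (\<lambda>n. (cmod (\<Phi> n - L))\<^sup>2)" by (intro summableI_nonneg_bounded[of _ K]) auto
  then show ?thesis ..
qed

text \<open>Bounding \<open>pz\<close> by a constant gives holomorphy and, testing on the Taylor
  coefficients of \<open>f\<close> themselves, membership in \<open>H^2\<close>. For the condition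
  at \<open>\<zeta>\<close> only the other factors of \<open>pz\<close> are bounded by constants,
  and \<open>variance_bound\<close> takes care of \<open>z - \<zeta>\<close>.\<close>

lemma in_Dmu_from_szego_bound:
  assumes Z: "finite Z" "Z \<subseteq> sphere 0 1"
    and B: "\<And>n w c. (\<forall>i<n. w i \<in> ball 0 1) \<Longrightarrow> (cmod (\<Sum>i<n. cnj (c i) * f (w i)))\<^sup>2 \<le> B * nrm2 (\<lambda>t. pz Z (cis t) * kf n w c (cis t))"
    and B0: "0 \<le> B"
  shows "in_Dmu Z f"
proof -
  have bp: "bmf (\<lambda>t. pz Y (cis t))" for Y by (rule bmf_circle[OF pz_cont])
  have bP: "bmf (\<lambda>t. \<Sum>n<J. c n * cis t ^ n)" for J and c :: "nat \<Rightarrow> complex"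
    by (intro bmf_sum bmf_mult bmf_const bmf_cis_power)
  have up: "cmod (pz Y (cis t)) \<le> 2 ^ card Y" if "Y \<subseteq> sphere 0 1" for Y t using that by (intro pz_upper) auto
  define A where "A = B * (2 ^ card Z)\<^sup>2"
  have A0: "0 \<le> A" using B0 by (simp add: A_def)
  have hol: "f holomorphic_on ball 0 1"
  proof (rule holomorphic_from_szego_bound)
    fix n and w c :: "nat \<Rightarrow> complex" assume w: "\<forall>i<n. w i \<in> ball 0 1"
    have bk: "bmf (\<lambda>t. kf n w c (cis t))" by (rule bfun_bmf[OF bfun_kf]) (use w in blast)
    have "nrm2 (\<lambda>t. pz Z (cis t) * kf n w c (cis t)) \<le> (2 ^ card Z)\<^sup>2 * nrm2 (\<lambda>t. kf n w c (cis t))"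
      by (rule nrm2_mono[OF bmf_mult[OF bp bk] bk]) (simp add: norm_mult mult_right_mono up[OF Z(2)])
    then have "B * nrm2 (\<lambda>t. pz Z (cis t) * kf n w c (cis t)) \<le> A * nrm2 (\<lambda>t. kf n w c (cis t))"
      unfolding A_def mult.assoc by (rule mult_left_mono[OF _ B0])
    then show "(cmod (\<Sum>i<n. cnj (c i) * f (w i)))\<^sup>2 \<le> A * nrm2 (\<lambda>t. kf n w c (cis t))"
      using B[OF w, of c] by linarith
  qed (rule A0)
  have C: "(cmod (\<Sum>n<J. cnj (c n) * tc f n))\<^sup>2 \<le> B * nrm2 (\<lambda>t. pz Z (cis t) * (\<Sum>n<J. c n * cis t ^ n))" for J c
    by (rule coefficient_bound[OF B B0 hol pz_cont])
  have "(\<Sum>n<J. (cmod (tc f n))\<^sup>2) \<le> A * (2 * pi)" for J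
  proof -
    define S where "S = (\<Sum>n<J. (cmod (tc f n))\<^sup>2)"
    have "nrm2 (\<lambda>t. pz Z (cis t) * (\<Sum>n<J. tc f n * cis t ^ n)) \<le> (2 ^ card Z)\<^sup>2 * nrm2 (\<lambda>t. \<Sum>n<J. tc f n * cis t ^ n)"
      by (rule nrm2_mono[OF bmf_mult[OF bp bP] bP]) (simp add: norm_mult mult_right_mono up[OF Z(2)])
    then have n: "nrm2 (\<lambda>t. pz Z (cis t) * (\<Sum>n<J. tc f n * cis t ^ n)) \<le> (2 ^ card Z)\<^sup>2 * (2 * pi * S)"
      unfolding nrm2_polynomial S_def .
    have "(\<Sum>n<J. cnj (tc f n) * tc f n) = of_real S"
      unfolding S_def of_real_sum by (intro sum.cong refl) (simp only: complex_norm_square mult.commute)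
    then have "S\<^sup>2 \<le> B * nrm2 (\<lambda>t. pz Z (cis t) * (\<Sum>n<J. tc f n * cis t ^ n))" using C[of "tc f" J] by simp
    also have "\<dots> \<le> B * ((2 ^ card Z)\<^sup>2 * (2 * pi * S))" by (rule mult_left_mono[OF n B0])
    finally have "S\<^sup>2 \<le> A * (2 * pi) * S" by (simp add: A_def mult_ac)
    moreover have "0 \<le> S" unfolding S_def by (rule sum_nonneg) simp
    moreover have "0 \<le> A * (2 * pi)" using A0 by simp
    ultimately have "S \<le> A * (2 * pi)" by (rule le_of_square_le)
    then show ?thesis by (simp only: S_def)
  qed
  then have "summable (\<lambda>n. (cmod (tc f n))\<^sup>2)" by (intro summableI_nonneg_bounded[of _ "A * (2 * pi)"]) auto
  then have H2: "H2 f" using hol by (simp add: H2_iff)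
  have "dirfin \<zeta> f" if \<zeta>: "\<zeta> \<in> Z" for \<zeta>
  proof -
    have c1: "cmod \<zeta> = 1" using \<zeta> Z by auto
    define Y where "Y = Z - {\<zeta>}"
    have Y: "Y \<subseteq> sphere 0 1" using Z by (auto simp: Y_def)
    define A' where "A' = B * (2 ^ card Y)\<^sup>2"
    \<comment> \<open>As \<open>psum \<zeta> f 0 = 0\<close>, prefixing \<open>tc f 0\<close> makes
      consecutive differences equal to \<open>tc f n * \<zeta> ^ n\<close> from \<open>n = 0\<close>
      on.\<close>
    define \<Phi> where "\<Phi> = (\<lambda>n. case n of 0 \<Rightarrow> tc f 0 | Suc m \<Rightarrow> psum \<zeta> f m)"
    have C': "(cmod (\<Sum>n<J. cnj (c n) * tc f n))\<^sup>2 \<le> A' * nrm2 (\<lambda>t. (cis t - \<zeta>) * (\<Sum>n<J. c n * cis t ^ n))" for J c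
    proof -
      have bl: "bmf (\<lambda>t. (cis t - \<zeta>) * (\<Sum>n<J. c n * cis t ^ n))"
        using bmf_mult[OF bp[of "{\<zeta>}"] bP] by (simp add: pz_def)
      have "nrm2 (\<lambda>t. pz Z (cis t) * (\<Sum>n<J. c n * cis t ^ n)) \<le> (2 ^ card Y)\<^sup>2 * nrm2 (\<lambda>t. (cis t - \<zeta>) * (\<Sum>n<J. c n * cis t ^ n))"
      proof (rule nrm2_mono[OF bmf_mult[OF bp bP] bl], rule AE_I2)
        fix t
        have "cmod (pz Z (cis t) * (\<Sum>n<J. c n * cis t ^ n)) = cmod (pz Y (cis t)) * cmod ((cis t - \<zeta>) * (\<Sum>n<J. c n * cis t ^ n))"
          unfolding pz_remove[OF Z(1) \<zeta>] Y_def norm_mult by (simp only: mult_ac)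
        also have "\<dots> \<le> 2 ^ card Y * cmod ((cis t - \<zeta>) * (\<Sum>n<J. c n * cis t ^ n))" by (rule mult_right_mono[OF up[OF Y] norm_ge_zero])
        finally show "cmod (pz Z (cis t) * (\<Sum>n<J. c n * cis t ^ n)) \<le> 2 ^ card Y * cmod ((cis t - \<zeta>) * (\<Sum>n<J. c n * cis t ^ n))" .
      qed
      from mult_left_mono[OF this B0] show ?thesis using C[of c J] unfolding A'_def mult.assoc by linarith
    qed
    have "\<exists>L. summable (\<lambda>n. (cmod (\<Phi> n - L))\<^sup>2)"
    proof (rule summable_variance)
      fix J
      show "\<exists>\<mu>. (\<Sum>n<Suc J. (cmod (\<Phi> n - \<mu>))\<^sup>2) \<le> A' * (2 * pi)"
      proof (rule variance_bound[OF C' _ c1])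
        show "0 \<le> A'" using B0 by (simp add: A'_def)
        show "tc f n * \<zeta> ^ n = \<Phi> n - \<Phi> (Suc n)" for n
          by (cases n) (simp_all add: \<Phi>_def psum_def)
      qed
    qed
    then obtain L where "summable (\<lambda>n. (cmod (\<Phi> n - L))\<^sup>2)" ..
    then have "summable (\<lambda>n. (cmod (\<Phi> (Suc n) - L))\<^sup>2)" by (simp only: summable_Suc_iff[where f = "\<lambda>n. (cmod (\<Phi> n - L))\<^sup>2"])
    then have "summable (\<lambda>n. (cmod (psum \<zeta> f n - L))\<^sup>2)" by (simp add: \<Phi>_def)
    then show ?thesis unfolding dirfin_iff_summable[OF hol c1] ..
  qed
  then show ?thesis using H2 by (simp add: in_Dmu_iff[OF Z(1)])
qed

section \<open>From comparability to equality of the spaces\<close>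

lemma nrm2_bounded:
  assumes u: "bmf u" and C: "\<And>t. cmod (u t) \<le> C" shows "nrm2 u \<le> 2 * pi * C\<^sup>2"
proof -
  have "nrm2 u \<le> C\<^sup>2 * nrm2 (\<lambda>t. 1)" by (rule nrm2_mono[OF u bmf_const]) (use C in simp)
  also have "nrm2 (\<lambda>t. 1) = 2 * pi" unfolding nrm2_def by (simp only: norm_one one_power2 integral_TT_const) simp
  finally show ?thesis by (simp add: mult_ac)
qed

text \<open>Cauchy-Schwarz with the Szego kernel, which is at most 2 in modulus here. The constant
  that results is \<open>2 / pi\<close>, which is below 1.\<close>

lemma point_evaluation_half:
  fixes G :: "complex \<Rightarrow> complex"
  assumes G: "continuous_on (cball 0 1) G" "G holomorphic_on ball 0 1" and z: "cmod z \<le> 1 / 2"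
  shows "(cmod (G z))\<^sup>2 \<le> nrm2 (\<lambda>t. G (cis t))"
proof -
  have z1: "cmod z < 1" using z by simp
  have bs: "bmf (\<lambda>t. cnj (szego z (cis t)))"
    by (intro bmf_cnj bmf_circle holomorphic_on_imp_continuous_on) (rule holomorphic_on_subset[OF szego_hol[OF z1]], auto)
  have bG: "bmf (\<lambda>t. G (cis t))" by (rule bmf_circle[OF continuous_on_subset[OF G(1)]]) auto
  have "cmod (szego z (cis t)) \<le> 2" for t
  proof -
    have "1 / 2 \<le> cmod (1 - cnj z * cis t)" using z norm_triangle_ineq2[of 1 "cnj z * cis t"] by (simp add: norm_mult)
    then have "1 / cmod (1 - cnj z * cis t) \<le> 1 / (1 / 2)" by (intro divide_left_mono) auto
    then show ?thesis by (simp add: szego_def norm_divide)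
  qed
  then have s: "nrm2 (\<lambda>t. cnj (szego z (cis t))) \<le> 2 * pi * 2\<^sup>2" by (intro nrm2_bounded[OF bs]) simp
  have "2 * pi * cmod (G z) = cmod (integral\<^sup>L TT (\<lambda>t. G (cis t) * cnj (szego z (cis t))))"
    unfolding cauchy_circle[OF G z1] by (simp add: norm_mult)
  also have "\<dots> \<le> sqrt (nrm2 (\<lambda>t. G (cis t))) * sqrt (nrm2 (\<lambda>t. cnj (szego z (cis t))))" by (rule Cauchy_Schwarz_integral[OF bG bs])
  finally have "(2 * pi * cmod (G z))\<^sup>2 \<le> (sqrt (nrm2 (\<lambda>t. G (cis t))) * sqrt (nrm2 (\<lambda>t. cnj (szego z (cis t)))))\<^sup>2"
    by (rule power_mono) simp
  also have "\<dots> = nrm2 (\<lambda>t. G (cis t)) * nrm2 (\<lambda>t. cnj (szego z (cis t)))" by (simp only: power_mult_distrib real_sqrt_pow2 nrm2_nonneg)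
  also have "\<dots> \<le> nrm2 (\<lambda>t. G (cis t)) * (2 * pi * 2\<^sup>2)" by (rule mult_left_mono[OF s nrm2_nonneg])
  finally have "(4 * pi) * (pi * (cmod (G z))\<^sup>2) \<le> (4 * pi) * (2 * nrm2 (\<lambda>t. G (cis t)))" by (simp add: power_mult_distrib power2_eq_square mult_ac)
  then have "pi * (cmod (G z))\<^sup>2 \<le> 2 * nrm2 (\<lambda>t. G (cis t))" by (rule mult_left_le_imp_le) simp
  moreover have "2 * (cmod (G z))\<^sup>2 \<le> pi * (cmod (G z))\<^sup>2" by (intro mult_right_mono) (use pi_gt3 in auto)
  ultimately show ?thesis by linarith
qed

lemma in_Hb_iff:
  "in_Hb b f \<longleftrightarrow> (\<exists>C\<ge>0. \<forall>n w c. (\<forall>i<n. w i \<in> ball 0 1) \<longrightarrow> (cmod (\<Sum>i<n. cnj (c i) * f (w i)))\<^sup>2 \<le> C * Qb b n w c)"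
  unfolding in_Hb_def Qb_def ..

text \<open>The first summand of \<open>kernel_form_identity\<close> is bounded through
  \<open>mate\<close>. For the residual, \<open>nrm2_rsd\<close> and \<open>hankel_bound\<close>
  give a multiple of its own norm, which is then divided out.\<close>

lemma kernel_form_le:
  fixes b :: "complex \<Rightarrow> complex"
  assumes Z: "finite Z" "Z \<subseteq> sphere 0 1" and b: "bfun b bs"
    and bs1: "\<And>t. cmod (bs t) \<le> 1"
    and low: "\<And>\<zeta>. \<zeta> \<in> Z \<Longrightarrow> \<exists>\<epsilon>>0. \<forall>z\<in>ball 0 1. dist z \<zeta> < \<epsilon> \<longrightarrow> 1 / 2 \<le> cmod (b z)"
    and A: "0 \<le> A" and mate: "AE t in TT. 1 - (cmod (bs t))\<^sup>2 \<le> A * (cmod (pz Z (cis t)))\<^sup>2"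
  shows "\<exists>K\<ge>0. \<forall>n w c. (\<forall>i<n. w i \<in> ball 0 1) \<longrightarrow> Qb b n w c \<le> K * nrm2 (\<lambda>t. pz Z (cis t) * kf n w c (cis t))"
proof -
  \<comment> \<open>\<open>hankel_bound\<close> wants the first power of \<open>pz\<close>, so the
    other factor is bounded by \<open>2 ^ card Z\<close>.\<close>
  define A' where "A' = A * 2 ^ card Z"
  have A'0: "0 \<le> A'" using A by (simp add: A'_def)
  have mate': "AE t in TT. 1 - (cmod (bs t))\<^sup>2 \<le> A' * cmod (pz Z (cis t))"
    using mate
  proof (rule AE_mp, intro AE_I2 impI)
    fix t assume "1 - (cmod (bs t))\<^sup>2 \<le> A * (cmod (pz Z (cis t)))\<^sup>2"
    also have "\<dots> \<le> A * (2 ^ card Z * cmod (pz Z (cis t)))"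
      unfolding power2_eq_square using pz_upper[OF Z(2), of "cis t"] by (intro mult_left_mono mult_right_mono A) auto
    finally show "1 - (cmod (bs t))\<^sup>2 \<le> A' * cmod (pz Z (cis t))" by (simp add: A'_def mult_ac)
  qed
  obtain C where C: "0 \<le> C" "\<forall>k ks h hs. bfun k ks \<longrightarrow> bfun h hs \<longrightarrow>
     cmod (integral\<^sup>L TT (\<lambda>t. cnj (bs t) * (ks t * hs t))) \<le> C * (sqrt (nrm2 (\<lambda>t. pz Z (cis t) * ks t)) * sqrt (nrm2 hs))"
    using hankel_bound[OF Z b bs1 low A'0 mate'] by blast
  have "2 * pi * Qb b n w c \<le> (A + C\<^sup>2) * nrm2 (\<lambda>t. pz Z (cis t) * kf n w c (cis t))" if w: "\<forall>i<n. w i \<in> ball 0 1" for n w c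
  proof -
    have w': "\<And>i. i < n \<Longrightarrow> w i \<in> ball 0 1" using w by blast
    define R where "R = rsd b bs n w c"
    define Y where "Y = nrm2 (\<lambda>t. pz Z (cis t) * kf n w c (cis t))"
    have Y0: "0 \<le> Y" unfolding Y_def by (rule nrm2_nonneg)
    obtain h where h: "bfun h (\<lambda>t. cnj (R t))" using rsd_bfun[where n = n and w = w and c = c, OF w' b] unfolding R_def by blast
    have k: "bfun (kf n w c) (\<lambda>t. kf n w c (cis t))" by (rule bfun_kf) (rule w')
    have nR: "nrm2 (\<lambda>t. cnj (R t)) = nrm2 R" by (simp only: nrm2_def complex_mod_cnj)
    have "complex_of_real (nrm2 R) = integral\<^sup>L TT (\<lambda>t. cnj (bs t) * (kf n w c (cis t) * cnj (R t)))"
      unfolding R_def by (rule nrm2_rsd[where n = n and w = w and c = c, OF w' b])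
    then have "nrm2 R = cmod (integral\<^sup>L TT (\<lambda>t. cnj (bs t) * (kf n w c (cis t) * cnj (R t))))"
      using nrm2_nonneg[of R] by (metis norm_of_real abs_of_nonneg)
    also have "\<dots> \<le> C * (sqrt (nrm2 (\<lambda>t. pz Z (cis t) * kf n w c (cis t))) * sqrt (nrm2 (\<lambda>t. cnj (R t))))"
      by (rule C(2)[rule_format, OF k h])
    finally have "(nrm2 R)\<^sup>2 \<le> (C * (sqrt Y * sqrt (nrm2 R)))\<^sup>2" unfolding nR Y_def by (rule power_mono[OF _ nrm2_nonneg])
    also have "\<dots> = C\<^sup>2 * Y * nrm2 R" by (simp only: power_mult_distrib real_sqrt_pow2 nrm2_nonneg Y0 mult.assoc)
    finally have R: "nrm2 R \<le> C\<^sup>2 * Y" by (rule le_of_square_le) (use Y0 nrm2_nonneg in auto)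
    have bk: "bmf (\<lambda>t. kf n w c (cis t))" by (rule bfun_bmf[OF k])
    have bpk: "bmf (\<lambda>t. pz Z (cis t) * kf n w c (cis t))" by (rule bmf_mult[OF bfun_bmf[OF bfun_pz] bk])
    have "integral\<^sup>L TT (\<lambda>t. (1 - (cmod (bs t))\<^sup>2) * (cmod (kf n w c (cis t)))\<^sup>2) \<le> integral\<^sup>L TT (\<lambda>t. A * (cmod (pz Z (cis t) * kf n w c (cis t)))\<^sup>2)"
    proof (rule integral_mono_AE)
      show "integrable TT (\<lambda>t. (1 - (cmod (bs t))\<^sup>2) * (cmod (kf n w c (cis t)))\<^sup>2)"
        by (intro bmf_integrable bmf_mult bmf_diff bmf_const bmf_power2 bmf_norm bk bfun_bmf[OF b])
      show "integrable TT (\<lambda>t. A * (cmod (pz Z (cis t) * kf n w c (cis t)))\<^sup>2)"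
        by (intro bmf_integrable bmf_mult[OF bmf_const] bmf_power2 bmf_norm bpk)
      show "AE t in TT. (1 - (cmod (bs t))\<^sup>2) * (cmod (kf n w c (cis t)))\<^sup>2 \<le> A * (cmod (pz Z (cis t) * kf n w c (cis t)))\<^sup>2"
        using mate by (rule AE_mp) (intro AE_I2 impI, simp add: norm_mult power_mult_distrib mult_right_mono mult.assoc[symmetric])
    qed
    also have "\<dots> = A * Y" unfolding Y_def nrm2_def by (rule integral_mult_right_zero)
    finally show ?thesis using R kernel_form_identity[where n = n and w = w and c = c, OF w' b]
      unfolding R_def Y_def[symmetric] distrib_right by linarith
  qed
  then have "Qb b n w c \<le> ((A + C\<^sup>2) / (2 * pi)) * nrm2 (\<lambda>t. pz Z (cis t) * kf n w c (cis t))" if "\<forall>i<n. w i \<in> ball 0 1" for n w c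
    using that by (simp add: field_simps)
  moreover have "0 \<le> (A + C\<^sup>2) / (2 * pi)" using A by simp
  ultimately show ?thesis by (intro exI[of _ "(A + C\<^sup>2) / (2 * pi)"]) simp
qed

lemma in_Hb_imp_in_Dmu:
  fixes b :: "complex \<Rightarrow> complex"
  assumes Z: "finite Z" "Z \<subseteq> sphere 0 1" and b: "bfun b bs"
    and bs1: "\<And>t. cmod (bs t) \<le> 1"
    and low: "\<And>\<zeta>. \<zeta> \<in> Z \<Longrightarrow> \<exists>\<epsilon>>0. \<forall>z\<in>ball 0 1. dist z \<zeta> < \<epsilon> \<longrightarrow> 1 / 2 \<le> cmod (b z)"
    and A: "0 \<le> A" and mate: "AE t in TT. 1 - (cmod (bs t))\<^sup>2 \<le> A * (cmod (pz Z (cis t)))\<^sup>2"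
    and f: "in_Hb b f"
  shows "in_Dmu Z f"
proof -
  obtain K where K: "0 \<le> K" "\<forall>n w c. (\<forall>i<n. w i \<in> ball 0 1) \<longrightarrow> Qb b n w c \<le> K * nrm2 (\<lambda>t. pz Z (cis t) * kf n w c (cis t))"
    using kernel_form_le[OF Z b bs1 low A mate] by blast
  obtain C where C: "0 \<le> C" "\<forall>n w c. (\<forall>i<n. w i \<in> ball 0 1) \<longrightarrow> (cmod (\<Sum>i<n. cnj (c i) * f (w i)))\<^sup>2 \<le> C * Qb b n w c"
    using f unfolding in_Hb_iff by blast
  show ?thesis
  proof (rule in_Dmu_from_szego_bound[OF Z])
    fix n and w c :: "nat \<Rightarrow> complex" assume w: "\<forall>i<n. w i \<in> ball 0 1"
    have "C * Qb b n w c \<le> C * (K * nrm2 (\<lambda>t. pz Z (cis t) * kf n w c (cis t)))" by (rule mult_left_mono[OF K(2)[THEN spec[of _ n], THEN spec[of _ w], THEN spec[of _ c], THEN mp, OF w] C(1)])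
    then show "(cmod (\<Sum>i<n. cnj (c i) * f (w i)))\<^sup>2 \<le> C * K * nrm2 (\<lambda>t. pz Z (cis t) * kf n w c (cis t))"
      using C(2)[THEN spec[of _ n], THEN spec[of _ w], THEN spec[of _ c], THEN mp, OF w] unfolding mult.assoc by linarith
  qed (use C(1) K(1) in simp)
qed

text \<open>In the integral of \<open>pz Z * G\<close> against \<open>cnj k\<close> the factor
  \<open>pz Z\<close> is moved to \<open>k\<close> before Cauchy-Schwarz is applied. As
  \<open>G\<close> may be unbounded, it is first replaced by its dilates; \<open>pz Z\<close> stays
  undilated so that the weight is the right one.\<close>

lemma szego_bound_multiple:
  assumes Z: "finite Z" "Z \<subseteq> sphere 0 1" and G: "H2 G"
  shows "\<exists>M\<ge>0. \<forall>n w c. (\<forall>i<n. w i \<in> ball 0 1) \<longrightarrow>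
    (cmod (\<Sum>i<n. cnj (c i) * (pz Z (w i) * G (w i))))\<^sup>2 \<le> M * nrm2 (\<lambda>t. pz Z (cis t) * kf n w c (cis t))"
proof -
  obtain M where M: "\<And>r. 0 \<le> r \<Longrightarrow> r < 1 \<Longrightarrow> nrm2 (\<lambda>t. G (complex_of_real r * cis t)) \<le> M"
    using G unfolding H2_nrm2 by blast
  have M0: "0 \<le> M" using M[of 0] nrm2_nonneg[of "\<lambda>t. G (complex_of_real 0 * cis t)"] by simp
  have hol: "G holomorphic_on ball 0 1" by (rule H2_hol[OF G])
  have "(cmod (\<Sum>i<n. cnj (c i) * (pz Z (w i) * G (w i))))\<^sup>2 \<le> (M / (2 * pi)\<^sup>2) * nrm2 (\<lambda>t. pz Z (cis t) * kf n w c (cis t))"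
    if w: "\<forall>i<n. w i \<in> ball 0 1" for n w c
  proof (rule LIMSEQ_le_const2)
    define Y where "Y = nrm2 (\<lambda>t. pz Z (cis t) * kf n w c (cis t))"
    have Y0: "0 \<le> Y" unfolding Y_def by (rule nrm2_nonneg)
    have rl: "rad \<longlonglongrightarrow> 1" using filterlim_mono[OF rad_lim at_le order_refl, of UNIV] by (simp add: filterlim_at)
    show "(\<lambda>m. (cmod (\<Sum>i<n. cnj (c i) * (pz Z (w i) * G (complex_of_real (rad m) * w i))))\<^sup>2) \<longlonglongrightarrow> (cmod (\<Sum>i<n. cnj (c i) * (pz Z (w i) * G (w i))))\<^sup>2"
    proof (intro tendsto_intros)
      fix i assume "i \<in> {..<n}"
      then have "w i \<in> ball 0 1" using w by simp
      then have "isCont G (w i)" using holomorphic_on_imp_continuous_on[OF hol] continuous_on_eq_continuous_at[OF open_ball] by blast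
      moreover have "(\<lambda>m. complex_of_real (rad m) * w i) \<longlonglongrightarrow> complex_of_real 1 * w i" by (intro tendsto_intros rl)
      ultimately show "(\<lambda>m. G (complex_of_real (rad m) * w i)) \<longlonglongrightarrow> G (w i)" by (intro isCont_tendsto_compose[of _ G]) auto
    qed
    have "(cmod (\<Sum>i<n. cnj (c i) * (pz Z (w i) * G (complex_of_real (rad m) * w i))))\<^sup>2 \<le> M / (2 * pi)\<^sup>2 * Y" for m
    proof -
      define Gr where "Gr = (\<lambda>z. G (complex_of_real (rad m) * z))"
      have inb: "complex_of_real (rad m) * z \<in> ball 0 1" if "cmod z \<le> 1" for z
        using mult_left_mono[OF that, of "rad m"] rad[of m] by (simp add: norm_mult)
      have cG: "continuous_on (cball 0 1) Gr" unfolding Gr_def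
        by (rule continuous_on_compose2[OF holomorphic_on_imp_continuous_on[OF hol]]) (use inb in \<open>auto intro!: continuous_intros\<close>)
      have hG: "Gr holomorphic_on ball 0 1" unfolding Gr_def
        by (rule holomorphic_on_compose_gen[unfolded o_def, OF _ hol]) (use inb in \<open>auto intro!: holomorphic_intros\<close>)
      have bG: "bfun Gr (\<lambda>t. Gr (cis t))" by (rule bfun_continuous[OF hG cG])
      have bk: "bmf (\<lambda>t. kf n w c (cis t))" by (rule bfun_bmf[OF bfun_kf]) (use w in blast)
      have bpk: "bmf (\<lambda>t. pz Z (cis t) * cnj (kf n w c (cis t)))" by (rule bmf_mult[OF bfun_bmf[OF bfun_pz] bmf_cnj[OF bk]])
      have nY: "nrm2 (\<lambda>t. pz Z (cis t) * cnj (kf n w c (cis t))) = Y" unfolding Y_def nrm2_def by (simp only: norm_mult complex_mod_cnj)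
      have "2 * pi * (\<Sum>i<n. cnj (c i) * (pz Z (w i) * Gr (w i))) = integral\<^sup>L TT (\<lambda>t. pz Z (cis t) * Gr (cis t) * cnj (kf n w c (cis t)))"
        by (rule integral_cnj_kf[OF _ bfun_mult[OF bfun_pz bG], symmetric]) (use w in blast)
      also have "\<dots> = integral\<^sup>L TT (\<lambda>t. Gr (cis t) * (pz Z (cis t) * cnj (kf n w c (cis t))))" by (simp only: mult_ac)
      finally have "2 * pi * cmod (\<Sum>i<n. cnj (c i) * (pz Z (w i) * Gr (w i))) = cmod (integral\<^sup>L TT (\<lambda>t. Gr (cis t) * (pz Z (cis t) * cnj (kf n w c (cis t)))))"
        by (drule_tac arg_cong[where f = cmod]) (simp add: norm_mult)
      also have "\<dots> \<le> sqrt (nrm2 (\<lambda>t. Gr (cis t))) * sqrt Y"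
        using Cauchy_Schwarz_integral[OF bfun_bmf[OF bG] bpk] unfolding nY .
      finally have "(2 * pi * cmod (\<Sum>i<n. cnj (c i) * (pz Z (w i) * Gr (w i))))\<^sup>2 \<le> (sqrt (nrm2 (\<lambda>t. Gr (cis t))) * sqrt Y)\<^sup>2"
        by (rule power_mono) simp
      also have "\<dots> = nrm2 (\<lambda>t. Gr (cis t)) * Y" by (simp only: power_mult_distrib real_sqrt_pow2 nrm2_nonneg Y0)
      also have "\<dots> \<le> M * Y" unfolding Gr_def by (rule mult_right_mono[OF M Y0]) (use rad in auto)
      finally show ?thesis unfolding Gr_def by (simp add: power_mult_distrib field_simps)
    qed
    then show "\<exists>N. \<forall>m\<ge>N. (cmod (\<Sum>i<n. cnj (c i) * (pz Z (w i) * G (complex_of_real (rad m) * w i))))\<^sup>2 \<le> M / (2 * pi)\<^sup>2 * nrm2 (\<lambda>t. pz Z (cis t) * kf n w c (cis t))"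
      unfolding Y_def by blast
  qed
  moreover have "0 \<le> M / (2 * pi)\<^sup>2" using M0 by simp
  ultimately show ?thesis by (intro exI[of _ "M / (2 * pi)\<^sup>2"]) blast
qed

text \<open>An entire \<open>q\<close> extends beyond the disc: \<open>q w\<close> is the value at
  \<open>w / 2\<close> of the dilate \<open>q (2 * z)\<close>. The Szego combination at the points
  \<open>w i / 2\<close> takes on the unit circle the values that \<open>k\<close> takes on the
  circle of radius 1/2. There \<open>pz\<close> is bounded below, and point evaluation is bounded by
  the norm of \<open>pz Z * k\<close>.\<close>

lemma szego_bound_entire:
  assumes Z: "finite Z" "Z \<subseteq> sphere 0 1" and q: "q holomorphic_on UNIV"
  shows "\<exists>M\<ge>0. \<forall>n w c. (\<forall>i<n. w i \<in> ball 0 1) \<longrightarrow>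
    (cmod (\<Sum>i<n. cnj (c i) * q (w i)))\<^sup>2 \<le> M * nrm2 (\<lambda>t. pz Z (cis t) * kf n w c (cis t))"
proof -
  have hq: "(\<lambda>z. q (2 * z)) holomorphic_on S" for S
    by (rule holomorphic_on_compose_gen[unfolded o_def, OF _ q]) (auto intro!: holomorphic_intros)
  have cq: "continuous_on S (\<lambda>z. q (2 * z))" for S by (rule holomorphic_on_imp_continuous_on[OF hq])
  have bq: "bfun (\<lambda>z. q (2 * z)) (\<lambda>t. q (2 * cis t))" by (rule bfun_continuous[OF hq cq])
  define N where "N = nrm2 (\<lambda>t. q (2 * cis t))"
  define L :: real where "L = 2 ^ card Z"
  have N0: "0 \<le> N" unfolding N_def by (rule nrm2_nonneg)
  have "(cmod (\<Sum>i<n. cnj (c i) * q (w i)))\<^sup>2 \<le> (N * L\<^sup>2) * nrm2 (\<lambda>t. pz Z (cis t) * kf n w c (cis t))"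
    if w: "\<forall>i<n. w i \<in> ball 0 1" for n w c
  proof -
    define Y where "Y = nrm2 (\<lambda>t. pz Z (cis t) * kf n w c (cis t))"
    have Y0: "0 \<le> Y" unfolding Y_def by (rule nrm2_nonneg)
    define w' where "w' = (\<lambda>i. w i / 2)"
    have w': "w' i \<in> ball 0 1" if "i < n" for i using w that by (auto simp: w'_def norm_divide)
    have kw: "kf n w' c z = kf n w c (z / 2)" for z by (simp add: kf_def szego_def w'_def)
    have hk: "kf n w c holomorphic_on cball 0 1" by (rule kf_hol) (use w in blast)
    have k: "cmod (kf n w' c (cis t)) \<le> L * sqrt Y" for t
    proof -
      let ?z = "cis t / 2"
      have "(cmod (pz Z ?z * kf n w c ?z))\<^sup>2 \<le> Y" unfolding Y_def
        by (rule point_evaluation_half)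
          (auto intro!: continuous_intros holomorphic_intros pz_cont pz_hol holomorphic_on_imp_continuous_on[OF hk] holomorphic_on_subset[OF hk] simp: norm_divide)
      then have 1: "cmod (pz Z ?z) * cmod (kf n w c ?z) \<le> sqrt Y" unfolding norm_mult by (rule real_le_rsqrt)
      have "(1 / 2) ^ card Z \<le> cmod (pz Z ?z)" using pz_lower[OF Z(2), of ?z] by (simp add: norm_divide)
      then have "(1 / 2) ^ card Z * cmod (kf n w c ?z) \<le> sqrt Y" using order_trans[OF mult_right_mono[OF _ norm_ge_zero] 1] by blast
      then have "L * ((1 / 2) ^ card Z * cmod (kf n w c ?z)) \<le> L * sqrt Y" by (rule mult_left_mono) (simp add: L_def)
      moreover have "L * (1 / 2) ^ card Z = 1" by (simp add: L_def flip: power_mult_distrib)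
      ultimately show ?thesis unfolding kw by (simp add: mult.assoc[symmetric])
    qed
    have bk: "bmf (\<lambda>t. kf n w' c (cis t))" by (rule bfun_bmf[OF bfun_kf]) (rule w')
    have nk: "nrm2 (\<lambda>t. cnj (kf n w' c (cis t))) \<le> 2 * pi * (L * sqrt Y)\<^sup>2"
      by (rule nrm2_bounded[OF bmf_cnj[OF bk]]) (simp only: complex_mod_cnj k)
    have "2 * pi * (\<Sum>i<n. cnj (c i) * q (w i)) = integral\<^sup>L TT (\<lambda>t. q (2 * cis t) * cnj (kf n w' c (cis t)))"
      using integral_cnj_kf[where n = n and w = w' and c = c, OF w' bq] by (simp add: w'_def)
    then have "2 * pi * cmod (\<Sum>i<n. cnj (c i) * q (w i)) = cmod (integral\<^sup>L TT (\<lambda>t. q (2 * cis t) * cnj (kf n w' c (cis t))))"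
      by (drule_tac arg_cong[where f = cmod]) (simp add: norm_mult)
    also have "\<dots> \<le> sqrt N * sqrt (nrm2 (\<lambda>t. cnj (kf n w' c (cis t))))"
      unfolding N_def by (rule Cauchy_Schwarz_integral[OF bfun_bmf[OF bq] bmf_cnj[OF bk]])
    finally have "(2 * pi * cmod (\<Sum>i<n. cnj (c i) * q (w i)))\<^sup>2 \<le> (sqrt N * sqrt (nrm2 (\<lambda>t. cnj (kf n w' c (cis t)))))\<^sup>2"
      by (rule power_mono) simp
    also have "\<dots> = N * nrm2 (\<lambda>t. cnj (kf n w' c (cis t)))" by (simp only: power_mult_distrib real_sqrt_pow2 nrm2_nonneg N0)
    also have "\<dots> \<le> N * (2 * pi * (L * sqrt Y)\<^sup>2)" by (rule mult_left_mono[OF nk N0])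
    also have "\<dots> = 2 * pi * (N * L\<^sup>2 * Y)" by (simp only: power_mult_distrib real_sqrt_pow2 Y0 mult_ac)
    finally have "(2 * pi) * (2 * pi * (cmod (\<Sum>i<n. cnj (c i) * q (w i)))\<^sup>2) \<le> (2 * pi) * (N * L\<^sup>2 * Y)"
      by (simp add: power_mult_distrib power2_eq_square mult_ac)
    then have "2 * pi * (cmod (\<Sum>i<n. cnj (c i) * q (w i)))\<^sup>2 \<le> N * L\<^sup>2 * Y" by (rule mult_left_le_imp_le) simp
    moreover have "1 * (cmod (\<Sum>i<n. cnj (c i) * q (w i)))\<^sup>2 \<le> 2 * pi * (cmod (\<Sum>i<n. cnj (c i) * q (w i)))\<^sup>2"
      by (rule mult_right_mono) (use pi_gt3 in auto)
    ultimately show ?thesis unfolding Y_def by linarith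
  qed
  moreover have "0 \<le> N * L\<^sup>2" using N0 by simp
  ultimately show ?thesis by (intro exI[of _ "N * L\<^sup>2"]) blast
qed

text \<open>The first summand of \<open>kernel_form_identity\<close> alone bounds \<open>Qb\<close>
  below by a multiple of the squared norm of \<open>pz Z * k\<close>, which in turn controls both
  parts of the decomposition of \<open>f\<close>.\<close>

lemma in_Dmu_imp_in_Hb:
  fixes b :: "complex \<Rightarrow> complex"
  assumes Z: "finite Z" "Z \<subseteq> sphere 0 1" and b: "bfun b bs"
    and d: "0 < \<delta>" and mate: "AE t in TT. \<delta> * (cmod (pz Z (cis t)))\<^sup>2 \<le> 1 - (cmod (bs t))\<^sup>2"
    and f: "in_Dmu Z f"
  shows "in_Hb b f"
proof -
  obtain q G where q: "q holomorphic_on UNIV" and G: "H2 G" and fq: "\<forall>z\<in>ball 0 1. f z = q z + pz Z z * G z"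
    using in_Dmu_decomposition[OF Z f] by blast
  obtain M1 where M1: "0 \<le> M1" "\<forall>n w c. (\<forall>i<n. w i \<in> ball 0 1) \<longrightarrow>
    (cmod (\<Sum>i<n. cnj (c i) * q (w i)))\<^sup>2 \<le> M1 * nrm2 (\<lambda>t. pz Z (cis t) * kf n w c (cis t))" using szego_bound_entire[OF Z q] by blast
  obtain M2 where M2: "0 \<le> M2" "\<forall>n w c. (\<forall>i<n. w i \<in> ball 0 1) \<longrightarrow>
    (cmod (\<Sum>i<n. cnj (c i) * (pz Z (w i) * G (w i))))\<^sup>2 \<le> M2 * nrm2 (\<lambda>t. pz Z (cis t) * kf n w c (cis t))" using szego_bound_multiple[OF Z G] by blast
  define M where "M = 2 * M1 + 2 * M2"
  have M0: "0 \<le> M" using M1(1) M2(1) by (simp add: M_def)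
  have "(cmod (\<Sum>i<n. cnj (c i) * f (w i)))\<^sup>2 \<le> (M * (2 * pi / \<delta>)) * Qb b n w c" if w: "\<forall>i<n. w i \<in> ball 0 1" for n w c
  proof -
    have w': "\<And>i. i < n \<Longrightarrow> w i \<in> ball 0 1" using w by blast
    define Y where "Y = nrm2 (\<lambda>t. pz Z (cis t) * kf n w c (cis t))"
    have bk: "bmf (\<lambda>t. kf n w c (cis t))" by (rule bfun_bmf[OF bfun_kf]) (rule w')
    have bpk: "bmf (\<lambda>t. pz Z (cis t) * kf n w c (cis t))" by (rule bmf_mult[OF bfun_bmf[OF bfun_pz] bk])
    have "\<delta> * Y = integral\<^sup>L TT (\<lambda>t. \<delta> * (cmod (pz Z (cis t) * kf n w c (cis t)))\<^sup>2)"
      unfolding Y_def nrm2_def by (rule integral_mult_right_zero[symmetric])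
    also have "\<dots> \<le> integral\<^sup>L TT (\<lambda>t. (1 - (cmod (bs t))\<^sup>2) * (cmod (kf n w c (cis t)))\<^sup>2)"
    proof (rule integral_mono_AE)
      show "integrable TT (\<lambda>t. (1 - (cmod (bs t))\<^sup>2) * (cmod (kf n w c (cis t)))\<^sup>2)"
        by (intro bmf_integrable bmf_mult bmf_diff bmf_const bmf_power2 bmf_norm bk bfun_bmf[OF b])
      show "integrable TT (\<lambda>t. \<delta> * (cmod (pz Z (cis t) * kf n w c (cis t)))\<^sup>2)"
        by (intro bmf_integrable bmf_mult[OF bmf_const] bmf_power2 bmf_norm bpk)
      show "AE t in TT. \<delta> * (cmod (pz Z (cis t) * kf n w c (cis t)))\<^sup>2 \<le> (1 - (cmod (bs t))\<^sup>2) * (cmod (kf n w c (cis t)))\<^sup>2"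
        using mate by (rule AE_mp) (intro AE_I2 impI, simp add: norm_mult power_mult_distrib mult_right_mono mult.assoc[symmetric])
    qed
    finally have "\<delta> * Y \<le> 2 * pi * Qb b n w c"
      using kernel_form_identity[where n = n and w = w and c = c, OF w' b] nrm2_nonneg[of "rsd b bs n w c"] by linarith
    then have Y: "Y \<le> 2 * pi / \<delta> * Qb b n w c" using d by (simp add: field_simps)
    define s1 where "s1 = (\<Sum>i<n. cnj (c i) * q (w i))"
    define s2 where "s2 = (\<Sum>i<n. cnj (c i) * (pz Z (w i) * G (w i)))"
    have "(\<Sum>i<n. cnj (c i) * f (w i)) = s1 + s2"
      unfolding s1_def s2_def sum.distrib[symmetric] by (intro sum.cong refl) (use w fq in \<open>simp add: distrib_left\<close>)
    then have "(cmod (\<Sum>i<n. cnj (c i) * f (w i)))\<^sup>2 \<le> (cmod s1 + cmod s2)\<^sup>2" by (simp add: norm_triangle_ineq power_mono)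
    also have "\<dots> \<le> 2 * (cmod s1)\<^sup>2 + 2 * (cmod s2)\<^sup>2" using sum_squares_bound[of "cmod s1" "cmod s2"] by (simp add: power2_sum)
    also have "\<dots> \<le> 2 * (M1 * Y) + 2 * (M2 * Y)"
      using M1(2)[THEN spec[of _ n], THEN spec[of _ w], THEN spec[of _ c], THEN mp, OF w] M2(2)[THEN spec[of _ n], THEN spec[of _ w], THEN spec[of _ c], THEN mp, OF w]
      unfolding s1_def s2_def Y_def by linarith
    also have "\<dots> = M * Y" by (simp add: M_def algebra_simps)
    also have "\<dots> \<le> M * (2 * pi / \<delta> * Qb b n w c)" by (rule mult_left_mono[OF Y M0])
    finally show ?thesis by (simp only: mult.assoc)
  qed
  moreover have "0 \<le> M * (2 * pi / \<delta>)" using M0 d by simp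
  ultimately show ?thesis unfolding in_Hb_iff by (intro exI[of _ "M * (2 * pi / \<delta>)"]) blast
qed

section \<open>From equality of the spaces to pointwise bounds\<close>

text \<open>If \<open>\<rho> \<kappa>\<close> is unbounded, take points with \<open>\<rho> \<kappa> > 4 ^ m\<close> and coefficients \<open>\<plusminus> 3 ^ -m\<close>, each sign chosen so that the new term does
  not cancel the previous ones at the new point.\<close>
lemma gliding_hump:
  fixes s :: "'a \<Rightarrow> 'a \<Rightarrow> complex" and \<kappa> \<rho> :: "'a \<Rightarrow> real"
  assumes le: "\<And>w z. w \<in> S \<Longrightarrow> z \<in> S \<Longrightarrow> cmod (s w z) \<le> \<kappa> z" and eq: "\<And>z. z \<in> S \<Longrightarrow> cmod (s z z) = \<kappa> z"
    and l0: "\<And>z. z \<in> S \<Longrightarrow> 0 \<le> \<rho> z"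
    and bd: "\<And>w c. (\<And>m::nat. w m \<in> S) \<Longrightarrow> summable (\<lambda>m. cmod (c m)) \<Longrightarrow> \<exists>C. \<forall>z\<in>S. \<rho> z * cmod (\<Sum>m. c m * s (w m) z) \<le> C"
  shows "\<exists>C. \<forall>z\<in>S. \<rho> z * \<kappa> z \<le> C"
proof (rule ccontr)
  assume "\<not> (\<exists>C. \<forall>z\<in>S. \<rho> z * \<kappa> z \<le> C)"
  then have "\<exists>z. z \<in> S \<and> C < \<rho> z * \<kappa> z" for C by (meson not_le)
  then obtain p where p: "\<And>C. p C \<in> S \<and> C < \<rho> (p C) * \<kappa> (p C)" by metis
  define w where "w = (\<lambda>m::nat. p (4 ^ m))"
  have wS: "w m \<in> S" and wl: "4 ^ m < \<rho> (w m) * \<kappa> (w m)" for m using p by (auto simp: w_def)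
  define E where "E = (\<lambda>m (G :: 'a \<Rightarrow> complex). if (1 / 3) ^ m * \<kappa> (w m) \<le> cmod (G (w m) + complex_of_real ((1 / 3) ^ m) * s (w m) (w m)) then complex_of_real ((1 / 3) ^ m) else - complex_of_real ((1 / 3) ^ m))"
  define F where "F = rec_nat (\<lambda>z::'a. 0::complex) (\<lambda>m G z. G z + E m G * s (w m) z)"
  define c where "c = (\<lambda>m. E m (F m))"
  have FS: "F (Suc m) z = F m z + c m * s (w m) z" for m z by (simp add: F_def c_def)
  have F: "F n z = (\<Sum>m<n. c m * s (w m) z)" for n z
    by (induction n) (simp add: F_def, simp only: FS sum.lessThan_Suc)
  have cn: "cmod (c m) = (1 / 3) ^ m" for m by (simp add: c_def E_def norm_power norm_divide)
  have big: "(1 / 3) ^ m * \<kappa> (w m) \<le> cmod (F (Suc m) (w m))" for m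
  proof (cases "(1 / 3) ^ m * \<kappa> (w m) \<le> cmod (F m (w m) + complex_of_real ((1 / 3) ^ m) * s (w m) (w m))")
    case True
    then show ?thesis by (simp only: FS c_def E_def if_True)
  next
    case False
    define x where "x = F m (w m)"
    define y where "y = complex_of_real ((1 / 3) ^ m) * s (w m) (w m)"
    have y: "cmod y = (1 / 3) ^ m * \<kappa> (w m)" using eq[OF wS[of m]] by (simp add: y_def norm_mult norm_power)
    \<comment> \<open>At least one of \<open>x + y\<close> and \<open>x - y\<close> has modulus no
      smaller than that of \<open>y\<close>, and the sign in \<open>E\<close> selects it.\<close>
    have "2 * cmod y \<le> cmod (x + y) + cmod (x - y)"
      using norm_triangle_ineq4[of "x + y" "x - y"] by (simp add: norm_mult flip: mult_2)
    moreover have "F (Suc m) (w m) = x - y" using False by (simp only: FS c_def E_def if_False x_def y_def) simp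
    ultimately show ?thesis using False y by (simp only: x_def[symmetric] y_def[symmetric])
  qed
  have sg: "summable (\<lambda>m. (1 / 3 :: real) ^ m)" by (rule summable_geometric) simp
  then have sc: "summable (\<lambda>m. cmod (c m))" by (simp only: cn)
  obtain C where C: "\<forall>z\<in>S. \<rho> z * cmod (\<Sum>m. c m * s (w m) z) \<le> C" using bd[of w c] wS sc by blast
  have lower: "(1 / 3) ^ m * \<kappa> (w m) / 2 \<le> cmod (\<Sum>i. c i * s (w i) (w m))" for m
  proof -
    have bdd: "norm (c i * s (w i) (w m)) \<le> (1 / 3) ^ i * \<kappa> (w m)" for i
      unfolding norm_mult cn by (intro mult_left_mono le wS) simp
    have s1: "summable (\<lambda>i. c i * s (w i) (w m))"
      by (rule summable_comparison_test'[OF summable_mult2[OF sg, of "\<kappa> (w m)"], of 0]) (rule bdd)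
    have sgm: "summable (\<lambda>i. (1 / 3) ^ (i + Suc m) * \<kappa> (w m))"
      using summable_ignore_initial_segment[OF summable_mult2[OF sg, of "\<kappa> (w m)"], of "Suc m"] .
    \<comment> \<open>The coefficients after \<open>m\<close> sum to \<open>(1 / 3) ^ m / 2\<close>,
      so later terms can destroy at most half of what the first \<open>Suc m\<close> terms secure at
      \<open>w m\<close>.\<close>
    have "cmod (\<Sum>i. c (i + Suc m) * s (w (i + Suc m)) (w m)) \<le> (\<Sum>i. (1 / 3) ^ (i + Suc m) * \<kappa> (w m))"
      by (rule norm_suminf_le[OF _ sgm]) (rule bdd)
    also have "(\<Sum>i. (1 / 3) ^ (i + Suc m) * \<kappa> (w m)) = (\<Sum>i. (1 / 3) ^ i * ((1 / 3) ^ Suc m * \<kappa> (w m)))"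
      by (simp only: power_add mult.assoc)
    also have "\<dots> = (\<Sum>i. (1 / 3) ^ i) * ((1 / 3) ^ Suc m * \<kappa> (w m))" by (rule suminf_mult2[OF sg, symmetric])
    also have "\<dots> = (1 / 3) ^ m * \<kappa> (w m) / 2" by (simp add: suminf_geometric)
    finally have t: "cmod (\<Sum>i. c (i + Suc m) * s (w (i + Suc m)) (w m)) \<le> (1 / 3) ^ m * \<kappa> (w m) / 2" .
    have "(\<Sum>i. c i * s (w i) (w m)) = (\<Sum>i. c (i + Suc m) * s (w (i + Suc m)) (w m)) + F (Suc m) (w m)"
      unfolding F by (rule suminf_split_initial_segment[OF s1])
    then show ?thesis using t big[of m] norm_triangle_ineq2[of "F (Suc m) (w m)" "- (\<Sum>i. c (i + Suc m) * s (w (i + Suc m)) (w m))"]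
      by (simp add: add.commute) 
  qed
  \<comment> \<open>The points were chosen with growth \<open>4 ^ m\<close>, which beats the decay
    \<open>(1 / 3) ^ m\<close> of the coefficients.\<close>
  have "(4 / 3) ^ m / 2 \<le> C" for m
  proof -
    have "(4 / 3 :: real) ^ m / 2 = (1 / 3) ^ m / 2 * 4 ^ m" by (simp add: power_divide)
    also have "\<dots> \<le> (1 / 3) ^ m / 2 * (\<rho> (w m) * \<kappa> (w m))" using wl[of m] by (intro mult_left_mono) auto
    also have "\<dots> = \<rho> (w m) * ((1 / 3) ^ m * \<kappa> (w m) / 2)" by simp
    also have "\<dots> \<le> \<rho> (w m) * cmod (\<Sum>i. c i * s (w i) (w m))" by (rule mult_left_mono[OF lower l0[OF wS]])
    also have "\<dots> \<le> C" using C wS by blast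
    finally show ?thesis .
  qed
  moreover obtain m where "2 * C < (4 / 3 :: real) ^ m" using real_arch_pow[of "4 / 3 :: real" "2 * C"] by auto
  ultimately show False by (smt (verit) field_sum_of_halves)
qed

section \<open>Positivity of the kernel form and series of normalized kernels\<close>

lemma Qb_nonneg:
  assumes b: "bfun b bs" and bs1: "\<And>t. cmod (bs t) \<le> 1" and w: "\<forall>i<n. w i \<in> ball 0 1"
  shows "0 \<le> Qb b n w c"
proof -
  have w': "\<And>i. i < n \<Longrightarrow> w i \<in> ball 0 1" using w by blast
  have "0 \<le> integral\<^sup>L TT (\<lambda>t. (1 - (cmod (bs t))\<^sup>2) * (cmod (kf n w c (cis t)))\<^sup>2)"
    using bs1 by (intro Bochner_Integration.integral_nonneg mult_nonneg_nonneg) (auto simp: power_le_one)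
  then have "0 \<le> 2 * pi * Qb b n w c"
    using kernel_form_identity[where n = n and w = w and c = c, OF w' b] nrm2_nonneg[of "rsd b bs n w c"] by linarith
  then have "2 * pi * 0 \<le> 2 * pi * Qb b n w c" by simp
  then show ?thesis by (rule mult_left_le_imp_le) simp
qed

text \<open>For \<open>b = 0\<close> the residual vanishes and the space is \<open>H^2\<close>; this
  is how the lemmas on \<open>H(b)\<close> are reused for Szego kernels.\<close>

lemma Qb_zero_function:
  assumes w: "\<forall>i<n. w i \<in> ball 0 1"
  shows "2 * pi * Qb (\<lambda>z. 0) n w c = nrm2 (\<lambda>t. kf n w c (cis t))"
proof -
  have w': "\<And>i. i < n \<Longrightarrow> w i \<in> ball 0 1" using w by blast
  have "rsd (\<lambda>z. 0) (\<lambda>t. 0) n w c = (\<lambda>t. 0)" by (rule ext) (simp add: rsd_def kf_def)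
  then have "nrm2 (rsd (\<lambda>z. 0) (\<lambda>t. 0) n w c) = 0" by (simp add: nrm2_def)
  then show ?thesis using kernel_form_identity[where n = n and w = w and c = c, OF w' bfun_const[of 0]] by (simp add: nrm2_def)
qed

lemma kb_hermitian: "kb b v w = cnj (kb b w v)"
  by (simp add: kb_def mult_ac)

lemma sum_lessThan_add: "(\<Sum>i<n + N. g i) = (\<Sum>i<n. g i) + (\<Sum>i<N. g (n + i))" for g :: "nat \<Rightarrow> 'a::comm_monoid_add"
  by (induction N) (simp_all add: add.assoc)

text \<open>Positivity of \<open>Qb\<close> on the concatenation of both families of points, with
  the two lists of coefficients scaled independently, gives a nonnegative quadratic form in two real
  variables, from which the inequality is read off.\<close>

lemma kernel_Cauchy_Schwarz:
  assumes b: "bfun b bs" and bs1: "\<And>t. cmod (bs t) \<le> 1" and v: "\<forall>i<n. v i \<in> ball 0 1" and w: "\<forall>i<N. w i \<in> ball 0 1"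
  shows "(cmod (\<Sum>i<n. \<Sum>j<N. c j * cnj (d i) * kb b (w j) (v i)))\<^sup>2 \<le> Qb b n v d * Qb b N w c"
proof -
  define S where "S = (\<Sum>i<n. \<Sum>j<N. c j * cnj (d i) * kb b (w j) (v i))"
  define A where "A = Qb b n v d"
  define B where "B = Qb b N w c"
  have A0: "0 \<le> A" and B0: "0 \<le> B" unfolding A_def B_def by (rule Qb_nonneg[OF b bs1 v], rule Qb_nonneg[OF b bs1 w])
  have Re_mult_real: "Re (complex_of_real r * z) = r * Re z" for r z by simp
  have quad: "0 \<le> x\<^sup>2 * A + y\<^sup>2 * (cmod S)\<^sup>2 * B - 2 * x * y * (cmod S)\<^sup>2" for x y :: real
  proof -
    define X where "X = complex_of_real x"
    \<comment> \<open>The factor \<open>cnj S\<close> makes the mixed terms real multiples of the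
      squared modulus of \<open>S\<close>, whatever its phase.\<close>
    define Y where "Y = - (complex_of_real y * cnj S)"
    define u where "u = (\<lambda>i. if i < n then v i else w (i - n))"
    define e where "e = (\<lambda>i. if i < n then X * d i else Y * c (i - n))"
    have u: "\<forall>i<n + N. u i \<in> ball 0 1" using v w by (auto simp: u_def)
    have S': "(\<Sum>i<N. \<Sum>j<n. d j * cnj (c i) * kb b (v j) (w i)) = cnj S"
      unfolding S_def cnj_sum by (subst sum.swap, intro sum.cong refl) (simp add: kb_hermitian[of b "v _" "w _"] mult_ac)
    have "(\<Sum>i<n + N. \<Sum>j<n + N. e j * cnj (e i) * kb b (u j) (u i)) =
       (\<Sum>i<n. \<Sum>j<n. (X * cnj X) * (d j * cnj (d i) * kb b (v j) (v i))) + (\<Sum>i<N. \<Sum>j<n. (X * cnj Y) * (d j * cnj (c i) * kb b (v j) (w i)))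
       + ((\<Sum>i<n. \<Sum>j<N. (Y * cnj X) * (c j * cnj (d i) * kb b (w j) (v i))) + (\<Sum>i<N. \<Sum>j<N. (Y * cnj Y) * (c j * cnj (c i) * kb b (w j) (w i))))"
      unfolding sum_lessThan_add sum.distrib
      by (intro arg_cong2[where f = "(+)"] sum.cong refl) (simp_all add: e_def u_def mult_ac)
    also have "\<dots> = X * cnj X * (\<Sum>i<n. \<Sum>j<n. d j * cnj (d i) * kb b (v j) (v i)) + X * cnj Y * cnj S
       + (Y * cnj X * S + Y * cnj Y * (\<Sum>i<N. \<Sum>j<N. c j * cnj (c i) * kb b (w j) (w i)))"
      unfolding S'[symmetric] unfolding S_def sum_distrib_left ..
    finally have "Qb b (n + N) u e = Re (X * cnj X * (\<Sum>i<n. \<Sum>j<n. d j * cnj (d i) * kb b (v j) (v i)) + X * cnj Y * cnj S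
       + (Y * cnj X * S + Y * cnj Y * (\<Sum>i<N. \<Sum>j<N. c j * cnj (c i) * kb b (w j) (w i))))" by (simp only: Qb_def)
    also have "X * cnj X = complex_of_real (x\<^sup>2)" by (simp add: X_def power2_eq_square)
    also have "X * cnj Y * cnj S = complex_of_real (- (x * y * (cmod S)\<^sup>2))"
      unfolding of_real_minus of_real_mult complex_norm_square by (simp add: X_def Y_def mult_ac)
    also have "Y * cnj X * S = complex_of_real (- (x * y * (cmod S)\<^sup>2))"
      unfolding of_real_minus of_real_mult complex_norm_square by (simp add: X_def Y_def mult_ac)
    also have "Y * cnj Y = complex_of_real (y\<^sup>2 * (cmod S)\<^sup>2)"
      unfolding of_real_mult complex_norm_square by (simp add: Y_def power2_eq_square mult_ac)
    finally have "Qb b (n + N) u e = x\<^sup>2 * A + y\<^sup>2 * (cmod S)\<^sup>2 * B - 2 * x * y * (cmod S)\<^sup>2"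
      unfolding plus_complex.sel Re_complex_of_real Re_mult_real A_def B_def Qb_def by linarith
    then show ?thesis using Qb_nonneg[OF b bs1 u, of e] by simp
  qed
  show ?thesis
  proof (cases "B = 0")
    case True
    have "cmod S = 0"
    proof (rule ccontr)
      assume S: "cmod S \<noteq> 0"
      show False using quad[of 1 "(A + 1) / (2 * (cmod S)\<^sup>2)"] S A0 True by (simp add: field_simps)
    qed
    then show ?thesis using True by (simp add: S_def[symmetric] B_def[symmetric])
  next
    case False
    have "0 \<le> B * (A * B - (cmod S)\<^sup>2)" using quad[of B 1] by (simp add: power2_eq_square algebra_simps)
    then have "0 \<le> A * B - (cmod S)\<^sup>2" using False B0 by (simp add: zero_le_mult_iff)
    then show ?thesis by (simp add: S_def A_def B_def)
  qed
qed

text \<open>The diagonal of the kernel \<open>kb\<close>, that is, the squared norm of evaluation at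
  \<open>z\<close> on \<open>H(b)\<close>.\<close>

definition kd :: "(complex \<Rightarrow> complex) \<Rightarrow> complex \<Rightarrow> real" where "kd b z = (1 - (cmod (b z))\<^sup>2) / (1 - (cmod z)\<^sup>2)"

lemma kb_diag: "kb b z z = complex_of_real (kd b z)"
  unfolding kb_def kd_def of_real_divide of_real_diff complex_norm_square by (simp add: mult.commute)

lemma Qb_single: "Qb b 1 (\<lambda>i. z) (\<lambda>i. c) = (cmod c)\<^sup>2 * kd b z"
proof -
  have "c * cnj c * kb b z z = complex_of_real ((cmod c)\<^sup>2 * kd b z)"
    unfolding of_real_mult complex_norm_square kb_diag by (simp only: mult_ac)
  then show ?thesis by (simp add: Qb_def)
qed

lemma kd_nonneg:
  assumes b: "bfun b bs" and bs1: "\<And>t. cmod (bs t) \<le> 1" and z: "z \<in> ball 0 1"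
  shows "0 \<le> kd b z"
  using Qb_nonneg[OF b bs1, of 1 "\<lambda>i. z" "\<lambda>i. 1"] z unfolding Qb_single by simp

lemma kb_le:
  assumes b: "bfun b bs" and bs1: "\<And>t. cmod (bs t) \<le> 1" and z: "z \<in> ball 0 1" and w: "w \<in> ball 0 1"
  shows "cmod (kb b w z) \<le> sqrt (kd b w) * sqrt (kd b z)"
proof -
  have "(cmod (kb b w z))\<^sup>2 \<le> kd b z * kd b w"
    using kernel_Cauchy_Schwarz[OF b bs1, of 1 "\<lambda>i. z" 1 "\<lambda>i. w" "\<lambda>i. 1" "\<lambda>i. 1"] z w unfolding Qb_single by simp
  then show ?thesis by (subst mult.commute) (simp add: real_le_rsqrt flip: real_sqrt_mult)
qed

text \<open>The kernel at \<open>w\<close> normalized in \<open>H(b)\<close>. If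
  \<open>kd b w = 0\<close>, division by zero makes it 0, and the estimates below still
  hold.\<close>

definition sk :: "(complex \<Rightarrow> complex) \<Rightarrow> complex \<Rightarrow> complex \<Rightarrow> complex" where
  "sk b w z = kb b w z / complex_of_real (sqrt (kd b w))"

lemma sk_le:
  assumes b: "bfun b bs" and bs1: "\<And>t. cmod (bs t) \<le> 1" and z: "z \<in> ball 0 1" and w: "w \<in> ball 0 1"
  shows "cmod (sk b w z) \<le> sqrt (kd b z)"
proof (cases "kd b w = 0")
  case True
  then show ?thesis using kd_nonneg[OF b bs1 z] by (simp add: sk_def)
next
  case False
  then have "0 < sqrt (kd b w)" using kd_nonneg[OF b bs1 w] by simp
  then show ?thesis using kb_le[OF b bs1 z w] by (simp add: sk_def norm_divide divide_le_mult_left)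
qed

lemma sk_diag:
  assumes b: "bfun b bs" and bs1: "\<And>t. cmod (bs t) \<le> 1" and z: "z \<in> ball 0 1"
  shows "cmod (sk b z z) = sqrt (kd b z)"
  using kd_nonneg[OF b bs1 z] by (simp add: sk_def kb_diag norm_divide real_div_sqrt)

text \<open>Absolutely convergent series of normalized kernels lie in \<open>H(b)\<close>. The
  partial sums have norm at most the sum of the moduli of the coefficients, and the functional bound
  passes to the limit pointwise, with no appeal to completeness.\<close>

lemma kernel_series_bound:
  assumes b: "bfun b bs" and bs1: "\<And>t. cmod (bs t) \<le> 1" and w: "\<And>m. w m \<in> ball 0 1" and c: "summable (\<lambda>m. cmod (c m))"
    and v: "\<forall>i<n. v i \<in> ball 0 1"
  shows "(cmod (\<Sum>i<n. cnj (d i) * (\<Sum>m. c m * sk b (w m) (v i))))\<^sup>2 \<le> (\<Sum>m. cmod (c m))\<^sup>2 * Qb b n v d"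
proof (rule LIMSEQ_le_const2)
  define M where "M = (\<Sum>m. cmod (c m))"
  show "(\<lambda>N. (cmod (\<Sum>i<n. cnj (d i) * (\<Sum>m<N. c m * sk b (w m) (v i))))\<^sup>2) \<longlonglongrightarrow> (cmod (\<Sum>i<n. cnj (d i) * (\<Sum>m. c m * sk b (w m) (v i))))\<^sup>2"
  proof (intro tendsto_intros)
    fix i assume "i \<in> {..<n}"
    then have vi: "v i \<in> ball 0 1" using v by simp
    have "summable (\<lambda>m. c m * sk b (w m) (v i))"
    proof (rule summable_comparison_test'[OF summable_mult2[OF c, of "sqrt (kd b (v i))"], of 0])
      show "norm (c m * sk b (w m) (v i)) \<le> cmod (c m) * sqrt (kd b (v i))" for m
        unfolding norm_mult by (rule mult_left_mono[OF sk_le[OF b bs1 vi w] norm_ge_zero])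
    qed
    then show "(\<lambda>N. \<Sum>m<N. c m * sk b (w m) (v i)) \<longlonglongrightarrow> (\<Sum>m. c m * sk b (w m) (v i))" by (rule summable_LIMSEQ)
  qed
  have "(cmod (\<Sum>i<n. cnj (d i) * (\<Sum>m<N. c m * sk b (w m) (v i))))\<^sup>2 \<le> M\<^sup>2 * Qb b n v d" for N
  proof -
    define e where "e = (\<lambda>m. c m / complex_of_real (sqrt (kd b (w m))))"
    have wN: "\<forall>m<N. w m \<in> ball 0 1" using w by simp
    have ek: "cmod (e m) * sqrt (kd b (w m)) \<le> cmod (c m)" for m
      using kd_nonneg[OF b bs1 w[of m]] by (cases "kd b (w m) = 0") (simp_all add: e_def norm_divide)
    have "Qb b N w e \<le> cmod (\<Sum>i<N. \<Sum>j<N. e j * cnj (e i) * kb b (w j) (w i))" unfolding Qb_def by (rule complex_Re_le_cmod)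
    also have "\<dots> \<le> (\<Sum>i<N. \<Sum>j<N. cmod (c i) * cmod (c j))"
    proof (intro sum_norm_le)
      fix i j
      have "cmod (e j * cnj (e i) * kb b (w j) (w i)) \<le> cmod (e j) * cmod (e i) * (sqrt (kd b (w j)) * sqrt (kd b (w i)))"
        unfolding norm_mult complex_mod_cnj by (intro mult_left_mono kb_le[OF b bs1 w w]) simp
      also have "\<dots> = (cmod (e i) * sqrt (kd b (w i))) * (cmod (e j) * sqrt (kd b (w j)))" by (simp only: mult_ac)
      also have "\<dots> \<le> cmod (c i) * cmod (c j)" by (intro mult_mono ek) (use kd_nonneg[OF b bs1 w] in auto)
      finally show "cmod (e j * cnj (e i) * kb b (w j) (w i)) \<le> cmod (c i) * cmod (c j)" .
    qed
    also have "\<dots> = (\<Sum>i<N. cmod (c i))\<^sup>2" unfolding power2_eq_square by (rule sum_product[symmetric])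
    also have "\<dots> \<le> M\<^sup>2" unfolding M_def by (intro power_mono sum_le_suminf[OF c] sum_nonneg) auto
    finally have Q: "Qb b N w e \<le> M\<^sup>2" .
    have "(\<Sum>i<n. cnj (d i) * (\<Sum>m<N. c m * sk b (w m) (v i))) = (\<Sum>i<n. \<Sum>j<N. e j * cnj (d i) * kb b (w j) (v i))"
      unfolding sum_distrib_left by (intro sum.cong refl) (simp add: e_def sk_def)
    then have "(cmod (\<Sum>i<n. cnj (d i) * (\<Sum>m<N. c m * sk b (w m) (v i))))\<^sup>2 \<le> Qb b n v d * Qb b N w e"
      using kernel_Cauchy_Schwarz[OF b bs1 v wN, of e d] by simp
    also have "\<dots> \<le> Qb b n v d * M\<^sup>2" by (rule mult_left_mono[OF Q Qb_nonneg[OF b bs1 v]])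
    finally show ?thesis by (simp only: mult.commute)
  qed
  then show "\<exists>K. \<forall>N\<ge>K. (cmod (\<Sum>i<n. cnj (d i) * (\<Sum>m<N. c m * sk b (w m) (v i))))\<^sup>2 \<le> (\<Sum>m. cmod (c m))\<^sup>2 * Qb b n v d"
    unfolding M_def by blast
qed

lemma in_Hb_pointwise:
  assumes "in_Hb b f" shows "\<exists>C\<ge>0. \<forall>z\<in>ball 0 1. (cmod (f z))\<^sup>2 \<le> C * kd b z"
proof -
  obtain C where C: "0 \<le> C" "\<forall>n w c. (\<forall>i<n. w i \<in> ball 0 1) \<longrightarrow> (cmod (\<Sum>i<n. cnj (c i) * f (w i)))\<^sup>2 \<le> C * Qb b n w c"
    using assms unfolding in_Hb_iff by blast
  have "(cmod (f z))\<^sup>2 \<le> C * kd b z" if "z \<in> ball 0 1" for z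
    using C(2)[THEN spec[of _ 1], THEN spec[of _ "\<lambda>i. z"], THEN spec[of _ "\<lambda>i. 1"]] that unfolding Qb_single by simp
  then show ?thesis using C(1) by blast
qed

text \<open>The case of the empty product in \<open>szego_bound_multiple\<close>, tested on a single
  kernel.\<close>

lemma H2_pointwise:
  assumes G: "H2 G" shows "\<exists>C\<ge>0. \<forall>z\<in>ball 0 1. (cmod (G z))\<^sup>2 \<le> C / (1 - (cmod z)\<^sup>2)"
proof -
  obtain M where M: "0 \<le> M" "\<forall>n w c. (\<forall>i<n. w i \<in> ball 0 1) \<longrightarrow>
    (cmod (\<Sum>i<n. cnj (c i) * (pz {} (w i) * G (w i))))\<^sup>2 \<le> M * nrm2 (\<lambda>t. pz {} (cis t) * kf n w c (cis t))"
    using szego_bound_multiple[of "{}", OF _ _ G] by auto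
  have p1: "pz {} z = 1" for z by (simp add: pz_def)
  have "(cmod (G z))\<^sup>2 \<le> (M * (2 * pi)) / (1 - (cmod z)\<^sup>2)" if "z \<in> ball 0 1" for z
  proof -
    have "nrm2 (\<lambda>t. kf 1 (\<lambda>i. z) (\<lambda>i. 1) (cis t)) = 2 * pi * kd (\<lambda>z. 0) z"
      using Qb_zero_function[of 1 "\<lambda>i. z" "\<lambda>i. 1"] that unfolding Qb_single by simp
    then show ?thesis using M(2)[THEN spec[of _ 1], THEN spec[of _ "\<lambda>i. z"], THEN spec[of _ "\<lambda>i. 1"]] that
      unfolding p1 mult_1 by (simp add: kd_def mult_ac)
  qed
  moreover have "0 \<le> M * (2 * pi)" using M(1) by simp
  ultimately show ?thesis by blast
qed

section \<open>The two pointwise bounds in the disc\<close>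

lemma pz_nonzero:
  assumes "Z \<subseteq> sphere 0 1" "z \<in> ball 0 1" shows "pz Z z \<noteq> 0"
proof -
  have "0 < (1 - cmod z) ^ card Z" using assms by simp
  moreover have "(1 - cmod z) ^ card Z \<le> cmod (pz Z z)" by (rule pz_lower[OF assms(1)]) (use assms(2) in simp)
  ultimately have "0 < cmod (pz Z z)" by linarith
  then show ?thesis by simp
qed

text \<open>In the decomposition of \<open>f\<close> the entire part is bounded on the disc, and the
  part in \<open>H^2\<close> grows at most like \<open>1 / sqrt (1 - (cmod z)\<^sup>2)\<close>
  before it is multiplied by \<open>pz Z\<close>.\<close>

lemma in_Dmu_pointwise:
  assumes Z: "finite Z" "Z \<subseteq> sphere 0 1" and f: "in_Dmu Z f"
  shows "\<exists>C\<ge>0. \<forall>z\<in>ball 0 1. (1 - (cmod z)\<^sup>2) * (cmod (f z))\<^sup>2 \<le> C * ((1 - (cmod z)\<^sup>2) + (cmod (pz Z z))\<^sup>2)"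
proof -
  obtain q G where q: "q holomorphic_on UNIV" and G: "H2 G" and fq: "\<forall>z\<in>ball 0 1. f z = q z + pz Z z * G z"
    using in_Dmu_decomposition[OF Z f] by blast
  obtain B where B: "\<forall>z\<in>ball 0 1. cmod (q z) \<le> B" using bounded_on_disc_entire[OF q] by blast
  obtain C where C: "0 \<le> C" "\<forall>z\<in>ball 0 1. (cmod (G z))\<^sup>2 \<le> C / (1 - (cmod z)\<^sup>2)" using H2_pointwise[OF G] by blast
  have "(1 - (cmod z)\<^sup>2) * (cmod (f z))\<^sup>2 \<le> (2 * B\<^sup>2 + 2 * C) * ((1 - (cmod z)\<^sup>2) + (cmod (pz Z z))\<^sup>2)" if z: "z \<in> ball 0 1" for z
  proof -
    define r where "r = 1 - (cmod z)\<^sup>2"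
    have r: "0 < r" using z by (simp add: r_def power_less_one_iff abs_square_less_1)
    have "(cmod (f z))\<^sup>2 \<le> (cmod (q z) + cmod (pz Z z * G z))\<^sup>2" using fq z by (simp add: norm_triangle_ineq power_mono)
    also have "\<dots> \<le> 2 * (cmod (q z))\<^sup>2 + 2 * (cmod (pz Z z * G z))\<^sup>2"
      using sum_squares_bound[of "cmod (q z)" "cmod (pz Z z * G z)"] by (simp add: power2_sum)
    also have "\<dots> \<le> 2 * B\<^sup>2 + 2 * ((cmod (pz Z z))\<^sup>2 * (C / r))"
      unfolding norm_mult power_mult_distrib
      using B C(2) z unfolding r_def by (intro add_mono mult_left_mono power_mono) auto
    finally have "r * (cmod (f z))\<^sup>2 \<le> r * (2 * B\<^sup>2 + 2 * ((cmod (pz Z z))\<^sup>2 * (C / r)))" by (rule mult_left_mono) (use r in simp)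
    also have "\<dots> = 2 * B\<^sup>2 * r + 2 * C * (cmod (pz Z z))\<^sup>2" using r by (simp add: field_simps)
    also have "\<dots> \<le> (2 * B\<^sup>2 + 2 * C) * (r + (cmod (pz Z z))\<^sup>2)"
      using r C(1) by (simp add: algebra_simps)
    finally show ?thesis by (simp only: r_def)
  qed
  moreover have "0 \<le> 2 * B\<^sup>2 + 2 * C" using C(1) by simp
  ultimately show ?thesis by blast
qed

text \<open>By \<open>in_Dmu_pointwise\<close> each member of \<open>H(b)\<close> is bounded after
  multiplication by the weight \<open>\<rho>\<close>. The gliding hump makes this uniform: the same
  weight bounds the norms \<open>sqrt (kd b z)\<close> of the point evaluations.\<close>

lemma kernel_le_of_in_Hb_imp_in_Dmu:
  assumes Z: "finite Z" "Z \<subseteq> sphere 0 1" and b: "bfun b bs" and bs1: "\<And>t. cmod (bs t) \<le> 1"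
    and sub: "\<And>f. in_Hb b f \<Longrightarrow> in_Dmu Z f"
  shows "\<exists>C. \<forall>z\<in>ball 0 1. 1 - (cmod (b z))\<^sup>2 \<le> C * ((1 - (cmod z)\<^sup>2) + (cmod (pz Z z))\<^sup>2)"
proof -
  define N where "N = (\<lambda>z. (1 - (cmod z)\<^sup>2) + (cmod (pz Z z))\<^sup>2)"
  define \<rho> where "\<rho> = (\<lambda>z. sqrt ((1 - (cmod z)\<^sup>2) / N z))"
  have r: "0 < 1 - (cmod z)\<^sup>2" if "z \<in> ball 0 1" for z using that by (simp add: abs_square_less_1)
  have N0: "0 < N z" if "z \<in> ball 0 1" for z using r[OF that] by (simp add: N_def add_pos_nonneg)
  have "\<exists>C. \<forall>z\<in>ball 0 1. \<rho> z * sqrt (kd b z) \<le> C"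
  proof (rule gliding_hump[where s = "sk b"])
    show "cmod (sk b w z) \<le> sqrt (kd b z)" if "w \<in> ball 0 1" "z \<in> ball 0 1" for w z by (rule sk_le[OF b bs1 that(2,1)])
    show "cmod (sk b z z) = sqrt (kd b z)" if "z \<in> ball 0 1" for z by (rule sk_diag[OF b bs1 that])
    show "0 \<le> \<rho> z" if "z \<in> ball 0 1" for z using r[OF that] N0[OF that] by (simp add: \<rho>_def)
  next
    fix w c :: "nat \<Rightarrow> complex" assume w: "\<And>m. w m \<in> ball 0 1" and c: "summable (\<lambda>m. cmod (c m))"
    define f where "f = (\<lambda>z. \<Sum>m. c m * sk b (w m) z)"
    have "in_Hb b f" unfolding in_Hb_iff f_def
    proof (rule exI, intro conjI allI impI)
      show "0 \<le> (\<Sum>m. cmod (c m))\<^sup>2" by simp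
    qed (rule kernel_series_bound[OF b bs1 w c])
    then obtain C where C: "\<forall>z\<in>ball 0 1. (1 - (cmod z)\<^sup>2) * (cmod (f z))\<^sup>2 \<le> C * N z"
      unfolding N_def using in_Dmu_pointwise[OF Z sub] by blast
    have "\<rho> z * cmod (f z) \<le> sqrt C" if z: "z \<in> ball 0 1" for z
    proof -
      have "(\<rho> z * cmod (f z))\<^sup>2 = (1 - (cmod z)\<^sup>2) * (cmod (f z))\<^sup>2 / N z"
        using r[OF z] N0[OF z] by (simp add: \<rho>_def power_mult_distrib)
      also have "\<dots> \<le> C" using C z N0[OF z] by (simp add: divide_le_eq)
      finally show ?thesis by (rule real_le_rsqrt)
    qed
    then show "\<exists>C. \<forall>z\<in>ball 0 1. \<rho> z * cmod (\<Sum>m. c m * sk b (w m) z) \<le> C" unfolding f_def by blast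
  qed
  then obtain C where C: "\<forall>z\<in>ball 0 1. \<rho> z * sqrt (kd b z) \<le> C" by blast
  have "1 - (cmod (b z))\<^sup>2 \<le> C\<^sup>2 * N z" if z: "z \<in> ball 0 1" for z
  proof -
    have "0 \<le> \<rho> z * sqrt (kd b z)" using r[OF z] N0[OF z] kd_nonneg[OF b bs1 z] by (simp add: \<rho>_def)
    then have "(\<rho> z * sqrt (kd b z))\<^sup>2 \<le> C\<^sup>2" using C z by (intro power_mono) auto
    also have "(\<rho> z * sqrt (kd b z))\<^sup>2 = (1 - (cmod (b z))\<^sup>2) / N z"
      using r[OF z] N0[OF z] kd_nonneg[OF b bs1 z] by (simp add: \<rho>_def power_mult_distrib) (simp add: kd_def)
    finally show ?thesis using N0[OF z] by (simp add: divide_le_eq)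
  qed
  then show ?thesis unfolding N_def by blast
qed

text \<open>Multiplication by \<open>pz Z\<close> maps \<open>H^2\<close> into
  \<open>D_\<mu>\<close>, hence into \<open>H(b)\<close>, where point evaluation is bounded by a
  multiple of \<open>sqrt (kd b z)\<close>. The gliding hump, now run over normalized Szego kernels,
  makes the resulting pointwise bound uniform over \<open>H^2\<close>.\<close>

lemma pz_le_of_in_Dmu_imp_in_Hb:
  assumes Z: "finite Z" "Z \<subseteq> sphere 0 1" and b: "bfun b bs" and bs1: "\<And>t. cmod (bs t) \<le> 1"
    and sub: "\<And>f. in_Dmu Z f \<Longrightarrow> in_Hb b f"
  shows "\<exists>C. \<forall>z\<in>ball 0 1. (cmod (pz Z z))\<^sup>2 \<le> C * (1 - (cmod (b z))\<^sup>2)"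
proof -
  define o0 where "o0 = (\<lambda>z::complex. 0::complex)"
  have b0: "bfun o0 (\<lambda>t. 0)" unfolding o0_def by (rule bfun_const)
  have r: "0 < 1 - (cmod z)\<^sup>2" if "z \<in> ball 0 1" for z using that by (simp add: abs_square_less_1)
  have kd0: "kd o0 z = 1 / (1 - (cmod z)\<^sup>2)" for z by (simp add: kd_def o0_def)
  \<comment> \<open>The function \<open>pz Z\<close> itself, which has no zero in the disc, shows
    \<open>kd b z > 0\<close>, so that the weight \<open>\<rho>\<close> below is a genuine
    quotient.\<close>
  have "in_Hb b (\<lambda>z. pz Z z * 1)" by (rule sub[OF in_Dmu_multiple[OF Z H2_const]])
  then obtain C0 where C0: "\<forall>z\<in>ball 0 1. (cmod (pz Z z))\<^sup>2 \<le> C0 * kd b z" using in_Hb_pointwise by fastforce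
  have kdp: "0 < kd b z" if z: "z \<in> ball 0 1" for z
  proof -
    have "kd b z \<noteq> 0" using C0 z pz_nonzero[OF Z(2) z] by force
    then show ?thesis using kd_nonneg[OF b bs1 z] by simp
  qed
  define \<rho> where "\<rho> = (\<lambda>z. cmod (pz Z z) / sqrt (kd b z))"
  have "\<exists>C. \<forall>z\<in>ball 0 1. \<rho> z * sqrt (kd o0 z) \<le> C"
  proof (rule gliding_hump[where s = "sk o0"])
    show "cmod (sk o0 w z) \<le> sqrt (kd o0 z)" if "w \<in> ball 0 1" "z \<in> ball 0 1" for w z by (rule sk_le[OF b0 _ that(2,1)]) simp
    show "cmod (sk o0 z z) = sqrt (kd o0 z)" if "z \<in> ball 0 1" for z by (rule sk_diag[OF b0 _ that]) simp
    show "0 \<le> \<rho> z" if "z \<in> ball 0 1" for z using kdp[OF that] by (simp add: \<rho>_def)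
  next
    fix w c :: "nat \<Rightarrow> complex" assume w: "\<And>m. w m \<in> ball 0 1" and c: "summable (\<lambda>m. cmod (c m))"
    define f where "f = (\<lambda>z. \<Sum>m. c m * sk o0 (w m) z)"
    \<comment> \<open>For the empty set \<open>in_Dmu\<close> is membership in
      \<open>H^2\<close>.\<close>
    have "in_Dmu {} f"
    proof (rule in_Dmu_from_szego_bound)
      fix n and v d :: "nat \<Rightarrow> complex" assume v: "\<forall>i<n. v i \<in> ball 0 1"
      have "(cmod (\<Sum>i<n. cnj (d i) * f (v i)))\<^sup>2 \<le> (\<Sum>m. cmod (c m))\<^sup>2 * Qb o0 n v d"
        unfolding f_def by (rule kernel_series_bound[OF b0 _ w c v]) simp
      also have "Qb o0 n v d = nrm2 (\<lambda>t. kf n v d (cis t)) / (2 * pi)"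
        using Qb_zero_function[OF v, of d] by (simp add: o0_def field_simps)
      finally show "(cmod (\<Sum>i<n. cnj (d i) * f (v i)))\<^sup>2 \<le> ((\<Sum>m. cmod (c m))\<^sup>2 / (2 * pi)) * nrm2 (\<lambda>t. pz {} (cis t) * kf n v d (cis t))"
        by (simp add: pz_def)
    qed auto
    then have "H2 f" by (simp add: in_Dmu_iff)
    then have "in_Hb b (\<lambda>z. pz Z z * f z)" by (intro sub in_Dmu_multiple[OF Z])
    then obtain C where C: "\<forall>z\<in>ball 0 1. (cmod (pz Z z * f z))\<^sup>2 \<le> C * kd b z" using in_Hb_pointwise by blast
    have "\<rho> z * cmod (f z) \<le> sqrt C" if z: "z \<in> ball 0 1" for z
    proof -
      have "(\<rho> z * cmod (f z))\<^sup>2 = (cmod (pz Z z * f z))\<^sup>2 / kd b z"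
        using kdp[OF z] by (simp add: \<rho>_def norm_mult power_mult_distrib power_divide)
      also have "\<dots> \<le> C" using C z kdp[OF z] by (simp add: divide_le_eq)
      finally show ?thesis by (rule real_le_rsqrt)
    qed
    then show "\<exists>C. \<forall>z\<in>ball 0 1. \<rho> z * cmod (\<Sum>m. c m * sk o0 (w m) z) \<le> C" unfolding f_def by blast
  qed
  then obtain C where C: "\<forall>z\<in>ball 0 1. \<rho> z * sqrt (kd o0 z) \<le> C" by blast
  have "(cmod (pz Z z))\<^sup>2 \<le> C\<^sup>2 * (1 - (cmod (b z))\<^sup>2)" if z: "z \<in> ball 0 1" for z
  proof -
    have "0 \<le> \<rho> z * sqrt (kd o0 z)" using kdp[OF z] r[OF z] by (simp add: \<rho>_def kd0)
    then have "(\<rho> z * sqrt (kd o0 z))\<^sup>2 \<le> C\<^sup>2" using C z by (intro power_mono) auto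
    also have "(\<rho> z * sqrt (kd o0 z))\<^sup>2 = (cmod (pz Z z))\<^sup>2 / (1 - (cmod (b z))\<^sup>2)"
      using kdp[OF z] r[OF z] by (simp add: \<rho>_def kd0 power_mult_distrib power_divide) (simp add: kd_def)
    finally have "(cmod (pz Z z))\<^sup>2 / (1 - (cmod (b z))\<^sup>2) \<le> C\<^sup>2" .
    moreover have "0 < 1 - (cmod (b z))\<^sup>2" using kdp[OF z] r[OF z] by (simp add: kd_def zero_less_divide_iff)
    ultimately show ?thesis by (simp add: divide_le_eq)
  qed
  then show ?thesis by blast
qed

section \<open>Outer functions\<close>

text \<open>The Poisson kernel, as the real part of the Herglotz kernel and without the factor
  \<open>1 / (2 * pi)\<close>.\<close>

definition pk :: "complex \<Rightarrow> real \<Rightarrow> real" where "pk z t = Re ((cis t + z) / (cis t - z))"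

lemma bmf_herglotz: "cmod z < 1 \<Longrightarrow> bmf (\<lambda>t. (cis t + z) / (cis t - z))"
  by (rule bmf_circle[of "\<lambda>x. (x + z) / (x - z)"]) (auto intro!: continuous_intros)

lemma bmf_pk: assumes "cmod z < 1" shows "bmf (pk z)"
proof -
  obtain B where "\<And>t. cmod ((cis t + z) / (cis t - z)) \<le> B" using bmf_herglotz[OF assms] unfolding bmf_def by blast
  then have "norm (pk z t) \<le> B" for t unfolding pk_def real_norm_def by (rule order_trans[OF abs_Re_le_cmod])
  moreover have "pk z \<in> borel_measurable TT" unfolding pk_def using bmf_meas[OF bmf_herglotz[OF assms]] by measurable
  ultimately show ?thesis by (intro bmfI)
qed

lemma pk_nonneg: assumes "cmod z < 1" shows "0 \<le> pk z t"
proof -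
  have "(cmod z)\<^sup>2 \<le> 1" using assms by (simp add: power_le_one)
  then have "(Re z)\<^sup>2 + (Im z)\<^sup>2 \<le> (cos t)\<^sup>2 + (sin t)\<^sup>2" by (simp add: cmod_power2)
  then have "0 \<le> (cos t + Re z) * (cos t - Re z) + (sin t + Im z) * (sin t - Im z)" by (simp add: power2_eq_square algebra_simps)
  then show ?thesis unfolding pk_def Re_divide by (simp add: divide_nonneg_nonneg)
qed

text \<open>The kernel is \<open>cnj (szego z) + szego z - 1\<close> on the circle. The first term
  reproduces \<open>H z\<close>; the second yields \<open>H 0\<close> by the mean value property,
  and the third takes it away again.\<close>

lemma poisson_reproduces:
  fixes H :: "complex \<Rightarrow> complex"
  assumes H: "continuous_on (cball 0 1) H" "H holomorphic_on ball 0 1" and z: "cmod z < 1"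
  shows "integral\<^sup>L TT (\<lambda>t. pk z t * Re (H (cis t))) = 2 * pi * Re (H z)"
proof -
  have pk: "complex_of_real (pk z t) = cnj (szego z (cis t)) + szego z (cis t) - 1" for t
  proof -
    have ne: "cis t - z \<noteq> 0" using z by auto
    have "(cis t + z) / (cis t - z) = 2 * cnj (szego z (cis t)) - 1"
      unfolding cnj_szego_cis[OF z] using ne by (simp add: field_simps)
    then show ?thesis unfolding pk_def by (simp add: complex_eq_iff)
  qed
  have hs: "szego z holomorphic_on cball 0 1" by (rule szego_hol[OF z])
  have cs: "continuous_on (cball 0 1) (szego z)" by (rule holomorphic_on_imp_continuous_on[OF hs])
  have bH: "bmf (\<lambda>t. H (cis t))" by (rule bmf_circle[OF continuous_on_subset[OF H(1)]]) auto
  have bs: "bmf (\<lambda>t. szego z (cis t))" by (rule bmf_circle[OF continuous_on_subset[OF cs]]) auto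
  have bp: "bmf (\<lambda>t. H (cis t) * complex_of_real (pk z t))" by (intro bmf_mult bmf_of_real bmf_pk bH z)
  have "integral\<^sup>L TT (\<lambda>t. H (cis t) * complex_of_real (pk z t)) =
     integral\<^sup>L TT (\<lambda>t. (H (cis t) * cnj (szego z (cis t)) + H (cis t) * szego z (cis t)) - H (cis t))"
    unfolding pk by (simp add: algebra_simps)
  also have "\<dots> = integral\<^sup>L TT (\<lambda>t. H (cis t) * cnj (szego z (cis t))) + integral\<^sup>L TT (\<lambda>t. H (cis t) * szego z (cis t)) - integral\<^sup>L TT (\<lambda>t. H (cis t))"
    by (subst Bochner_Integration.integral_diff, intro bmf_integrable bmf_add bmf_mult bH bs bmf_cnj, intro bmf_integrable bH,
        subst Bochner_Integration.integral_add, intro bmf_integrable bmf_mult bH bs bmf_cnj, intro bmf_integrable bmf_mult bH bs, rule refl)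
  also have "integral\<^sup>L TT (\<lambda>t. H (cis t) * szego z (cis t)) = 2 * pi * (H 0 * szego z 0)"
    by (rule mean_value_circle[where G = "\<lambda>x. H x * szego z x"])
      (auto intro!: continuous_intros holomorphic_intros H cs holomorphic_on_subset[OF hs])
  finally have "integral\<^sup>L TT (\<lambda>t. H (cis t) * complex_of_real (pk z t)) = 2 * pi * H z"
    unfolding cauchy_circle[OF H z] mean_value_circle[OF H] by (simp add: szego_def)
  then have "Re (integral\<^sup>L TT (\<lambda>t. H (cis t) * complex_of_real (pk z t))) = 2 * pi * Re (H z)" by simp
  then show ?thesis unfolding integral_Re[OF bmf_integrable[OF bp], symmetric] by (simp add: mult.commute)
qed

text \<open>The logarithm of the modulus of an outer function is the Poisson integral of its
  boundary values. The kernel is bounded and the logarithm absolutely integrable, so the gauge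
  integral in \<open>outer\<close> is a Lebesgue integral and real parts can be taken under
  it.\<close>

lemma norm_outer:
  assumes a: "outer a" and z: "z \<in> ball 0 1"
  shows "integrable TT (\<lambda>t. ln (cmod (bdry a t)))"
    and "integrable TT (\<lambda>t. pk z t * ln (cmod (bdry a t)))"
    and "cmod (a z) = exp (integral\<^sup>L TT (\<lambda>t. pk z t * ln (cmod (bdry a t))) / (2 * pi))"
proof -
  define u where "u = (\<lambda>t. ln (cmod (bdry a t)))"
  have z1: "cmod z < 1" using z by simp
  obtain \<gamma> where g: "cmod \<gamma> = 1" and az: "a z = \<gamma> * exp (integral {0..2*pi} (\<lambda>t. (cis t + z) / (cis t - z) * complex_of_real (u t)) / (2 * pi))"
    using a z unfolding outer_def u_def by blast
  have iu: "integrable TT u"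
    using a unfolding outer_def u_def[symmetric] by (simp add: integrable_restrict_space set_integrable_def)
  then show "integrable TT (\<lambda>t. ln (cmod (bdry a t)))" by (simp only: u_def)
  obtain B where B: "\<And>t. cmod ((cis t + z) / (cis t - z)) \<le> B" using bmf_herglotz[OF z1] unfolding bmf_def by blast
  have iK: "integrable TT (\<lambda>t. (cis t + z) / (cis t - z) * complex_of_real (u t))"
  proof (rule Bochner_Integration.integrable_bound)
    show "integrable TT (\<lambda>t. B * \<bar>u t\<bar>)" by (intro integrable_mult_right integrable_abs iu)
    show "(\<lambda>t. (cis t + z) / (cis t - z) * complex_of_real (u t)) \<in> borel_measurable TT"
      by (rule borel_measurable_times[OF bmf_meas[OF bmf_herglotz[OF z1]] measurable_compose[OF borel_measurable_integrable[OF iu] borel_measurable_of_real]])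
    show "AE t in TT. norm ((cis t + z) / (cis t - z) * complex_of_real (u t)) \<le> norm (B * \<bar>u t\<bar>)"
    proof (rule AE_I2)
      fix t
      have "0 \<le> B" using order_trans[OF norm_ge_zero B[of t]] .
      then show "norm ((cis t + z) / (cis t - z) * complex_of_real (u t)) \<le> norm (B * \<bar>u t\<bar>)"
        using mult_right_mono[OF B[of t], of "\<bar>u t\<bar>"] by (simp only: norm_mult norm_of_real real_norm_def abs_mult abs_abs abs_of_nonneg abs_ge_zero)
    qed
  qed
  have Re: "Re ((cis t + z) / (cis t - z) * complex_of_real (u t)) = pk z t * u t" for t
  proof -
    have "Re (x * complex_of_real r) = Re x * r" for x r by simp
    then show ?thesis unfolding pk_def .
  qed
  have "integrable TT (\<lambda>t. Re ((cis t + z) / (cis t - z) * complex_of_real (u t)))" by (rule integrable_Re[OF iK])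
  then show "integrable TT (\<lambda>t. pk z t * ln (cmod (bdry a t)))" unfolding Re by (simp only: u_def)
  have "integral {0..2*pi} (\<lambda>t. (cis t + z) / (cis t - z) * complex_of_real (u t)) = integral\<^sup>L TT (\<lambda>t. (cis t + z) / (cis t - z) * complex_of_real (u t))"
    by (rule lebesgue_integral_eq_integral[OF iK, symmetric]) simp
  moreover have "Re (integral\<^sup>L TT (\<lambda>t. (cis t + z) / (cis t - z) * complex_of_real (u t))) = integral\<^sup>L TT (\<lambda>t. pk z t * u t)"
    unfolding integral_Re[OF iK, symmetric] Re ..
  moreover have "Re (x / (2 * pi)) = Re x / (2 * pi)" for x :: complex
  proof -
    have "x / (2 * pi) = x / complex_of_real (2 * pi)" by simp
    then show ?thesis by (simp only: Re_divide_of_real)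
  qed
  ultimately have "cmod (a z) = exp (integral\<^sup>L TT (\<lambda>t. pk z t * u t) / (2 * pi))"
    by (simp only: az norm_mult g norm_exp_eq_Re mult_1)
  then show "cmod (a z) = exp (integral\<^sup>L TT (\<lambda>t. pk z t * ln (cmod (bdry a t))) / (2 * pi))" by (simp only: u_def)
qed

text \<open>The logarithm of \<open>cmod (pz Z x)\<close> with the zeros moved to radius
  \<open>R\<close>; for \<open>R = 1\<close> the two agree off \<open>Z\<close>.\<close>

definition lp :: "complex set \<Rightarrow> real \<Rightarrow> complex \<Rightarrow> real" where
  "lp Z R x = (\<Sum>\<zeta>\<in>Z. ln (cmod (x - complex_of_real R * \<zeta>)))"

lemma lp_one: assumes "finite Z" "pz Z x \<noteq> 0" shows "lp Z 1 x = ln (cmod (pz Z x))"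
proof -
  have "x \<noteq> \<zeta>" if "\<zeta> \<in> Z" for \<zeta> using assms that by (auto simp: pz_def)
  then show ?thesis unfolding lp_def cmod_pz using assms(1) by (subst ln_prod) auto
qed

lemma poisson_lp:
  assumes Z: "finite Z" "Z \<subseteq> sphere 0 1" and R: "1 < R" and z: "cmod z < 1"
  shows "integral\<^sup>L TT (\<lambda>t. pk z t * lp Z R (cis t)) = 2 * pi * lp Z R z"
proof -
  \<comment> \<open>A holomorphic function with real part \<open>lp Z R\<close>: for
    \<open>R > 1\<close> the number \<open>1 - x / (R * \<zeta>)\<close> has positive real part on
    the closed disc, so its principal logarithm is available, and \<open>ln R\<close> restores the
    modulus of the factor \<open>R * \<zeta>\<close>.\<close>
  define H where "H = (\<lambda>x. \<Sum>\<zeta>\<in>Z. Ln (1 - x / (complex_of_real R * \<zeta>)) + complex_of_real (ln R))"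
  have pos: "0 < Re (1 - x / (complex_of_real R * \<zeta>))" if "\<zeta> \<in> Z" "cmod x \<le> 1" for x \<zeta>
  proof -
    have "cmod (x / (complex_of_real R * \<zeta>)) = cmod x / R" using that Z R by (auto simp: norm_divide norm_mult)
    also have "\<dots> < 1" using that R by simp
    finally show ?thesis using complex_Re_le_cmod[of "x / (complex_of_real R * \<zeta>)"] by (simp del: Re_divide)
  qed
  have hol: "H holomorphic_on cball 0 1" unfolding H_def
  proof (intro holomorphic_intros)
    fix \<zeta> x :: complex assume "\<zeta> \<in> Z" "x \<in> cball 0 1"
    then show "1 - x / (complex_of_real R * \<zeta>) \<notin> \<real>\<^sub>\<le>\<^sub>0" using pos[of \<zeta> x] by (auto simp: complex_nonpos_Reals_iff simp del: Re_divide)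
  qed (use Z R in auto)
  have ReH: "Re (H x) = lp Z R x" if x: "cmod x \<le> 1" for x
    unfolding H_def lp_def Re_sum
  proof (intro sum.cong refl)
    fix \<zeta> assume z: "\<zeta> \<in> Z"
    have ne: "1 - x / (complex_of_real R * \<zeta>) \<noteq> 0" using pos[OF z x] by (auto simp del: Re_divide)
    have z0: "cmod \<zeta> = 1" "\<zeta> \<noteq> 0" using z Z by auto
    have "x - complex_of_real R * \<zeta> = - (complex_of_real R * \<zeta>) * (1 - x / (complex_of_real R * \<zeta>))" using R z0 by (simp add: field_simps)
    then have "cmod (x - complex_of_real R * \<zeta>) = R * cmod (1 - x / (complex_of_real R * \<zeta>))" using R z0 by (simp add: norm_mult)
    then have "ln (cmod (x - complex_of_real R * \<zeta>)) = ln R + ln (cmod (1 - x / (complex_of_real R * \<zeta>)))" using R ne by (simp add: ln_mult)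
    then show "Re (Ln (1 - x / (complex_of_real R * \<zeta>)) + complex_of_real (ln R)) = ln (cmod (x - complex_of_real R * \<zeta>))" using ne by simp
  qed
  have "integral\<^sup>L TT (\<lambda>t. pk z t * Re (H (cis t))) = 2 * pi * Re (H z)"
    by (rule poisson_reproduces[OF holomorphic_on_imp_continuous_on[OF hol] holomorphic_on_subset[OF hol] z]) auto
  then show ?thesis using ReH z by simp
qed

text \<open>The squared distance is \<open>1 + r\<^sup>2 - 2 * r * x\<close> with
  \<open>x \<le> 1\<close>, which increases for \<open>r \<ge> 1\<close>. Moving the zeros outwards
  only raises \<open>lp\<close> on the circle, so a lower bound for \<open>R = 1\<close> serves all
  larger \<open>R\<close>.\<close>

lemma cmod_circle_diff_mono:
  fixes e \<zeta> :: complex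
  assumes "cmod e = 1" "cmod \<zeta> = 1" "1 \<le> R" shows "cmod (e - \<zeta>) \<le> cmod (e - complex_of_real R * \<zeta>)"
proof -
  define x where "x = Re e * Re \<zeta> + Im e * Im \<zeta>"
  have one: "(Re e)\<^sup>2 + (Im e)\<^sup>2 = 1" "(Re \<zeta>)\<^sup>2 + (Im \<zeta>)\<^sup>2 = 1" using assms by (simp_all flip: cmod_power2)
  have sq: "(cmod (e - complex_of_real r * \<zeta>))\<^sup>2 = 1 + r\<^sup>2 - 2 * r * x" for r
  proof -
    have "(cmod (e - complex_of_real r * \<zeta>))\<^sup>2 = (Re e - r * Re \<zeta>)\<^sup>2 + (Im e - r * Im \<zeta>)\<^sup>2" by (simp add: cmod_power2)
    also have "\<dots> = ((Re e)\<^sup>2 + (Im e)\<^sup>2) + r\<^sup>2 * ((Re \<zeta>)\<^sup>2 + (Im \<zeta>)\<^sup>2) - 2 * r * x" by (simp add: x_def power2_eq_square algebra_simps)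
    finally show ?thesis unfolding one by simp
  qed
  have "x \<le> 1" using sq[of 1] zero_le_power2[of "cmod (e - complex_of_real 1 * \<zeta>)"] by simp
  then have "0 \<le> (R - 1) * (R + 1 - 2 * x)" using assms(3) by simp
  then have "(cmod (e - complex_of_real 1 * \<zeta>))\<^sup>2 \<le> (cmod (e - complex_of_real R * \<zeta>))\<^sup>2" unfolding sq by (simp add: power2_eq_square algebra_simps)
  from power2_le_imp_le[OF this norm_ge_zero] show ?thesis by simp
qed

text \<open>The logarithm of \<open>pz Z\<close> has its zeros on the circle; they are moved outside the disc, where the Poisson
  formula is classical, and a limit is taken.\<close>
lemma poisson_ln_pz:
  assumes Z: "finite Z" "Z \<subseteq> sphere 0 1" and z: "z \<in> ball 0 1"
    and u: "integrable TT u" and low: "AE t in TT. u t - M \<le> lp Z 1 (cis t)" and nz: "AE t in TT. pz Z (cis t) \<noteq> 0"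
  shows "integrable TT (\<lambda>t. pk z t * lp Z 1 (cis t))"
    and "integral\<^sup>L TT (\<lambda>t. pk z t * lp Z 1 (cis t)) = 2 * pi * ln (cmod (pz Z z))"
proof -
  have z1: "cmod z < 1" using z by simp
  define R where "R = (\<lambda>n. 1 + inverse (real (Suc n)))"
  have R: "1 < R n" "R n \<le> 2" for n by (simp_all add: R_def field_simps)
  have Rl: "R \<longlonglongrightarrow> 1" unfolding R_def by (rule LIMSEQ_inverse_real_of_nat_add)
  obtain B where B: "\<And>t. norm (pk z t) \<le> B" using bmf_pk[OF z1] unfolding bmf_def by blast
  have B0: "0 \<le> B" using order_trans[OF norm_ge_zero B[of 0]] .
  \<comment> \<open>From below the logarithm is controlled by \<open>u t - M\<close>, from above by
    \<open>ln 3\<close> for each zero because \<open>R n \<le> 2\<close>. Integrability of the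
    logarithm of \<open>pz Z\<close> is a result here and not an input.\<close>
  define W where "W = (\<lambda>t. B * (\<bar>u t\<bar> + (\<bar>M\<bar> + real (card Z) * ln 3)))"
  have iW: "integrable TT W" unfolding W_def
    by (intro integrable_mult_right Bochner_Integration.integrable_add integrable_abs u bmf_integrable bmf_const)
  have ml: "(\<lambda>t. lp Z r (cis t)) \<in> borel_measurable TT" for r
  proof -
    have "(\<lambda>t. cis t - complex_of_real r * \<zeta>) \<in> borel_measurable TT" for \<zeta>
      by (rule bmf_meas[OF bmf_circle[of "\<lambda>x. x - complex_of_real r * \<zeta>"]]) (intro continuous_intros)
    then have m: "(\<lambda>t. cmod (cis t - complex_of_real r * \<zeta>)) \<in> borel_measurable TT" for \<zeta>
      by (rule measurable_compose[OF _ borel_measurable_norm])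
    show ?thesis unfolding lp_def by (intro borel_measurable_sum borel_measurable_ln m)
  qed
  have mp: "(\<lambda>t. pk z t * lp Z r (cis t)) \<in> borel_measurable TT" for r by (intro borel_measurable_times ml bmf_meas[OF bmf_pk[OF z1]])
  have lim: "(\<lambda>n. lp Z (R n) x) \<longlonglongrightarrow> lp Z 1 x" if "pz Z x \<noteq> 0" for x
    unfolding lp_def
  proof (intro tendsto_sum tendsto_ln tendsto_norm tendsto_diff tendsto_const tendsto_mult tendsto_of_real Rl)
    fix \<zeta> assume "\<zeta> \<in> Z"
    then have "x \<noteq> \<zeta>" using that Z by (auto simp: pz_def)
    then show "cmod (x - complex_of_real 1 * \<zeta>) \<noteq> 0" by simp
  qed
  have bd: "\<bar>lp Z r (cis t)\<bar> \<le> \<bar>u t\<bar> + (\<bar>M\<bar> + real (card Z) * ln 3)"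
    if p: "pz Z (cis t) \<noteq> 0" and l: "u t - M \<le> lp Z 1 (cis t)" and r: "1 \<le> r" "r \<le> 2" for t r
  proof -
    have pos: "0 < cmod (cis t - \<zeta>)" if "\<zeta> \<in> Z" for \<zeta> using p that Z by (auto simp: pz_def)
    have 1: "lp Z 1 (cis t) \<le> lp Z r (cis t)" unfolding lp_def
    proof (rule sum_mono)
      fix \<zeta> assume z: "\<zeta> \<in> Z"
      have "cmod (cis t - \<zeta>) \<le> cmod (cis t - complex_of_real r * \<zeta>)" by (rule cmod_circle_diff_mono) (use z Z r in auto)
      then show "ln (cmod (cis t - complex_of_real 1 * \<zeta>)) \<le> ln (cmod (cis t - complex_of_real r * \<zeta>))" using pos[OF z] by (simp add: ln_mono)
    qed
    have 2: "lp Z r (cis t) \<le> real (card Z) * ln 3" unfolding lp_def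
    proof (rule sum_bounded_above)
      fix \<zeta> assume z: "\<zeta> \<in> Z"
      have "cmod (cis t - complex_of_real r * \<zeta>) \<le> 1 + r * 1" using norm_triangle_ineq4[of "cis t" "complex_of_real r * \<zeta>"] z Z r by (auto simp: norm_mult)
      moreover have "0 < cmod (cis t - complex_of_real r * \<zeta>)"
        by (rule less_le_trans[OF pos[OF z] cmod_circle_diff_mono]) (use z Z r in auto)
      ultimately show "ln (cmod (cis t - complex_of_real r * \<zeta>)) \<le> ln 3" using r by simp
    qed
    have "0 \<le> real (card Z) * ln 3" by simp
    then show ?thesis using 1 2 l by linarith
  qed
  have pb: "norm (pk z t * lp Z r (cis t)) \<le> W t"
    if "pz Z (cis t) \<noteq> 0" "u t - M \<le> lp Z 1 (cis t)" "1 \<le> r" "r \<le> 2" for t r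
    unfolding W_def real_norm_def abs_mult by (rule mult_mono[OF _ bd[OF that]]) (use B[of t] B0 in auto)
  have dom: "AE t in TT. norm (pk z t * lp Z r (cis t)) \<le> W t" if "1 \<le> r" "r \<le> 2" for r
    using nz low
  proof eventually_elim
    case (elim t)
    then show ?case by (rule pb[OF _ _ that])
  qed
  have L: "AE t in TT. (\<lambda>n. pk z t * lp Z (R n) (cis t)) \<longlonglongrightarrow> pk z t * lp Z 1 (cis t)"
    using nz
  proof eventually_elim
    case (elim t)
    then show ?case by (intro tendsto_mult_left lim)
  qed
  have d: "AE t in TT. norm (pk z t * lp Z (R n) (cis t)) \<le> W t" for n using R[of n] by (intro dom) auto
  show "integrable TT (\<lambda>t. pk z t * lp Z 1 (cis t))"
    by (rule integrable_dominated_convergence[OF mp mp iW L d])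
  have "(\<lambda>n. integral\<^sup>L TT (\<lambda>t. pk z t * lp Z (R n) (cis t))) \<longlonglongrightarrow> integral\<^sup>L TT (\<lambda>t. pk z t * lp Z 1 (cis t))"
    by (rule integral_dominated_convergence[OF mp mp iW L d])
  moreover have "(\<lambda>n. integral\<^sup>L TT (\<lambda>t. pk z t * lp Z (R n) (cis t))) \<longlonglongrightarrow> 2 * pi * lp Z 1 z"
    unfolding poisson_lp[OF Z R(1) z1] by (intro tendsto_mult_left lim pz_nonzero[OF Z(2) z])
  ultimately show "integral\<^sup>L TT (\<lambda>t. pk z t * lp Z 1 (cis t)) = 2 * pi * ln (cmod (pz Z z))"
    unfolding lp_one[OF Z(1) pz_nonzero[OF Z(2) z], symmetric] by (rule LIMSEQ_unique)
qed

text \<open>The upper comparison bounds the logarithm of \<open>pz Z\<close> from below by an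
  integrable function, as \<open>poisson_ln_pz\<close> requires. Both logarithms are then Poisson
  integrals, and a nonnegative kernel preserves the two inequalities.\<close>

lemma outer_comparison:
  assumes a: "outer a" and Z: "finite Z" "Z \<subseteq> sphere 0 1" and k: "0 < k" and K: "0 < K"
    and pos: "AE t in TT. 0 < cmod (bdry a t)"
    and lo: "AE t in TT. k * cmod (pz Z (cis t)) \<le> cmod (bdry a t)"
    and up: "AE t in TT. cmod (bdry a t) \<le> K * cmod (pz Z (cis t))" and z: "z \<in> ball 0 1"
  shows "k * cmod (pz Z z) \<le> cmod (a z) \<and> cmod (a z) \<le> K * cmod (pz Z z)"
proof -
  have z1: "cmod z < 1" using z by simp
  have pn: "0 < cmod (pz Z z)" using pz_nonzero[OF Z(2) z] by simp
  define u where "u = (\<lambda>t. ln (cmod (bdry a t)))"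
  have nz: "AE t in TT. pz Z (cis t) \<noteq> 0"
    using pos up
  proof eventually_elim
    case (elim t)
    then show ?case by auto
  qed
  have up': "AE t in TT. u t - ln K \<le> lp Z 1 (cis t)"
    using pos up nz
  proof eventually_elim
    case (elim t)
    then have "u t \<le> ln (K * cmod (pz Z (cis t)))" unfolding u_def by (intro ln_mono) auto
    then show ?case using elim K by (simp add: lp_one[OF Z(1)] ln_mult)
  qed
  have lo': "AE t in TT. lp Z 1 (cis t) \<le> u t - ln k"
    using pos lo nz
  proof eventually_elim
    case (elim t)
    then have "ln (k * cmod (pz Z (cis t))) \<le> u t" unfolding u_def using k by (intro ln_mono) auto
    then show ?case using elim k by (simp add: lp_one[OF Z(1)] ln_mult)
  qed
  have iu: "integrable TT u" unfolding u_def by (rule norm_outer(1)[OF a z])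
  have ipu: "integrable TT (\<lambda>t. pk z t * u t)" unfolding u_def by (rule norm_outer(2)[OF a z])
  have az: "cmod (a z) = exp (integral\<^sup>L TT (\<lambda>t. pk z t * u t) / (2 * pi))" unfolding u_def by (rule norm_outer(3)[OF a z])
  have il: "integrable TT (\<lambda>t. pk z t * lp Z 1 (cis t))"
    and I: "integral\<^sup>L TT (\<lambda>t. pk z t * lp Z 1 (cis t)) = 2 * pi * ln (cmod (pz Z z))"
    using poisson_ln_pz[OF Z z iu up' nz] by auto
  have ic: "integrable TT (\<lambda>t. pk z t * c)" for c by (intro bmf_integrable bmf_mult bmf_pk z1 bmf_const)
  have c: "integral\<^sup>L TT (\<lambda>t. pk z t * c) = 2 * pi * c" for c
    using poisson_reproduces[of "\<lambda>x. complex_of_real c" z] z1 by simp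
  have sum: "integral\<^sup>L TT (\<lambda>t. pk z t * lp Z 1 (cis t) + pk z t * c) = 2 * pi * (ln (cmod (pz Z z)) + c)" for c
    by (subst Bochner_Integration.integral_add[OF il ic]) (simp only: I \<open>\<And>c. integral\<^sup>L TT (\<lambda>t. pk z t * c) = 2 * pi * c\<close> distrib_left)
  have "integral\<^sup>L TT (\<lambda>t. pk z t * lp Z 1 (cis t) + pk z t * ln k) \<le> integral\<^sup>L TT (\<lambda>t. pk z t * u t)"
  proof (rule integral_mono_AE[OF Bochner_Integration.integrable_add[OF il ic] ipu])
    show "AE t in TT. pk z t * lp Z 1 (cis t) + pk z t * ln k \<le> pk z t * u t"
      using lo'
    proof eventually_elim
      case (elim t)
      then show ?case unfolding distrib_left[symmetric] by (intro mult_left_mono pk_nonneg z1) simp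
    qed
  qed
  then have 1: "ln (cmod (pz Z z)) + ln k \<le> integral\<^sup>L TT (\<lambda>t. pk z t * u t) / (2 * pi)" unfolding sum by (simp add: field_simps)
  have "integral\<^sup>L TT (\<lambda>t. pk z t * u t) \<le> integral\<^sup>L TT (\<lambda>t. pk z t * lp Z 1 (cis t) + pk z t * ln K)"
  proof (rule integral_mono_AE[OF ipu Bochner_Integration.integrable_add[OF il ic]])
    show "AE t in TT. pk z t * u t \<le> pk z t * lp Z 1 (cis t) + pk z t * ln K"
      using up'
    proof eventually_elim
      case (elim t)
      then show ?case unfolding distrib_left[symmetric] by (intro mult_left_mono pk_nonneg z1) simp
    qed
  qed
  then have 2: "integral\<^sup>L TT (\<lambda>t. pk z t * u t) / (2 * pi) \<le> ln (cmod (pz Z z)) + ln K" unfolding sum by (simp add: field_simps)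
  have e: "exp (ln (cmod (pz Z z)) + ln c) = c * cmod (pz Z z)" if "0 < c" for c unfolding exp_add using that pn by simp
  show ?thesis unfolding az e[OF k, symmetric] e[OF K, symmetric] exp_le_cancel_iff using 1 2 by (rule conjI)
qed

section \<open>The equivalences\<close>

text \<open>The common form into which both the condition on the potential and the factorization are
  translated.\<close>

definition comparable :: "(complex \<Rightarrow> complex) \<Rightarrow> complex set \<Rightarrow> bool" where
  "comparable a Z \<longleftrightarrow> (\<exists>k>0. \<exists>K>0. \<forall>z\<in>ball 0 1. k * cmod (pz Z z) \<le> cmod (a z) \<and> cmod (a z) \<le> K * cmod (pz Z z))"

lemma factorization_iff_comparable:
  assumes Z: "Z \<subseteq> sphere 0 1" and a: "a holomorphic_on ball 0 1"
  shows "(\<exists>g. Hinf g \<and> 0 < (INF z\<in>ball 0 1. cmod (g z)) \<and> (\<forall>z\<in>ball 0 1. a z = (\<Prod>\<zeta>\<in>Z. z - \<zeta>) * g z)) \<longleftrightarrow> comparable a Z"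
proof
  assume "\<exists>g. Hinf g \<and> 0 < (INF z\<in>ball 0 1. cmod (g z)) \<and> (\<forall>z\<in>ball 0 1. a z = (\<Prod>\<zeta>\<in>Z. z - \<zeta>) * g z)"
  then obtain g where g: "Hinf g" and i: "0 < (INF z\<in>ball 0 1. cmod (g z))" and az: "\<forall>z\<in>ball 0 1. a z = (\<Prod>\<zeta>\<in>Z. z - \<zeta>) * g z" by blast
  obtain K where K: "0 < K" "\<forall>x\<in>g ` ball 0 1. cmod x \<le> K" using g unfolding Hinf_def bounded_pos by blast
  have lo: "(INF z\<in>ball 0 1. cmod (g z)) \<le> cmod (g z)" if "z \<in> ball 0 1" for z
    by (rule cINF_lower[OF _ that]) (auto intro: bdd_belowI[of _ 0])
  have "(INF z\<in>ball 0 1. cmod (g z)) * cmod (pz Z z) \<le> cmod (a z) \<and> cmod (a z) \<le> K * cmod (pz Z z)" if z: "z \<in> ball 0 1" for z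
  proof -
    have "cmod (a z) = cmod (g z) * cmod (pz Z z)" using az z by (simp add: pz_def norm_mult mult.commute)
    then show ?thesis using lo[OF z] K(2) z by (auto intro!: mult_right_mono)
  qed
  then show "comparable a Z" unfolding comparable_def using i K(1) by blast
next
  assume "comparable a Z"
  then obtain k K where k: "0 < k" "0 < K" and c: "\<And>z. z \<in> ball 0 1 \<Longrightarrow> k * cmod (pz Z z) \<le> cmod (a z) \<and> cmod (a z) \<le> K * cmod (pz Z z)"
    unfolding comparable_def by blast
  define g where "g = (\<lambda>z. a z / pz Z z)"
  have n: "0 < cmod (pz Z z)" if "z \<in> ball 0 1" for z using pz_nonzero[OF Z that] by simp
  have b: "k \<le> cmod (g z) \<and> cmod (g z) \<le> K" if z: "z \<in> ball 0 1" for z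
    using c[OF z] n[OF z] by (simp add: g_def norm_divide le_divide_eq divide_le_eq)
  have "g holomorphic_on ball 0 1" unfolding g_def by (intro holomorphic_intros a pz_hol pz_nonzero[OF Z])
  moreover have "bounded (g ` ball 0 1)" unfolding bounded_iff using b by blast
  moreover have "k \<le> (INF z\<in>ball 0 1. cmod (g z))" by (rule cINF_greatest) (use b in auto)
  moreover have "\<forall>z\<in>ball 0 1. a z = (\<Prod>\<zeta>\<in>Z. z - \<zeta>) * g z" using pz_nonzero[OF Z] by (simp add: g_def pz_def[symmetric])
  ultimately show "\<exists>g. Hinf g \<and> 0 < (INF z\<in>ball 0 1. cmod (g z)) \<and> (\<forall>z\<in>ball 0 1. a z = (\<Prod>\<zeta>\<in>Z. z - \<zeta>) * g z)"
    unfolding Hinf_def using k(1) by (intro exI[of _ g]) auto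
qed

text \<open>\<open>V_mu Z z * (cmod (pz Z z))\<^sup>2\<close> is the continuous function \<open>z \<mapsto> (\<Sum>\<zeta>\<in>Z. (cmod (pz (Z - {\<zeta>}) z))\<^sup>2)\<close>, which has no zero
  on the closed disc as long as \<open>Z\<close> is nonempty.\<close>
lemma potential_bounds:
  assumes Z: "finite Z" "Z \<subseteq> sphere 0 1" "Z \<noteq> {}"
  shows "\<exists>\<alpha>>0. \<exists>\<beta>. \<forall>z\<in>ball 0 1. \<alpha> \<le> V_mu Z z * (cmod (pz Z z))\<^sup>2 \<and> V_mu Z z * (cmod (pz Z z))\<^sup>2 \<le> \<beta>"
proof -
  define W where "W = (\<lambda>z. \<Sum>\<zeta>\<in>Z. (cmod (pz (Z - {\<zeta>}) z))\<^sup>2)"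
  have eq: "V_mu Z z * (cmod (pz Z z))\<^sup>2 = W z" if z: "z \<in> ball 0 1" for z
    unfolding V_mu_def W_def sum_distrib_right
  proof (intro sum.cong refl)
    fix \<zeta> assume \<zeta>: "\<zeta> \<in> Z"
    then have "cmod (z - \<zeta>) \<noteq> 0" using Z(2) z by auto
    then show "1 / (cmod (z - \<zeta>))\<^sup>2 * (cmod (pz Z z))\<^sup>2 = (cmod (pz (Z - {\<zeta>}) z))\<^sup>2"
      unfolding pz_remove[OF Z(1) \<zeta>] norm_mult power_mult_distrib by simp
  qed
  have cW: "continuous_on (cball 0 1) W" unfolding W_def by (intro continuous_intros pz_cont)
  have pos: "0 < W z" for z
  proof -
    obtain \<zeta> where \<zeta>: "\<zeta> \<in> Z" "pz (Z - {\<zeta>}) z \<noteq> 0"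
    proof (cases "z \<in> Z")
      case True
      have "pz (Z - {z}) z \<noteq> 0" using Z(1) by (simp add: pz_def)
      then show ?thesis using True that by blast
    next
      case False
      obtain \<zeta> where "\<zeta> \<in> Z" using Z(3) by blast
      moreover have "pz (Z - {\<zeta>}) z \<noteq> 0" using Z(1) False by (auto simp: pz_def)
      ultimately show ?thesis using that by blast
    qed
    have "0 < (cmod (pz (Z - {\<zeta>}) z))\<^sup>2" using \<zeta>(2) by simp
    also have "\<dots> \<le> W z" unfolding W_def by (rule member_le_sum[OF \<zeta>(1) _ Z(1)]) simp
    finally show ?thesis .
  qed
  obtain x where x: "\<forall>z\<in>cball 0 1. W x \<le> W z" using continuous_attains_inf[OF compact_cball _ cW] by auto
  obtain y where y: "\<forall>z\<in>cball 0 1. W z \<le> W y" using continuous_attains_sup[OF compact_cball _ cW] by auto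
  show ?thesis
  proof (rule exI[of _ "W x"], intro conjI pos exI[of _ "W y"] ballI)
    fix z :: complex assume z: "z \<in> ball 0 1"
    then have "z \<in> cball 0 1" by simp
    then show "W x \<le> V_mu Z z * (cmod (pz Z z))\<^sup>2" "V_mu Z z * (cmod (pz Z z))\<^sup>2 \<le> W y"
      unfolding eq[OF z] using x y by blast+
  qed
qed

text \<open>Up to constants the potential is \<open>1 / (cmod (pz Z z))\<^sup>2\<close>, so bounds
  for its product with \<open>(cmod (a z))\<^sup>2\<close> are bounds for the ratio of
  \<open>a\<close> and \<open>pz Z\<close>.\<close>

lemma potential_iff_comparable:
  assumes Z: "finite Z" "Z \<subseteq> sphere 0 1" "Z \<noteq> {}"
  shows "0 < (INF z\<in>ball 0 1. (cmod (a z))\<^sup>2 * V_mu Z z) \<and> bdd_above ((\<lambda>z. (cmod (a z))\<^sup>2 * V_mu Z z) ` ball 0 1) \<longleftrightarrow> comparable a Z"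
proof -
  obtain \<alpha> \<beta> where al: "0 < \<alpha>" and be: "\<And>z. z \<in> ball 0 1 \<Longrightarrow> \<alpha> \<le> V_mu Z z * (cmod (pz Z z))\<^sup>2 \<and> V_mu Z z * (cmod (pz Z z))\<^sup>2 \<le> \<beta>"
    using potential_bounds[OF Z] by blast
  have "\<alpha> \<le> \<beta>" using be[of 0] by simp
  then have b0: "0 < \<beta>" using al by linarith
  have V0: "0 \<le> V_mu Z z" for z by (simp add: V_mu_def sum_nonneg)
  have P: "0 < (cmod (pz Z z))\<^sup>2" if "z \<in> ball 0 1" for z using pz_nonzero[OF Z(2) that] by simp
  show ?thesis
  proof
    assume A: "0 < (INF z\<in>ball 0 1. (cmod (a z))\<^sup>2 * V_mu Z z) \<and> bdd_above ((\<lambda>z. (cmod (a z))\<^sup>2 * V_mu Z z) ` ball 0 1)"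
    define i where "i = (INF z\<in>ball 0 1. (cmod (a z))\<^sup>2 * V_mu Z z)"
    have i0: "0 < i" using A by (simp add: i_def)
    obtain s where s: "\<And>z. z \<in> ball 0 1 \<Longrightarrow> (cmod (a z))\<^sup>2 * V_mu Z z \<le> s" using A unfolding bdd_above_def by blast
    have lo: "i \<le> (cmod (a z))\<^sup>2 * V_mu Z z" if "z \<in> ball 0 1" for z
      unfolding i_def by (rule cINF_lower[OF _ that]) (auto intro!: bdd_belowI[of _ 0] mult_nonneg_nonneg V0)
    have s0: "0 < s" using lo[of 0] s[of 0] i0 by simp
    have "sqrt (i / \<beta>) * cmod (pz Z z) \<le> cmod (a z) \<and> cmod (a z) \<le> sqrt (s / \<alpha>) * cmod (pz Z z)" if z: "z \<in> ball 0 1" for z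
    proof -
      define A2 V p where "A2 = (cmod (a z))\<^sup>2" and "V = V_mu Z z" and "p = (cmod (pz Z z))\<^sup>2"
      have f: "i \<le> A2 * V" "A2 * V \<le> s" "\<alpha> \<le> V * p" "V * p \<le> \<beta>" "0 < p" "0 \<le> V" "0 \<le> A2"
        using lo[OF z] s[OF z] be[OF z] P[OF z] V0 by (simp_all add: A2_def V_def p_def)
      have "i * p \<le> (A2 * V) * p" using f by (intro mult_right_mono) auto
      also have "\<dots> = A2 * (V * p)" by (rule mult.assoc)
      also have "\<dots> \<le> A2 * \<beta>" using f by (intro mult_left_mono) auto
      finally have "i / \<beta> * p \<le> A2" using b0 by (simp add: field_simps)
      then have "(sqrt (i / \<beta>) * cmod (pz Z z))\<^sup>2 \<le> (cmod (a z))\<^sup>2" using i0 b0 by (simp add: power_mult_distrib A2_def p_def)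
      then have 1: "sqrt (i / \<beta>) * cmod (pz Z z) \<le> cmod (a z)" by (rule power2_le_imp_le) simp
      have "A2 * \<alpha> \<le> A2 * (V * p)" using f by (intro mult_left_mono) auto
      also have "\<dots> = (A2 * V) * p" by simp
      also have "\<dots> \<le> s * p" using f by (intro mult_right_mono) auto
      finally have "A2 \<le> s / \<alpha> * p" using al by (simp add: field_simps)
      then have "(cmod (a z))\<^sup>2 \<le> (sqrt (s / \<alpha>) * cmod (pz Z z))\<^sup>2" using s0 al by (simp add: power_mult_distrib A2_def p_def)
      then have "cmod (a z) \<le> sqrt (s / \<alpha>) * cmod (pz Z z)" by (rule power2_le_imp_le) (use s0 al in simp)
      with 1 show ?thesis ..
    qed
    moreover have "0 < sqrt (i / \<beta>)" "0 < sqrt (s / \<alpha>)" using i0 b0 s0 al by auto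
    ultimately show "comparable a Z" unfolding comparable_def by blast
  next
    assume "comparable a Z"
    then obtain k K where k: "0 < k" "0 < K" and c: "\<And>z. z \<in> ball 0 1 \<Longrightarrow> k * cmod (pz Z z) \<le> cmod (a z) \<and> cmod (a z) \<le> K * cmod (pz Z z)"
      unfolding comparable_def by blast
    have b: "k\<^sup>2 * \<alpha> \<le> (cmod (a z))\<^sup>2 * V_mu Z z \<and> (cmod (a z))\<^sup>2 * V_mu Z z \<le> K\<^sup>2 * \<beta>" if z: "z \<in> ball 0 1" for z
    proof
      have "k\<^sup>2 * \<alpha> \<le> k\<^sup>2 * (V_mu Z z * (cmod (pz Z z))\<^sup>2)" using be[OF z] by (intro mult_left_mono) auto
      also have "\<dots> = (k * cmod (pz Z z))\<^sup>2 * V_mu Z z" by (simp add: power_mult_distrib)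
      also have "\<dots> \<le> (cmod (a z))\<^sup>2 * V_mu Z z" using c[OF z] k by (intro mult_right_mono power_mono V0) auto
      finally show "k\<^sup>2 * \<alpha> \<le> (cmod (a z))\<^sup>2 * V_mu Z z" .
      have "(cmod (a z))\<^sup>2 * V_mu Z z \<le> (K * cmod (pz Z z))\<^sup>2 * V_mu Z z" using c[OF z] by (intro mult_right_mono power_mono V0) auto
      also have "\<dots> = K\<^sup>2 * (V_mu Z z * (cmod (pz Z z))\<^sup>2)" by (simp add: power_mult_distrib)
      also have "\<dots> \<le> K\<^sup>2 * \<beta>" using be[OF z] by (intro mult_left_mono) auto
      finally show "(cmod (a z))\<^sup>2 * V_mu Z z \<le> K\<^sup>2 * \<beta>" .
    qed
    have "k\<^sup>2 * \<alpha> \<le> (INF z\<in>ball 0 1. (cmod (a z))\<^sup>2 * V_mu Z z)" by (rule cINF_greatest) (use b in auto)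
    moreover have "0 < k\<^sup>2 * \<alpha>" using k al by simp
    ultimately have "0 < (INF z\<in>ball 0 1. (cmod (a z))\<^sup>2 * V_mu Z z)" by linarith
    moreover have "bdd_above ((\<lambda>z. (cmod (a z))\<^sup>2 * V_mu Z z) ` ball 0 1)" by (rule bdd_aboveI[of _ "K\<^sup>2 * \<beta>"]) (use b in auto)
    ultimately show "0 < (INF z\<in>ball 0 1. (cmod (a z))\<^sup>2 * V_mu Z z) \<and> bdd_above ((\<lambda>z. (cmod (a z))\<^sup>2 * V_mu Z z) ` ball 0 1)" ..
  qed
qed

text \<open>Since \<open>cmod (bdry b t) < 1\<close> almost everywhere, the boundary values of the
  mate are nonzero almost everywhere, which protects the later logarithms from the convention
  \<open>ln 0 = 0\<close>.\<close>

lemma boundary_mate: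
  assumes b: "nonextreme b" and a: "pyth_mate b a"
  shows "\<exists>bs. bfun b bs \<and> (\<forall>t. cmod (bs t) \<le> 1) \<and>
    (AE t in TT. (cmod (bdry a t))\<^sup>2 = 1 - (cmod (bs t))\<^sup>2 \<and> 0 < cmod (bdry a t))"
proof -
  have hol: "b holomorphic_on ball 0 1" and b1: "\<And>z. z \<in> ball 0 1 \<Longrightarrow> cmod (b z) \<le> 1"
    and lt: "AE t in TT. cmod (bdry b t) < 1" using b by (auto simp: nonextreme_def Hinf_ball1_def)
  have eq: "AE t in TT. (cmod (bdry a t))\<^sup>2 + (cmod (bdry b t))\<^sup>2 = 1" using a by (simp add: pyth_mate_def)
  obtain bs where bs: "bs \<in> borel_measurable TT" "\<And>t. cmod (bs t) \<le> 1"
    "AE t in TT. bdry b t = bs t" "AE t in TT. ((\<lambda>r. b (complex_of_real r * cis t)) \<longlongrightarrow> bs t) (at_left 1)"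
  proof (rule boundary_function[OF hol b1])
    fix fs assume "fs \<in> borel_measurable TT" "\<And>t. cmod (fs t) \<le> 1" "AE t in TT. bdry b t = fs t"
      "AE t in TT. ((\<lambda>r. b (complex_of_real r * cis t)) \<longlongrightarrow> fs t) (at_left 1)"
    then show thesis by (rule that)
  qed
  have "bfun b bs" by (rule bfunI[OF hol b1 bmfI[OF bs(1,2)] bs(4)])
  moreover have "AE t in TT. (cmod (bdry a t))\<^sup>2 = 1 - (cmod (bs t))\<^sup>2 \<and> 0 < cmod (bdry a t)"
    using lt eq bs(3)
  proof eventually_elim
    case (elim t)
    have "(cmod (bdry b t))\<^sup>2 < 1" using elim(1) by (simp add: abs_square_less_1)
    then have "0 < (cmod (bdry a t))\<^sup>2" using elim(2) by linarith
    then show ?case using elim(2,3) by simp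
  qed
  ultimately show ?thesis using bs(2) by blast
qed

lemma comparable_imp_eq:
  assumes b: "nonextreme b" and a: "pyth_mate b a" and Z: "finite Z" "Z \<subseteq> sphere 0 1"
    and sp: "Z \<subseteq> sphere 0 1 - spectrum_b b" and c: "comparable a Z"
  shows "in_Hb b f \<longleftrightarrow> in_Dmu Z f"
proof -
  obtain bs where bf: "bfun b bs" and bs1: "\<And>t. cmod (bs t) \<le> 1"
    and mate: "AE t in TT. (cmod (bdry a t))\<^sup>2 = 1 - (cmod (bs t))\<^sup>2 \<and> 0 < cmod (bdry a t)"
    using boundary_mate[OF b a] by blast
  obtain k K where k: "0 < k" "0 < K" and kK: "\<And>z. z \<in> ball 0 1 \<Longrightarrow> k * cmod (pz Z z) \<le> cmod (a z) \<and> cmod (a z) \<le> K * cmod (pz Z z)"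
    using c unfolding comparable_def by blast
  have hol: "a holomorphic_on ball 0 1" using a by (simp add: pyth_mate_def outer_def)
  \<comment> \<open>Comparability makes \<open>a\<close> bounded, so its radial limits exist almost
    everywhere and inherit the comparison with \<open>pz Z\<close>.\<close>
  have ab: "cmod (a z) \<le> K * 2 ^ card Z" if z: "z \<in> ball 0 1" for z
  proof -
    have "cmod (a z) \<le> K * cmod (pz Z z)" using kK[OF z] by simp
    also have "\<dots> \<le> K * 2 ^ card Z" using pz_upper[OF Z(2), of z] z k by (intro mult_left_mono) auto
    finally show ?thesis .
  qed
  obtain as where as: "as \<in> borel_measurable TT" "\<And>t. cmod (as t) \<le> K * 2 ^ card Z"
    "AE t in TT. bdry a t = as t" "AE t in TT. ((\<lambda>r. a (complex_of_real r * cis t)) \<longlongrightarrow> as t) (at_left 1)"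
  proof (rule boundary_function[OF hol ab])
    fix fs assume "fs \<in> borel_measurable TT" "\<And>t. cmod (fs t) \<le> K * 2 ^ card Z" "AE t in TT. bdry a t = fs t"
      "AE t in TT. ((\<lambda>r. a (complex_of_real r * cis t)) \<longlongrightarrow> fs t) (at_left 1)"
    then show thesis by (rule that)
  qed
  have af: "bfun a as" by (rule bfunI[OF hol ab bmfI[OF as(1,2)] as(4)])
  have cmp: "AE t in TT. k\<^sup>2 * (cmod (pz Z (cis t)))\<^sup>2 \<le> 1 - (cmod (bs t))\<^sup>2 \<and> 1 - (cmod (bs t))\<^sup>2 \<le> K\<^sup>2 * (cmod (pz Z (cis t)))\<^sup>2"
    using mate as(3) bfun_seq[OF af] bfun_seq[OF bfun_pz[of Z]]
  proof eventually_elim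
    case (elim t)
    have inb: "complex_of_real (rad n) * cis t \<in> ball 0 1" for n using rad[of n] by (simp add: norm_mult)
    have "k * cmod (pz Z (cis t)) \<le> cmod (as t)"
      by (rule LIMSEQ_le[OF tendsto_mult_left[OF tendsto_norm[OF elim(4)]] tendsto_norm[OF elim(3)]]) (use kK[OF inb] in blast)
    then have "(k * cmod (pz Z (cis t)))\<^sup>2 \<le> (cmod (as t))\<^sup>2" by (rule power_mono) (use k in simp)
    moreover have "cmod (as t) \<le> K * cmod (pz Z (cis t))"
      by (rule LIMSEQ_le[OF tendsto_norm[OF elim(3)] tendsto_mult_left[OF tendsto_norm[OF elim(4)]]]) (use kK[OF inb] in blast)
    then have "(cmod (as t))\<^sup>2 \<le> (K * cmod (pz Z (cis t)))\<^sup>2" by (rule power_mono) simp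
    ultimately show ?case using elim(1,2) by (simp add: power_mult_distrib)
  qed
  \<comment> \<open>Off the spectrum the lower limit of \<open>cmod (b z)\<close> is at least 1, so
    any bound below 1 holds near \<open>\<zeta>\<close>; the Hankel estimate uses 1/2.\<close>
  have low: "\<exists>\<epsilon>>0. \<forall>z\<in>ball 0 1. dist z \<zeta> < \<epsilon> \<longrightarrow> 1 / 2 \<le> cmod (b z)" if \<zeta>: "\<zeta> \<in> Z" for \<zeta>
  proof -
    have "1 \<le> Liminf (at \<zeta> within ball 0 1) (\<lambda>z. ereal (cmod (b z)))" using sp \<zeta> unfolding spectrum_b_def by auto
    then have "ereal (1 / 2) < Liminf (at \<zeta> within ball 0 1) (\<lambda>z. ereal (cmod (b z)))" by (rule less_le_trans[rotated]) simp
    from less_LiminfD[OF this] obtain \<epsilon> where "0 < \<epsilon>" "\<forall>z\<in>ball 0 1. z \<noteq> \<zeta> \<and> dist z \<zeta> < \<epsilon> \<longrightarrow> 1 / 2 < cmod (b z)"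
      unfolding eventually_at by auto
    moreover have "\<zeta> \<notin> ball 0 1" using \<zeta> Z by auto
    ultimately show ?thesis by (intro exI[of _ \<epsilon>]) (auto simp: less_imp_le)
  qed
  have up: "AE t in TT. 1 - (cmod (bs t))\<^sup>2 \<le> K\<^sup>2 * (cmod (pz Z (cis t)))\<^sup>2" using cmp by eventually_elim simp
  have lo: "AE t in TT. k\<^sup>2 * (cmod (pz Z (cis t)))\<^sup>2 \<le> 1 - (cmod (bs t))\<^sup>2" using cmp by eventually_elim simp
  have "0 < k\<^sup>2" using k by simp
  then show ?thesis
    using in_Hb_imp_in_Dmu[OF Z bf bs1 low zero_le_power2 up] in_Dmu_imp_in_Hb[OF Z bf _ lo] by blast
qed

section \<open>Consequences of the pointwise bounds and the final equivalence\<close>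

lemma trivial_limit_disc: assumes "cmod \<zeta> = 1" shows "\<not> trivial_limit (at \<zeta> within ball 0 1)"
proof -
  have "\<zeta> \<in> closure (ball 0 1 - {\<zeta>})" using assms by (simp add: Diff_triv)
  then show ?thesis using not_trivial_limit_within[of \<zeta> "ball 0 1"] by blast
qed

lemma eq_imp_bounds:
  assumes b: "bfun b bs" and bs1: "\<And>t. cmod (bs t) \<le> 1" and Z: "finite Z" "Z \<subseteq> sphere 0 1"
    and eq: "\<And>f. in_Hb b f \<longleftrightarrow> in_Dmu Z f"
  shows "\<exists>C>0. \<forall>z\<in>ball 0 1. 1 - (cmod (b z))\<^sup>2 \<le> C * ((1 - (cmod z)\<^sup>2) + (cmod (pz Z z))\<^sup>2) \<and> (cmod (pz Z z))\<^sup>2 \<le> C * (1 - (cmod (b z))\<^sup>2)"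
proof -
  obtain C1 where C1: "\<And>z. z \<in> ball 0 1 \<Longrightarrow> 1 - (cmod (b z))\<^sup>2 \<le> C1 * ((1 - (cmod z)\<^sup>2) + (cmod (pz Z z))\<^sup>2)"
    using kernel_le_of_in_Hb_imp_in_Dmu[OF Z b bs1] eq by blast
  obtain C2 where C2: "\<And>z. z \<in> ball 0 1 \<Longrightarrow> (cmod (pz Z z))\<^sup>2 \<le> C2 * (1 - (cmod (b z))\<^sup>2)"
    using pz_le_of_in_Dmu_imp_in_Hb[OF Z b bs1] eq by blast
  define C where "C = \<bar>C1\<bar> + \<bar>C2\<bar> + 1"
  have C: "0 < C" "C1 \<le> C" "C2 \<le> C" by (simp_all add: C_def)
  have "1 - (cmod (b z))\<^sup>2 \<le> C * ((1 - (cmod z)\<^sup>2) + (cmod (pz Z z))\<^sup>2) \<and> (cmod (pz Z z))\<^sup>2 \<le> C * (1 - (cmod (b z))\<^sup>2)" if z: "z \<in> ball 0 1" for z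
  proof
    have r: "0 < 1 - (cmod z)\<^sup>2" using z by (simp add: abs_square_less_1)
    have "0 \<le> kd b z" by (rule kd_nonneg[OF b bs1 z])
    then have b0: "0 \<le> 1 - (cmod (b z))\<^sup>2" using r by (simp add: kd_def zero_le_divide_iff)
    have "C1 * ((1 - (cmod z)\<^sup>2) + (cmod (pz Z z))\<^sup>2) \<le> C * ((1 - (cmod z)\<^sup>2) + (cmod (pz Z z))\<^sup>2)"
      using r C by (intro mult_right_mono add_nonneg_nonneg) auto
    then show "1 - (cmod (b z))\<^sup>2 \<le> C * ((1 - (cmod z)\<^sup>2) + (cmod (pz Z z))\<^sup>2)" using C1[OF z] by linarith
    have "C2 * (1 - (cmod (b z))\<^sup>2) \<le> C * (1 - (cmod (b z))\<^sup>2)" using C b0 by (intro mult_right_mono)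
    then show "(cmod (pz Z z))\<^sup>2 \<le> C * (1 - (cmod (b z))\<^sup>2)" using C2[OF z] by linarith
  qed
  then show ?thesis using C(1) by blast
qed

lemma pz_eq_0_iff: "finite Z \<Longrightarrow> pz Z z = 0 \<longleftrightarrow> z \<in> Z"
  by (simp add: pz_def)

text \<open>At a point of \<open>Z\<close> the first bound forces \<open>cmod (b z)\<close> to 1. At
  any other point of the circle the second bound keeps it away from 1 nearby.\<close>

lemma bounds_imp_spectrum:
  assumes Z: "finite Z" "Z \<subseteq> sphere 0 1" and C: "0 < C"
    and bd: "\<forall>z\<in>ball 0 1. 1 - (cmod (b z))\<^sup>2 \<le> C * ((1 - (cmod z)\<^sup>2) + (cmod (pz Z z))\<^sup>2) \<and> (cmod (pz Z z))\<^sup>2 \<le> C * (1 - (cmod (b z))\<^sup>2)"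
  shows "Z = sphere 0 1 - spectrum_b b"
proof -
  have pt: "((\<lambda>z. cmod (pz Z z)) \<longlongrightarrow> cmod (pz Z \<zeta>)) (at \<zeta> within ball 0 1)" for \<zeta>
    using pz_cont[of UNIV Z] by (intro tendsto_norm) (auto simp: continuous_on_eq_continuous_at isCont_def intro: tendsto_within_subset)
  have ev: "eventually (\<lambda>z. z \<in> ball 0 1) (at \<zeta> within ball 0 1)" for \<zeta> :: complex by (simp add: eventually_at_filter)
  have "\<zeta> \<in> Z \<longleftrightarrow> \<not> Liminf (at \<zeta> within ball 0 1) (\<lambda>z. ereal (cmod (b z))) < 1" if \<zeta>: "cmod \<zeta> = 1" for \<zeta>
  proof (cases "\<zeta> \<in> Z")
    case True
    \<comment> \<open>A continuous minorant of \<open>cmod (b z)\<close> with limit 1 at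
      \<open>\<zeta>\<close>; the maximum keeps the square root meaningful where the bound says
      nothing.\<close>
    define h where "h = (\<lambda>z. sqrt (max 0 (1 - C * ((1 - (cmod z)\<^sup>2) + (cmod (pz Z z))\<^sup>2))))"
    have "(h \<longlongrightarrow> sqrt (max 0 (1 - C * ((1 - (cmod \<zeta>)\<^sup>2) + (cmod (pz Z \<zeta>))\<^sup>2)))) (at \<zeta> within ball 0 1)"
      unfolding h_def by (intro tendsto_intros pt)
    moreover have "pz Z \<zeta> = 0" using True Z by (simp add: pz_eq_0_iff)
    ultimately have "(h \<longlongrightarrow> 1) (at \<zeta> within ball 0 1)" by (simp add: \<zeta>)
    then have "Liminf (at \<zeta> within ball 0 1) (\<lambda>z. ereal (h z)) = ereal 1" by (intro lim_imp_Liminf trivial_limit_disc \<zeta>) simp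
    moreover have "Liminf (at \<zeta> within ball 0 1) (\<lambda>z. ereal (h z)) \<le> Liminf (at \<zeta> within ball 0 1) (\<lambda>z. ereal (cmod (b z)))"
    proof (rule Liminf_mono, rule eventually_mono[OF ev])
      fix z :: complex assume z: "z \<in> ball 0 1"
      have "max 0 (1 - C * ((1 - (cmod z)\<^sup>2) + (cmod (pz Z z))\<^sup>2)) \<le> (cmod (b z))\<^sup>2" using bd z by force
      then show "ereal (h z) \<le> ereal (cmod (b z))" unfolding h_def by (simp add: real_le_lsqrt)
    qed
    ultimately show ?thesis using True by (simp add: not_less one_ereal_def)
  next
    case False
    define h where "h = (\<lambda>z. sqrt (max 0 (1 - (cmod (pz Z z))\<^sup>2 / C)))"
    have "(h \<longlongrightarrow> h \<zeta>) (at \<zeta> within ball 0 1)" unfolding h_def using C by (intro tendsto_intros pt) auto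
    then have "Liminf (at \<zeta> within ball 0 1) (\<lambda>z. ereal (h z)) = ereal (h \<zeta>)" by (intro lim_imp_Liminf trivial_limit_disc \<zeta>) simp
    moreover have "Liminf (at \<zeta> within ball 0 1) (\<lambda>z. ereal (cmod (b z))) \<le> Liminf (at \<zeta> within ball 0 1) (\<lambda>z. ereal (h z))"
    proof (rule Liminf_mono, rule eventually_mono[OF ev])
      fix z :: complex assume z: "z \<in> ball 0 1"
      have "(cmod (pz Z z))\<^sup>2 / C \<le> 1 - (cmod (b z))\<^sup>2" using bd z C by (auto simp: divide_le_eq mult.commute)
      then have "(cmod (b z))\<^sup>2 \<le> max 0 (1 - (cmod (pz Z z))\<^sup>2 / C)" by linarith
      then show "ereal (cmod (b z)) \<le> ereal (h z)" unfolding h_def by (simp add: real_le_rsqrt)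
    qed
    moreover have "h \<zeta> < 1"
    proof -
      have "0 < (cmod (pz Z \<zeta>))\<^sup>2 / C" using False Z C by (simp add: pz_eq_0_iff)
      then show ?thesis unfolding h_def by simp
    qed
    ultimately show ?thesis using False by (simp add: one_ereal_def) (meson ereal_less_eq(3) le_less_trans less_ereal.simps(1))
  qed
  then show ?thesis using Z(2) unfolding spectrum_b_def by auto
qed

text \<open>In the radial limit the term \<open>1 - (cmod z)\<^sup>2\<close> disappears, and the two
  bounds compare \<open>bdry a\<close> with \<open>pz Z\<close> almost everywhere on the circle.
  Then \<open>outer_comparison\<close> carries this back into the disc.\<close>

lemma bounds_imp_comparable:
  assumes b: "bfun b bs" and a: "outer a"
    and mate: "AE t in TT. (cmod (bdry a t))\<^sup>2 = 1 - (cmod (bs t))\<^sup>2 \<and> 0 < cmod (bdry a t)"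
    and Z: "finite Z" "Z \<subseteq> sphere 0 1" and C: "0 < C"
    and bd: "\<forall>z\<in>ball 0 1. 1 - (cmod (b z))\<^sup>2 \<le> C * ((1 - (cmod z)\<^sup>2) + (cmod (pz Z z))\<^sup>2) \<and> (cmod (pz Z z))\<^sup>2 \<le> C * (1 - (cmod (b z))\<^sup>2)"
  shows "comparable a Z"
proof -
  have rl: "rad \<longlonglongrightarrow> 1" unfolding rad_def by real_asymp
  have cmp: "AE t in TT. (cmod (bdry a t))\<^sup>2 \<le> C * (cmod (pz Z (cis t)))\<^sup>2 \<and> (cmod (pz Z (cis t)))\<^sup>2 \<le> C * (cmod (bdry a t))\<^sup>2"
    using mate bfun_seq[OF b] bfun_seq[OF bfun_pz[of Z]]
  proof eventually_elim
    case (elim t)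
    have inb: "complex_of_real (rad n) * cis t \<in> ball 0 1" for n using rad[of n] by (simp add: norm_mult)
    have nr: "cmod (complex_of_real (rad n) * cis t) = rad n" for n using rad[of n] by (simp add: norm_mult)
    have l1: "(\<lambda>n. 1 - (cmod (b (complex_of_real (rad n) * cis t)))\<^sup>2) \<longlonglongrightarrow> 1 - (cmod (bs t))\<^sup>2" by (intro tendsto_intros elim)
    have l2: "(\<lambda>n. (cmod (pz Z (complex_of_real (rad n) * cis t)))\<^sup>2) \<longlonglongrightarrow> (cmod (pz Z (cis t)))\<^sup>2" by (intro tendsto_intros elim)
    have l3: "(\<lambda>n. 1 - (rad n)\<^sup>2) \<longlonglongrightarrow> 1 - 1\<^sup>2" by (intro tendsto_intros rl)
    have "1 - (cmod (bs t))\<^sup>2 \<le> C * ((1 - 1\<^sup>2) + (cmod (pz Z (cis t)))\<^sup>2)"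
      by (rule LIMSEQ_le[OF l1 tendsto_mult_left[OF tendsto_add[OF l3 l2]]]) (use bd[THEN bspec, OF inb, unfolded nr] in blast)
    moreover have "(cmod (pz Z (cis t)))\<^sup>2 \<le> C * (1 - (cmod (bs t))\<^sup>2)"
      by (rule LIMSEQ_le[OF l2 tendsto_mult_left[OF l1]]) (use bd[THEN bspec, OF inb] in blast)
    ultimately show ?case using elim(1) by simp
  qed
  define K where "K = sqrt C"
  have K: "0 < K" "K\<^sup>2 = C" using C by (simp_all add: K_def)
  have pos: "AE t in TT. 0 < cmod (bdry a t)" using mate by eventually_elim simp
  have up: "AE t in TT. cmod (bdry a t) \<le> K * cmod (pz Z (cis t))"
    using cmp
  proof eventually_elim
    case (elim t)
    then have "(cmod (bdry a t))\<^sup>2 \<le> (K * cmod (pz Z (cis t)))\<^sup>2" by (simp add: power_mult_distrib K)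
    then show ?case by (rule power2_le_imp_le) (use K in simp)
  qed
  have lo: "AE t in TT. 1 / K * cmod (pz Z (cis t)) \<le> cmod (bdry a t)"
    using cmp
  proof eventually_elim
    case (elim t)
    then have "(cmod (pz Z (cis t)))\<^sup>2 \<le> (K * cmod (bdry a t))\<^sup>2" by (simp add: power_mult_distrib K)
    then have "cmod (pz Z (cis t)) \<le> K * cmod (bdry a t)" by (rule power2_le_imp_le) (use K in simp)
    then show ?case using K by (simp add: field_simps)
  qed
  have k: "0 < 1 / K" using K by simp
  show ?thesis unfolding comparable_def
    using outer_comparison[OF a Z k K(1) pos lo up] k K(1) by blast
qed

text \<open>The empty product is 1, so \<open>(cmod (b z))\<^sup>2\<close> stays below
  \<open>1 - 1 / C\<close>. This rules out equality of the spaces for empty \<open>Z\<close> when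
  \<open>b\<close> has norm one.\<close>

lemma empty_not_Hinf_norm_one:
  assumes C: "0 < C" and bd: "\<forall>z\<in>ball 0 1. (cmod (pz {} z))\<^sup>2 \<le> C * (1 - (cmod (b z))\<^sup>2)"
  shows "Hinf_norm b < 1"
proof -
  have "cmod (b z) \<le> sqrt (1 - 1 / C)" if "z \<in> ball 0 1" for z
  proof -
    have "1 / C \<le> 1 - (cmod (b z))\<^sup>2" using bd that C by (auto simp: pz_def divide_le_eq mult.commute)
    then show ?thesis by (intro real_le_rsqrt) simp
  qed
  then have "Hinf_norm b \<le> sqrt (1 - 1 / C)" unfolding Hinf_norm_def by (intro cSUP_least) auto
  also have "\<dots> < 1" using C by simp
  finally show ?thesis .
qed

theorem theoremC:
  fixes b a :: "complex \<Rightarrow> complex" and Z :: "complex set"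
  assumes "nonextreme b"
    and "Hinf_norm b = 1"
    and "pyth_mate b a"
    and "finite Z" and "Z \<subseteq> sphere 0 1"
  shows "((\<forall>f. in_Hb b f \<longleftrightarrow> in_Dmu Z f)
          \<longleftrightarrow> (Z = sphere 0 1 - spectrum_b b \<and>
               0 < (INF z\<in>ball 0 1. (cmod (a z))\<^sup>2 * V_mu Z z) \<and>
               bdd_above ((\<lambda>z. (cmod (a z))\<^sup>2 * V_mu Z z) ` ball 0 1)))
       \<and> ((\<forall>f. in_Hb b f \<longleftrightarrow> in_Dmu Z f)
          \<longleftrightarrow> (Z = sphere 0 1 - spectrum_b b \<and>
               (\<exists>g. Hinf g \<and> 0 < (INF z\<in>ball 0 1. cmod (g z)) \<and>
                    (\<forall>z\<in>ball 0 1. a z = (\<Prod>\<zeta>\<in>Z. z - \<zeta>) * g z))))"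
proof -
  note Z = assms(4,5)
  have a: "outer a" "a holomorphic_on ball 0 1" using assms(3) by (auto simp: pyth_mate_def outer_def)
  obtain bs where bf: "bfun b bs" and bs1: "\<And>t. cmod (bs t) \<le> 1"
    and mate: "AE t in TT. (cmod (bdry a t))\<^sup>2 = 1 - (cmod (bs t))\<^sup>2 \<and> 0 < cmod (bdry a t)"
    using boundary_mate[OF assms(1,3)] by blast
  let ?A = "\<forall>f. in_Hb b f \<longleftrightarrow> in_Dmu Z f"
  let ?S = "Z = sphere 0 1 - spectrum_b b"
  let ?V = "0 < (INF z\<in>ball 0 1. (cmod (a z))\<^sup>2 * V_mu Z z) \<and> bdd_above ((\<lambda>z. (cmod (a z))\<^sup>2 * V_mu Z z) ` ball 0 1)"
  have bounds: "\<exists>C>0. \<forall>z\<in>ball 0 1. 1 - (cmod (b z))\<^sup>2 \<le> C * ((1 - (cmod z)\<^sup>2) + (cmod (pz Z z))\<^sup>2) \<and> (cmod (pz Z z))\<^sup>2 \<le> C * (1 - (cmod (b z))\<^sup>2)"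
    if ?A by (rule eq_imp_bounds[OF bf bs1 Z]) (use that in blast)
  have main: "?A \<longleftrightarrow> ?S \<and> comparable a Z"
  proof
    assume ?A
    from bounds[OF this] show "?S \<and> comparable a Z"
      using bounds_imp_spectrum[OF Z] bounds_imp_comparable[OF bf a(1) mate Z] by blast
  next
    assume R: "?S \<and> comparable a Z"
    then have "Z \<subseteq> sphere 0 1 - spectrum_b b" by blast
    then show ?A using comparable_imp_eq[OF assms(1,3) Z] R by blast
  qed
  have B: "?S \<and> ?V \<longleftrightarrow> ?S \<and> comparable a Z"
  proof (cases "Z = {}")
    case False
    show ?thesis by (rule arg_cong2[where f = "(\<and>)", OF refl potential_iff_comparable[OF Z False]])
  next
    \<comment> \<open>The potential of the empty set is 0, so its infimum is not positive.
      Comparability together with the spectral condition fails as well: by \<open>main\<close> it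
      would give equality of the spaces, and then \<open>b\<close> would have norm less than
      1.\<close>
    case True
    have notA: "\<not> ?A"
    proof
      assume ?A
      from bounds[OF this] obtain C where "0 < C" "\<forall>z\<in>ball 0 1. (cmod (pz {} z))\<^sup>2 \<le> C * (1 - (cmod (b z))\<^sup>2)"
        unfolding True by blast
      then have "Hinf_norm b < 1" by (rule empty_not_Hinf_norm_one)
      then show False using assms(2) by simp
    qed
    have "\<not> (?S \<and> comparable a Z)" using notA by (simp only: main not_False_eq_True)
    moreover have "\<not> ?V" unfolding True by (simp add: V_mu_def)
    ultimately show ?thesis by argo
  qed
  show ?thesis unfolding B factorization_iff_comparable[OF Z(2) a(2)] by (intro conjI main)
qed

end
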